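(* Let $s\in(3/4,1)$, $a,b,m>0$, $1<q<2$ and $4<p<2^*_s$, where $2^*_s=\frac{6}{3-2s}$. Then there exists $\lambda_*>0$ such that, for all $\lambda\in(0,\lambda_* )$, the problem $$\left\{\begin{array}{ll}(a+b|u|^{2}_{\mathbb{H}^{s}_{2\pi}})(-\Delta+m^{2})^{s}u=\lambda|u|^{q-2}u+|u|^{p-2}u & \text{in } (-\pi,\pi)^{3},\\ u(x+2\pi e_{i})=u(x) & \text{for all } x\in\mathbb{R}^{3},\ i=1,2,3,\end{array}\right.$$ has infinitely many (weak) periodic solutions.
   Context: All functions are real-valued. $\{e_i\}_{i=1,2,3}$ is the canonical basis of $\mathbb{R}^3$; $|\cdot|_r$ is the norm of $L^r((-\pi,\pi)^3)$; $2^*_s=\frac{6}{3-2s}$ (so $2^*_s>4$ when $s>3/4$). For a $2\pi$-periodic (in each variable) function $u=\sum_{k\in\mathbb{Z}^3}c_k\frac{e^{\imath k\cdot x}}{(2\pi)^{3/2}}$ with Fourier coefficients $c_k=(2\pi)^{-3/2}\int_{(-\pi,\pi)^3}u(x)e^{-\imath k\cdot x}dx$, set $(-\Delta+m^2)^su=\sum_k c_k(|k|^2+m^2)^s\frac{e^{\imath k\cdot x}}{(2\pi)^{3/2}}$ and $|u|_{\mathbb{H}^s_{2\pi}}^2=\sum_k(|k|^2+m^2)^s|c_k|^2$. The Hilbert space $\mathbb{H}^s_{2\pi}$ consists of those $u\in L^2((-\pi,\pi)^3)$ with $|u|_{\mathbb{H}^s_{2\pi}}<\infty$. Let $\mathcal{S}_{2\pi}=(-\pi,\pi)^3\times(0,\infty)$,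 with points $(x,y)$, and $\kappa_s=2^{1-2s}\Gamma(1-s)/\Gamma(s)$. The Hilbert space $\mathbb{X}^s_{2\pi}$ is the closure of the set of smooth functions on $\mathbb{R}^3\times[0,\infty)$ that are $2\pi$-periodic in each $x_i$ (and of finite norm) with respect to the norm induced by the inner product $$\langle U,V\rangle_{\mathbb{X}^s_{2\pi}}=\frac1{\kappa_s}\iint_{\mathcal{S}_{2\pi}}y^{1-2s}(\nabla U\cdot\nabla V+m^2UV)\,dx\,dy .$$ There is a bounded surjective linear trace operator $\mathrm{Tr}:\mathbb{X}^s_{2\pi}\to\mathbb{H}^s_{2\pi}$ extending $U\mapsto U(\cdot,0)$ from smooth functions; it satisfies $|\mathrm{Tr}(U)|_{\mathbb{H}^s_{2\pi}}\le\|U\|_{\mathbb{X}^s_{2\pi}}$, and $\mathrm{Tr}(\mathbb{X}^s_{2\pi})\subset L^r((-\pi,\pi)^3)$ continuously for $1\le r\le 2^*_s$. Weak solution: $u\in\mathbb{H}^s_{2\pi}$ is a weak (periodic) solution of the problem if $u=\mathrm{Tr}(U)$ for some $U\in\mathbb{X}^s_{2\pi}$ such that, for every $V\in\mathbb{X}^s_{2\pi}$, $$(a+b\|U\|^2_{\mathbb{X}^s_{2\pi}})\langle U,V\rangle_{\mathbb{X}^s_{2\pi}}=\int_{(-\pi,\pi)^3}\big[\lambda|u|^{q-2}u+|u|^{p-2}u\big]\mathrm{Tr}(V)\,dx .$$ *)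

theory Defs
  imports "HOL-Analysis.Analysis"
begin

definition periodic :: "(real ^ 3 \<Rightarrow> real) \<Rightarrow> bool" where
  "periodic u \<longleftrightarrow> (\<forall>x i. u (x + (2 * pi) *\<^sub>R axis i 1) = u x)"

definition cube :: "(real ^ 3) set" where
  "cube = box (vec (- pi)) (vec pi)"

definition fourier_coeff :: "(real ^ 3 \<Rightarrow> real) \<Rightarrow> int ^ 3 \<Rightarrow> complex" where
  "fourier_coeff u k =
     (2 * pi) powr (- 3 / 2) *
     (LINT x:cube|lborel. u x * exp (- (\<i> * (\<Sum>i\<in>UNIV. of_int (k $ i) * x $ i))))"

definition Hs_coeff :: "real \<Rightarrow> real \<Rightarrow> (real ^ 3 \<Rightarrow> real) \<Rightarrow> int ^ 3 \<Rightarrow> real" where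
  "Hs_coeff s m u k =
     ((\<Sum>i\<in>UNIV. (real_of_int (k $ i))\<^sup>2) + m\<^sup>2) powr s * (cmod (fourier_coeff u k))\<^sup>2"

definition Hs_norm :: "real \<Rightarrow> real \<Rightarrow> (real ^ 3 \<Rightarrow> real) \<Rightarrow> real" where
  "Hs_norm s m u = sqrt (\<Sum>\<^sub>\<infinity>k. Hs_coeff s m u k)"

text \<open>
  Elements of function spaces are represented by functions, not by classes modulo null sets.
  An element of \<open>L\<^sup>2\<close> of the cube is represented by a Borel function on the whole space that is
  periodic everywhere; every class has such a representative.
\<close>

definition Hs :: "real \<Rightarrow> real \<Rightarrow> (real ^ 3 \<Rightarrow> real) set" where
  "Hs s m = {u. periodic u \<and> u \<in> borel_measurable borel
     \<and> set_integrable lborel cube (\<lambda>x. (u x)\<^sup>2)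
     \<and> Hs_coeff s m u summable_on UNIV}"

definition kappa :: "real \<Rightarrow> real" where
  "kappa s = 2 powr (1 - 2 * s) * Gamma (1 - s) / Gamma s"

definition cyl_measure :: "real \<Rightarrow> ((real ^ 3) \<times> real) measure" where
  "cyl_measure s =
     density (restrict_space lborel (cube \<times> {0<..})) (\<lambda>p. ennreal (snd p powr (1 - 2 * s)))"

text \<open>
  Derivatives are taken within \<open>S\<close>, so that on a closed half-space smoothness means smoothness
  up to the boundary, with one-sided normal derivatives there.
\<close>

primrec Ck_on :: "nat \<Rightarrow> 'a::euclidean_space set \<Rightarrow> ('a \<Rightarrow> real) \<Rightarrow> bool" where
  "Ck_on 0 S f \<longleftrightarrow> continuous_on S f"
| "Ck_on (Suc k) S f \<longleftrightarrow>
     f differentiable_on S \<and> (\<forall>v. Ck_on k S (\<lambda>x. frechet_derivative f (at x within S) v))"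

definition smooth_on :: "'a::euclidean_space set \<Rightarrow> ('a \<Rightarrow> real) \<Rightarrow> bool" where
  "smooth_on S f \<longleftrightarrow> (\<forall>k. Ck_on k S f)"

definition grad :: "('a::euclidean_space \<Rightarrow> real) \<Rightarrow> 'a \<Rightarrow> 'a" where
  "grad f p = (\<Sum>e\<in>Basis. frechet_derivative f (at p) e *\<^sub>R e)"

text \<open>
  The space \<open>\<bbbX>\<^sup>s\<close> is a completion. It is realised as the closure of the pairs \<open>(\<phi>, grad \<phi>)\<close>, with
  \<open>\<phi>\<close> smooth, periodic and of finite norm, in the weighted \<open>L\<^sup>2\<close> space of pairs \<open>(U, G)\<close> of a scalar
  function and a vector field on the cylinder; \<open>G\<close> is then the weak gradient of \<open>U\<close>.
\<close>

type_synonym jet = "((real ^ 3) \<times> real \<Rightarrow> real) \<times> ((real ^ 3) \<times> real \<Rightarrow> (real ^ 3) \<times> real)"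

definition X_inner :: "real \<Rightarrow> real \<Rightarrow> jet \<Rightarrow> jet \<Rightarrow> real" where
  "X_inner s m W Z = 1 / kappa s *
     (LINT p|cyl_measure s. snd W p \<bullet> snd Z p + m\<^sup>2 * (fst W p * fst Z p))"

definition X_norm :: "real \<Rightarrow> real \<Rightarrow> jet \<Rightarrow> real" where
  "X_norm s m W = sqrt (X_inner s m W W)"

definition weighted_L2 :: "real \<Rightarrow> jet set" where
  "weighted_L2 s = {(U, G).
     U \<in> borel_measurable (cyl_measure s) \<and> G \<in> borel_measurable (cyl_measure s) \<and>
     integrable (cyl_measure s) (\<lambda>p. (U p)\<^sup>2) \<and> integrable (cyl_measure s) (\<lambda>p. (norm (G p))\<^sup>2)}"

definition smooth_periodic :: "real \<Rightarrow> ((real ^ 3) \<times> real \<Rightarrow> real) set" where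
  "smooth_periodic s = {\<phi>. smooth_on (UNIV \<times> {0..}) \<phi>
     \<and> (\<forall>y\<ge>0. periodic (\<lambda>x. \<phi> (x, y)))
     \<and> (\<phi>, grad \<phi>) \<in> weighted_L2 s}"

definition X_approx ::
  "real \<Rightarrow> real \<Rightarrow> jet \<Rightarrow> (nat \<Rightarrow> (real ^ 3) \<times> real \<Rightarrow> real) \<Rightarrow> bool" where
  "X_approx s m W \<phi> \<longleftrightarrow> (\<forall>n. \<phi> n \<in> smooth_periodic s)
     \<and> (\<lambda>n. X_norm s m ((\<lambda>p. fst W p - \<phi> n p), (\<lambda>p. snd W p - grad (\<phi> n) p))) \<longlonglongrightarrow> 0"

definition Xs :: "real \<Rightarrow> real \<Rightarrow> jet set" where
  "Xs s m = {W \<in> weighted_L2 s. \<exists>\<phi>. X_approx s m W \<phi>}"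

text \<open>
  The trace is the continuous extension of \<open>\<phi> \<mapsto> \<phi>(\<cdot>, 0)\<close> from the dense set of smooth functions.
  It is a relation because its value is determined only up to null sets.
\<close>

definition has_trace :: "real \<Rightarrow> real \<Rightarrow> jet \<Rightarrow> (real ^ 3 \<Rightarrow> real) \<Rightarrow> bool" where
  "has_trace s m W u \<longleftrightarrow> W \<in> Xs s m \<and> u \<in> Hs s m \<and>
     (\<exists>\<phi>. X_approx s m W \<phi> \<and> (\<lambda>n. Hs_norm s m (\<lambda>x. u x - \<phi> n (x, 0))) \<longlonglongrightarrow> 0)"

definition weak_solution ::
  "real \<Rightarrow> real \<Rightarrow> real \<Rightarrow> real \<Rightarrow> real \<Rightarrow> real \<Rightarrow> real \<Rightarrow> (real ^ 3 \<Rightarrow> real) \<Rightarrow> bool" where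
  "weak_solution s a b m q p lam u \<longleftrightarrow> u \<in> Hs s m \<and>
     (\<exists>U\<in>Xs s m. has_trace s m U u \<and>
       (\<forall>V\<in>Xs s m. \<forall>v. has_trace s m V v \<longrightarrow>
         (a + b * (X_norm s m U)\<^sup>2) * X_inner s m U V =
         (LINT x:cube|lborel.
            (lam * (\<bar>u x\<bar> powr (q - 2) * u x) + \<bar>u x\<bar> powr (p - 2) * u x) * v x)))"

definition ae_eq :: "((real ^ 3 \<Rightarrow> real) \<times> (real ^ 3 \<Rightarrow> real)) set" where
  "ae_eq = {(u, v). AE x in lborel. x \<in> cube \<longrightarrow> u x = v x}"

end

theory Submission
  imports Defs "HOL-Library.Diagonal_Subsequence"
begin

text \<open>
  A single solution that varies in \<open>x\<^sub>1\<close> already gives infinitely many. If \<open>u\<close> is a solution, so is each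
  translate \<open>u(\<cdot> + t)\<close>, and its Fourier coefficient of index \<open>k\<close> is \<open>e\<^sup>i\<^sup>k\<^sup>t\<close> times that of \<open>u\<close>. If a
  coefficient with \<open>k\<^sub>1 \<noteq> 0\<close> does not vanish, the translates along the first axis represent infinitely
  many classes modulo null sets (\<open>infinitely_many_solutions\<close>). It remains to find such a solution.

  Let \<open>N(\<phi>)\<close> be the squared norm of a smooth periodic \<open>\<phi>\<close> in \<open>\<bbbX>\<^sup>s\<close>, called \<open>form \<phi> \<phi>\<close> below. The
  energy \<open>a/2 N + b/4 N\<^sup>2 - \<integral> (\<lambda>/q |u|\<^sup>q + 1/p |u|\<^sup>p)\<close>, with \<open>u = \<phi>(\<cdot>, 0)\<close>, is minimised over the ball
  \<open>N \<le> R\<close> in the class of functions with \<open>\<phi>(x + \<pi> e\<^sub>1, y) = - \<phi>(x, y)\<close>, whose coefficients with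
  \<open>k\<^sub>1 = 0\<close> vanish. For small \<open>R\<close> the term of order \<open>p > 2\<close> is dominated by the quadratic one, and for
  small \<open>\<lambda>\<close> the energy is nonnegative on \<open>R/2 \<le> N \<le> R\<close>. Since \<open>q < 2\<close>, it takes negative values near
  the origin (\<open>energy_negative\<close>). Hence minimising sequences remain in the interior of the ball.

  Weak compactness is avoided: a suitable minimising sequence is Cauchy in \<open>\<bbbX>\<^sup>s\<close>. On a bounded set the
  potential term is close for two functions as soon as finitely many boundary coefficients are close
  (\<open>Rellich\<close>, \<open>pot_uniformly_continuous\<close>), and a diagonal subsequence makes all of them converge; since
  \<open>a/2 N + b/4 N\<^sup>2\<close> is strongly convex, the comparison with midpoints does the rest
  (\<open>midpoint_energy\<close>). The weak equation holds asymptotically along the sequence. The potential is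
  convex, so that the tangent inequality replaces the derivative of the energy
  (\<open>residual_bound\<close>); and test functions that are not in the class may be replaced by their
  part in it, as the problem is invariant under the translation by half a period and under the change of
  sign (\<open>form_antiperiodic\<close>, \<open>react_antiperiodic\<close>). Both statements pass to the limit, which exists together
  with its trace (\<open>Cauchy_has_trace\<close>, \<open>critical_sequence_solution\<close>). A limit of negative energy has a
  nonzero boundary coefficient.

  The function spaces are accessible through Fourier series. The boundary value of a mode is written as
  the integral of the derivative of \<open>(1 - y/L) \<phi>\<close>, with \<open>L\<close> adapted to the frequency, which
  bounds the trace (\<open>trace_bound\<close>). Decomposing frequencies into dyadic shells yields the subcritical
  Sobolev inequality (\<open>Sobolev\<close>) and, with the finitely many low frequencies set apart, its
  compactness. Convergence of Fourier series rests on the uniqueness of coefficients (\<open>fourier_unique\<close>),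
  which follows from the Stone--Weierstrass theorem.
\<close>

section \<open>Square integrable functions\<close>

definition L2 :: "'a measure \<Rightarrow> ('a \<Rightarrow> 'b::euclidean_space) set" where
  "L2 M = {f \<in> borel_measurable M. integrable M (\<lambda>x. (norm (f x))\<^sup>2)}"

definition l2_inner :: "'a measure \<Rightarrow> ('a \<Rightarrow> 'b::euclidean_space) \<Rightarrow> ('a \<Rightarrow> 'b) \<Rightarrow> real" where
  "l2_inner M f g = (LINT x|M. f x \<bullet> g x)"

definition l2_norm :: "'a measure \<Rightarrow> ('a \<Rightarrow> 'b::euclidean_space) \<Rightarrow> real" where
  "l2_norm M f = sqrt (l2_inner M f f)"

lemma L2_measurable [measurable_dest]: "f \<in> L2 M \<Longrightarrow> f \<in> borel_measurable M"
  by (simp add: L2_def)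

lemma L2_integrable_norm_sq: "f \<in> L2 M \<Longrightarrow> integrable M (\<lambda>x. (norm (f x))\<^sup>2)"
  by (simp add: L2_def)

lemma inner_le_half_squares:
  fixes a b :: "'b::real_inner"
  shows "\<bar>a \<bullet> b\<bar> \<le> (norm a)\<^sup>2 / 2 + (norm b)\<^sup>2 / 2"
proof -
  have "\<bar>a \<bullet> b\<bar> \<le> norm a * norm b" by (rule Cauchy_Schwarz_ineq2)
  also have "\<dots> \<le> (norm a)\<^sup>2 / 2 + (norm b)\<^sup>2 / 2"
    using sum_squares_bound[of "norm a" "norm b"] by simp
  finally show ?thesis .
qed

lemma L2_inner_integrable:
  assumes f: "f \<in> L2 M" and g: "g \<in> L2 M"
  shows "integrable M (\<lambda>x. f x \<bullet> g x)"
proof (rule Bochner_Integration.integrable_bound)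
  show "integrable M (\<lambda>x. (norm (f x))\<^sup>2 / 2 + (norm (g x))\<^sup>2 / 2)"
    using f g by (simp add: L2_integrable_norm_sq)
  show "(\<lambda>x. f x \<bullet> g x) \<in> borel_measurable M"
    using f g by (intro borel_measurable_inner) (auto simp: L2_def)
  show "AE x in M. norm (f x \<bullet> g x) \<le> norm ((norm (f x))\<^sup>2 / 2 + (norm (g x))\<^sup>2 / 2)"
    by (rule AE_I2) (use inner_le_half_squares in \<open>fastforce intro: order_trans\<close>)
qed

lemma L2_add:
  assumes f: "f \<in> L2 M" and g: "g \<in> L2 M"
  shows "(\<lambda>x. f x + g x) \<in> L2 M"
proof -
  have "(\<lambda>x. (norm (f x + g x))\<^sup>2) = (\<lambda>x. (norm (f x))\<^sup>2 + (norm (g x))\<^sup>2 + 2 * (f x \<bullet> g x))"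
    by (auto simp: power2_norm_eq_inner inner_add_left inner_add_right inner_commute)
  then show ?thesis
    using f g L2_inner_integrable[OF f g] by (auto simp: L2_def)
qed

lemma L2_scale:
  assumes f: "f \<in> L2 M"
  shows "(\<lambda>x. c *\<^sub>R f x) \<in> L2 M"
  using f by (auto simp: L2_def power_mult_distrib)

lemma L2_diff:
  assumes f: "f \<in> L2 M" and g: "g \<in> L2 M"
  shows "(\<lambda>x. f x - g x) \<in> L2 M"
  using L2_add[OF f L2_scale[OF g, of "-1"]] by simp

lemma l2_inner_commute: "l2_inner M f g = l2_inner M g f"
  by (simp add: l2_inner_def inner_commute)

lemma l2_inner_add_left:
  "f \<in> L2 M \<Longrightarrow> g \<in> L2 M \<Longrightarrow> h \<in> L2 M \<Longrightarrow>
    l2_inner M (\<lambda>x. f x + g x) h = l2_inner M f h + l2_inner M g h"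
  by (simp add: l2_inner_def inner_add_left L2_inner_integrable)

lemma l2_inner_diff_left:
  "f \<in> L2 M \<Longrightarrow> g \<in> L2 M \<Longrightarrow> h \<in> L2 M \<Longrightarrow>
    l2_inner M (\<lambda>x. f x - g x) h = l2_inner M f h - l2_inner M g h"
  by (simp add: l2_inner_def inner_diff_left L2_inner_integrable)

lemma l2_inner_scale_left: "l2_inner M (\<lambda>x. c *\<^sub>R f x) h = c * l2_inner M f h"
  by (simp add: l2_inner_def)

lemma l2_inner_self: "l2_inner M f f = (LINT x|M. (norm (f x))\<^sup>2)"
  by (simp add: l2_inner_def power2_norm_eq_inner)

lemma l2_inner_self_nonneg: "0 \<le> l2_inner M f f"
  unfolding l2_inner_self by simp

lemma l2_norm_nonneg: "0 \<le> l2_norm M f"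
  by (simp add: l2_norm_def l2_inner_self_nonneg)

lemma l2_norm_sq: "(l2_norm M f)\<^sup>2 = l2_inner M f f"
  by (simp add: l2_norm_def l2_inner_self_nonneg)

lemma l2_norm_minus_commute: "l2_norm M (\<lambda>x. f x - g x) = l2_norm M (\<lambda>x. g x - f x)"
  by (simp add: l2_norm_def l2_inner_self norm_minus_commute)

lemma l2_inner_add_self:
  assumes f: "f \<in> L2 M" and g: "g \<in> L2 M"
  shows "l2_inner M (\<lambda>x. f x + t *\<^sub>R g x) (\<lambda>x. f x + t *\<^sub>R g x)
       = l2_inner M f f + 2 * t * l2_inner M f g + t\<^sup>2 * l2_inner M g g"
proof -
  note S = L2_scale[OF g, of t]
  have "l2_inner M (\<lambda>x. f x + t *\<^sub>R g x) h = l2_inner M f h + t * l2_inner M g h"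
    if "h \<in> L2 M" for h
    using l2_inner_add_left[OF f S that] by (simp add: l2_inner_scale_left)
  note this[OF L2_add[OF f S]]
  moreover have "l2_inner M h (\<lambda>x. f x + t *\<^sub>R g x) = l2_inner M h f + t * l2_inner M h g"
    if "h \<in> L2 M" for h
    using l2_inner_add_left[OF f S that] by (simp add: l2_inner_scale_left l2_inner_commute[of M h])
  note this[OF f] this[OF g]
  ultimately show ?thesis
    by (simp add: l2_inner_commute[of M g f] power2_eq_square algebra_simps)
qed

text \<open>The quadratic \<open>t \<mapsto> \<parallel>f + t g\<parallel>\<^sup>2\<close> is nonnegative, so its discriminant is not positive.\<close>

lemma l2_Cauchy_Schwarz:
  assumes f: "f \<in> L2 M" and g: "g \<in> L2 M"
  shows "\<bar>l2_inner M f g\<bar> \<le> l2_norm M f * l2_norm M g"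
proof -
  let ?A = "l2_inner M f f" and ?B = "l2_inner M f g" and ?C = "l2_inner M g g"
  have q: "0 \<le> ?A + 2 * t * ?B + t\<^sup>2 * ?C" for t
    using l2_inner_self_nonneg[of M "\<lambda>x. f x + t *\<^sub>R g x"] l2_inner_add_self[OF f g, of t] by simp
  have "?B\<^sup>2 \<le> ?A * ?C"
  proof (cases "?C = 0")
    case True
    have "?B = 0"
    proof (rule ccontr)
      assume "?B \<noteq> 0"
      then show False
        using q[of "- (?A + 1) / (2 * ?B)"] True by (simp add: field_simps)
    qed
    then show ?thesis using True by simp
  next
    case False
    then have C: "0 < ?C" using l2_inner_self_nonneg[of M g] by simp
    have "0 \<le> ?A - ?B\<^sup>2 / ?C"
      using q[of "- ?B / ?C"] C by (simp add: power2_eq_square field_simps)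
    then show ?thesis using C by (simp add: field_simps)
  qed
  then have "sqrt (?B\<^sup>2) \<le> sqrt (?A * ?C)" by (rule real_sqrt_le_mono)
  then show ?thesis by (simp add: l2_norm_def real_sqrt_mult)
qed

lemma l2_inner_tendsto:
  assumes f: "\<And>n. f n \<in> L2 M" "f' \<in> L2 M" and g: "\<And>n. g n \<in> L2 M" "g' \<in> L2 M"
    and lf: "(\<lambda>n. l2_norm M (\<lambda>x. f n x - f' x)) \<longlonglongrightarrow> 0"
    and lg: "(\<lambda>n. l2_norm M (\<lambda>x. g n x - g' x)) \<longlonglongrightarrow> 0"
  shows "(\<lambda>n. l2_inner M (f n) (g n)) \<longlonglongrightarrow> l2_inner M f' g'"
proof -
  have b: "\<bar>l2_inner M (f n) (g n) - l2_inner M f' g'\<bar>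
      \<le> l2_norm M (\<lambda>x. f n x - f' x) * l2_norm M (\<lambda>x. g n x - g' x)
        + l2_norm M (\<lambda>x. f n x - f' x) * l2_norm M g' + l2_norm M f' * l2_norm M (\<lambda>x. g n x - g' x)" for n
  proof -
    have e: "l2_inner M (f n) (g n) - l2_inner M f' g'
      = l2_inner M (\<lambda>x. f n x - f' x) (\<lambda>x. g n x - g' x)
        + l2_inner M (\<lambda>x. f n x - f' x) g' + l2_inner M f' (\<lambda>x. g n x - g' x)"
    proof -
      have r: "l2_inner M h (\<lambda>x. g n x - g' x) = l2_inner M h (g n) - l2_inner M h g'" if "h \<in> L2 M" for h
        using l2_inner_diff_left[OF g(1) g(2) that] by (simp add: l2_inner_commute[of M h])
      show ?thesis
        using r[OF L2_diff[OF f(1) f(2)]] r[OF f(2)]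
        by (simp add: l2_inner_diff_left f g)
    qed
    show ?thesis
      unfolding e
      using l2_Cauchy_Schwarz[OF L2_diff[OF f(1)[of n] f(2)] L2_diff[OF g(1)[of n] g(2)]]
        l2_Cauchy_Schwarz[OF L2_diff[OF f(1)[of n] f(2)] g(2)]
        l2_Cauchy_Schwarz[OF f(2) L2_diff[OF g(1)[of n] g(2)]] by linarith
  qed
  have "(\<lambda>n. l2_inner M (f n) (g n) - l2_inner M f' g') \<longlonglongrightarrow> 0"
  proof (rule Lim_null_comparison)
    show "\<forall>\<^sub>F n in sequentially. norm (l2_inner M (f n) (g n) - l2_inner M f' g') \<le>
      l2_norm M (\<lambda>x. f n x - f' x) * l2_norm M (\<lambda>x. g n x - g' x)
        + l2_norm M (\<lambda>x. f n x - f' x) * l2_norm M g' + l2_norm M f' * l2_norm M (\<lambda>x. g n x - g' x)"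
      using b by simp
    show "(\<lambda>n. l2_norm M (\<lambda>x. f n x - f' x) * l2_norm M (\<lambda>x. g n x - g' x)
        + l2_norm M (\<lambda>x. f n x - f' x) * l2_norm M g' + l2_norm M f' * l2_norm M (\<lambda>x. g n x - g' x)) \<longlonglongrightarrow> 0"
      using lf lg by (auto intro!: tendsto_eq_intros)
  qed
  then show ?thesis by (simp add: LIM_zero_iff)
qed

lemma l2_norm_tendsto:
  assumes f: "\<And>n. f n \<in> L2 M" "f' \<in> L2 M"
    and lf: "(\<lambda>n. l2_norm M (\<lambda>x. f n x - f' x)) \<longlonglongrightarrow> 0"
  shows "(\<lambda>n. l2_norm M (f n)) \<longlonglongrightarrow> l2_norm M f'"
  unfolding l2_norm_def by (intro tendsto_real_sqrt l2_inner_tendsto assms)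

text \<open>
  The squared errors tend to \<open>0\<close> in \<open>L\<^sup>1\<close>, hence along a subsequence almost everywhere.
\<close>

lemma l2_AE_subseq:
  assumes f: "\<And>n. f n \<in> L2 M" "f' \<in> L2 M"
    and lf: "(\<lambda>n. l2_norm M (\<lambda>x. f n x - f' x)) \<longlonglongrightarrow> 0"
  shows "\<exists>r. strict_mono r \<and> (AE x in M. (\<lambda>n. f (r n) x) \<longlonglongrightarrow> f' x)"
proof -
  have d: "(\<lambda>x. f n x - f' x) \<in> L2 M" for n by (rule L2_diff[OF f])
  have "(\<lambda>n. (l2_norm M (\<lambda>x. f n x - f' x))\<^sup>2) \<longlonglongrightarrow> 0"
    using lf by (auto intro!: tendsto_eq_intros)
  then have "(\<lambda>n. LINT x|M. norm ((norm (f n x - f' x))\<^sup>2)) \<longlonglongrightarrow> 0"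
    by (simp add: l2_norm_sq l2_inner_self)
  from tendsto_L1_AE_subseq[OF L2_integrable_norm_sq[OF d] this]
  obtain r where r: "strict_mono r" "AE x in M. (\<lambda>n. (norm (f (r n) x - f' x))\<^sup>2) \<longlonglongrightarrow> 0" by auto
  have "AE x in M. (\<lambda>n. f (r n) x) \<longlonglongrightarrow> f' x"
    using r(2)
  proof eventually_elim
    case (elim x)
    from tendsto_real_sqrt[OF elim] have "(\<lambda>n. norm (f (r n) x - f' x)) \<longlonglongrightarrow> 0" by simp
    then show ?case by (simp add: tendsto_norm_zero_iff LIM_zero_iff)
  qed
  with r(1) show ?thesis by blast
qed

text \<open>
  Riesz--Fischer. Along a subsequence with \<open>\<parallel>f\<^sub>n\<^sub>+\<^sub>1 - f\<^sub>n\<parallel>\<^sup>2 \<le> 8\<^sup>-\<^sup>n\<close> the bound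
  \<open>|d\<^sub>n| \<le> 2\<^sup>-\<^sup>n + 2\<^sup>n |d\<^sub>n|\<^sup>2\<close> on the increments \<open>d\<^sub>n\<close> makes them absolutely summable almost
  everywhere, because the functions \<open>2\<^sup>n |d\<^sub>n|\<^sup>2\<close> have summable integrals. Fatou's lemma then
  turns the pointwise limit into a limit in the mean.
\<close>

lemma l2_complete:
  fixes f :: "nat \<Rightarrow> 'a \<Rightarrow> 'b::euclidean_space"
  assumes f: "\<And>n. f n \<in> L2 M"
    and cau: "\<And>e. 0 < e \<Longrightarrow> \<exists>N. \<forall>i\<ge>N. \<forall>j\<ge>N. l2_norm M (\<lambda>x. f i x - f j x) < e"
  shows "\<exists>g\<in>L2 M. (\<lambda>n. l2_norm M (\<lambda>x. f n x - g x)) \<longlonglongrightarrow> 0"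
proof -
  have [measurable]: "f n \<in> borel_measurable M" for n using f by (rule L2_measurable)
  have nn: "(\<integral>\<^sup>+x. ennreal ((norm (h x))\<^sup>2) \<partial>M) = ennreal (l2_inner M h h)" if "h \<in> L2 M" for h :: "'a \<Rightarrow> 'b"
    using that by (simp add: l2_inner_self nn_integral_eq_integral L2_integrable_norm_sq)
  have cau2: "\<exists>N. \<forall>i\<ge>N. \<forall>j\<ge>N. l2_inner M (\<lambda>x. f i x - f j x) (\<lambda>x. f i x - f j x) < e" if "0 < e" for e
  proof -
    from cau[of "sqrt e"] that obtain N where
      "\<forall>i\<ge>N. \<forall>j\<ge>N. l2_norm M (\<lambda>x. f i x - f j x) < sqrt e" by auto
    then show ?thesis by (auto simp: l2_norm_def)
  qed
  obtain N where N: "\<And>k i j. i \<ge> N k \<Longrightarrow> j \<ge> N k \<Longrightarrow>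
      l2_inner M (\<lambda>x. f i x - f j x) (\<lambda>x. f i x - f j x) < (1/8)^k"
    using cau2[of "(1/8)^k" for k] by (metis zero_less_power zero_less_divide_1_iff zero_less_numeral)
  define r where "r k = (\<Sum>i\<le>k. N i + 1)" for k
  have rN: "r k \<ge> N k" for k unfolding r_def by (cases k) auto
  have rS: "r (Suc k) > r k" for k unfolding r_def by simp
  have rmono: "strict_mono r" using rS by (simp add: strict_mono_Suc_iff)
  define d where "d k x = f (r (Suc k)) x - f (r k) x" for k x
  have dL2: "d k \<in> L2 M" for k unfolding d_def by (intro L2_diff f)
  have [measurable]: "d k \<in> borel_measurable M" for k using dL2 by (rule L2_measurable)
  have dint: "l2_inner M (d k) (d k) \<le> (1/8)^k" for k
    unfolding d_def using N[of k "r (Suc k)" "r k"] rN[of k] rS[of k] by fastforce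
  have "(\<integral>\<^sup>+x. (\<Sum>k. ennreal (2^k * (norm (d k x))\<^sup>2)) \<partial>M) = (\<Sum>k. \<integral>\<^sup>+x. ennreal (2^k * (norm (d k x))\<^sup>2) \<partial>M)"
    by (intro nn_integral_suminf) measurable
  also have "\<dots> = (\<Sum>k. ennreal (2^k * l2_inner M (d k) (d k)))"
    by (simp add: ennreal_mult' nn_integral_cmult nn[OF dL2])
  also have "\<dots> \<le> (\<Sum>k. ennreal ((1/4)^k))"
  proof (intro suminf_le ennreal_leI)
    fix k
    have "2^k * l2_inner M (d k) (d k) \<le> 2^k * (1/8)^k" using dint by simp
    also have "\<dots> = (1/4::real)^k" by (simp add: power_mult_distrib[symmetric])
    finally show "2^k * l2_inner M (d k) (d k) \<le> (1/4)^k" .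
  qed auto
  also have "\<dots> < \<infinity>"
    by (subst suminf_ennreal_eq[OF _ summable_sums]) (auto simp: summable_geometric)
  finally have "AE x in M. (\<Sum>k. ennreal (2^k * (norm (d k x))\<^sup>2)) \<noteq> \<infinity>"
    by (intro nn_integral_noteq_infinite) auto
  then have conv: "AE x in M. convergent (\<lambda>k. f (r k) x)"
  proof eventually_elim
    case (elim x)
    then have s1: "summable (\<lambda>k. 2^k * (norm (d k x))\<^sup>2)"
      by (intro summable_suminf_not_top) auto
    have "summable (\<lambda>k. (1/2)^k + 2^k * (norm (d k x))\<^sup>2)"
      by (intro summable_add s1 summable_geometric) auto
    then have "summable (\<lambda>k. d k x)"
    proof (rule summable_comparison_test'[where N=0])
      fix n :: nat
      let ?t = "norm (d n x)"
      have "2 * (?t * 2 ^ n) \<le> 1 + (?t * 2^n)\<^sup>2"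
        using sum_squares_bound[of 1 "?t * 2^n"] by simp
      then have "?t * 2^n \<le> 1 + (?t * 2^n)\<^sup>2" by (smt (verit) zero_le_power2)
      then show "norm (d n x) \<le> (1/2)^n + 2^n * (norm (d n x))\<^sup>2"
        by (simp add: field_simps power2_eq_square)
    qed
    then have "(\<lambda>n. \<Sum>k<n. d k x) \<longlonglongrightarrow> (\<Sum>k. d k x)" by (rule summable_LIMSEQ)
    moreover have "(\<Sum>k<n. d k x) = f (r n) x - f (r 0) x" for n
      by (induction n) (auto simp: d_def)
    ultimately have "(\<lambda>n. f (r n) x - f (r 0) x + f (r 0) x) \<longlonglongrightarrow> (\<Sum>k. d k x) + f (r 0) x"
      by (intro tendsto_add tendsto_const) auto
    then show ?case by (auto simp: convergent_def)
  qed
  define g where "g x = lim (\<lambda>k. f (r k) x)" for x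
  have [measurable]: "g \<in> borel_measurable M" unfolding g_def by measurable
  have lim: "AE x in M. (\<lambda>k. f (r k) x) \<longlonglongrightarrow> g x"
    using conv by eventually_elim (simp add: g_def convergent_LIMSEQ_iff)
  have fatou: "(\<integral>\<^sup>+x. ennreal ((norm (f n x - g x))\<^sup>2) \<partial>M) \<le> ennreal e"
    if e: "0 < e" and n: "\<And>i j. i \<ge> K \<Longrightarrow> j \<ge> K \<Longrightarrow> l2_inner M (\<lambda>x. f i x - f j x) (\<lambda>x. f i x - f j x) < e"
      "n \<ge> K" for n K e
  proof -
    have "(\<integral>\<^sup>+x. ennreal ((norm (f n x - g x))\<^sup>2) \<partial>M)
        = (\<integral>\<^sup>+x. liminf (\<lambda>k. ennreal ((norm (f n x - f (r k) x))\<^sup>2)) \<partial>M)"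
    proof (rule nn_integral_cong_AE, use lim in eventually_elim)
      fix x assume "(\<lambda>k. f (r k) x) \<longlonglongrightarrow> g x"
      then have "(\<lambda>k. ennreal ((norm (f n x - f (r k) x))\<^sup>2)) \<longlonglongrightarrow> ennreal ((norm (f n x - g x))\<^sup>2)"
        by (intro tendsto_intros)
      then show "ennreal ((norm (f n x - g x))\<^sup>2) = liminf (\<lambda>k. ennreal ((norm (f n x - f (r k) x))\<^sup>2))"
        by (intro lim_imp_Liminf[symmetric]) auto
    qed
    also have "\<dots> \<le> liminf (\<lambda>k. \<integral>\<^sup>+x. ennreal ((norm (f n x - f (r k) x))\<^sup>2) \<partial>M)"
      by (intro nn_integral_liminf) measurable
    also have "\<dots> = liminf (\<lambda>k. ennreal (l2_inner M (\<lambda>x. f n x - f (r k) x) (\<lambda>x. f n x - f (r k) x)))"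
      by (subst nn[OF L2_diff[OF f f]]) simp
    also have "\<dots> \<le> ennreal e"
    proof (rule Liminf_le)
      show "\<forall>\<^sub>F k in sequentially. ennreal (l2_inner M (\<lambda>x. f n x - f (r k) x) (\<lambda>x. f n x - f (r k) x)) \<le> ennreal e"
        using eventually_ge_at_top[of K]
      proof eventually_elim
        case (elim k)
        have "r k \<ge> K" using seq_suble[OF rmono, of k] elim by simp
        then show ?case using n by (intro ennreal_leI) fastforce
      qed
    qed simp
    finally show ?thesis .
  qed
  have dif: "(\<lambda>x. f n x - g x) \<in> L2 M"
    if "(\<integral>\<^sup>+x. ennreal ((norm (f n x - g x))\<^sup>2) \<partial>M) \<le> ennreal e" for n e
    unfolding L2_def using that by (auto intro!: integrableI_bounded simp: top_unique less_top[symmetric])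
  obtain K where "\<And>i j. i \<ge> K \<Longrightarrow> j \<ge> K \<Longrightarrow> l2_inner M (\<lambda>x. f i x - f j x) (\<lambda>x. f i x - f j x) < 1"
    using cau2[of 1] by auto
  from dif[OF fatou[OF _ this order_refl]] have "(\<lambda>x. f K x - g x) \<in> L2 M" by simp
  from L2_diff[OF f[of K] this] have gL2: "g \<in> L2 M" by simp
  have "(\<lambda>n. l2_norm M (\<lambda>x. f n x - g x)) \<longlonglongrightarrow> 0"
  proof (rule LIMSEQ_I)
    fix e :: real assume e: "0 < e"
    then have e2: "0 < (e/2)\<^sup>2" by simp
    from cau2[OF e2] obtain K where K: "\<And>i j. i \<ge> K \<Longrightarrow> j \<ge> K \<Longrightarrow> l2_inner M (\<lambda>x. f i x - f j x) (\<lambda>x. f i x - f j x) < (e/2)\<^sup>2"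
      by auto
    have "norm (l2_norm M (\<lambda>x. f n x - g x) - 0) < e" if "n \<ge> K" for n
    proof -
      from fatou[OF e2 K that] have "ennreal (l2_inner M (\<lambda>x. f n x - g x) (\<lambda>x. f n x - g x)) \<le> ennreal ((e/2)\<^sup>2)"
        using nn[OF L2_diff[OF f[of n] gL2]] by simp
      then have "(l2_norm M (\<lambda>x. f n x - g x))\<^sup>2 \<le> (e/2)\<^sup>2"
        by (simp add: l2_norm_sq)
      then have "l2_norm M (\<lambda>x. f n x - g x) \<le> e/2" by (rule power2_le_imp_le) (use e in simp)
      then show ?thesis using e l2_norm_nonneg[of M "\<lambda>x. f n x - g x"] by simp
    qed
    then show "\<exists>no. \<forall>n\<ge>no. norm (l2_norm M (\<lambda>x. f n x - g x) - 0) < e" by blast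
  qed
  with gL2 show ?thesis by blast
qed

section \<open>The torus\<close>

abbreviation torus :: "(real ^ 3) measure" where
  "torus \<equiv> restrict_space lborel cube"

lemma open_cube: "open cube"
  unfolding cube_def by (rule open_box)

lemma cube_sets [measurable, simp]: "cube \<in> sets borel"
  using open_cube by simp

lemma mem_cube: "x \<in> cube \<longleftrightarrow> (\<forall>i. - pi < x $ i \<and> x $ i < pi)"
  by (simp add: cube_def mem_box_cart)

lemma space_torus [simp]: "space torus = cube"
  by (simp add: space_restrict_space)

lemma LINT_cube:
  fixes f :: "real ^ 3 \<Rightarrow> 'b::{banach, second_countable_topology}"
  shows "(LINT x:cube|lborel. f x) = integral\<^sup>L torus f"
  unfolding set_lebesgue_integral_def by (subst integral_restrict_space) auto

lemma set_integrable_cube: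
  fixes f :: "real ^ 3 \<Rightarrow> 'b::{banach, second_countable_topology}"
  shows "set_integrable lborel cube f \<longleftrightarrow> integrable torus f"
  unfolding set_integrable_def by (subst integrable_restrict_space) auto

lemma borel_torus: "f \<in> borel_measurable borel \<Longrightarrow> f \<in> borel_measurable torus"
  by (simp add: measurable_restrict_space1)

lemma continuous_torus:
  "continuous_on UNIV f \<Longrightarrow> (f :: _ \<Rightarrow> 'b::topological_space) \<in> borel_measurable torus"
  by (intro borel_torus borel_measurable_continuous_onI)

lemma measure_cube: "measure lborel cube = (2 * pi) ^ 3"
proof -
  have "measure lborel cube = measure lborel (cbox (vec (- pi)) (vec pi :: real ^ 3))"
    unfolding cube_def by (simp add: measure_def emeasure_lborel_box_eq emeasure_lborel_cbox_eq)
  also have "\<dots> = (\<Prod>i\<in>UNIV. (vec pi :: real ^ 3) $ i - vec (- pi) $ i)"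
    by (rule content_cbox_cart) (auto simp: interval_ne_empty_cart)
  finally show ?thesis by simp
qed

lemma emeasure_cube_finite: "emeasure lborel cube < \<infinity>"
  unfolding cube_def by (rule emeasure_lborel_box_finite)

lemma measure_torus: "measure torus cube = (2 * pi) ^ 3"
  by (simp add: measure_restrict_space measure_cube)

interpretation torus: finite_measure torus
  by standard (use emeasure_cube_finite in \<open>auto simp: emeasure_restrict_space less_top\<close>)

text \<open>
  The half-open cell meets every orbit of the period lattice exactly once, unlike the open cube, from
  which it differs by a null set. The map \<open>wrap\<close> sends a point to the representative of its orbit.
\<close>

definition cell :: "(real ^ 3) set" where
  "cell = {x. \<forall>i. - pi \<le> x $ i \<and> x $ i < pi}"

definition lattice :: "int ^ 3 \<Rightarrow> real ^ 3" where
  "lattice n = (\<chi> i. 2 * pi * real_of_int (n $ i))"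

definition wrap_index :: "real ^ 3 \<Rightarrow> int ^ 3" where
  "wrap_index x = (\<chi> i. - \<lfloor>(x $ i + pi) / (2 * pi)\<rfloor>)"

definition wrap :: "real ^ 3 \<Rightarrow> real ^ 3" where
  "wrap x = x + lattice (wrap_index x)"

lemma cell_unique: "x + lattice n \<in> cell \<longleftrightarrow> n = wrap_index x"
proof -
  have "(- pi \<le> (x + lattice n) $ i \<and> (x + lattice n) $ i < pi) \<longleftrightarrow> n $ i = wrap_index x $ i" for i
  proof -
    have "- pi \<le> (x + lattice n) $ i \<longleftrightarrow> - of_int (n $ i) \<le> (x $ i + pi) / (2 * pi)"
      by (simp add: lattice_def field_simps) linarith
    moreover have "(x + lattice n) $ i < pi \<longleftrightarrow> (x $ i + pi) / (2 * pi) < - of_int (n $ i) + 1"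
      by (simp add: lattice_def field_simps)
    moreover have "\<lfloor>(x $ i + pi) / (2 * pi)\<rfloor> = - n $ i \<longleftrightarrow>
        of_int (- n $ i) \<le> (x $ i + pi) / (2 * pi) \<and> (x $ i + pi) / (2 * pi) < of_int (- n $ i) + 1"
      by (rule floor_eq_iff)
    ultimately show ?thesis by (auto simp: wrap_index_def)
  qed
  then show ?thesis by (auto simp: cell_def vec_eq_iff)
qed

lemma wrap_cell: "wrap x \<in> cell"
  unfolding wrap_def cell_unique ..

lemma cell_sets [measurable]: "cell \<in> sets borel"
  unfolding cell_def by measurable

lemma wrap_measurable [measurable]: "wrap \<in> borel_measurable borel"
proof -
  have "wrap = (\<lambda>x. \<Sum>i\<in>UNIV. (x $ i - 2 * pi * real_of_int \<lfloor>(x $ i + pi) / (2 * pi)\<rfloor>) *\<^sub>R axis i 1)"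
    by (auto simp: fun_eq_iff wrap_def vec_eq_iff wrap_index_def lattice_def axis_def if_distrib cong: if_cong)
  also have "\<dots> \<in> borel_measurable borel"
    by (intro borel_measurable_sum borel_measurable_scaleR) measurable
  finally show ?thesis .
qed

lemma AE_cell_cube: "AE x in lborel. x \<in> cell \<longleftrightarrow> x \<in> cube"
proof -
  let ?C = "cbox (vec (- pi)) (vec pi :: real ^ 3)"
  have e: "emeasure lborel (?C - cube) = 0"
  proof -
    have "emeasure lborel (?C - cube) = emeasure lborel ?C - emeasure lborel cube"
      using emeasure_cube_finite by (intro emeasure_Diff) (auto simp: cube_def box_subset_cbox)
    also have "\<dots> = 0"
      unfolding cube_def by (simp add: emeasure_lborel_box_eq emeasure_lborel_cbox_eq)
    finally show ?thesis .
  qed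
  have "AE x in lborel. x \<notin> ?C - cube"
    using e by (intro AE_not_in) (auto simp: null_sets_def)
  then show ?thesis
  proof eventually_elim
    case (elim x)
    then show ?case
      unfolding cell_def mem_cube Diff_iff mem_box_cart mem_Collect_eq vec_component by (meson less_imp_le order_less_le)
  qed
qed

lemma nn_integral_translate:
  fixes f :: "'a::euclidean_space \<Rightarrow> ennreal"
  assumes "f \<in> borel_measurable borel"
  shows "(\<integral>\<^sup>+x. f (x + t) \<partial>lborel) = (\<integral>\<^sup>+x. f x \<partial>lborel)"
proof -
  have "(\<integral>\<^sup>+x. f x \<partial>lborel) = (\<integral>\<^sup>+x. f x \<partial>distr lborel borel ((+) t))"
    by (simp add: lborel_distr_plus)
  also have "\<dots> = (\<integral>\<^sup>+x. f (t + x) \<partial>lborel)"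
    using assms by (intro nn_integral_distr) auto
  finally show ?thesis by (simp add: add.commute)
qed

text \<open>
  Translating the cell and cutting it along the lattice is a rearrangement: both sides are the
  integral of \<open>f(x) [x + n \<in> cell] [x - t \<in> cell]\<close> summed over the lattice.
\<close>

lemma nn_integral_cell_translate:
  fixes f :: "real ^ 3 \<Rightarrow> ennreal"
  assumes [measurable]: "f \<in> borel_measurable borel" and per: "\<And>x n. f (x + lattice n) = f x"
  shows "(\<integral>\<^sup>+x. indicator cell x * f (x + t) \<partial>lborel) = (\<integral>\<^sup>+x. indicator cell x * f x \<partial>lborel)"
proof -
  have one: "(\<integral>\<^sup>+n. indicator cell (x + lattice n) \<partial>count_space UNIV) = 1" for x
  proof -
    have "(\<lambda>n. indicator cell (x + lattice n) :: ennreal) = indicator {wrap_index x}"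
      by (auto simp: fun_eq_iff cell_unique split: split_indicator)
    then show ?thesis by simp
  qed
  have neg: "lattice (- n) = - lattice n" for n by (simp add: lattice_def vec_eq_iff)
  have one': "(\<integral>\<^sup>+n. indicator cell (x - lattice n) \<partial>count_space UNIV) = 1" for x
  proof -
    have "(\<integral>\<^sup>+n. indicator cell (x - lattice n) \<partial>count_space UNIV)
        = (\<integral>\<^sup>+n. indicator cell (x + lattice (uminus n)) \<partial>count_space UNIV)" by (simp add: neg)
    also have "\<dots> = (\<integral>\<^sup>+n. indicator cell (x + lattice n) \<partial>count_space UNIV)"
      by (rule nn_integral_bij_count_space) (rule bij_uminus)
    finally show ?thesis by (simp add: one)
  qed
  have "(\<integral>\<^sup>+x. indicator cell x * f (x + t) \<partial>lborel) = (\<integral>\<^sup>+x. indicator cell (x - t) * f x \<partial>lborel)"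
    using nn_integral_translate[of "\<lambda>x. indicator cell (x - t) * f x" t] by simp
  also have "\<dots> = (\<integral>\<^sup>+x. (\<integral>\<^sup>+n. indicator cell (x + lattice n) * (indicator cell (x - t) * f x) \<partial>count_space UNIV) \<partial>lborel)"
    by (subst nn_integral_multc) (auto simp: one)
  also have "\<dots> = (\<integral>\<^sup>+n. (\<integral>\<^sup>+x. indicator cell (x + lattice n) * (indicator cell (x - t) * f x) \<partial>lborel) \<partial>count_space UNIV)"
    by (rule nn_integral_count_space_nn_integral) auto
  also have "\<dots> = (\<integral>\<^sup>+n. (\<integral>\<^sup>+x. indicator cell x * (indicator cell (x - t - lattice n) * f x) \<partial>lborel) \<partial>count_space UNIV)"
  proof (rule nn_integral_cong)
    fix n
    have f': "f (x - lattice n) = f x" for x using per[of "x - lattice n" n] by simp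
    show "(\<integral>\<^sup>+x. indicator cell (x + lattice n) * (indicator cell (x - t) * f x) \<partial>lborel)
      = (\<integral>\<^sup>+x. indicator cell x * (indicator cell (x - t - lattice n) * f x) \<partial>lborel)"
      using nn_integral_translate[of "\<lambda>x. indicator cell x * (indicator cell (x - t - lattice n) * f x)" "lattice n"]
      by (simp add: per algebra_simps)
  qed
  also have "\<dots> = (\<integral>\<^sup>+x. (\<integral>\<^sup>+n. indicator cell x * (indicator cell (x - t - lattice n) * f x) \<partial>count_space UNIV) \<partial>lborel)"
    by (rule nn_integral_count_space_nn_integral[symmetric]) auto
  also have "\<dots> = (\<integral>\<^sup>+x. indicator cell x * f x \<partial>lborel)"
    by (subst nn_integral_cmult, simp, subst nn_integral_multc) (auto simp: one')
  finally show ?thesis .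
qed

lemma nn_integral_torus: "(\<integral>\<^sup>+x. f x \<partial>torus) = (\<integral>\<^sup>+x. indicator cell x * f x \<partial>lborel)"
proof -
  have "(\<integral>\<^sup>+x. f x \<partial>torus) = (\<integral>\<^sup>+x. f x * indicator cube x \<partial>lborel)"
    by (simp add: nn_integral_restrict_space)
  also have "\<dots> = (\<integral>\<^sup>+x. indicator cell x * f x \<partial>lborel)"
    using AE_cell_cube by (intro nn_integral_cong_AE) (auto split: split_indicator)
  finally show ?thesis .
qed

lemma nn_integral_torus_translate:
  fixes f :: "real ^ 3 \<Rightarrow> ennreal"
  assumes "f \<in> borel_measurable borel" and "\<And>x n. f (x + lattice n) = f x"
  shows "(\<integral>\<^sup>+x. f (x + t) \<partial>torus) = (\<integral>\<^sup>+x. f x \<partial>torus)"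
  unfolding nn_integral_torus by (rule nn_integral_cell_translate[OF assms])

lemma wrap_lattice: "wrap (x + lattice n) = wrap x"
proof -
  have "wrap x = (x + lattice n) + lattice (wrap_index x - n)"
    by (simp add: wrap_def lattice_def vec_eq_iff algebra_simps)
  moreover from this have "wrap_index x - n = wrap_index (x + lattice n)"
    using cell_unique wrap_cell by metis
  ultimately show ?thesis by (simp add: wrap_def)
qed

text \<open>
  A periodic function factors through \<open>wrap\<close>. The equality of the two image measures therefore carries
  translation invariance over from nonnegative functions to all Bochner integrals.
\<close>

lemma distr_wrap_translate: "distr torus borel (\<lambda>x. wrap (x + t)) = distr torus borel wrap"
proof (rule measure_eqI)
  have [measurable]: "wrap \<in> borel_measurable torus" "(\<lambda>x. wrap (x + t)) \<in> borel_measurable torus"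
    by (auto intro!: borel_torus)
  fix A assume "A \<in> sets (distr torus borel (\<lambda>x. wrap (x + t)))"
  then have [measurable]: "A \<in> sets borel" by simp
  have "emeasure (distr torus borel (\<lambda>x. wrap (x + t))) A = (\<integral>\<^sup>+y. indicator A y \<partial>distr torus borel (\<lambda>x. wrap (x + t)))"
    by simp
  also have "\<dots> = (\<integral>\<^sup>+x. indicator A (wrap (x + t)) \<partial>torus)"
    by (rule nn_integral_distr) measurable
  also have "\<dots> = (\<integral>\<^sup>+x. indicator A (wrap x) \<partial>torus)"
    by (rule nn_integral_torus_translate) (auto simp: wrap_lattice)
  also have "\<dots> = (\<integral>\<^sup>+y. indicator A y \<partial>distr torus borel wrap)"
    by (rule nn_integral_distr[symmetric]) measurable
  finally show "emeasure (distr torus borel (\<lambda>x. wrap (x + t))) A = emeasure (distr torus borel wrap) A"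
    by simp
qed simp

lemma
  fixes f :: "real ^ 3 \<Rightarrow> 'b::{banach, second_countable_topology}"
  assumes [measurable]: "f \<in> borel_measurable borel" and per: "\<And>x n. f (x + lattice n) = f x"
  shows integral_torus_translate: "(LINT x|torus. f (x + t)) = (LINT x|torus. f x)"
    and integrable_torus_translate: "integrable torus (\<lambda>x. f (x + t)) \<longleftrightarrow> integrable torus f"
proof -
  have [measurable]: "wrap \<in> borel_measurable torus" "(\<lambda>x. wrap (x + t)) \<in> borel_measurable torus"
    by (auto intro!: borel_torus)
  have w: "f (wrap x) = f x" for x by (simp add: wrap_def per)
  have "(LINT x|torus. f (x + t)) = (LINT x|distr torus borel (\<lambda>x. wrap (x + t)). f x)"
    by (subst integral_distr) (auto simp: w)
  also have "\<dots> = (LINT x|torus. f x)"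
    unfolding distr_wrap_translate by (subst integral_distr) (auto simp: w)
  finally show "(LINT x|torus. f (x + t)) = (LINT x|torus. f x)" .
  have "integrable torus (\<lambda>x. f (x + t)) \<longleftrightarrow> integrable (distr torus borel (\<lambda>x. wrap (x + t))) f"
    by (subst integrable_distr_eq) (auto simp: w)
  also have "\<dots> \<longleftrightarrow> integrable torus f"
    unfolding distr_wrap_translate by (subst integrable_distr_eq) (auto simp: w)
  finally show "integrable torus (\<lambda>x. f (x + t)) \<longleftrightarrow> integrable torus f" .
qed

lemma periodic_lattice:
  assumes "periodic u"
  shows "u (x + lattice n) = u x"
proof -
  have i: "u (x + (2 * pi * real_of_int k) *\<^sub>R axis i 1) = u x" for x i and k :: int
  proof (induction k rule: int_induct[where k = 0])
    case (step1 k)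
    have "x + (2 * pi * real_of_int (k + 1)) *\<^sub>R axis i 1
        = (x + (2 * pi * real_of_int k) *\<^sub>R axis i 1) + (2 * pi) *\<^sub>R axis i 1"
      by (simp add: algebra_simps)
    then show ?case using assms step1.IH unfolding periodic_def by metis
  next
    case (step2 k)
    have "x + (2 * pi * real_of_int k) *\<^sub>R axis i 1
        = (x + (2 * pi * real_of_int (k - 1)) *\<^sub>R axis i 1) + (2 * pi) *\<^sub>R axis i 1"
      by (simp add: algebra_simps)
    then show ?case using assms step2.IH unfolding periodic_def by metis
  qed simp
  have "x + lattice n = x + (2 * pi * real_of_int (n $ 1)) *\<^sub>R axis 1 1
      + (2 * pi * real_of_int (n $ 2)) *\<^sub>R axis 2 1 + (2 * pi * real_of_int (n $ 3)) *\<^sub>R axis 3 1"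
    by (simp add: vec_eq_iff lattice_def axis_def forall_3)
  then show ?thesis by (metis i)
qed

lemma integrable_mult_bounded:
  fixes f g :: "'a \<Rightarrow> 'b::{real_normed_algebra, banach, second_countable_topology}"
  assumes f: "integrable M f" and g: "g \<in> borel_measurable M" and B: "\<And>x. x \<in> space M \<Longrightarrow> norm (g x) \<le> B"
  shows "integrable M (\<lambda>x. f x * g x)"
proof (rule Bochner_Integration.integrable_bound)
  show "integrable M (\<lambda>x. B * norm (f x))" using f by simp
  show "(\<lambda>x. f x * g x) \<in> borel_measurable M"
    using f g by (intro borel_measurable_times) auto
  show "AE x in M. norm (f x * g x) \<le> norm (B * norm (f x))"
  proof (rule AE_I2)
    fix x assume "x \<in> space M"
    have "norm (f x * g x) \<le> norm (f x) * norm (g x)" by (rule norm_mult_ineq)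
    also have "\<dots> \<le> norm (f x) * B" using B[OF \<open>x \<in> space M\<close>] by (rule mult_left_mono) simp
    also have "\<dots> \<le> norm (B * norm (f x))" by (simp add: abs_mult mult.commute mult_right_mono)
    finally show "norm (f x * g x) \<le> norm (B * norm (f x))" .
  qed
qed

section \<open>Fourier coefficients\<close>

definition kdot :: "int ^ 3 \<Rightarrow> real ^ 3 \<Rightarrow> real" where
  "kdot k x = (\<Sum>i\<in>UNIV. real_of_int (k $ i) * x $ i)"

lemma kdot_add_left: "kdot (k + l) x = kdot k x + kdot l x"
  by (simp add: kdot_def algebra_simps sum.distrib)

lemma kdot_diff_left: "kdot (k - l) x = kdot k x - kdot l x"
  by (simp add: kdot_def algebra_simps sum_subtractf)

lemma kdot_add_right: "kdot k (x + y) = kdot k x + kdot k y"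
  by (simp add: kdot_def algebra_simps sum.distrib)

lemma kdot_axis: "kdot k (axis i c) = real_of_int (k $ i) * c"
proof -
  have "kdot k (axis i c) = (\<Sum>j\<in>UNIV. if j = i then real_of_int (k $ i) * c else 0)"
    unfolding kdot_def by (intro sum.cong) (auto simp: axis_def)
  then show ?thesis by simp
qed

lemma kdot_axis_left: "kdot (axis i c) x = real_of_int c * x $ i"
proof -
  have "kdot (axis i c) x = (\<Sum>j\<in>UNIV. if j = i then real_of_int c * x $ i else 0)"
    unfolding kdot_def by (intro sum.cong) (auto simp: axis_def)
  then show ?thesis by simp
qed

text \<open>The inner product of a frequency with a period is a multiple of \<open>2 \<pi>\<close>.\<close>

lemma kdot_lattice: "cis (kdot k (x + lattice n)) = cis (kdot k x)"
proof -
  have "kdot k (lattice n) = 2 * pi * of_int (\<Sum>i\<in>UNIV. k $ i * n $ i)"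
    by (simp add: kdot_def lattice_def sum_distrib_left mult.commute mult.left_commute)
  then have "cis (kdot k (lattice n)) = 1"
    by (simp only: cis_multiple_2pi Ints_of_int)
  then show ?thesis unfolding kdot_add_right cis_mult[symmetric] by simp
qed

lemma continuous_kdot [continuous_intros]: "continuous_on A g \<Longrightarrow> continuous_on A (\<lambda>x. kdot k (g x))"
  unfolding kdot_def by (intro continuous_intros)

lemma cis_kdot_measurable [measurable]: "(\<lambda>x. cis (kdot k x)) \<in> borel_measurable borel"
  by (intro borel_measurable_continuous_onI continuous_intros)

lemma integral_character: "(LINT x|torus. cis (kdot k x)) = (if k = 0 then of_real ((2 * pi) ^ 3) else 0)"
proof (cases "k = 0")
  case True
  have "(LINT x|torus. (1::complex)) = of_real ((2 * pi) ^ 3)"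
    by (simp add: scaleR_conv_of_real measure_torus)
  with True show ?thesis by (simp add: kdot_def)
next
  case False
  then obtain i where i: "k $ i \<noteq> 0" by (auto simp: vec_eq_iff)
  \<comment> \<open>A translation by half a wavelength changes the sign of the character.\<close>
  let ?t = "axis i (pi / real_of_int (k $ i)) :: real ^ 3"
  have "(LINT x|torus. cis (kdot k x)) = (LINT x|torus. cis (kdot k (x + ?t)))"
    by (rule integral_torus_translate[symmetric]) (auto simp: kdot_lattice)
  also have "\<dots> = (LINT x|torus. - cis (kdot k x))"
    unfolding kdot_add_right cis_mult[symmetric] using i by (simp add: kdot_axis)
  finally show ?thesis using False by simp
qed

definition mode :: "int ^ 3 \<Rightarrow> real ^ 3 \<Rightarrow> complex" where
  "mode k x = of_real ((2 * pi) powr (- 3 / 2)) * cis (kdot k x)"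

definition mode_coeff :: "(real ^ 3 \<Rightarrow> complex) \<Rightarrow> int ^ 3 \<Rightarrow> complex" where
  "mode_coeff f k = (LINT x|torus. f x * cnj (mode k x))"

definition trig :: "(int ^ 3) set \<Rightarrow> (int ^ 3 \<Rightarrow> complex) \<Rightarrow> real ^ 3 \<Rightarrow> complex" where
  "trig F c x = (\<Sum>k\<in>F. c k * mode k x)"

lemma norm_mode: "cmod (mode k x) = (2 * pi) powr (- 3 / 2)"
  by (simp add: mode_def norm_mult)

lemma continuous_mode [continuous_intros]: "continuous_on A g \<Longrightarrow> continuous_on A (\<lambda>x. mode k (g x))"
  unfolding mode_def by (intro continuous_intros)

lemma mode_measurable [measurable]: "mode k \<in> borel_measurable borel"
  using continuous_mode[of UNIV "\<lambda>x. x"] by (auto intro: borel_measurable_continuous_onI)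

lemma cnj_mode_measurable [measurable]: "(\<lambda>x. cnj (mode k x)) \<in> borel_measurable borel"
  by (intro borel_measurable_continuous_onI continuous_intros)

lemma mode_torus [measurable]: "mode k \<in> borel_measurable torus"
  by (rule borel_torus) measurable

lemma trig_measurable [measurable]: "trig F c \<in> borel_measurable borel"
  unfolding trig_def[abs_def] by measurable

lemma mode_lattice: "mode k (x + lattice n) = mode k x"
  by (simp add: mode_def kdot_lattice)

lemma fourier_coeff_eq: "fourier_coeff u k = mode_coeff (\<lambda>x. of_real (u x)) k"
proof -
  have "of_real (u x) * exp (- (\<i> * of_real (\<Sum>i\<in>UNIV. of_int (k $ i) * x $ i))) = of_real (u x) * cnj (cis (kdot k x))" for x
    by (simp add: kdot_def cis_conv_exp exp_cnj)
  then have "fourier_coeff u k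
      = of_real ((2 * pi) powr (- 3 / 2)) * (LINT x|torus. of_real (u x) * cnj (cis (kdot k x)))"
    unfolding fourier_coeff_def LINT_cube by (simp only:)
  also have "\<dots> = (LINT x|torus. of_real ((2 * pi) powr (- 3 / 2)) * (of_real (u x) * cnj (cis (kdot k x))))"
    by (rule integral_mult_right_zero[symmetric])
  also have "\<dots> = mode_coeff (\<lambda>x. of_real (u x)) k"
    unfolding mode_coeff_def mode_def by (intro Bochner_Integration.integral_cong refl) simp
  finally show ?thesis .
qed

lemma mode_orthonormal: "(LINT x|torus. mode k x * cnj (mode l x)) = (if k = l then 1 else 0)"
proof -
  have p: "(2 * pi) powr (- 3 / 2) * ((2 * pi) powr (- 3 / 2) * (2 * pi) ^ 3) = (1::real)"
  proof -
    have "(2 * pi) powr (- 3 / 2) * (2 * pi) powr (- 3 / 2) * (2 * pi) powr 3 = (2 * pi) powr (- 3 / 2 + - 3 / 2 + 3)"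
      by (simp only: powr_add)
    also have "\<dots> = 1" by simp
    finally have "(2 * pi) powr (- 3 / 2) * (2 * pi) powr (- 3 / 2) * (2 * pi) powr 3 = 1" .
    moreover have "(2 * pi) powr 3 = (2 * pi) ^ 3" by (rule powr_numeral) simp
    ultimately show ?thesis by (simp only: mult.assoc)
  qed
  then have p': "of_real ((2 * pi) powr (- 3 / 2)) * of_real ((2 * pi) powr (- 3 / 2)) * of_real ((2 * pi) ^ 3) = (1 :: complex)"
    by (metis of_real_mult of_real_1 mult.assoc)
  have "(LINT x|torus. mode k x * cnj (mode l x))
      = (LINT x|torus. (of_real ((2 * pi) powr (- 3 / 2)) * of_real ((2 * pi) powr (- 3 / 2))) * cis (kdot (k - l) x))"
  proof (intro Bochner_Integration.integral_cong refl)
    fix x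
    have "cis (kdot (k - l) x) = cis (kdot k x) * cnj (cis (kdot l x))"
      by (simp add: kdot_diff_left cis_cnj cis_mult)
    then show "mode k x * cnj (mode l x)
        = of_real ((2 * pi) powr (- 3 / 2)) * of_real ((2 * pi) powr (- 3 / 2)) * cis (kdot (k - l) x)"
      unfolding mode_def by (simp only: complex_cnj_mult complex_cnj_complex_of_real mult_ac)
  qed
  also have "\<dots> = (if k = l then 1 else 0)"
  proof (cases "k = l")
    case True
    then show ?thesis unfolding integral_mult_right_zero integral_character using p' by (simp only: diff_self if_True simp_thms)
  next
    case False
    then show ?thesis unfolding integral_mult_right_zero integral_character by simp
  qed
  finally show ?thesis .
qed

lemma integrable_mult_mode:
  assumes "integrable torus f"
  shows "integrable torus (\<lambda>x. f x * mode k x)" "integrable torus (\<lambda>x. f x * cnj (mode k x))"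
proof -
  have "(\<lambda>x. cnj (mode k x)) \<in> borel_measurable torus"
    by (intro continuous_torus continuous_intros)
  then show "integrable torus (\<lambda>x. f x * mode k x)" "integrable torus (\<lambda>x. f x * cnj (mode k x))"
    by (intro integrable_mult_bounded[OF assms, where B = "(2 * pi) powr (- 3 / 2)"]; simp add: norm_mode)+
qed

lemma L2_integrable_torus:
  assumes "f \<in> L2 torus"
  shows "integrable torus f"
proof (rule Bochner_Integration.integrable_bound)
  show "integrable torus (\<lambda>x. 1 + (norm (f x))\<^sup>2)"
    using assms by (simp add: L2_def)
  show "f \<in> borel_measurable torus" using assms by (rule L2_measurable)
  have "norm (f x) \<le> norm (1 + (norm (f x))\<^sup>2)" for x
    using sum_squares_bound[of 1 "norm (f x)"] by (simp add: power2_eq_square) (smt (verit) norm_ge_zero)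
  then show "AE x in torus. norm (f x) \<le> norm (1 + (norm (f x))\<^sup>2)" by simp
qed

lemma bounded_L2_torus:
  assumes "f \<in> borel_measurable torus" and B: "\<And>x. x \<in> cube \<Longrightarrow> norm (f x) \<le> B"
  shows "f \<in> L2 torus"
proof -
  have "integrable torus (\<lambda>x. (norm (f x))\<^sup>2)"
  proof (rule torus.integrable_const_bound)
    show "AE x in torus. norm ((norm (f x))\<^sup>2) \<le> B\<^sup>2"
      by (rule AE_I2) (auto intro: power_mono B)
  qed (use assms in measurable)
  then show ?thesis using assms by (simp add: L2_def)
qed

lemma trig_L2: "trig F c \<in> L2 torus"
proof (rule bounded_L2_torus)
  show "trig F c \<in> borel_measurable torus" by (rule borel_torus) measurable
  show "norm (trig F c x) \<le> (\<Sum>k\<in>F. cmod (c k) * (2 * pi) powr (- 3 / 2))" for x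
    unfolding trig_def by (intro order_trans[OF norm_sum] sum_mono) (simp add: norm_mult norm_mode)
qed

lemma complex_inner: "(x::complex) \<bullet> y = Re (x * cnj y)"
  by (simp add: inner_complex_def)

lemma l2_inner_trig:
  assumes "f \<in> L2 torus"
  shows "l2_inner torus f (trig F c) = (\<Sum>k\<in>F. mode_coeff f k \<bullet> c k)"
proof -
  note i = integrable_mult_mode(2)[OF L2_integrable_torus[OF assms]]
  have e: "f x \<bullet> trig F c x = (\<Sum>k\<in>F. Re (cnj (c k) * (f x * cnj (mode k x))))" for x
    by (simp only: trig_def complex_inner cnj_sum complex_cnj_mult sum_distrib_left Re_sum)
      (simp add: mult.left_commute mult.commute)
  have "l2_inner torus f (trig F c) = (\<Sum>k\<in>F. (LINT x|torus. Re (cnj (c k) * (f x * cnj (mode k x)))))"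
    unfolding l2_inner_def e using i by (intro Bochner_Integration.integral_sum integrable_Re integrable_mult_right) auto
  also have "\<dots> = (\<Sum>k\<in>F. Re (cnj (c k) * mode_coeff f k))"
    unfolding mode_coeff_def using i by (intro sum.cong refl, subst integral_Re) auto
  finally show ?thesis by (simp add: complex_inner mult.commute)
qed

lemma coeff_trig:
  assumes "finite F"
  shows "mode_coeff (trig F c) k = (if k \<in> F then c k else 0)"
proof -
  have m: "integrable torus (\<lambda>x. mode l x * cnj (mode k x))" for l
  proof (rule integrable_mult_mode)
    show "integrable torus (mode l)"
      by (rule torus.integrable_const_bound[where B = "(2 * pi) powr (- 3 / 2)"]) (auto simp: norm_mode)
  qed
  have "mode_coeff (trig F c) k = (LINT x|torus. (\<Sum>l\<in>F. c l * (mode l x * cnj (mode k x))))"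
    by (simp add: mode_coeff_def trig_def sum_distrib_right mult.assoc)
  also have "\<dots> = (\<Sum>l\<in>F. c l * (if l = k then 1 else 0))"
    using m by (subst Bochner_Integration.integral_sum) (auto simp: mode_orthonormal)
  also have "\<dots> = (if k \<in> F then c k else 0)"
    using assms by (simp add: if_distrib cong: if_cong)
  finally show ?thesis .
qed

lemma l2_inner_trig_trig:
  assumes "finite F"
  shows "l2_inner torus (trig F c) (trig F c) = (\<Sum>k\<in>F. (cmod (c k))\<^sup>2)"
  by (simp add: l2_inner_trig[OF trig_L2] coeff_trig[OF assms] power2_norm_eq_inner)

text \<open>The partial Fourier sum is the orthogonal projection onto the span of its modes.\<close>

lemma trig_approx_sq:
  assumes "f \<in> L2 torus" "finite F"
  shows "l2_inner torus (\<lambda>x. f x - trig F (mode_coeff f) x) (\<lambda>x. f x - trig F (mode_coeff f) x)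
     = l2_inner torus f f - (\<Sum>k\<in>F. (cmod (mode_coeff f k))\<^sup>2)"
  using l2_inner_add_self[OF assms(1) trig_L2, of "-1" F "mode_coeff f"]
  by (simp add: l2_inner_trig[OF assms(1)] l2_inner_trig_trig[OF assms(2)] power2_norm_eq_inner)

lemma Bessel:
  assumes "f \<in> L2 torus" "finite F"
  shows "(\<Sum>k\<in>F. (cmod (mode_coeff f k))\<^sup>2) \<le> l2_inner torus f f"
  using trig_approx_sq[OF assms] l2_inner_self_nonneg[of torus "\<lambda>x. f x - trig F (mode_coeff f) x"] by simp

lemma coeff_bound: "f \<in> L2 torus \<Longrightarrow> cmod (mode_coeff f k) \<le> l2_norm torus f"
  using Bessel[of f "{k}"] by (simp add: l2_norm_def real_le_rsqrt)

lemma coeff_diff: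
  assumes "f \<in> L2 torus" "g \<in> L2 torus"
  shows "mode_coeff (\<lambda>x. f x - g x) k = mode_coeff f k - mode_coeff g k"
  using integrable_mult_mode(2)[OF L2_integrable_torus[OF assms(1)]]
    integrable_mult_mode(2)[OF L2_integrable_torus[OF assms(2)]]
  by (simp add: mode_coeff_def left_diff_distrib)

lemma coeff_tendsto:
  assumes f: "\<And>n. f n \<in> L2 torus" "g \<in> L2 torus"
    and l: "(\<lambda>n. l2_norm torus (\<lambda>x. f n x - g x)) \<longlonglongrightarrow> 0"
  shows "(\<lambda>n. mode_coeff (f n) k) \<longlonglongrightarrow> mode_coeff g k"
proof -
  have "(\<lambda>n. mode_coeff (f n) k - mode_coeff g k) \<longlonglongrightarrow> 0"
  proof (rule Lim_null_comparison[OF _ l])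
    show "\<forall>\<^sub>F n in sequentially. cmod (mode_coeff (f n) k - mode_coeff g k) \<le> l2_norm torus (\<lambda>x. f n x - g x)"
      using coeff_bound[OF L2_diff[OF f(1) f(2)]] unfolding coeff_diff[OF f(1) f(2)] by (intro always_eventually allI)
  qed
  then show ?thesis by (simp add: LIM_zero_iff)
qed

lemma coeff_translate:
  fixes f :: "real ^ 3 \<Rightarrow> complex"
  assumes [measurable]: "f \<in> borel_measurable borel" and per: "\<And>x n. f (x + lattice n) = f x"
  shows "mode_coeff (\<lambda>x. f (x + t)) k = cis (kdot k t) * mode_coeff f k"
proof -
  have "mode_coeff f k = (LINT x|torus. f (x + t) * cnj (mode k (x + t)))"
    unfolding mode_coeff_def by (rule integral_torus_translate[symmetric]) (measurable, simp add: per mode_lattice)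
  also have "\<dots> = (LINT x|torus. cis (- kdot k t) * (f (x + t) * cnj (mode k x)))"
    unfolding mode_def kdot_add_right cis_mult[symmetric]
    by (intro Bochner_Integration.integral_cong refl) (simp add: cis_cnj)
  also have "\<dots> = cis (- kdot k t) * mode_coeff (\<lambda>x. f (x + t)) k"
    unfolding mode_coeff_def by simp
  finally show ?thesis by (simp add: cis_mult mult.assoc[symmetric])
qed

section \<open>Functions with the same Fourier coefficients\<close>

text \<open>
  Composed with this map, real polynomials on \<open>\<complex>\<^sup>3\<close> become trigonometric polynomials. They are dense in the
  continuous functions on a ball that contains its image, which is how the Stone--Weierstrass
  theorem enters.
\<close>

definition to_circles :: "real ^ 3 \<Rightarrow> complex ^ 3" where
  "to_circles x = (\<chi> i. cis (x $ i))"

lemma continuous_to_circles: "continuous_on A to_circles"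
  unfolding to_circles_def by (intro continuous_intros continuous_on_vec_lambda)

lemma norm_to_circles: "norm (to_circles x) \<le> 3"
  unfolding norm_vec_def by (rule order_trans[OF L2_set_le_sum]) (simp_all add: to_circles_def sum_3)

lemma to_circles_inj: "inj_on to_circles cube"
proof (rule inj_onI)
  fix x y assume x: "x \<in> cube" and y: "y \<in> cube" and e: "to_circles x = to_circles y"
  have "x $ i = y $ i" for i
  proof -
    have "cis (x $ i) = cis (y $ i)" using e by (metis to_circles_def vec_lambda_beta)
    moreover have "Arg (cis (x $ i)) = x $ i" "Arg (cis (y $ i)) = y $ i"
      using x y by (auto intro!: Arg_cis simp: mem_cube less_imp_le)
    ultimately show ?thesis by metis
  qed
  then show "x = y" by (simp add: vec_eq_iff)
qed

text \<open>
  If \<open>\<Integral> f g e\<^sub>k = 0\<close> for all \<open>k\<close>, then the same holds with \<open>g\<close> replaced by \<open>g p\<close>, for every \<open>p\<close> that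
  is a polynomial in the coordinates of \<open>to_circles\<close>. Quantifying over the factor \<open>g\<close> makes the property
  of \<open>p\<close> stable under products.
\<close>

lemma polynomial_orthogonal:
  fixes f :: "real ^ 3 \<Rightarrow> complex"
  assumes p: "real_polynomial_function p" and f: "integrable torus f"
    and g: "continuous_on UNIV g" "\<And>x. cmod (g x) \<le> B"
    and z: "\<And>k. (LINT x|torus. f x * g x * cis (kdot k x)) = 0"
  shows "(LINT x|torus. f x * (g x * of_real (p (to_circles x))) * cis (kdot k x)) = 0"
  using p g z
proof (induction p arbitrary: g B k rule: real_polynomial_function.induct)
  case (linear h)
  have ii: "integrable torus (\<lambda>x. f x * g x * cis (kdot l x))" for l
  proof -
    have "integrable torus (\<lambda>x. f x * (g x * cis (kdot l x)))"
      using linear by (intro integrable_mult_bounded[OF f, where B = B] continuous_torus continuous_intros)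
        (auto simp: norm_mult)
    then show ?thesis by (simp add: mult.assoc)
  qed
  interpret h: bounded_linear h by fact
  define a b where "a i = h (axis i 1)" and "b i = h (axis i \<i>)" for i
  have hx: "h (to_circles x) = (\<Sum>i\<in>UNIV. a i * cos (x $ i) + b i * sin (x $ i))" for x
  proof -
    have "to_circles x = (\<Sum>i\<in>UNIV. cos (x $ i) *\<^sub>R axis i 1 + sin (x $ i) *\<^sub>R axis i \<i>)"
      by (simp add: vec_eq_iff to_circles_def axis_def if_distrib sum.distrib cis_conv_exp complex_eq_iff
          Re_exp Im_exp cong: if_cong)
    then show ?thesis by (simp add: h.sum h.add h.scaleR a_def b_def mult.commute)
  qed
  define \<alpha> \<beta> where "\<alpha> i = Complex (a i / 2) (- b i / 2)" and "\<beta> i = Complex (a i / 2) (b i / 2)" for i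
  have c: "of_real (a i * cos t + b i * sin t) = \<alpha> i * cis t + \<beta> i * cis (- t)" for i t
    by (simp add: complex_eq_iff \<alpha>_def \<beta>_def)
  have "f x * (g x * of_real (h (to_circles x))) * cis (kdot k x)
      = (\<Sum>i\<in>UNIV. \<alpha> i * (f x * g x * cis (kdot (k + axis i 1) x))
          + \<beta> i * (f x * g x * cis (kdot (k + axis i (- 1)) x)))" for x
  proof -
    have "cis (kdot (k + axis i 1) x) = cis (x $ i) * cis (kdot k x)" for i
      by (simp add: kdot_add_left kdot_axis_left cis_mult add.commute)
    moreover have "cis (kdot (k + axis i (- 1)) x) = cis (- x $ i) * cis (kdot k x)" for i
      by (simp add: kdot_add_left kdot_axis_left cis_mult add.commute)
    ultimately show ?thesis
      unfolding hx of_real_sum c by (simp add: sum_distrib_left sum_distrib_right algebra_simps)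
  qed
  then have "(LINT x|torus. f x * (g x * of_real (h (to_circles x))) * cis (kdot k x))
      = (LINT x|torus. (\<Sum>i\<in>UNIV. \<alpha> i * (f x * g x * cis (kdot (k + axis i 1) x))
          + \<beta> i * (f x * g x * cis (kdot (k + axis i (- 1)) x))))"
    by (simp only:)
  also have "\<dots> = (\<Sum>i\<in>UNIV. \<alpha> i * (LINT x|torus. f x * g x * cis (kdot (k + axis i 1) x))
      + \<beta> i * (LINT x|torus. f x * g x * cis (kdot (k + axis i (- 1)) x)))"
    using ii by (subst Bochner_Integration.integral_sum) (auto simp del: sum_3)
  also have "\<dots> = 0" using linear by simp
  finally show ?case .
next
  case (const c)
  have "(LINT x|torus. f x * (g x * of_real c) * cis (kdot k x))
      = (LINT x|torus. of_real c * (f x * g x * cis (kdot k x)))"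
    by (intro Bochner_Integration.integral_cong) (auto simp: mult_ac)
  then show ?case using const by simp
next
  case (add p1 p2)
  have ii: "integrable torus (\<lambda>x. f x * (g x * of_real (p (to_circles x))) * cis (kdot k x))"
    if p: "real_polynomial_function p" for p
  proof -
    have cont: "continuous_on UNIV (\<lambda>x. p (to_circles x))"
      using continuous_on_compose2[OF continuous_on_polymonial_function continuous_to_circles] p
      by (auto simp: real_polynomial_function_eq)
    have "compact (p ` (cball 0 3))"
      using p by (intro compact_continuous_image continuous_on_polymonial_function) (auto simp: real_polynomial_function_eq)
    then obtain C where C: "\<And>z. z \<in> cball 0 3 \<Longrightarrow> \<bar>p z\<bar> \<le> C"
      using compact_imp_bounded by (fastforce simp: bounded_iff)
    then have bd: "\<bar>p (to_circles x)\<bar> \<le> C" for x by (intro C) (simp add: norm_to_circles)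
    have "0 \<le> B" using add.prems(2)[of 0] by (rule order_trans[OF norm_ge_zero])
    have "integrable torus (\<lambda>x. f x * ((g x * of_real (p (to_circles x))) * cis (kdot k x)))"
    proof (intro integrable_mult_bounded[OF f, where B = "B * C"] continuous_torus continuous_intros cont add.prems)
      show "cmod (g x * of_real (p (to_circles x)) * cis (kdot k x)) \<le> B * C" for x
        using add.prems(2) bd \<open>0 \<le> B\<close> by (auto simp: norm_mult intro!: mult_mono)
    qed
    then show ?thesis by (simp add: mult.assoc)
  qed
  have "(LINT x|torus. f x * (g x * of_real (p1 (to_circles x) + p2 (to_circles x))) * cis (kdot k x))
     = (LINT x|torus. f x * (g x * of_real (p1 (to_circles x))) * cis (kdot k x)
         + f x * (g x * of_real (p2 (to_circles x))) * cis (kdot k x))"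
    by (simp add: algebra_simps)
  also have "\<dots> = 0"
    using ii[OF add.hyps(1)] ii[OF add.hyps(2)] add.IH(1)[OF add.prems] add.IH(2)[OF add.prems] by simp
  finally show ?case .
next
  case (mult p1 p2)
  have cont: "continuous_on UNIV (\<lambda>x. p1 (to_circles x))"
    using continuous_on_compose2[OF continuous_on_polymonial_function continuous_to_circles] mult.hyps(1)
    by (auto simp: real_polynomial_function_eq)
  have "compact (p1 ` (cball 0 3))"
    using mult.hyps(1) by (intro compact_continuous_image continuous_on_polymonial_function) (auto simp: real_polynomial_function_eq)
  then obtain C where C: "\<And>z. z \<in> cball 0 3 \<Longrightarrow> \<bar>p1 z\<bar> \<le> C"
    using compact_imp_bounded by (fastforce simp: bounded_iff)
  then have bd: "\<bar>p1 (to_circles x)\<bar> \<le> C" for x by (intro C) (simp add: norm_to_circles)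
  have "0 \<le> B" using mult.prems(2)[of 0] by (rule order_trans[OF norm_ge_zero])
  have "(LINT x|torus. f x * ((g x * of_real (p1 (to_circles x))) * of_real (p2 (to_circles x))) * cis (kdot k x)) = 0"
  proof (rule mult.IH(2)[where B = "B * C"])
    show "continuous_on UNIV (\<lambda>x. g x * complex_of_real (p1 (to_circles x)))"
      by (intro continuous_intros mult.prems cont)
    show "cmod (g x * of_real (p1 (to_circles x))) \<le> B * C" for x
      using mult.prems(2) bd \<open>0 \<le> B\<close> by (auto simp: norm_mult intro!: mult_mono)
    show "(LINT x|torus. f x * (g x * of_real (p1 (to_circles x))) * cis (kdot l x)) = 0" for l
      by (rule mult.IH(1)[OF mult.prems])
  qed
  then show ?case by (simp add: mult.assoc)
qed

text \<open>Continuous functions on the ball are uniform limits of polynomials, for which the claim is known.\<close>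

lemma continuous_orthogonal:
  fixes f :: "real ^ 3 \<Rightarrow> complex" and h :: "complex ^ 3 \<Rightarrow> real"
  assumes f: "integrable torus f" and z: "\<And>k. (LINT x|torus. f x * cis (kdot k x)) = 0"
    and h: "continuous_on UNIV h"
  shows "(LINT x|torus. f x * of_real (h (to_circles x))) = 0"
proof -
  have bound: "cmod (LINT x|torus. f x * of_real (h (to_circles x))) \<le> e * (LINT x|torus. cmod (f x))"
    if e: "0 < e" for e
  proof -
    have "continuous_on (cball 0 3) h" using h continuous_on_subset by blast
    then obtain p where p: "real_polynomial_function p" and ph: "\<And>z. z \<in> cball 0 3 \<Longrightarrow> \<bar>h z - p z\<bar> < e"
      using Stone_Weierstrass_real_polynomial_function[OF compact_cball _ e] by blast
    have hp: "\<bar>h (to_circles x) - p (to_circles x)\<bar> \<le> e" for x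
      using ph[of "to_circles x"] norm_to_circles[of x] by simp
    have cp: "continuous_on UNIV (\<lambda>x. p (to_circles x))" "continuous_on UNIV (\<lambda>x. h (to_circles x))"
      using continuous_on_compose2[OF continuous_on_polymonial_function continuous_to_circles] p
        continuous_on_compose2[OF h continuous_to_circles]
      by (auto simp: real_polynomial_function_eq)
    have "(LINT x|torus. f x * (1 * of_real (p (to_circles x))) * cis (kdot 0 x)) = 0"
      by (rule polynomial_orthogonal[OF p f, where B = 1]) (use z in auto)
    then have p0: "(LINT x|torus. f x * of_real (p (to_circles x))) = 0"
      by (simp add: kdot_def)
    obtain C where C: "\<And>z. z \<in> cball 0 3 \<Longrightarrow> \<bar>h z\<bar> \<le> C"
      using compact_imp_bounded[OF compact_continuous_image[OF \<open>continuous_on (cball 0 3) h\<close> compact_cball]]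
      by (fastforce simp: bounded_iff)
    have i1: "integrable torus (\<lambda>x. f x * of_real (h (to_circles x)))"
      by (rule integrable_mult_bounded[OF f, where B = C])
        (use C norm_to_circles cp in \<open>auto intro!: continuous_torus continuous_intros\<close>)
    have i2: "integrable torus (\<lambda>x. f x * of_real (h (to_circles x) - p (to_circles x)))"
      by (rule integrable_mult_bounded[OF f, where B = e])
        (use hp cp in \<open>auto intro!: continuous_torus continuous_intros simp flip: of_real_diff\<close>)
    have i3: "integrable torus (\<lambda>x. f x * of_real (p (to_circles x)))"
      using Bochner_Integration.integrable_diff[OF i1 i2] by (simp add: algebra_simps)
    have "(LINT x|torus. f x * of_real (h (to_circles x)))
        = (LINT x|torus. f x * of_real (h (to_circles x) - p (to_circles x)))"
      using Bochner_Integration.integral_diff[OF i1 i3] p0 by (simp add: algebra_simps)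
    also have "cmod \<dots> \<le> (LINT x|torus. cmod (f x * of_real (h (to_circles x) - p (to_circles x))))"
      by (rule integral_norm_bound)
    also have "\<dots> \<le> (LINT x|torus. e * cmod (f x))"
    proof (rule integral_mono)
      fix x
      show "cmod (f x * of_real (h (to_circles x) - p (to_circles x))) \<le> e * cmod (f x)"
        unfolding norm_mult norm_of_real using mult_left_mono[OF hp[of x], of "cmod (f x)"]
        by (simp add: mult.commute)
    qed (use i2 f in \<open>auto intro: integrable_norm\<close>)
    finally show ?thesis by simp
  qed
  have "cmod (LINT x|torus. f x * of_real (h (to_circles x))) \<le> 0"
  proof (rule field_le_epsilon)
    fix e :: real assume e: "0 < e"
    let ?I = "LINT x|torus. cmod (f x)"
    have I: "0 \<le> ?I" by simp
    have "e / (J + 1) * J \<le> e" if "0 \<le> J" for J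
      using e that by (simp add: field_simps)
    note this[OF I]
    then show "cmod (LINT x|torus. f x * of_real (h (to_circles x))) \<le> 0 + e"
      using bound[of "e / (?I + 1)"] e I by simp
  qed
  then show ?thesis by simp
qed

text \<open>
  Bump functions of the distance to the compact image of \<open>A\<close> decrease to the indicator of \<open>A\<close>,
  because \<open>to_circles\<close> is injective on the cube.
\<close>

lemma compact_orthogonal:
  fixes f :: "real ^ 3 \<Rightarrow> complex"
  assumes f: "integrable torus f" and z: "\<And>k. (LINT x|torus. f x * cis (kdot k x)) = 0"
    and A: "compact A" "A \<subseteq> cube"
  shows "(LINT x|torus. f x * of_real (indicator A x)) = 0"
proof (cases "A = {}")
  case False
  define E where "E = to_circles ` A"
  have E: "closed E" "E \<noteq> {}"
    using A False by (auto simp: E_def intro!: compact_imp_closed compact_continuous_image continuous_to_circles)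
  define h where "h n y = max 0 (1 - real n * infdist y E)" for n y
  have hc: "continuous_on UNIV (h n)" for n
    unfolding h_def by (intro continuous_intros)
  have hb: "\<bar>h n y\<bar> \<le> 1" for n y by (simp add: h_def infdist_nonneg)
  have lim: "(\<lambda>n. h n (to_circles x)) \<longlonglongrightarrow> indicator A x" if x: "x \<in> cube" for x
  proof (cases "x \<in> A")
    case True
    then have "h n (to_circles x) = 1" for n by (simp add: h_def E_def)
    then show ?thesis using True by simp
  next
    case False
    then have "to_circles x \<notin> E"
      using x A to_circles_inj by (auto simp: E_def dest: inj_onD)
    then have d: "0 < infdist (to_circles x) E"
      using E by (metis in_closed_iff_infdist_zero infdist_nonneg less_eq_real_def)
    obtain N where N: "1 / infdist (to_circles x) E \<le> real N" using real_arch_simple by blast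
    have "\<forall>\<^sub>F n in sequentially. h n (to_circles x) = 0"
      using eventually_ge_at_top[of N]
    proof eventually_elim
      case (elim n)
      then have "1 / infdist (to_circles x) E \<le> real n" using N by linarith
      then show ?case using d by (simp add: h_def field_simps)
    qed
    then show ?thesis using False by (simp add: tendsto_eventually)
  qed
  have "(\<lambda>n. LINT x|torus. f x * of_real (h n (to_circles x))) \<longlonglongrightarrow> (LINT x|torus. f x * of_real (indicator A x))"
  proof (rule integral_dominated_convergence)
    have [measurable]: "A \<in> sets borel" using A by (simp add: borel_compact)
    have [measurable]: "f \<in> borel_measurable torus" using f by simp
    have "(\<lambda>x. complex_of_real (indicator A x)) \<in> borel_measurable torus"
      by (rule borel_torus) measurable
    then show "(\<lambda>x. f x * of_real (indicator A x)) \<in> borel_measurable torus" by measurable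
    have "(\<lambda>x. complex_of_real (h n (to_circles x))) \<in> borel_measurable torus" for n
      using continuous_on_compose2[OF hc continuous_to_circles]
      by (intro continuous_torus continuous_intros) auto
    then show "(\<lambda>x. f x * of_real (h n (to_circles x))) \<in> borel_measurable torus" for n by measurable
    show "integrable torus (\<lambda>x. cmod (f x))" using f by (rule integrable_norm)
    show "AE x in torus. (\<lambda>n. f x * of_real (h n (to_circles x))) \<longlonglongrightarrow> f x * of_real (indicator A x)"
      using lim by (intro AE_I2 tendsto_intros) auto
    show "AE x in torus. cmod (f x * of_real (h n (to_circles x))) \<le> cmod (f x)" for n
      using hb by (intro AE_I2) (auto simp: norm_mult intro!: mult_left_le)
  qed
  moreover have "(LINT x|torus. f x * of_real (h n (to_circles x))) = 0" for n
    by (rule continuous_orthogonal[OF f z hc])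
  ultimately show ?thesis by (simp add: LIMSEQ_const_iff)
qed simp

text \<open>
  If \<open>g > 0\<close> on a set of positive measure, inner regularity gives a compact subset of positive measure,
  and over it the integral of \<open>g\<close> would be positive.
\<close>

lemma AE_nonpos_of_compact:
  fixes g :: "real ^ 3 \<Rightarrow> real"
  assumes [measurable]: "g \<in> borel_measurable borel" and g: "integrable torus g"
    and z: "\<And>A. compact A \<Longrightarrow> A \<subseteq> cube \<Longrightarrow> (LINT x|torus. g x * indicator A x) = 0"
  shows "AE x in torus. g x \<le> 0"
proof (rule ccontr)
  assume neg: "\<not> (AE x in torus. g x \<le> 0)"
  define B where "B = {x\<in>cube. 0 < g x}"
  have B [measurable]: "B \<in> sets borel" unfolding B_def by measurable
  define M where "M = density lborel (indicator cube)"
  have eM: "emeasure M A = emeasure lborel (A \<inter> cube)" if "A \<in> sets borel" for A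
  proof -
    have "emeasure M A = (\<integral>\<^sup>+x. indicator (A \<inter> cube) x \<partial>lborel)"
      using that unfolding M_def by (subst emeasure_density) (auto simp del: nn_integral_indicator intro!: nn_integral_cong split: split_indicator)
    then show ?thesis using that by simp
  qed
  have "emeasure M B = (SUP K\<in>{K. K \<subseteq> B \<and> compact K}. emeasure M K)"
  proof (rule inner_regular)
    show "emeasure M (space M) \<noteq> \<infinity>"
      using emeasure_cube_finite by (simp add: M_def eM[unfolded M_def])
  qed (auto simp: M_def)
  moreover have "emeasure M B \<noteq> 0"
  proof
    assume "emeasure M B = 0"
    then have "B \<in> null_sets lborel" using eM[OF B] by (simp add: null_sets_def B_def Int_absorb2)
    then have "AE x in lborel. x \<notin> B" by (rule AE_not_in)
    then have "AE x in torus. g x \<le> 0"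
      by (subst AE_restrict_space_iff) (auto simp: B_def elim!: eventually_mono)
    with neg show False by blast
  qed
  ultimately obtain K where K: "K \<subseteq> B" "compact K" "emeasure M K \<noteq> 0"
    by (metis (mono_tags, lifting) SUP_bot_conv(2) bot_ennreal mem_Collect_eq)
  have [measurable]: "K \<in> sets borel" using K by (simp add: borel_compact)
  have mK: "indicator K \<in> borel_measurable torus" by (rule borel_torus) measurable
  have i: "integrable torus (\<lambda>x. g x * indicator K x)"
    by (rule integrable_mult_bounded[OF g, where B = 1]) (use mK in \<open>auto split: split_indicator\<close>)
  have "(LINT x|torus. g x * indicator K x) = 0"
    using K by (intro z) (auto simp: B_def)
  then have "AE x in torus. g x * indicator K x = 0"
    using K by (subst (asm) integral_nonneg_eq_0_iff_AE[OF i]) (auto simp: B_def split: split_indicator intro!: AE_I2)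
  then have "AE x in lborel. x \<notin> K"
    using K by (subst (asm) AE_restrict_space_iff) (auto simp: B_def elim!: eventually_mono split: split_indicator_asm)
  then have "emeasure lborel K = 0"
    by (subst (asm) AE_iff_measurable[of K]) auto
  moreover have "K \<inter> cube = K" using K by (auto simp: B_def)
  ultimately show False using K eM[of K] by simp
qed

text \<open>
  All integrals of \<open>f\<close> over compact sets vanish, so that the real parts of \<open>\<plusminus> f\<close> and \<open>\<plusminus> \<i> f\<close> are all
  nonpositive almost everywhere.
\<close>

lemma fourier_unique:
  fixes f :: "real ^ 3 \<Rightarrow> complex"
  assumes m [measurable]: "f \<in> borel_measurable borel" and f: "integrable torus f" and z: "\<And>k. mode_coeff f k = 0"
  shows "AE x in torus. f x = 0"
proof -
  have z': "(LINT x|torus. f x * cis (kdot k x)) = 0" for k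
  proof -
    have "mode_coeff f (- k) = of_real ((2 * pi) powr (- 3 / 2)) * (LINT x|torus. f x * cis (kdot k x))"
      unfolding mode_coeff_def integral_mult_right_zero[symmetric]
      by (intro Bochner_Integration.integral_cong refl) (simp add: mode_def kdot_def cis_cnj sum_negf)
    then show ?thesis using z[of "- k"] by simp
  qed
  have c: "(LINT x|torus. f x * of_real (indicator A x)) = 0" if "compact A" "A \<subseteq> cube" for A
    by (rule compact_orthogonal[OF f z' that])
  have cr: "(LINT x|torus. Re (c * f x) * indicator A x) = 0" if A: "compact A" "A \<subseteq> cube" for A c
  proof -
    have "integrable torus (\<lambda>x. f x * of_real (indicator A x))"
    proof (rule integrable_mult_bounded[OF f, where B = 1])
      have [measurable]: "A \<in> sets borel" using A by (simp add: borel_compact)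
      show "(\<lambda>x. complex_of_real (indicator A x)) \<in> borel_measurable torus"
        by (rule borel_torus) measurable
    qed (auto split: split_indicator)
    then have "(LINT x|torus. Re (c * (f x * of_real (indicator A x)))) = Re (c * (LINT x|torus. f x * of_real (indicator A x)))"
      by (subst integral_Re) auto
    then show ?thesis by (simp add: c[OF A] mult.assoc[symmetric])
  qed
  have "AE x in torus. Re (c * f x) \<le> 0" for c
    by (rule AE_nonpos_of_compact) (use f cr in auto)
  from this[of 1] this[of "-1"] this[of \<i>] this[of "- \<i>"]
  show ?thesis by eventually_elim (simp add: complex_eq_iff)
qed

section \<open>Trigonometric partial sums\<close>

definition mode_cube :: "nat \<Rightarrow> (int ^ 3) set" where
  "mode_cube n = {k. \<forall>i. \<bar>k $ i\<bar> \<le> int n}"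

lemma finite_int_vec:
  fixes A :: "'n::finite \<Rightarrow> int set"
  assumes "\<And>i. finite (A i)"
  shows "finite {k :: int ^ 'n. \<forall>i. k $ i \<in> A i}" "card {k :: int ^ 'n. \<forall>i. k $ i \<in> A i} = (\<Prod>i\<in>UNIV. card (A i))"
proof -
  have b: "bij_betw vec_nth {k :: int ^ 'n. \<forall>i. k $ i \<in> A i} (PiE UNIV A)"
    by (rule bij_betwI[where g = vec_lambda]) (auto simp: PiE_def)
  show "finite {k :: int ^ 'n. \<forall>i. k $ i \<in> A i}"
    using bij_betw_finite[OF b] assms by (simp add: finite_PiE)
  show "card {k :: int ^ 'n. \<forall>i. k $ i \<in> A i} = (\<Prod>i\<in>UNIV. card (A i))"
    using bij_betw_same_card[OF b] by (simp add: card_PiE)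
qed

lemma mode_cube_eq: "mode_cube n = {k. \<forall>i. k $ i \<in> {- int n..int n}}"
proof -
  have "\<bar>a\<bar> \<le> int n \<longleftrightarrow> a \<in> {- int n..int n}" for a by auto
  then show ?thesis unfolding mode_cube_def by (simp only:)
qed

lemma finite_mode_cube [simp]: "finite (mode_cube n)"
  unfolding mode_cube_eq by (rule finite_int_vec) simp

lemma card_mode_cube: "card (mode_cube n) = (2 * n + 1) ^ 3"
proof -
  have "card {- int n..int n} = 2 * n + 1" by simp
  then show ?thesis unfolding mode_cube_eq finite_int_vec(2)[of "\<lambda>_. {- int n..int n}", OF finite_atLeastAtMost_int]
    by simp
qed

lemma mode_cube_mono: "i \<le> j \<Longrightarrow> mode_cube i \<subseteq> mode_cube j"
  unfolding mode_cube_def by (auto intro: order_trans)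

lemma mode_cube_exhaust: "\<exists>n. k \<in> mode_cube n"
proof
  show "k \<in> mode_cube (nat (\<Sum>i\<in>UNIV. \<bar>k $ i\<bar>))"
    unfolding mode_cube_def using member_le_sum[of _ UNIV "\<lambda>i. \<bar>k $ i\<bar>"] by (auto simp: sum_nonneg)
qed

text \<open>
  By Bessel's inequality and completeness the partial sums converge to some \<open>g\<close>. It has the same
  coefficients as \<open>f\<close>, so that it is equal to \<open>f\<close> almost everywhere.
\<close>

lemma trig_partial_sums_tendsto:
  assumes f: "f \<in> L2 torus" and fm: "f \<in> borel_measurable borel"
  shows "(\<lambda>n. l2_norm torus (\<lambda>x. trig (mode_cube n) (mode_coeff f) x - f x)) \<longlonglongrightarrow> 0"
proof -
  define S where "S n = (\<Sum>k\<in>mode_cube n. (cmod (mode_coeff f k))\<^sup>2)" for n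
  let ?T = "\<lambda>n. trig (mode_cube n) (mode_coeff f)"
  have dif: "(l2_norm torus (\<lambda>x. ?T i x - ?T j x))\<^sup>2 = \<bar>S i - S j\<bar>" for i j
  proof -
    have *: "(l2_norm torus (\<lambda>x. ?T j x - ?T i x))\<^sup>2 = S j - S i \<and> S i \<le> S j" if "i \<le> j" for i j
    proof -
      have "?T j x - ?T i x = trig (mode_cube j - mode_cube i) (mode_coeff f) x" for x
        unfolding trig_def using mode_cube_mono[OF that] by (subst sum_diff) auto
      then show ?thesis
        using mode_cube_mono[OF that] unfolding S_def
        by (simp add: l2_norm_sq l2_inner_trig_trig sum_diff sum_mono2)
    qed
    show ?thesis
      using *[of i j] *[of j i] l2_norm_minus_commute[of torus "?T i" "?T j"]
      by (cases "i \<le> j") (auto simp: abs_real_def)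
  qed
  have "incseq S" unfolding S_def incseq_def using mode_cube_mono by (auto intro!: sum_mono2)
  moreover have "S n \<le> l2_inner torus f f" for n unfolding S_def by (rule Bessel[OF f]) simp
  ultimately obtain L where "S \<longlonglongrightarrow> L" using incseq_convergent by blast
  then have cau: "Cauchy S" by (rule LIMSEQ_imp_Cauchy)
  have "\<exists>g\<in>L2 torus. (\<lambda>n. l2_norm torus (\<lambda>x. ?T n x - g x)) \<longlonglongrightarrow> 0"
  proof (rule l2_complete[OF trig_L2])
    fix e :: real assume e: "0 < e"
    then obtain N where N: "\<And>i j. i \<ge> N \<Longrightarrow> j \<ge> N \<Longrightarrow> \<bar>S i - S j\<bar> < e\<^sup>2"
      using CauchyD[OF cau, of "e\<^sup>2"] by auto
    have "l2_norm torus (\<lambda>x. ?T i x - ?T j x) < e" if "i \<ge> N" "j \<ge> N" for i j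
      by (rule power2_less_imp_less) (use N[OF that] dif e in auto)
    then show "\<exists>N. \<forall>i\<ge>N. \<forall>j\<ge>N. l2_norm torus (\<lambda>x. ?T i x - ?T j x) < e" by blast
  qed
  then obtain g where g: "g \<in> L2 torus" and lim: "(\<lambda>n. l2_norm torus (\<lambda>x. ?T n x - g x)) \<longlonglongrightarrow> 0" by blast
  have cg: "mode_coeff g k = mode_coeff f k" for k
  proof -
    obtain N where N: "k \<in> mode_cube N" using mode_cube_exhaust by blast
    have "\<forall>\<^sub>F n in sequentially. mode_coeff (?T n) k = mode_coeff f k"
      using eventually_ge_at_top[of N]
      by eventually_elim (use N mode_cube_mono in \<open>auto simp: coeff_trig\<close>)
    then have "(\<lambda>n. mode_coeff (?T n) k) \<longlonglongrightarrow> mode_coeff f k" by (rule tendsto_eventually)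
    with coeff_tendsto[OF trig_L2 g lim, of k] show ?thesis using LIMSEQ_unique by blast
  qed
  define d where "d x = indicator cube x *\<^sub>R (g x - f x)" for x
  have "(\<lambda>x. g x - f x) \<in> borel_measurable torus"
    using g f by (intro borel_measurable_diff L2_measurable)
  then have dm: "d \<in> borel_measurable borel"
    unfolding d_def[abs_def] by (subst (asm) borel_measurable_restrict_space_iff) auto
  have "mode_coeff d k = 0" for k
  proof -
    have "mode_coeff d k = mode_coeff (\<lambda>x. g x - f x) k"
      unfolding mode_coeff_def by (intro Bochner_Integration.integral_cong) (auto simp: d_def)
    then show ?thesis by (simp add: coeff_diff g f cg)
  qed
  moreover have "integrable torus d"
  proof -
    have "integrable torus (\<lambda>x. g x - f x)" using g f by (intro L2_integrable_torus L2_diff)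
    then show ?thesis by (rule Bochner_Integration.integrable_cong[THEN iffD1, rotated 2]) (auto simp: d_def)
  qed
  ultimately have "AE x in torus. d x = 0" using dm by (intro fourier_unique)
  then have ae: "AE x in torus. f x = g x"
    using AE_space by eventually_elim (auto simp: d_def)
  have "l2_norm torus (\<lambda>x. ?T n x - f x) = l2_norm torus (\<lambda>x. ?T n x - g x)" for n
  proof -
    have "l2_inner torus (\<lambda>x. ?T n x - f x) (\<lambda>x. ?T n x - f x) = l2_inner torus (\<lambda>x. ?T n x - g x) (\<lambda>x. ?T n x - g x)"
      unfolding l2_inner_def
      by (rule integral_cong_AE)
        (use ae L2_inner_integrable[OF L2_diff[OF trig_L2 f] L2_diff[OF trig_L2 f]]
           L2_inner_integrable[OF L2_diff[OF trig_L2 g] L2_diff[OF trig_L2 g]] in auto)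
    then show ?thesis by (simp add: l2_norm_def)
  qed
  with lim show ?thesis by simp
qed

section \<open>Sobolev embedding and compactness\<close>

text \<open>The Fourier symbol of \<open>- \<Delta> + m\<^sup>2\<close>.\<close>

definition symbol :: "real \<Rightarrow> int ^ 3 \<Rightarrow> real" where
  "symbol m k = (\<Sum>i\<in>UNIV. (real_of_int (k $ i))\<^sup>2) + m\<^sup>2"

lemma symbol_ge: "m\<^sup>2 \<le> symbol m k"
  by (simp add: symbol_def sum_nonneg)

lemma symbol_pos: "0 < m \<Longrightarrow> 0 < symbol m k"
  using symbol_ge[of m k] by (meson less_le_trans zero_less_power)

lemma symbol_coord: "(real_of_int (k $ i))\<^sup>2 \<le> symbol m k"
proof -
  have "(real_of_int (k $ i))\<^sup>2 \<le> (\<Sum>i\<in>UNIV. (real_of_int (k $ i))\<^sup>2)"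
    by (rule member_le_sum) auto
  then show ?thesis by (simp add: symbol_def add_increasing2)
qed

lemma symbol_le_mode_cube: "{k. symbol m k \<le> (real N)\<^sup>2} \<subseteq> mode_cube N"
proof
  fix k assume "k \<in> {k. symbol m k \<le> (real N)\<^sup>2}"
  then have "(real_of_int (k $ i))\<^sup>2 \<le> (real N)\<^sup>2" for i
    using symbol_coord[of k i m] by simp
  then have "\<bar>real_of_int (k $ i)\<bar> \<le> real N" for i
    by (simp add: abs_le_square_iff[symmetric])
  then have "\<bar>k $ i\<bar> \<le> int N" for i by (metis of_int_abs of_int_le_iff of_int_of_nat_eq)
  then show "k \<in> mode_cube N" by (simp add: mode_cube_def)
qed

text \<open>
  Dyadic shells of frequencies. The smallest value of the symbol is \<open>m\<^sup>2\<close>, so that the shells with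
  \<open>j \<ge> 0\<close> cover all frequencies.
\<close>

definition shell :: "real \<Rightarrow> nat \<Rightarrow> (int ^ 3) set" where
  "shell m j = {k. (2 ^ j * m)\<^sup>2 \<le> symbol m k \<and> symbol m k < (2 ^ Suc j * m)\<^sup>2}"

lemma shell_subset: "shell m j \<subseteq> mode_cube (nat \<lceil>2 ^ Suc j * \<bar>m\<bar>\<rceil>)"
proof -
  have "(2 ^ Suc j * m)\<^sup>2 \<le> (real (nat \<lceil>2 ^ Suc j * \<bar>m\<bar>\<rceil>))\<^sup>2"
  proof -
    have "2 ^ Suc j * \<bar>m\<bar> \<le> real (nat \<lceil>2 ^ Suc j * \<bar>m\<bar>\<rceil>)" by linarith
    then have "(2 ^ Suc j * \<bar>m\<bar>)\<^sup>2 \<le> (real (nat \<lceil>2 ^ Suc j * \<bar>m\<bar>\<rceil>))\<^sup>2" by (rule power_mono) simp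
    then show ?thesis by (simp add: power_mult_distrib)
  qed
  then have "shell m j \<subseteq> {k. symbol m k \<le> (real (nat \<lceil>2 ^ Suc j * \<bar>m\<bar>\<rceil>))\<^sup>2}"
    unfolding shell_def by auto
  then show ?thesis using symbol_le_mode_cube by blast
qed

lemma finite_shell: "finite (shell m j)"
  using shell_subset finite_mode_cube by (rule finite_subset)

lemma card_shell:
  assumes "0 < m"
  shows "real (card (shell m j)) \<le> (4 * m + 3) ^ 3 * 8 ^ j"
proof -
  let ?N = "nat \<lceil>2 ^ Suc j * \<bar>m\<bar>\<rceil>"
  have "card (shell m j) \<le> (2 * ?N + 1) ^ 3"
    using card_mono[OF finite_mode_cube shell_subset] by (simp only: card_mode_cube)
  then have "real (card (shell m j)) \<le> (2 * real ?N + 1) ^ 3"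
    by (metis (mono_tags, opaque_lifting) of_nat_1 of_nat_add of_nat_le_iff of_nat_mult of_nat_numeral of_nat_power)
  also have "\<dots> \<le> ((4 * m + 3) * 2 ^ j) ^ 3"
  proof (rule power_mono)
    have "real ?N \<le> 2 ^ Suc j * m + 1" using assms by simp
    moreover have "1 \<le> (2::real) ^ j" by simp
    ultimately have "2 * real ?N + 1 \<le> 2 * (2 ^ Suc j * m + 1) + 2 ^ j"
      by (intro add_mono mult_left_mono) simp_all
    also have "\<dots> \<le> (4 * m + 3) * 2 ^ j" by (simp add: algebra_simps)
    finally show "2 * real ?N + 1 \<le> (4 * m + 3) * 2 ^ j" .
  qed (intro add_nonneg_nonneg mult_nonneg_nonneg of_nat_0_le_iff zero_le_numeral zero_le_one)
  also have "\<dots> = (4 * m + 3) ^ 3 * 8 ^ j"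
    by (simp add: power_mult_distrib power_commutes[symmetric] flip: power_mult) (simp add: power_mult mult.commute[of j])
  finally show ?thesis .
qed

lemma shell_exists:
  assumes m: "0 < m"
  shows "\<exists>j. k \<in> shell m j"
proof -
  have "\<exists>j. symbol m k < (2 ^ Suc j * m)\<^sup>2"
  proof -
    obtain j where j: "symbol m k / m\<^sup>2 < 2 ^ j" using real_arch_pow[of 2] by auto
    have "(2::real) ^ j \<le> 2 ^ (Suc j + Suc j)" by (rule power_increasing) auto
    then have "(2::real) ^ j \<le> 2 ^ Suc j * 2 ^ Suc j" by (simp only: power_add)
    then have "symbol m k / m\<^sup>2 < (2 ^ Suc j)\<^sup>2"
      unfolding power2_eq_square[of "2 ^ Suc j :: real"] using j by linarith
    then show ?thesis using m by (auto simp: power_mult_distrib field_simps intro!: exI[of _ j])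
  qed
  then have ex: "symbol m k < (2 ^ Suc (LEAST j. symbol m k < (2 ^ Suc j * m)\<^sup>2) * m)\<^sup>2" by (rule LeastI_ex)
  define j where "j = (LEAST j. symbol m k < (2 ^ Suc j * m)\<^sup>2)"
  have "(2 ^ j * m)\<^sup>2 \<le> symbol m k"
  proof (cases j)
    case 0 then show ?thesis using symbol_ge by simp
  next
    case (Suc i)
    then have "i < (LEAST j. symbol m k < (2 ^ Suc j * m)\<^sup>2)" unfolding j_def by simp
    from not_less_Least[OF this] have "\<not> symbol m k < (2 ^ Suc i * m)\<^sup>2" .
    then show ?thesis using Suc by simp
  qed
  then show ?thesis using ex unfolding j_def shell_def by blast
qed

lemma shell_unique:
  assumes m: "0 < m" and k: "k \<in> shell m i" "k \<in> shell m j"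
  shows "i = j"
proof -
  have "i \<le> j" if k: "k \<in> shell m i" "k \<in> shell m j" for i j
  proof -
    have "(2 ^ i * m)\<^sup>2 < (2 ^ Suc j * m)\<^sup>2" using k by (auto simp: shell_def)
    then have "2 ^ i * m < 2 ^ Suc j * m" using m by (rule_tac power2_less_imp_less) auto
    then have "(2::real) ^ i < 2 ^ Suc j" using m by simp
    then have "i < Suc j" using power_less_imp_less_exp[of "2::real" i "Suc j"] by simp
    then show ?thesis by simp
  qed
  then show ?thesis using k by (meson antisym)
qed

text \<open>
  On one dyadic shell the Fourier sum is bounded in the mean by Parseval and pointwise by the
  number of modes in the shell; interpolation between the two gives the \<open>r\<close>-th moment.
\<close>

lemma shell_moment:
  assumes m: "0 < m" and r: "2 < r" and F: "finite F" "F \<subseteq> shell m j"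
    and H: "(\<Sum>k\<in>F. symbol m k powr \<sigma> * (cmod (c k))\<^sup>2) \<le> H" and \<sigma>: "0 < \<sigma>"
  shows "(LINT x|torus. cmod (trig F c x) powr r)
    \<le> ((4 * m + 3) ^ 3) powr ((r - 2) / 2) * m powr (- \<sigma> * r) * H powr (r / 2)
       * (2 powr (- (3 - r * (3 / 2 - \<sigma>)))) powr real j"
    and "integrable torus (\<lambda>x. cmod (trig F c x) powr r)"
proof -
  define K where "K = (4 * m + 3) ^ 3"
  have K: "0 < K" using m by (simp add: K_def)
  define B where "B = (\<Sum>k\<in>F. (cmod (c k))\<^sup>2)"
  have B0: "0 \<le> B" by (simp add: B_def sum_nonneg)
  have H0: "0 \<le> H" by (rule order_trans[OF _ H]) (simp add: sum_nonneg)
  have BH: "B \<le> m powr (-2 * \<sigma>) * 2 powr (-2 * \<sigma> * j) * H"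
  proof -
    have "(2 ^ j * m)\<^sup>2 powr \<sigma> * B \<le> (\<Sum>k\<in>F. symbol m k powr \<sigma> * (cmod (c k))\<^sup>2)"
      unfolding B_def sum_distrib_left
    proof (intro sum_mono mult_right_mono powr_mono2)
      fix k assume "k \<in> F"
      then show "(2 ^ j * m)\<^sup>2 \<le> symbol m k" using F by (auto simp: shell_def)
    qed (use \<sigma> in auto)
    then have *: "(2 ^ j * m)\<^sup>2 powr \<sigma> * B \<le> H" using H by simp
    have "(2 ^ j * m)\<^sup>2 = (2 powr j * m) powr 2" using m by (simp add: powr_realpow)
    then have "(2 ^ j * m)\<^sup>2 powr \<sigma> = (2 powr j * m) powr (2 * \<sigma>)" by (simp add: powr_powr)
    also have "\<dots> = 2 powr (2 * \<sigma> * j) * m powr (2 * \<sigma>)"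
      using m by (simp add: powr_mult powr_powr mult_ac)
    finally have e: "(2 ^ j * m)\<^sup>2 powr \<sigma> = 2 powr (2 * \<sigma> * j) * m powr (2 * \<sigma>)" .
    have "B = m powr (-2 * \<sigma>) * 2 powr (-2 * \<sigma> * j) * ((2 ^ j * m)\<^sup>2 powr \<sigma> * B)"
      unfolding e using m by (simp add: powr_minus field_simps)
    also have "\<dots> \<le> m powr (-2 * \<sigma>) * 2 powr (-2 * \<sigma> * j) * H"
      by (rule mult_left_mono[OF *]) simp
    finally show ?thesis .
  qed
  have w2: "(cmod (trig F c x))\<^sup>2 \<le> K * 8 ^ j * B" for x
  proof -
    have "cmod (trig F c x) \<le> (\<Sum>k\<in>F. cmod (c k) * 1)"
    proof -
      have "(2 * pi) powr (- 3 / 2) \<le> 1"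
        using powr_mono[of "- 3 / 2" 0 "2 * pi"] pi_gt3 by simp
      then show ?thesis
        unfolding trig_def by (intro order_trans[OF norm_sum] sum_mono) (simp add: norm_mult norm_mode mult_left_le)
    qed
    then have "(cmod (trig F c x))\<^sup>2 \<le> (\<Sum>k\<in>F. cmod (c k) * 1)\<^sup>2" by (intro power_mono) auto
    also have "\<dots> \<le> B * real (card F)"
      using Cauchy_Schwarz_ineq_sum[of "\<lambda>k. cmod (c k)" "\<lambda>_. 1" F] by (simp add: B_def)
    also have "\<dots> \<le> B * (K * 8 ^ j)"
    proof (rule mult_left_mono[OF _ B0])
      have "real (card F) \<le> real (card (shell m j))" using F by (simp add: card_mono finite_shell)
      then show "real (card F) \<le> K * 8 ^ j" using card_shell[OF m, of j] by (simp add: K_def)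
    qed
    finally show ?thesis by (simp add: mult_ac)
  qed
  have pw: "cmod (trig F c x) powr r \<le> (K * 8 ^ j * B) powr ((r - 2) / 2) * (cmod (trig F c x))\<^sup>2" for x
  proof -
    have "cmod (trig F c x) powr r = cmod (trig F c x) powr (r - 2) * cmod (trig F c x) powr 2"
      using powr_add[of "cmod (trig F c x)" "r - 2" 2] by (simp only: diff_add_cancel)
    also have "cmod (trig F c x) powr 2 = (cmod (trig F c x))\<^sup>2" by simp
    also have "cmod (trig F c x) powr (r - 2) = ((cmod (trig F c x))\<^sup>2) powr ((r - 2) / 2)"
    proof -
      have "((cmod (trig F c x)) powr 2) powr ((r - 2) / 2) = cmod (trig F c x) powr (r - 2)"
        unfolding powr_powr by (rule arg_cong[where f = "\<lambda>t. cmod (trig F c x) powr t"]) simp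
      then show ?thesis by simp
    qed
    finally show ?thesis
      using w2[of x] r by (auto intro!: mult_right_mono powr_mono2)
  qed
  have i2: "integrable torus (\<lambda>x. (cmod (trig F c x))\<^sup>2)" using trig_L2 by (rule L2_integrable_norm_sq)
  show ir: "integrable torus (\<lambda>x. cmod (trig F c x) powr r)"
  proof (rule Bochner_Integration.integrable_bound)
    show "integrable torus (\<lambda>x. (K * 8 ^ j * B) powr ((r - 2) / 2) * (cmod (trig F c x))\<^sup>2)"
      using i2 by simp
    show "(\<lambda>x. cmod (trig F c x) powr r) \<in> borel_measurable torus" by (rule borel_torus) measurable
    show "AE x in torus. norm (cmod (trig F c x) powr r) \<le> norm ((K * 8 ^ j * B) powr ((r - 2) / 2) * (cmod (trig F c x))\<^sup>2)"
      using pw by (intro AE_I2) (simp add: abs_mult)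
  qed
  have "(LINT x|torus. cmod (trig F c x) powr r) \<le> (LINT x|torus. (K * 8 ^ j * B) powr ((r - 2) / 2) * (cmod (trig F c x))\<^sup>2)"
    using ir i2 pw by (intro integral_mono) auto
  also have "\<dots> = (K * 8 ^ j * B) powr ((r - 2) / 2) * B"
    using l2_inner_trig_trig[OF F(1), of c] by (simp add: l2_inner_self B_def)
  also have "\<dots> = (K * 8 ^ j) powr ((r - 2) / 2) * B powr (r / 2)"
  proof (cases "B = 0")
    case False
    then have "B powr (r / 2) = B powr ((r - 2) / 2) * B powr 1" unfolding powr_add[symmetric] by (simp add: field_simps)
    then show ?thesis using False B0 K by (simp add: powr_mult)
  qed simp
  also have "\<dots> \<le> (K * 8 ^ j) powr ((r - 2) / 2) * (m powr (-2 * \<sigma>) * 2 powr (-2 * \<sigma> * j) * H) powr (r / 2)"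
    using BH B0 r by (intro mult_left_mono powr_mono2) auto
  also have "\<dots> = K powr ((r - 2) / 2) * m powr (- \<sigma> * r) * H powr (r / 2)
       * (2 powr (- (3 - r * (3 / 2 - \<sigma>)))) powr real j"
  proof -
    have "(8::real) ^ j = 2 powr (3 * real j)"
    proof -
      have "(8::real) ^ j = (2 ^ 3) ^ j" by simp
      also have "\<dots> = 2 ^ (3 * j)" by (simp only: power_mult)
      also have "\<dots> = 2 powr real (3 * j)" by (simp only: powr_realpow zero_less_numeral)
      finally show ?thesis by simp
    qed
    then have e1: "(K * 8 ^ j) powr ((r - 2) / 2) = K powr ((r - 2) / 2) * 2 powr (3 * real j * ((r - 2) / 2))"
      using K by (simp add: powr_mult powr_powr)
    have e2: "(m powr (-2 * \<sigma>) * 2 powr (-2 * \<sigma> * j) * H) powr (r / 2)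
        = m powr (- \<sigma> * r) * 2 powr (-2 * \<sigma> * j * (r / 2)) * H powr (r / 2)"
      using m H0 by (simp add: powr_mult powr_powr)
    have "2 powr (3 * real j * ((r - 2) / 2)) * 2 powr (-2 * \<sigma> * j * (r / 2))
        = (2::real) powr (3 * real j * ((r - 2) / 2) + -2 * \<sigma> * j * (r / 2))"
      by (rule powr_add[symmetric])
    also have "3 * real j * ((r - 2) / 2) + -2 * \<sigma> * j * (r / 2) = (- (3 - r * (3 / 2 - \<sigma>))) * j"
      by (simp add: field_simps)
    finally have e3: "2 powr (3 * real j * ((r - 2) / 2)) * 2 powr (-2 * \<sigma> * j * (r / 2))
        = (2 powr (- (3 - r * (3 / 2 - \<sigma>)))) powr real j"
      by (simp only: powr_powr)
    show ?thesis unfolding e1 e2 e3[symmetric] by (simp only: mult_ac)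
  qed
  finally show "(LINT x|torus. cmod (trig F c x) powr r)
    \<le> ((4 * m + 3) ^ 3) powr ((r - 2) / 2) * m powr (- \<sigma> * r) * H powr (r / 2)
       * (2 powr (- (3 - r * (3 / 2 - \<sigma>)))) powr real j" unfolding K_def .
qed

text \<open>
  An \<open>r\<close>-th power of a sum is estimated by the sum of \<open>r\<close>-th powers with geometric weights: each
  summand \<open>w\<^sub>j\<close> is at most \<open>\<theta>\<^sup>j T\<close> where \<open>T\<^sup>r\<close> is the weighted sum of the \<open>|w\<^sub>j|\<^sup>r\<close>.
\<close>

lemma powr_sum_geometric:
  fixes w :: "nat \<Rightarrow> real"
  assumes w: "\<And>j. 0 \<le> w j" and r: "0 < r" and \<rho>: "0 < \<rho>" "\<rho> < 1"
  shows "(\<Sum>j<J. w j) powr r \<le> (1 / (1 - \<rho> powr (1 / r))) powr r * (\<Sum>j<J. \<rho> powr (- real j) * w j powr r)"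
proof -
  define T where "T = (\<Sum>j<J. \<rho> powr (- real j) * w j powr r)"
  define \<theta> where "\<theta> = \<rho> powr (1 / r)"
  have T0: "0 \<le> T" by (simp add: T_def sum_nonneg)
  have \<theta>: "0 < \<theta>" "\<theta> < 1"
    using \<rho> r powr_less_mono2[of "1 / r" \<rho> 1] by (auto simp: \<theta>_def)
  have wj: "w j \<le> \<theta> ^ j * T powr (1 / r)" if "j < J" for j
  proof -
    have "\<rho> powr (- real j) * w j powr r \<le> T"
      unfolding T_def by (rule member_le_sum) (use that in auto)
    then have "(\<rho> powr (- real j) * w j powr r) powr (1 / r) \<le> T powr (1 / r)"
      using r by (intro powr_mono2) auto
    moreover have "(\<rho> powr (- real j) * w j powr r) powr (1 / r) = \<rho> powr (- real j / r) * w j"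
      using w r by (simp add: powr_mult powr_powr)
    moreover have "\<rho> powr (- real j / r) = 1 / \<theta> ^ j"
      using \<theta> \<rho> by (simp add: \<theta>_def powr_powr powr_minus divide_inverse mult.commute flip: powr_realpow)
    ultimately have "1 / \<theta> ^ j * w j \<le> T powr (1 / r)" by metis
    then show ?thesis using \<theta> by (simp add: field_simps)
  qed
  have "(\<Sum>j<J. w j) \<le> (\<Sum>j<J. \<theta> ^ j) * T powr (1 / r)"
    unfolding sum_distrib_right using wj by (intro sum_mono) auto
  also have "\<dots> \<le> (1 / (1 - \<theta>)) * T powr (1 / r)"
  proof (rule mult_right_mono)
    have "(\<Sum>j<J. \<theta> ^ j) = (1 - \<theta> ^ J) / (1 - \<theta>)" using \<theta> by (simp add: sum_gp_strict)
    then show "(\<Sum>j<J. \<theta> ^ j) \<le> 1 / (1 - \<theta>)" using \<theta> by (simp add: divide_right_mono)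
  qed simp
  finally have "(\<Sum>j<J. w j) powr r \<le> ((1 / (1 - \<theta>)) * T powr (1 / r)) powr r"
    using r w by (intro powr_mono2) (auto intro: sum_nonneg)
  also have "\<dots> = (1 / (1 - \<theta>)) powr r * T"
  proof -
    have "0 \<le> 1 / (1 - \<theta>)" using \<theta> by simp
    then have "((1 / (1 - \<theta>)) * T powr (1 / r)) powr r = (1 / (1 - \<theta>)) powr r * (T powr (1 / r)) powr r"
      by (subst powr_mult) auto
    moreover have "(T powr (1 / r)) powr r = T" using r T0 by (simp add: powr_powr)
    ultimately show ?thesis by simp
  qed
  finally show ?thesis by (simp add: \<theta>_def T_def)
qed

text \<open>
  The moments of the shells decay like \<open>2\<^sup>-\<^sup>\<gamma>\<^sup>j\<close> with \<open>\<gamma> = 3 - r (3/2 - \<sigma>) > 0\<close>. Half of this decay pays for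
  the weights in the estimate of the \<open>r\<close>-th power of the sum over the shells, the other half makes
  the remaining series converge.
\<close>

lemma Sobolev_trig:
  assumes m: "0 < m" and \<sigma>: "0 < \<sigma>" and r: "2 < r" "r * (3 / 2 - \<sigma>) < 3"
  shows "\<exists>C>0. \<forall>F c. finite F \<longrightarrow> (LINT x|torus. cmod (trig F c x) powr r)
    \<le> C * (\<Sum>k\<in>F. symbol m k powr \<sigma> * (cmod (c k))\<^sup>2) powr (r / 2)"
proof -
  define \<gamma> where "\<gamma> = 3 - r * (3 / 2 - \<sigma>)"
  define \<rho> where "\<rho> = 2 powr (- (\<gamma> / 2))"
  have \<gamma>: "0 < \<gamma>" using r by (simp add: \<gamma>_def)
  have \<rho>: "0 < \<rho>" "\<rho> < 1"
    using \<gamma> powr_less_mono[of "- (\<gamma> / 2)" 0 2] by (auto simp: \<rho>_def)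
  have \<rho>2: "2 powr (- \<gamma>) = \<rho> * \<rho>" unfolding \<rho>_def powr_add[symmetric] by simp
  define K where "K = ((4 * m + 3) ^ 3) powr ((r - 2) / 2) * m powr (- \<sigma> * r)"
  have K: "0 < K" using m by (simp add: K_def)
  define D where "D = (1 / (1 - \<rho> powr (1 / r))) powr r"
  have "\<rho> powr (1 / r) < 1" using \<rho> r powr_less_mono2[of "1 / r" \<rho> 1] by simp
  then have D: "0 < D" by (simp add: D_def)
  have main: "(LINT x|torus. cmod (trig F c x) powr r) \<le> D * (K / (1 - \<rho>)) * H powr (r / 2)"
    if F: "finite F" and H: "H = (\<Sum>k\<in>F. symbol m k powr \<sigma> * (cmod (c k))\<^sup>2)" for F c H
  proof -
    obtain J where J: "F \<subseteq> (\<Union>j<J. shell m j)"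
    proof -
      have "\<forall>k\<in>F. \<exists>j. k \<in> shell m j" using shell_exists[OF m] by blast
      then obtain js where js: "\<And>k. k \<in> F \<Longrightarrow> k \<in> shell m (js k)" by metis
      have "F \<subseteq> (\<Union>j<Suc (Max (js ` F)). shell m j)"
      proof
        fix k assume k: "k \<in> F"
        then have "js k \<in> {..<Suc (Max (js ` F))}" using F by (simp add: less_Suc_eq_le)
        with js[OF k] show "k \<in> (\<Union>j<Suc (Max (js ` F)). shell m j)" by blast
      qed
      then show ?thesis by (rule that)
    qed
    define G where "G j = F \<inter> shell m j" for j
    have G: "finite (G j)" "G j \<subseteq> shell m j" for j using F by (auto simp: G_def)
    have HG: "(\<Sum>k\<in>G j. symbol m k powr \<sigma> * (cmod (c k))\<^sup>2) \<le> H" for j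
      unfolding H by (rule sum_mono2) (use F in \<open>auto simp: G_def\<close>)
    note mom = shell_moment[OF m r(1) G HG \<sigma>]
    have split: "trig F c x = (\<Sum>j<J. trig (G j) c x)" for x
    proof -
      have "F = (\<Union>j<J. G j)" using J by (auto simp: G_def)
      then have "trig F c x = (\<Sum>k\<in>(\<Union>j<J. G j). c k * mode k x)" by (simp add: trig_def)
      also have "\<dots> = (\<Sum>j<J. \<Sum>k\<in>G j. c k * mode k x)"
        by (rule sum.UNION_disjoint) (use G shell_unique[OF m] in \<open>auto simp: G_def\<close>)
      finally show ?thesis by (simp add: trig_def)
    qed
    have pw: "cmod (trig F c x) powr r \<le> D * (\<Sum>j<J. \<rho> powr (- real j) * cmod (trig (G j) c x) powr r)" for x
    proof -
      have "cmod (trig F c x) powr r \<le> (\<Sum>j<J. cmod (trig (G j) c x)) powr r"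
        unfolding split using r by (intro powr_mono2 norm_sum) auto
      also have "\<dots> \<le> D * (\<Sum>j<J. \<rho> powr (- real j) * cmod (trig (G j) c x) powr r)"
        unfolding D_def using \<rho> r by (intro powr_sum_geometric) auto
      finally show ?thesis .
    qed
    have ii: "integrable torus (\<lambda>x. D * (\<Sum>j<J. \<rho> powr (- real j) * cmod (trig (G j) c x) powr r))"
      using mom(2) by (intro integrable_mult_right Bochner_Integration.integrable_sum) auto
    have "(LINT x|torus. cmod (trig F c x) powr r)
        \<le> (LINT x|torus. D * (\<Sum>j<J. \<rho> powr (- real j) * cmod (trig (G j) c x) powr r))"
    proof (rule integral_mono[OF _ ii pw])
      show "integrable torus (\<lambda>x. cmod (trig F c x) powr r)"
      proof (rule Bochner_Integration.integrable_bound[OF ii])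
        show "(\<lambda>x. cmod (trig F c x) powr r) \<in> borel_measurable torus" by (rule borel_torus) measurable
        show "AE x in torus. norm (cmod (trig F c x) powr r) \<le> norm (D * (\<Sum>j<J. \<rho> powr (- real j) * cmod (trig (G j) c x) powr r))"
          using pw by (intro AE_I2) (simp, smt (verit))
      qed
    qed
    also have "\<dots> = D * (\<Sum>j<J. \<rho> powr (- real j) * (LINT x|torus. cmod (trig (G j) c x) powr r))"
      using mom(2) by (subst integral_mult_right_zero, subst Bochner_Integration.integral_sum) auto
    also have "\<dots> \<le> D * (\<Sum>j<J. K * H powr (r / 2) * \<rho> ^ j)"
    proof (intro mult_left_mono[OF _ less_imp_le[OF D]] sum_mono)
      fix j
      have "\<rho> powr (- real j) * (LINT x|torus. cmod (trig (G j) c x) powr r)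
          \<le> \<rho> powr (- real j) * (K * H powr (r / 2) * (2 powr (- \<gamma>)) powr real j)"
        using mom(1)[of j] unfolding \<gamma>_def K_def by (intro mult_left_mono) auto
      also have "\<dots> = K * H powr (r / 2) * (\<rho> powr (- real j) * \<rho> powr real j * \<rho> powr real j)"
        using \<rho> unfolding \<rho>2 by (simp add: powr_mult)
      also have "\<dots> = K * H powr (r / 2) * \<rho> ^ j"
        using \<rho> by (simp add: powr_minus powr_realpow)
      finally show "\<rho> powr (- real j) * (LINT x|torus. cmod (trig (G j) c x) powr r) \<le> K * H powr (r / 2) * \<rho> ^ j" .
    qed
    also have "\<dots> \<le> D * (K * H powr (r / 2) * (1 / (1 - \<rho>)))"
      unfolding sum_distrib_left[symmetric]
    proof (intro mult_left_mono)
      have "(\<Sum>j<J. \<rho> ^ j) = (1 - \<rho> ^ J) / (1 - \<rho>)" using \<rho> by (simp add: sum_gp_strict)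
      then show "(\<Sum>j<J. \<rho> ^ j) \<le> 1 / (1 - \<rho>)" using \<rho> by (simp add: divide_right_mono)
    qed (use K D in auto)
    finally show ?thesis by (simp add: mult_ac)
  qed
  have "0 < D * (K / (1 - \<rho>))" using D K \<rho> by simp
  then show ?thesis using main by blast
qed

definition sobolev_sum :: "real \<Rightarrow> real \<Rightarrow> (real ^ 3 \<Rightarrow> complex) \<Rightarrow> real" where
  "sobolev_sum \<sigma> m f = (\<Sum>\<^sub>\<infinity>k. symbol m k powr \<sigma> * (cmod (mode_coeff f k))\<^sup>2)"

definition sobolev_class :: "real \<Rightarrow> real \<Rightarrow> (real ^ 3 \<Rightarrow> complex) set" where
  "sobolev_class \<sigma> m = {f \<in> L2 torus. f \<in> borel_measurable borel \<and>
     (\<lambda>k. symbol m k powr \<sigma> * (cmod (mode_coeff f k))\<^sup>2) summable_on UNIV}"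

text \<open>The bound passes from the partial Fourier sums to their almost everywhere limit by Fatou's lemma.\<close>

lemma Sobolev:
  assumes m: "0 < m" and \<sigma>: "0 < \<sigma>" and r: "2 < r" "r * (3 / 2 - \<sigma>) < 3"
  shows "\<exists>C>0. \<forall>f\<in>sobolev_class \<sigma> m. integrable torus (\<lambda>x. cmod (f x) powr r) \<and>
    (LINT x|torus. cmod (f x) powr r) \<le> C * sobolev_sum \<sigma> m f powr (r / 2)"
proof -
  obtain C where C: "0 < C" and CT: "\<And>F c. finite F \<Longrightarrow> (LINT x|torus. cmod (trig F c x) powr r)
    \<le> C * (\<Sum>k\<in>F. symbol m k powr \<sigma> * (cmod (c k))\<^sup>2) powr (r / 2)"
    using Sobolev_trig[OF assms] by blast
  have "integrable torus (\<lambda>x. cmod (f x) powr r) \<and>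
    (LINT x|torus. cmod (f x) powr r) \<le> C * sobolev_sum \<sigma> m f powr (r / 2)" if "f \<in> sobolev_class \<sigma> m" for f
  proof -
    have f: "f \<in> L2 torus" "f \<in> borel_measurable borel" and
      s: "(\<lambda>k. symbol m k powr \<sigma> * (cmod (mode_coeff f k))\<^sup>2) summable_on UNIV"
      using that by (auto simp: sobolev_class_def)
    note [measurable] = borel_torus[OF f(2)]
    let ?T = "\<lambda>n. trig (mode_cube n) (mode_coeff f)"
    have [measurable]: "?T n \<in> borel_measurable torus" for n by (rule borel_torus) measurable
    obtain q where q: "strict_mono q" "AE x in torus. (\<lambda>n. ?T (q n) x) \<longlonglongrightarrow> f x"
      using l2_AE_subseq[OF trig_L2 f(1) trig_partial_sums_tendsto[OF f]] by blast
    define R where "R = C * sobolev_sum \<sigma> m f powr (r / 2)"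
    have R0: "0 \<le> R" using C by (simp add: R_def)
    have Tb: "(\<integral>\<^sup>+x. ennreal (cmod (?T n x) powr r) \<partial>torus) \<le> ennreal R" for n
    proof -
      have "integrable torus (\<lambda>x. cmod (?T n x) powr r)"
      proof (rule torus.integrable_const_bound)
        show "AE x in torus. norm (cmod (?T n x) powr r) \<le> (\<Sum>k\<in>mode_cube n. cmod (mode_coeff f k) * (2 * pi) powr (- 3 / 2)) powr r"
        proof (rule AE_I2)
          fix x
          have "cmod (?T n x) \<le> (\<Sum>k\<in>mode_cube n. cmod (mode_coeff f k) * (2 * pi) powr (- 3 / 2))"
            unfolding trig_def by (intro order_trans[OF norm_sum] sum_mono) (simp add: norm_mult norm_mode)
          then show "norm (cmod (?T n x) powr r) \<le> (\<Sum>k\<in>mode_cube n. cmod (mode_coeff f k) * (2 * pi) powr (- 3 / 2)) powr r"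
            using r by (simp add: powr_mono2)
        qed
      qed measurable
      then have "(\<integral>\<^sup>+x. ennreal (cmod (?T n x) powr r) \<partial>torus) = ennreal (LINT x|torus. cmod (?T n x) powr r)"
        by (intro nn_integral_eq_integral) auto
      also have "\<dots> \<le> ennreal R"
      proof (rule ennreal_leI)
        have "(\<Sum>k\<in>mode_cube n. symbol m k powr \<sigma> * (cmod (mode_coeff f k))\<^sup>2) \<le> sobolev_sum \<sigma> m f"
          unfolding sobolev_sum_def by (rule finite_sum_le_infsum[OF s]) auto
        then show "(LINT x|torus. cmod (?T n x) powr r) \<le> R"
          unfolding R_def using C r
          by (intro order_trans[OF CT[OF finite_mode_cube]] mult_left_mono powr_mono2) (auto intro!: sum_nonneg)
      qed
      finally show ?thesis .
    qed
    have "(\<integral>\<^sup>+x. ennreal (cmod (f x) powr r) \<partial>torus) = (\<integral>\<^sup>+x. liminf (\<lambda>n. ennreal (cmod (?T (q n) x) powr r)) \<partial>torus)"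
    proof (rule nn_integral_cong_AE, use q(2) in eventually_elim)
      fix x assume "(\<lambda>n. ?T (q n) x) \<longlonglongrightarrow> f x"
      then have "(\<lambda>n. ennreal (cmod (?T (q n) x) powr r)) \<longlonglongrightarrow> ennreal (cmod (f x) powr r)"
        using r by (intro tendsto_ennrealI tendsto_powr2 tendsto_norm tendsto_const) auto
      then show "ennreal (cmod (f x) powr r) = liminf (\<lambda>n. ennreal (cmod (?T (q n) x) powr r))"
        by (intro lim_imp_Liminf[symmetric]) auto
    qed
    also have "\<dots> \<le> liminf (\<lambda>n. \<integral>\<^sup>+x. ennreal (cmod (?T (q n) x) powr r) \<partial>torus)"
      by (intro nn_integral_liminf) measurable
    also have "\<dots> \<le> ennreal R" by (rule Liminf_le) (use Tb in auto)
    finally have b: "(\<integral>\<^sup>+x. ennreal (cmod (f x) powr r) \<partial>torus) \<le> ennreal R" .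
    then have i: "integrable torus (\<lambda>x. cmod (f x) powr r)"
      by (intro integrableI_bounded) (auto simp: top_unique less_top[symmetric])
    then have "ennreal (LINT x|torus. cmod (f x) powr r) \<le> ennreal R"
      using b by (subst nn_integral_eq_integral[symmetric]) auto
    then show ?thesis using i R0 by (simp add: R_def)
  qed
  with C show ?thesis by blast
qed

lemma sobolev_class_mono:
  assumes m: "0 < m" and \<sigma>: "\<sigma> \<le> s" and f: "f \<in> sobolev_class s m"
  shows "f \<in> sobolev_class \<sigma> m"
proof -
  have "(\<lambda>k. symbol m k powr \<sigma> * (cmod (mode_coeff f k))\<^sup>2) summable_on UNIV"
  proof (rule summable_on_comparison_test)
    show "(\<lambda>k. (m\<^sup>2) powr (\<sigma> - s) * (symbol m k powr s * (cmod (mode_coeff f k))\<^sup>2)) summable_on UNIV"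
      using f by (intro summable_on_cmult_right) (simp add: sobolev_class_def)
    fix k
    have "symbol m k powr \<sigma> = symbol m k powr (\<sigma> - s) * symbol m k powr s"
      by (simp flip: powr_add)
    also have "\<dots> \<le> (m\<^sup>2) powr (\<sigma> - s) * symbol m k powr s"
      using m \<sigma> by (intro mult_right_mono powr_mono2') (auto simp: symbol_ge)
    finally show "symbol m k powr \<sigma> * (cmod (mode_coeff f k))\<^sup>2 \<le> (m\<^sup>2) powr (\<sigma> - s) * (symbol m k powr s * (cmod (mode_coeff f k))\<^sup>2)"
      by (simp add: mult_right_mono mult.assoc[symmetric])
  qed auto
  then show ?thesis using f by (simp add: sobolev_class_def)
qed

text \<open>
  Compactness of the embedding, in quantitative form. The embedding already holds for some \<open>\<sigma> < s\<close>. In the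
  sum of order \<open>\<sigma>\<close> the high frequencies are small because of the gap between \<open>\<sigma>\<close> and \<open>s\<close>, and there
  are only finitely many low ones.
\<close>

lemma Rellich:
  assumes m: "0 < m" and s: "0 < s" and p: "2 < p" "p * (3 / 2 - s) < 3" and e: "0 < e" and R: "0 \<le> R"
  shows "\<exists>F \<delta>. finite F \<and> 0 < \<delta> \<and> (\<forall>f\<in>sobolev_class s m. sobolev_sum s m f \<le> R \<longrightarrow>
    (\<forall>k\<in>F. cmod (mode_coeff f k) \<le> \<delta>) \<longrightarrow> (LINT x|torus. cmod (f x) powr p) \<le> e)"
proof -
  define \<sigma> where "\<sigma> = (s + max 0 (3 / 2 - 3 / p)) / 2"
  have "3 / 2 - 3 / p < s" using p by (simp add: field_simps)
  then have \<sigma>: "0 < \<sigma>" "\<sigma> < s" "3 / 2 - 3 / p < \<sigma>" using s by (auto simp: \<sigma>_def max_def)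
  then have ps: "p * (3 / 2 - \<sigma>) < 3" using p by (simp add: field_simps)
  obtain C where C: "0 < C" and CS: "\<And>f. f \<in> sobolev_class \<sigma> m \<Longrightarrow>
      (LINT x|torus. cmod (f x) powr p) \<le> C * sobolev_sum \<sigma> m f powr (p / 2)"
    using Sobolev[OF m \<sigma>(1) p(1) ps] by blast
  \<comment> \<open>It suffices to bring the sum of order \<open>\<sigma>\<close> below \<open>\<eta>\<close>. Half of it is spent on the frequencies above \<open>L\<close>.\<close>
  define \<eta> where "\<eta> = (e / C) powr (2 / p)"
  have \<eta>: "0 < \<eta>" "C * \<eta> powr (p / 2) = e" using e C p by (auto simp: \<eta>_def powr_powr)
  define L where "L = (\<eta> / (2 * (R + 1))) powr (1 / (\<sigma> - s))"
  have L0: "0 < L" using \<eta> R by (simp add: L_def)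
  have "L powr (\<sigma> - s) = \<eta> / (2 * (R + 1))" using \<sigma> \<eta> R by (simp add: L_def powr_powr)
  then have "L powr (\<sigma> - s) * (R + 1) = \<eta> / 2" using R by (simp add: field_simps)
  moreover have "L powr (\<sigma> - s) * R \<le> L powr (\<sigma> - s) * (R + 1)" by (rule mult_left_mono) auto
  ultimately have L: "L powr (\<sigma> - s) * R \<le> \<eta> / 2" by simp
  define F where "F = {k. symbol m k \<le> L}"
  have F: "finite F"
  proof -
    obtain N :: nat where N: "sqrt L \<le> real N" using real_arch_simple by blast
    then have "(sqrt L)\<^sup>2 \<le> (real N)\<^sup>2" using L0 by (intro power_mono) auto
    then have "L \<le> (real N)\<^sup>2" using L0 by simp
    then have "F \<subseteq> {k. symbol m k \<le> (real N)\<^sup>2}" by (auto simp: F_def)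
    then show ?thesis using symbol_le_mode_cube finite_mode_cube by (meson finite_subset)
  qed
  define S where "S = (\<Sum>k\<in>F. symbol m k powr \<sigma>)"
  have S: "0 \<le> S" by (simp add: S_def sum_nonneg)
  define \<delta> where "\<delta> = sqrt (\<eta> / (2 * (S + 1)))"
  have \<delta>: "0 < \<delta>" "\<delta>\<^sup>2 = \<eta> / (2 * (S + 1))" using \<eta> S by (auto simp: \<delta>_def)
  have S\<delta>: "S * \<delta>\<^sup>2 \<le> \<eta> / 2" unfolding \<delta> using \<eta> S by (simp add: field_simps)
  have "(LINT x|torus. cmod (f x) powr p) \<le> e"
    if f: "f \<in> sobolev_class s m" and fR: "sobolev_sum s m f \<le> R" and fF: "\<forall>k\<in>F. cmod (mode_coeff f k) \<le> \<delta>" for f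
  proof -
    let ?a = "\<lambda>k. symbol m k powr \<sigma> * (cmod (mode_coeff f k))\<^sup>2"
    let ?b = "\<lambda>k. symbol m k powr s * (cmod (mode_coeff f k))\<^sup>2"
    have sb: "?b summable_on UNIV" using f by (simp add: sobolev_class_def)
    have f\<sigma>: "f \<in> sobolev_class \<sigma> m" using sobolev_class_mono[OF m _ f] \<sigma> by simp
    then have sa: "?a summable_on UNIV" by (simp add: sobolev_class_def)
    have "sobolev_sum \<sigma> m f \<le> \<eta>"
      unfolding sobolev_sum_def
    proof (rule infsum_le_finite_sums[OF sa])
      fix A :: "(int ^ 3) set" assume A: "finite A"
      have "sum ?a A = sum ?a (A \<inter> F) + sum ?a (A - F)" using A by (rule sum.Int_Diff)
      also have "sum ?a (A \<inter> F) \<le> (\<Sum>k\<in>F. symbol m k powr \<sigma> * \<delta>\<^sup>2)"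
      proof -
        have "sum ?a (A \<inter> F) \<le> (\<Sum>k\<in>A \<inter> F. symbol m k powr \<sigma> * \<delta>\<^sup>2)"
          using fF by (intro sum_mono mult_left_mono power_mono) auto
        also have "\<dots> \<le> (\<Sum>k\<in>F. symbol m k powr \<sigma> * \<delta>\<^sup>2)" using F by (intro sum_mono2) auto
        finally show ?thesis .
      qed
      also have "\<dots> = S * \<delta>\<^sup>2" by (simp add: S_def sum_distrib_right)
      also have "sum ?a (A - F) \<le> (\<Sum>k\<in>A - F. L powr (\<sigma> - s) * ?b k)"
      proof (rule sum_mono)
        fix k assume "k \<in> A - F"
        then have k: "L \<le> symbol m k" by (simp add: F_def)
        have "symbol m k powr \<sigma> = symbol m k powr (\<sigma> - s) * symbol m k powr s"
          by (simp flip: powr_add)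
        also have "\<dots> \<le> L powr (\<sigma> - s) * symbol m k powr s"
          using L0 k \<sigma> by (intro mult_right_mono powr_mono2') auto
        finally show "?a k \<le> L powr (\<sigma> - s) * ?b k"
          by (simp add: mult_right_mono mult.assoc[symmetric])
      qed
      also have "\<dots> \<le> L powr (\<sigma> - s) * R"
        unfolding sum_distrib_left[symmetric]
      proof (rule mult_left_mono)
        have "sum ?b (A - F) \<le> sobolev_sum s m f"
          unfolding sobolev_sum_def using A by (intro finite_sum_le_infsum[OF sb]) auto
        then show "sum ?b (A - F) \<le> R" using fR by simp
      qed simp
      finally show "sum ?a A \<le> \<eta>" using L S\<delta> by linarith
    qed
    moreover have "0 \<le> sobolev_sum \<sigma> m f" unfolding sobolev_sum_def by (rule infsum_nonneg) simp
    ultimately have "C * sobolev_sum \<sigma> m f powr (p / 2) \<le> C * \<eta> powr (p / 2)"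
      using C p by (intro mult_left_mono powr_mono2) auto
    then show ?thesis using CS[OF f\<sigma>] \<eta> by linarith
  qed
  then show ?thesis using F \<delta>(1) by blast
qed

section \<open>Smooth functions on the half space\<close>

abbreviation closed_half :: "((real ^ 3) \<times> real) set" where
  "closed_half \<equiv> UNIV \<times> {0..}"

abbreviation open_half :: "((real ^ 3) \<times> real) set" where
  "open_half \<equiv> UNIV \<times> {0<..}"

lemma open_open_half: "open open_half"
  by (intro open_Times) auto

text \<open>
  Derivatives within the closed half space are unique also at the boundary, because the positive
  basis directions stay inside.
\<close>

lemma half_derivative_unique:
  fixes f :: "(real ^ 3) \<times> real \<Rightarrow> real"
  assumes p: "p \<in> closed_half" and f: "(f has_derivative f') (at p within closed_half)"
  shows "frechet_derivative f (at p within closed_half) = f'"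
proof -
  have "f differentiable (at p within closed_half)" using f by (auto simp: differentiable_def)
  then have "(f has_derivative frechet_derivative f (at p within closed_half)) (at p within closed_half)"
    by (simp add: frechet_derivative_works)
  then show ?thesis using f
  proof (rule frechet_derivative_unique_within)
    fix i :: "(real ^ 3) \<times> real" and e :: real assume i: "i \<in> Basis" and e: "0 < e"
    have "0 \<le> snd i" using i by (auto simp: Basis_prod_def)
    then have "p + (e / 2) *\<^sub>R i \<in> closed_half" using p e by (auto simp: mem_Times_iff)
    then show "\<exists>d. 0 < \<bar>d\<bar> \<and> \<bar>d\<bar> < e \<and> p + d *\<^sub>R i \<in> closed_half"
      using e by (intro exI[of _ "e / 2"]) auto
  qed
qed

lemma half_derivative:
  assumes "f differentiable_on closed_half" "p \<in> closed_half"
  shows "(f has_derivative frechet_derivative f (at p within closed_half)) (at p within closed_half)"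
  using assms unfolding differentiable_on_def frechet_derivative_works by blast

lemma Ck_on_cong:
  assumes "Ck_on k closed_half f" "\<And>p. p \<in> closed_half \<Longrightarrow> f p = g p"
  shows "Ck_on k closed_half g"
  using assms
proof (induction k arbitrary: f g)
  case 0
  then show ?case using continuous_on_cong by (metis Ck_on.simps(1))
next
  case (Suc k)
  have d: "(g has_derivative frechet_derivative f (at p within closed_half)) (at p within closed_half)"
    if p: "p \<in> closed_half" for p
  proof (rule has_derivative_transform_within[OF half_derivative zero_less_one p])
    show "f differentiable_on closed_half" using Suc.prems(1) by simp
  qed (use p Suc.prems(2) in blast)+
  then have "g differentiable_on closed_half"
    unfolding differentiable_on_def differentiable_def by blast
  moreover have "Ck_on k closed_half (\<lambda>p. frechet_derivative g (at p within closed_half) v)" for v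
  proof (rule Suc.IH[of "\<lambda>p. frechet_derivative f (at p within closed_half) v"])
    show "Ck_on k closed_half (\<lambda>p. frechet_derivative f (at p within closed_half) v)"
      using Suc.prems(1) unfolding Ck_on.simps by blast
  qed (simp only: half_derivative_unique[OF _ d])
  ultimately show ?case by simp
qed

lemma Ck_on_lincomb:
  assumes "Ck_on k closed_half f" "Ck_on k closed_half g"
  shows "Ck_on k closed_half (\<lambda>p. a * f p + b * g p)"
  using assms
proof (induction k arbitrary: f g)
  case 0
  then show ?case by (auto intro!: continuous_intros)
next
  case (Suc k)
  let ?D = "\<lambda>f p. frechet_derivative f (at p within closed_half)"
  have d: "((\<lambda>p. a * f p + b * g p) has_derivative (\<lambda>v. a * ?D f p v + b * ?D g p v)) (at p within closed_half)"
    if p: "p \<in> closed_half" for p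
    using half_derivative[of f p] half_derivative[of g p] Suc.prems p
    by (auto intro!: derivative_eq_intros)
  then have "(\<lambda>p. a * f p + b * g p) differentiable_on closed_half"
    unfolding differentiable_on_def differentiable_def by blast
  moreover have "Ck_on k closed_half (\<lambda>p. ?D (\<lambda>p. a * f p + b * g p) p v)" for v
  proof (rule Ck_on_cong[OF Suc.IH[of "\<lambda>p. ?D f p v" "\<lambda>p. ?D g p v"]])
    show "Ck_on k closed_half (\<lambda>p. ?D f p v)" "Ck_on k closed_half (\<lambda>p. ?D g p v)"
      using Suc.prems unfolding Ck_on.simps by blast+
  qed (simp only: half_derivative_unique[OF _ d])
  ultimately show ?case by simp
qed

lemma half_derivative_translate:
  fixes f :: "(real ^ 3) \<times> real \<Rightarrow> real"
  assumes f: "f differentiable_on closed_half" and p: "p \<in> closed_half"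
  shows "((\<lambda>p. f (p + (t, 0))) has_derivative frechet_derivative f (at (p + (t, 0)) within closed_half)) (at p within closed_half)"
proof -
  have im: "(\<lambda>p. p + (t, 0)) ` closed_half = closed_half"
  proof
    show "closed_half \<subseteq> (\<lambda>p. p + (t, 0)) ` closed_half"
    proof
      fix q :: "(real ^ 3) \<times> real" assume "q \<in> closed_half"
      then have "q - (t, 0) \<in> closed_half" by (auto simp: mem_Times_iff)
      then show "q \<in> (\<lambda>p. p + (t, 0)) ` closed_half" by (rule rev_image_eqI) simp
    qed
  qed (auto simp: mem_Times_iff)
  have "p + (t, 0) \<in> closed_half" using p by (auto simp: mem_Times_iff)
  from half_derivative[OF f this]
  have "(f has_derivative frechet_derivative f (at (p + (t, 0)) within closed_half))
      (at (p + (t, 0)) within (\<lambda>p. p + (t, 0)) ` closed_half)" unfolding im .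
  then have "(f \<circ> (\<lambda>p. p + (t, 0)) has_derivative frechet_derivative f (at (p + (t, 0)) within closed_half) \<circ> (\<lambda>v. v))
      (at p within closed_half)"
    by (intro diff_chain_within) (auto intro!: derivative_eq_intros)
  then show ?thesis by (simp add: o_def)
qed

lemma continuous_on_translate_half:
  fixes f :: "(real ^ 3) \<times> real \<Rightarrow> real"
  assumes f: "continuous_on closed_half f"
  shows "continuous_on closed_half (\<lambda>p. f (p + (t, 0)))"
proof (rule continuous_on_compose2[OF f])
  show "continuous_on closed_half (\<lambda>p. p + (t, 0 :: real))" by (intro continuous_intros)
qed (auto simp: mem_Times_iff)

lemma Ck_on_translate:
  assumes "Ck_on k closed_half f"
  shows "Ck_on k closed_half (\<lambda>p. f (p + (t, 0)))"
  using assms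
proof (induction k arbitrary: f)
  case 0
  then show ?case using continuous_on_translate_half by simp
next
  case (Suc k)
  let ?D = "\<lambda>f p. frechet_derivative f (at p within closed_half)"
  have d: "((\<lambda>p. f (p + (t, 0))) has_derivative ?D f (p + (t, 0))) (at p within closed_half)"
    if p: "p \<in> closed_half" for p
    by (rule half_derivative_translate[OF _ p]) (use Suc.prems in simp)
  then have "(\<lambda>p. f (p + (t, 0))) differentiable_on closed_half"
    unfolding differentiable_on_def differentiable_def by blast
  moreover have "Ck_on k closed_half (\<lambda>p. ?D (\<lambda>p. f (p + (t, 0))) p v)" for v
  proof (rule Ck_on_cong[OF Suc.IH[of "\<lambda>p. ?D f p v"]])
    show "Ck_on k closed_half (\<lambda>p. ?D f p v)"
      using Suc.prems unfolding Ck_on.simps by blast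
  qed (simp only: half_derivative_unique[OF _ d])
  ultimately show ?case by simp
qed

text \<open>The two products of \<open>exp (- y)\<close> with \<open>cos x\<^sub>1\<close> and \<open>sin x\<^sub>1\<close> span a space closed under differentiation.\<close>

lemma Ck_on_wave: "Ck_on k closed_half (\<lambda>p. exp (- snd p) * (A * cos (fst p $ 1) + B * sin (fst p $ 1)))"
proof (induction k arbitrary: A B)
  case 0
  show ?case by (auto intro!: continuous_intros)
next
  case (Suc k)
  let ?f = "\<lambda>p :: (real ^ 3) \<times> real. exp (- snd p) * (A * cos (fst p $ 1) + B * sin (fst p $ 1))"
  have d: "(?f has_derivative (\<lambda>v. exp (- snd p) * ((B * fst v $ 1 - A * snd v) * cos (fst p $ 1) + (- A * fst v $ 1 - B * snd v) * sin (fst p $ 1))))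
     (at p within closed_half)" for p
    by (rule derivative_eq_intros bounded_linear.has_derivative[OF bounded_linear_vec_nth] refl)+
      (auto simp: fun_eq_iff algebra_simps)
  then have "?f differentiable_on closed_half"
    unfolding differentiable_on_def differentiable_def by blast
  moreover have "Ck_on k closed_half (\<lambda>p. frechet_derivative ?f (at p within closed_half) v)" for v
    by (rule Ck_on_cong[OF Suc.IH]) (simp only: half_derivative_unique[OF _ d])
  ultimately show ?case by simp
qed

section \<open>Gradients\<close>

text \<open>
  The function \<open>grad\<close> consists of full derivatives and is meaningful only in the interior. The one-sided
  derivatives extend it continuously to the boundary, where the trace is taken.
\<close>

definition pd :: "((real ^ 3) \<times> real \<Rightarrow> real) \<Rightarrow> (real ^ 3) \<times> real \<Rightarrow> (real ^ 3) \<times> real \<Rightarrow> real" where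
  "pd f v p = frechet_derivative f (at p within closed_half) v"

text \<open>The energy and the trace involve only first derivatives.\<close>

definition C1 :: "((real ^ 3) \<times> real \<Rightarrow> real) \<Rightarrow> bool" where
  "C1 f \<longleftrightarrow> f differentiable_on closed_half \<and> (\<forall>v. continuous_on closed_half (pd f v))"

lemma C1_continuous: "C1 f \<Longrightarrow> continuous_on closed_half f"
  by (auto simp: C1_def intro: differentiable_imp_continuous_on)

lemma C1_differentiable: "C1 f \<Longrightarrow> f differentiable_on closed_half"
  unfolding C1_def by blast

lemma C1_continuous_pd: "C1 f \<Longrightarrow> continuous_on closed_half (pd f v)"
  unfolding C1_def by blast

lemma smooth_on_C1: "smooth_on closed_half f \<Longrightarrow> C1 f"
  unfolding smooth_on_def C1_def pd_def by (drule spec[of _ "Suc 0"]) simp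

lemma C1_derivative_interior:
  assumes "C1 f" "p \<in> open_half"
  shows "(f has_derivative (\<lambda>v. pd f v p)) (at p)"
proof -
  have "(f has_derivative (\<lambda>v. pd f v p)) (at p within closed_half)"
    unfolding pd_def using assms by (intro half_derivative) (auto simp: C1_def mem_Times_iff)
  then have "(f has_derivative (\<lambda>v. pd f v p)) (at p within open_half)"
    by (rule has_derivative_subset) auto
  then show ?thesis using at_within_open[OF assms(2) open_open_half] by simp
qed

lemma grad_pd:
  assumes "C1 f" "p \<in> open_half"
  shows "grad f p = (\<Sum>e\<in>Basis. pd f e p *\<^sub>R e)"
  using frechet_derivative_at[OF C1_derivative_interior[OF assms]] unfolding grad_def by metis

lemma grad_inner:
  assumes "C1 f" "p \<in> open_half" "e \<in> Basis"
  shows "grad f p \<bullet> e = pd f e p"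
  unfolding grad_pd[OF assms(1,2)] using assms(3)
  by (simp add: inner_sum_left inner_Basis if_distrib cong: if_cong)

lemma norm_grad:
  assumes "C1 f" "p \<in> open_half"
  shows "(norm (grad f p))\<^sup>2 = (\<Sum>i\<in>UNIV. (pd f (axis i 1, 0) p)\<^sup>2) + (pd f (0, 1) p)\<^sup>2"
proof -
  have "(norm (grad f p))\<^sup>2 = (\<Sum>e\<in>Basis. (grad f p \<bullet> e)\<^sup>2)"
    unfolding power2_norm_eq_inner by (subst euclidean_inner) (simp add: power2_eq_square)
  also have "\<dots> = (\<Sum>e\<in>Basis. (pd f e p)\<^sup>2)" using grad_inner[OF assms] by simp
  also have "\<dots> = (\<Sum>e\<in>(\<lambda>u. (u, 0)) ` Basis \<union> (\<lambda>u. (0, u)) ` Basis. (pd f e p)\<^sup>2)"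
    by (simp add: Basis_prod_def)
  also have "\<dots> = (\<Sum>e\<in>(\<lambda>u. (u, 0)) ` Basis. (pd f e p)\<^sup>2) + (pd f (0, 1) p)\<^sup>2"
    by (subst sum.union_disjoint) auto
  also have "(\<Sum>e\<in>(\<lambda>u. (u, 0 :: real)) ` (Basis :: (real ^ 3) set). (pd f e p)\<^sup>2) = (\<Sum>e\<in>(Basis :: (real ^ 3) set). (pd f (e, 0) p)\<^sup>2)"
    by (subst sum.reindex) (auto simp: inj_on_def)
  also have "(\<Sum>e\<in>(Basis :: (real ^ 3) set). (pd f (e, 0) p)\<^sup>2) = (\<Sum>i\<in>UNIV. (pd f (axis i 1, 0) p)\<^sup>2)"
  proof -
    have "(Basis :: (real ^ 3) set) = range (\<lambda>i. axis i 1)" by (auto simp: Basis_vec_def)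
    moreover have "inj (\<lambda>i::3. axis i (1::real))" by (auto simp: inj_on_def axis_eq_axis)
    ultimately show ?thesis by (metis (no_types, lifting) sum.reindex_cong)
  qed
  finally show ?thesis .
qed

lemma C1_lincomb:
  assumes "C1 f" "C1 g"
  shows "C1 (\<lambda>p. a * f p + b * g p)"
    and "p \<in> closed_half \<Longrightarrow> pd (\<lambda>p. a * f p + b * g p) v p = a * pd f v p + b * pd g v p"
proof -
  have d: "((\<lambda>p. a * f p + b * g p) has_derivative (\<lambda>v. a * pd f v p + b * pd g v p)) (at p within closed_half)"
    if p: "p \<in> closed_half" for p
    using half_derivative[of f p] half_derivative[of g p] assms p
    by (auto intro!: derivative_eq_intros simp: C1_def pd_def)
  have e: "pd (\<lambda>p. a * f p + b * g p) v p = a * pd f v p + b * pd g v p" if "p \<in> closed_half" for p v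
    unfolding pd_def[of "\<lambda>p. a * f p + b * g p"] half_derivative_unique[OF that d[OF that]] ..
  show "p \<in> closed_half \<Longrightarrow> pd (\<lambda>p. a * f p + b * g p) v p = a * pd f v p + b * pd g v p" by (rule e)
  have "continuous_on closed_half (pd (\<lambda>p. a * f p + b * g p) v)" for v
    by (subst continuous_on_cong[OF refl e]) (intro continuous_intros C1_continuous_pd assms | assumption)+
  then show "C1 (\<lambda>p. a * f p + b * g p)"
    unfolding C1_def differentiable_on_def differentiable_def[of "\<lambda>p. a * f p + b * g p"] using d by blast
qed

lemma grad_lincomb:
  assumes "C1 f" "C1 g" "p \<in> open_half"
  shows "grad (\<lambda>p. a * f p + b * g p) p = a *\<^sub>R grad f p + b *\<^sub>R grad g p"
proof -
  have "p \<in> closed_half" using assms by auto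
  then show ?thesis
    by (simp add: grad_pd C1_lincomb assms scaleR_add_left sum.distrib scaleR_sum_right)
qed

lemma C1_translate:
  assumes "C1 f"
  shows "C1 (\<lambda>p. f (p + (t, 0)))"
    and "p \<in> closed_half \<Longrightarrow> pd (\<lambda>p. f (p + (t, 0))) v p = pd f v (p + (t, 0))"
proof -
  note d = half_derivative_translate[of f _ t]
  have e: "pd (\<lambda>p. f (p + (t, 0))) v p = pd f v (p + (t, 0))" if "p \<in> closed_half" for p v
    unfolding pd_def using half_derivative_unique[OF that d[OF _ that]] assms by (simp add: C1_def)
  show "p \<in> closed_half \<Longrightarrow> pd (\<lambda>p. f (p + (t, 0))) v p = pd f v (p + (t, 0))" by (rule e)
  have "continuous_on closed_half (\<lambda>p. pd f v (p + (t, 0)))" for v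
    by (rule continuous_on_translate_half[OF C1_continuous_pd[OF assms]])
  then have "continuous_on closed_half (pd (\<lambda>p. f (p + (t, 0))) v)" for v
    by (subst continuous_on_cong[OF refl e]) assumption
  then show "C1 (\<lambda>p. f (p + (t, 0)))"
    unfolding C1_def differentiable_on_def differentiable_def[of "\<lambda>p. f (p + (t, 0))"]
    using d[OF C1_differentiable[OF assms]] by blast
qed

lemma grad_translate:
  assumes "C1 f" "p \<in> open_half"
  shows "grad (\<lambda>p. f (p + (t, 0))) p = grad f (p + (t, 0))"
proof -
  have "p \<in> closed_half" "p + (t, 0) \<in> open_half" using assms by (auto simp: mem_Times_iff)
  then show ?thesis using assms by (simp add: grad_pd C1_translate)
qed

lemma pd_cong:
  assumes "\<And>p. p \<in> closed_half \<Longrightarrow> f p = g p" "f differentiable_on closed_half" "p \<in> closed_half"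
  shows "pd g v p = pd f v p"
proof -
  have "(g has_derivative frechet_derivative f (at p within closed_half)) (at p within closed_half)"
    by (rule has_derivative_transform_within[OF half_derivative[OF assms(2,3)] zero_less_one assms(3)])
      (use assms(1) in blast)
  then show ?thesis unfolding pd_def using half_derivative_unique[OF assms(3)] by metis
qed

lemma C1_periodic:
  assumes f: "C1 f" and per: "\<And>p n. p \<in> closed_half \<Longrightarrow> f (p + (lattice n, 0)) = f p" and p: "p \<in> closed_half"
  shows "pd f v (p + (lattice n, 0)) = pd f v p"
proof -
  have "pd (\<lambda>p. f (p + (lattice n, 0))) v p = pd f v p"
    by (rule pd_cong[OF _ _ p]) (use f per in \<open>simp_all only: C1_def\<close>)
  then show ?thesis using C1_translate(2)[OF f p] by metis
qed

section \<open>The energy form\<close>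

lemma L2_cong: "(\<And>x. x \<in> space M \<Longrightarrow> f x = g x) \<Longrightarrow> f \<in> L2 M \<longleftrightarrow> g \<in> L2 M"
  unfolding L2_def by (auto cong: measurable_cong_simp Bochner_Integration.integrable_cong)

lemma l2_inner_cong:
  "(\<And>x. x \<in> space M \<Longrightarrow> f x = f' x) \<Longrightarrow> (\<And>x. x \<in> space M \<Longrightarrow> g x = g' x) \<Longrightarrow> l2_inner M f g = l2_inner M f' g'"
  unfolding l2_inner_def by (intro Bochner_Integration.integral_cong) auto

lemma kappa_pos: "0 < s \<Longrightarrow> s < 1 \<Longrightarrow> 0 < kappa s"
  by (simp add: kappa_def Gamma_real_pos)

lemma space_cyl [simp]: "space (cyl_measure s) = cube \<times> {0<..}"
  by (simp add: cyl_measure_def space_restrict_space)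

lemma cyl_sets [measurable]: "cube \<times> {0<..} \<in> sets (borel :: ((real ^ 3) \<times> real) measure)"
  by (intro borel_open open_Times open_cube) auto

lemma borel_cyl: "f \<in> borel_measurable borel \<Longrightarrow> f \<in> borel_measurable (cyl_measure s)"
  unfolding cyl_measure_def by (simp add: measurable_restrict_space1)

lemma continuous_cyl:
  fixes f :: "(real ^ 3) \<times> real \<Rightarrow> 'b::real_normed_vector"
  assumes "continuous_on open_half f"
  shows "f \<in> borel_measurable (cyl_measure s)"
proof -
  have "(\<lambda>p. indicator open_half p *\<^sub>R f p) \<in> borel_measurable borel"
    using assms open_open_half by (intro borel_measurable_continuous_on_indicator) auto
  then have "(\<lambda>p. indicator open_half p *\<^sub>R f p) \<in> borel_measurable (cyl_measure s)" by (rule borel_cyl)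
  then show ?thesis by (rule measurable_cong[THEN iffD1, rotated]) auto
qed

text \<open>
  Tonelli's theorem on the weighted cylinder: the energy is an integral over the slices \<open>y = const\<close>.
\<close>

lemma nn_integral_cyl:
  fixes f :: "(real ^ 3) \<times> real \<Rightarrow> ennreal"
  assumes [measurable]: "f \<in> borel_measurable borel"
  shows "(\<integral>\<^sup>+p. f p \<partial>cyl_measure s)
    = (\<integral>\<^sup>+y. indicator {0<..} y * ennreal (y powr (1 - 2 * s)) * (\<integral>\<^sup>+x. f (x, y) \<partial>torus) \<partial>lborel)"
proof -
  have m: "f \<in> borel_measurable (borel \<Otimes>\<^sub>M borel)" using assms by (simp add: borel_prod)
  have "(\<lambda>p :: (real ^ 3) \<times> real. snd p) \<in> borel_measurable borel"
    by (intro borel_measurable_continuous_onI continuous_intros)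
  then have w [measurable]: "(\<lambda>p :: (real ^ 3) \<times> real. snd p powr (1 - 2 * s)) \<in> borel_measurable borel"
    by measurable
  then have [measurable]: "(\<lambda>p :: (real ^ 3) \<times> real. snd p powr (1 - 2 * s)) \<in> borel_measurable (restrict_space lborel (cube \<times> {0<..}))"
    by (simp add: measurable_restrict_space1)
  have "(\<integral>\<^sup>+p. f p \<partial>cyl_measure s)
      = (\<integral>\<^sup>+p. ennreal (snd p powr (1 - 2 * s)) * f p * indicator (cube \<times> {0<..}) p \<partial>lborel)"
    unfolding cyl_measure_def
    by (subst nn_integral_density) (auto simp: nn_integral_restrict_space measurable_restrict_space1)
  also have "\<dots> = (\<integral>\<^sup>+p. ennreal (snd p powr (1 - 2 * s)) * f p * (indicator cube (fst p) * indicator {0<..} (snd p)) \<partial>(lborel \<Otimes>\<^sub>M lborel))"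
    unfolding lborel_prod by (intro nn_integral_cong) (auto simp: indicator_def)
  also have "\<dots> = (\<integral>\<^sup>+y. \<integral>\<^sup>+x. ennreal (y powr (1 - 2 * s)) * f (x, y) * (indicator cube x * indicator {0<..} y) \<partial>lborel \<partial>lborel)"
    using m by (subst lborel_pair.nn_integral_snd[symmetric]) (auto simp: split_beta')
  also have "\<dots> = (\<integral>\<^sup>+y. indicator {0<..} y * ennreal (y powr (1 - 2 * s)) * (\<integral>\<^sup>+x. f (x, y) \<partial>torus) \<partial>lborel)"
  proof (intro nn_integral_cong)
    fix y
    have [measurable]: "(\<lambda>x. f (x, y)) \<in> borel_measurable borel"
      using measurable_compose[OF measurable_Pair2' m] by simp
    have "(\<integral>\<^sup>+x. ennreal (y powr (1 - 2 * s)) * f (x, y) * (indicator cube x * indicator {0<..} y) \<partial>lborel)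
        = (\<integral>\<^sup>+x. (indicator {0<..} y * ennreal (y powr (1 - 2 * s))) * (f (x, y) * indicator cube x) \<partial>lborel)"
      by (intro nn_integral_cong) (simp add: mult_ac)
    also have "\<dots> = (indicator {0<..} y * ennreal (y powr (1 - 2 * s))) * (\<integral>\<^sup>+x. f (x, y) * indicator cube x \<partial>lborel)"
      by (rule nn_integral_cmult) measurable
    finally show "(\<integral>\<^sup>+x. ennreal (y powr (1 - 2 * s)) * f (x, y) * (indicator cube x * indicator {0<..} y) \<partial>lborel)
       = indicator {0<..} y * ennreal (y powr (1 - 2 * s)) * (\<integral>\<^sup>+x. f (x, y) \<partial>torus)"
      by (simp add: nn_integral_restrict_space)
  qed
  finally show ?thesis .
qed

text \<open>The norm of \<open>\<bbbX>\<^sup>s\<close> is, up to the constant, the \<open>L\<^sup>2\<close> norm of the vector field \<open>(m U, G)\<close>.\<close>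

definition jet_field :: "real \<Rightarrow> jet \<Rightarrow> (real ^ 3) \<times> real \<Rightarrow> real \<times> ((real ^ 3) \<times> real)" where
  "jet_field m W p = (m * fst W p, snd W p)"

lemma X_inner_l2: "X_inner s m W Z = 1 / kappa s * l2_inner (cyl_measure s) (jet_field m W) (jet_field m Z)"
  by (simp add: X_inner_def l2_inner_def jet_field_def power2_eq_square algebra_simps)

lemma weighted_L2_iff:
  assumes m: "0 < m"
  shows "W \<in> weighted_L2 s \<longleftrightarrow> jet_field m W \<in> L2 (cyl_measure s)"
proof
  assume W: "W \<in> weighted_L2 s"
  have [measurable]: "fst W \<in> borel_measurable (cyl_measure s)" "snd W \<in> borel_measurable (cyl_measure s)"
    using W by (auto simp: weighted_L2_def)
  have "jet_field m W \<in> borel_measurable (cyl_measure s)"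
    unfolding jet_field_def[abs_def] by (intro borel_measurable_Pair) measurable
  moreover have "(norm (jet_field m W p))\<^sup>2 = m\<^sup>2 * (fst W p)\<^sup>2 + (norm (snd W p))\<^sup>2" for p
    by (simp add: jet_field_def norm_prod_def power_mult_distrib)
  ultimately show "jet_field m W \<in> L2 (cyl_measure s)"
    using W by (simp add: L2_def weighted_L2_def split_beta)
next
  assume J: "jet_field m W \<in> L2 (cyl_measure s)"
  have mJ: "jet_field m W \<in> borel_measurable (cyl_measure s)" using J by (rule L2_measurable)
  have mf: "fst W \<in> borel_measurable (cyl_measure s)"
  proof -
    have "(\<lambda>p. inverse m * fst (jet_field m W p)) \<in> borel_measurable (cyl_measure s)"
      using measurable_compose[OF mJ borel_measurable_continuous_onI[OF continuous_on_fst[OF continuous_on_id]]]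
      by (intro borel_measurable_times) simp_all
    then show ?thesis using m by (simp add: jet_field_def mult.assoc[symmetric])
  qed
  have ms: "snd W \<in> borel_measurable (cyl_measure s)"
  proof -
    have "(\<lambda>p. snd (jet_field m W p)) \<in> borel_measurable (cyl_measure s)"
      using measurable_compose[OF mJ borel_measurable_continuous_onI[OF continuous_on_snd[OF continuous_on_id]]]
      by simp
    then show ?thesis by (simp add: jet_field_def)
  qed
  have n: "(norm (jet_field m W p))\<^sup>2 = m\<^sup>2 * (fst W p)\<^sup>2 + (norm (snd W p))\<^sup>2" for p
    by (simp add: jet_field_def norm_prod_def power_mult_distrib)
  note i = L2_integrable_norm_sq[OF J]
  have "integrable (cyl_measure s) (\<lambda>p. inverse (m\<^sup>2) * (norm (jet_field m W p))\<^sup>2)" using i by simp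
  then have i1: "integrable (cyl_measure s) (\<lambda>p. (fst W p)\<^sup>2)"
    by (rule Bochner_Integration.integrable_bound) (use m mf n in \<open>auto simp: field_simps\<close>)
  have i2: "integrable (cyl_measure s) (\<lambda>p. (norm (snd W p))\<^sup>2)"
    by (rule Bochner_Integration.integrable_bound[OF i]) (use ms n in auto)
  show "W \<in> weighted_L2 s"
    using mf ms i1 i2 by (simp add: weighted_L2_def split_beta)
qed

lemma jet_field_diff:
  "jet_field m ((\<lambda>p. fst W p - fst Z p), (\<lambda>p. snd W p - snd Z p)) = (\<lambda>p. jet_field m W p - jet_field m Z p)"
  by (auto simp: jet_field_def fun_eq_iff algebra_simps)

definition smooth_field :: "real \<Rightarrow> ((real ^ 3) \<times> real \<Rightarrow> real) \<Rightarrow> (real ^ 3) \<times> real \<Rightarrow> real \<times> ((real ^ 3) \<times> real)" where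
  "smooth_field m \<phi> = jet_field m (\<phi>, grad \<phi>)"

definition form :: "real \<Rightarrow> real \<Rightarrow> ((real ^ 3) \<times> real \<Rightarrow> real) \<Rightarrow> ((real ^ 3) \<times> real \<Rightarrow> real) \<Rightarrow> real" where
  "form s m \<phi> \<psi> = X_inner s m (\<phi>, grad \<phi>) (\<psi>, grad \<psi>)"

lemma form_l2: "form s m \<phi> \<psi> = 1 / kappa s * l2_inner (cyl_measure s) (smooth_field m \<phi>) (smooth_field m \<psi>)"
  by (simp add: form_def smooth_field_def X_inner_l2)

lemma smooth_periodicD:
  assumes "\<phi> \<in> smooth_periodic s"
  shows "C1 \<phi>" "continuous_on closed_half \<phi>"
    and "0 < m \<Longrightarrow> smooth_field m \<phi> \<in> L2 (cyl_measure s)"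
    and "0 \<le> y \<Longrightarrow> periodic (\<lambda>x. \<phi> (x, y))"
    and "p \<in> closed_half \<Longrightarrow> \<phi> (p + (lattice n, 0)) = \<phi> p"
proof -
  show c: "C1 \<phi>" using assms smooth_on_C1 by (auto simp: smooth_periodic_def)
  then show "continuous_on closed_half \<phi>" by (rule C1_continuous)
  show "0 < m \<Longrightarrow> smooth_field m \<phi> \<in> L2 (cyl_measure s)"
    using assms by (simp add: smooth_field_def weighted_L2_iff[symmetric] smooth_periodic_def)
  show per: "periodic (\<lambda>x. \<phi> (x, y))" if "0 \<le> y" for y
    using assms that by (simp add: smooth_periodic_def)
  show "\<phi> (p + (lattice n, 0)) = \<phi> p" if "p \<in> closed_half"
    using periodic_lattice[OF per[of "snd p"], of "fst p" n] that
    by (cases p) (auto simp: mem_Times_iff)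
qed

lemma smooth_field_lincomb:
  assumes "C1 \<phi>" "C1 \<psi>" "p \<in> open_half"
  shows "smooth_field m (\<lambda>p. a * \<phi> p + b * \<psi> p) p = a *\<^sub>R smooth_field m \<phi> p + b *\<^sub>R smooth_field m \<psi> p"
  using assms by (simp add: smooth_field_def jet_field_def grad_lincomb algebra_simps)

lemma smooth_periodic_lincomb:
  assumes \<phi>: "\<phi> \<in> smooth_periodic s" and \<psi>: "\<psi> \<in> smooth_periodic s"
  shows "(\<lambda>p. a * \<phi> p + b * \<psi> p) \<in> smooth_periodic s"
proof -
  have "smooth_on closed_half (\<lambda>p. a * \<phi> p + b * \<psi> p)"
    using \<phi> \<psi> Ck_on_lincomb unfolding smooth_periodic_def smooth_on_def by blast
  moreover have "\<forall>y\<ge>0. periodic (\<lambda>x. a * \<phi> (x, y) + b * \<psi> (x, y))"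
    using \<phi> \<psi> unfolding smooth_periodic_def periodic_def by auto
  moreover have "smooth_field 1 (\<lambda>p. a * \<phi> p + b * \<psi> p) \<in> L2 (cyl_measure s)"
  proof (subst L2_cong)
    show "(\<lambda>p. a *\<^sub>R smooth_field 1 \<phi> p + b *\<^sub>R smooth_field 1 \<psi> p) \<in> L2 (cyl_measure s)"
      by (intro L2_add L2_scale smooth_periodicD(3)[OF \<phi>] smooth_periodicD(3)[OF \<psi>]) auto
  qed (use smooth_field_lincomb smooth_periodicD(1)[OF \<phi>] smooth_periodicD(1)[OF \<psi>] in auto)
  ultimately show ?thesis
    by (simp add: smooth_periodic_def smooth_field_def weighted_L2_iff[of 1])
qed

lemma form_commute: "form s m \<phi> \<psi> = form s m \<psi> \<phi>"
  by (simp add: form_l2 l2_inner_commute)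

lemma form_lincomb_left:
  assumes m: "0 < m" and \<phi>: "\<phi> \<in> smooth_periodic s" and \<psi>: "\<psi> \<in> smooth_periodic s" and \<omega>: "\<omega> \<in> smooth_periodic s"
  shows "form s m (\<lambda>p. a * \<phi> p + b * \<psi> p) \<omega> = a * form s m \<phi> \<omega> + b * form s m \<psi> \<omega>"
proof -
  note L = smooth_periodicD(3)[OF \<phi> m] smooth_periodicD(3)[OF \<psi> m] smooth_periodicD(3)[OF \<omega> m]
  have "l2_inner (cyl_measure s) (smooth_field m (\<lambda>p. a * \<phi> p + b * \<psi> p)) (smooth_field m \<omega>)
      = l2_inner (cyl_measure s) (\<lambda>p. a *\<^sub>R smooth_field m \<phi> p + b *\<^sub>R smooth_field m \<psi> p) (smooth_field m \<omega>)"
    using smooth_field_lincomb smooth_periodicD(1)[OF \<phi>] smooth_periodicD(1)[OF \<psi>] by (intro l2_inner_cong) auto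
  also have "\<dots> = a * l2_inner (cyl_measure s) (smooth_field m \<phi>) (smooth_field m \<omega>)
      + b * l2_inner (cyl_measure s) (smooth_field m \<psi>) (smooth_field m \<omega>)"
    using L by (simp add: l2_inner_add_left L2_scale l2_inner_scale_left)
  finally show ?thesis by (simp add: form_l2 algebra_simps add_divide_distrib)
qed

lemma form_lincomb_self:
  assumes "0 < m" "\<phi> \<in> smooth_periodic s" "\<psi> \<in> smooth_periodic s"
  shows "form s m (\<lambda>p. a * \<phi> p + b * \<psi> p) (\<lambda>p. a * \<phi> p + b * \<psi> p)
    = a\<^sup>2 * form s m \<phi> \<phi> + 2 * a * b * form s m \<phi> \<psi> + b\<^sup>2 * form s m \<psi> \<psi>"
proof -
  have "form s m \<omega> (\<lambda>p. a * \<phi> p + b * \<psi> p) = a * form s m \<omega> \<phi> + b * form s m \<omega> \<psi>"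
    if "\<omega> \<in> smooth_periodic s" for \<omega>
    using form_lincomb_left[OF assms that] by (simp add: form_commute[of s m \<omega>])
  then show ?thesis
    using form_lincomb_left[OF assms smooth_periodic_lincomb[OF assms(2,3)]] assms
    by (simp add: form_commute[of s m \<psi> \<phi>] power2_eq_square algebra_simps)
qed

lemma form_nonneg: "0 < s \<Longrightarrow> s < 1 \<Longrightarrow> 0 \<le> form s m \<phi> \<phi>"
  using kappa_pos[of s] by (simp add: form_l2 l2_inner_self_nonneg)

lemma form_diff_self:
  assumes "\<phi> \<in> smooth_periodic s" "\<psi> \<in> smooth_periodic s"
  shows "form s m (\<lambda>p. \<phi> p - \<psi> p) (\<lambda>p. \<phi> p - \<psi> p)
    = 1 / kappa s * l2_inner (cyl_measure s) (\<lambda>p. smooth_field m \<phi> p - smooth_field m \<psi> p)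
         (\<lambda>p. smooth_field m \<phi> p - smooth_field m \<psi> p)"
  unfolding form_l2
  using smooth_field_lincomb[OF smooth_periodicD(1)[OF assms(1)] smooth_periodicD(1)[OF assms(2)], of _ m 1 "-1"]
  by (intro arg_cong[where f = "(*) _"] l2_inner_cong) auto

section \<open>Energy by slices\<close>

lemma continuous_grad:
  assumes "C1 \<phi>"
  shows "continuous_on open_half (grad \<phi>)"
proof (subst continuous_on_cong[OF refl grad_pd[OF assms]])
  have "continuous_on open_half (pd \<phi> e)" for e
    using C1_continuous_pd[OF assms] by (rule continuous_on_subset) auto
  then show "continuous_on open_half (\<lambda>p. \<Sum>e\<in>Basis. pd \<phi> e p *\<^sub>R e)" by (intro continuous_intros)
qed

lemma norm_smooth_field: "(norm (smooth_field m \<phi> p))\<^sup>2 = m\<^sup>2 * (\<phi> p)\<^sup>2 + (norm (grad \<phi> p))\<^sup>2"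
  by (simp add: smooth_field_def jet_field_def norm_prod_def power_mult_distrib)

lemma continuous_smooth_field:
  assumes "C1 \<phi>"
  shows "continuous_on open_half (smooth_field m \<phi>)"
proof -
  have "continuous_on open_half \<phi>" using C1_continuous[OF assms] by (rule continuous_on_subset) auto
  then show ?thesis
    unfolding smooth_field_def jet_field_def[abs_def] using continuous_grad[OF assms]
    by (auto intro!: continuous_intros)
qed

lemma nn_energy_slices:
  assumes "C1 \<phi>"
  shows "(\<integral>\<^sup>+p. ennreal ((norm (smooth_field m \<phi> p))\<^sup>2) \<partial>cyl_measure s)
    = (\<integral>\<^sup>+y. indicator {0<..} y * ennreal (y powr (1 - 2 * s))
         * (\<integral>\<^sup>+x. ennreal ((norm (smooth_field m \<phi> (x, y)))\<^sup>2) \<partial>torus) \<partial>lborel)"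
proof -
  define f where "f p = ennreal ((norm (indicator open_half p *\<^sub>R smooth_field m \<phi> p))\<^sup>2)" for p
  have "(\<lambda>p. indicator open_half p *\<^sub>R smooth_field m \<phi> p) \<in> borel_measurable borel"
    using continuous_smooth_field[OF assms] open_open_half by (intro borel_measurable_continuous_on_indicator) auto
  then have f: "f \<in> borel_measurable borel" unfolding f_def[abs_def] by measurable
  have "(\<integral>\<^sup>+p. ennreal ((norm (smooth_field m \<phi> p))\<^sup>2) \<partial>cyl_measure s) = (\<integral>\<^sup>+p. f p \<partial>cyl_measure s)"
    by (intro nn_integral_cong) (auto simp: f_def)
  also note nn_integral_cyl[OF f]
  also have "(\<integral>\<^sup>+y. indicator {0<..} y * ennreal (y powr (1 - 2 * s)) * (\<integral>\<^sup>+x. f (x, y) \<partial>torus) \<partial>lborel)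
    = (\<integral>\<^sup>+y. indicator {0<..} y * ennreal (y powr (1 - 2 * s))
         * (\<integral>\<^sup>+x. ennreal ((norm (smooth_field m \<phi> (x, y)))\<^sup>2) \<partial>torus) \<partial>lborel)"
    by (intro nn_integral_cong) (auto simp: f_def split: split_indicator)
  finally show ?thesis .
qed

lemma smooth_periodic_grad_lattice:
  assumes "\<phi> \<in> smooth_periodic s" "p \<in> open_half"
  shows "grad \<phi> (p + (lattice n, 0)) = grad \<phi> p"
proof -
  note c = smooth_periodicD(1)[OF assms(1)]
  have p: "p \<in> closed_half" "p + (lattice n, 0) \<in> open_half" using assms(2) by (auto simp: mem_Times_iff)
  have "pd \<phi> e (p + (lattice n, 0)) = pd \<phi> e p" for e
    by (rule C1_periodic[OF c smooth_periodicD(5)[OF assms(1)] p(1)])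
  then show ?thesis using p assms(2) by (simp add: grad_pd[OF c])
qed

text \<open>
  A translation in \<open>x\<close> acts on every slice, where the integral over the torus does not change.
\<close>

lemma energy_translate:
  assumes \<phi>: "\<phi> \<in> smooth_periodic s"
  shows "(\<integral>\<^sup>+p. ennreal ((norm (smooth_field m (\<lambda>p. \<phi> (p + (t, 0))) p))\<^sup>2) \<partial>cyl_measure s)
    = (\<integral>\<^sup>+p. ennreal ((norm (smooth_field m \<phi> p))\<^sup>2) \<partial>cyl_measure s)"
proof -
  note c = smooth_periodicD(1)[OF \<phi>]
  have "(\<integral>\<^sup>+x. ennreal ((norm (smooth_field m (\<lambda>p. \<phi> (p + (t, 0))) (x, y)))\<^sup>2) \<partial>torus)
      = (\<integral>\<^sup>+x. ennreal ((norm (smooth_field m \<phi> (x, y)))\<^sup>2) \<partial>torus)" if y: "0 < y" for y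
  proof -
    have "smooth_field m (\<lambda>p. \<phi> (p + (t, 0))) (x, y) = smooth_field m \<phi> (x + t, y)" for x
      using grad_translate[OF c, of "(x, y)" t] y by (simp add: smooth_field_def jet_field_def)
    then have "(\<integral>\<^sup>+x. ennreal ((norm (smooth_field m (\<lambda>p. \<phi> (p + (t, 0))) (x, y)))\<^sup>2) \<partial>torus)
      = (\<integral>\<^sup>+x. ennreal ((norm (smooth_field m \<phi> (x + t, y)))\<^sup>2) \<partial>torus)" by simp
    also have "\<dots> = (\<integral>\<^sup>+x. ennreal ((norm (smooth_field m \<phi> (x, y)))\<^sup>2) \<partial>torus)"
    proof (rule nn_integral_torus_translate)
      have "continuous_on UNIV (\<lambda>x. smooth_field m \<phi> (x, y))"
        by (rule continuous_on_compose2[OF continuous_smooth_field[OF c]]) (use y in \<open>auto intro!: continuous_intros\<close>)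
      then have "(\<lambda>x. smooth_field m \<phi> (x, y)) \<in> borel_measurable borel"
        by (rule borel_measurable_continuous_onI)
      then show "(\<lambda>x. ennreal ((norm (smooth_field m \<phi> (x, y)))\<^sup>2)) \<in> borel_measurable borel" by measurable
      fix x n
      have "smooth_field m \<phi> ((x, y) + (lattice n, 0)) = smooth_field m \<phi> (x, y)"
        using smooth_periodic_grad_lattice[OF \<phi>, of "(x, y)" n] smooth_periodicD(5)[OF \<phi>, of "(x, y)" n] y
        by (simp add: smooth_field_def jet_field_def)
      then show "ennreal ((norm (smooth_field m \<phi> (x + lattice n, y)))\<^sup>2) = ennreal ((norm (smooth_field m \<phi> (x, y)))\<^sup>2)"
        by simp
    qed
    finally show ?thesis .
  qed
  then show ?thesis
    unfolding nn_energy_slices[OF c] nn_energy_slices[OF C1_translate(1)[OF c]]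
    by (intro nn_integral_cong) (auto split: split_indicator)
qed

lemma smooth_periodic_translate:
  assumes \<phi>: "\<phi> \<in> smooth_periodic s"
  shows "(\<lambda>p. \<phi> (p + (t, 0))) \<in> smooth_periodic s"
proof -
  note c = C1_translate(1)[OF smooth_periodicD(1)[OF \<phi>], of t]
  have L: "smooth_field 1 \<phi> \<in> L2 (cyl_measure s)" by (rule smooth_periodicD(3)[OF \<phi>]) simp
  have "smooth_on closed_half (\<lambda>p. \<phi> (p + (t, 0)))"
    using \<phi> Ck_on_translate unfolding smooth_periodic_def smooth_on_def by blast
  moreover have "\<forall>y\<ge>0. periodic (\<lambda>x. \<phi> (x + t, y))"
  proof (intro allI impI)
    fix y :: real assume "0 \<le> y"
    then have "\<phi> (x + t + (2 * pi) *\<^sub>R axis i 1, y) = \<phi> (x + t, y)" for x i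
      using smooth_periodicD(4)[OF \<phi>] unfolding periodic_def by blast
    then show "periodic (\<lambda>x. \<phi> (x + t, y))" by (simp add: periodic_def add.assoc add.commute[of t])
  qed
  moreover have "smooth_field 1 (\<lambda>p. \<phi> (p + (t, 0))) \<in> L2 (cyl_measure s)"
    unfolding L2_def
  proof (intro CollectI conjI integrableI_bounded)
    show "smooth_field 1 (\<lambda>p. \<phi> (p + (t, 0))) \<in> borel_measurable (cyl_measure s)"
      by (rule continuous_cyl[OF continuous_smooth_field[OF c]])
    then show "(\<lambda>p. (norm (smooth_field 1 (\<lambda>p. \<phi> (p + (t, 0))) p))\<^sup>2) \<in> borel_measurable (cyl_measure s)"
      by measurable
    have "(\<integral>\<^sup>+p. ennreal ((norm (smooth_field 1 \<phi> p))\<^sup>2) \<partial>cyl_measure s) < \<infinity>"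
      using L2_integrable_norm_sq[OF L] by (simp add: integrable_iff_bounded)
    then show "(\<integral>\<^sup>+p. ennreal (norm ((norm (smooth_field 1 (\<lambda>p. \<phi> (p + (t, 0))) p))\<^sup>2)) \<partial>cyl_measure s) < \<infinity>"
      using energy_translate[OF \<phi>, of 1 t] by simp
  qed
  ultimately show ?thesis
    by (simp add: smooth_periodic_def smooth_field_def weighted_L2_iff[of 1])
qed

lemma form_translate_self:
  assumes m: "0 < m" and \<phi>: "\<phi> \<in> smooth_periodic s"
  shows "form s m (\<lambda>p. \<phi> (p + (t, 0))) (\<lambda>p. \<phi> (p + (t, 0))) = form s m \<phi> \<phi>"
proof -
  have "ennreal (l2_inner (cyl_measure s) (smooth_field m \<omega>) (smooth_field m \<omega>))
      = (\<integral>\<^sup>+p. ennreal ((norm (smooth_field m \<omega> p))\<^sup>2) \<partial>cyl_measure s)" if "\<omega> \<in> smooth_periodic s" for \<omega>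
    unfolding l2_inner_self
    using L2_integrable_norm_sq[OF smooth_periodicD(3)[OF that m]] by (intro nn_integral_eq_integral[symmetric]) auto
  from this[OF \<phi>] this[OF smooth_periodic_translate[OF \<phi>, of t]]
  show ?thesis unfolding form_l2 energy_translate[OF \<phi>]
    by (metis ennreal_inj l2_inner_self_nonneg)
qed

text \<open>Polarisation of the invariance of the quadratic form.\<close>

lemma form_translate:
  assumes m: "0 < m" and \<phi>: "\<phi> \<in> smooth_periodic s" and \<psi>: "\<psi> \<in> smooth_periodic s"
  shows "form s m (\<lambda>p. \<phi> (p + (t, 0))) (\<lambda>p. \<psi> (p + (t, 0))) = form s m \<phi> \<psi>"
  using form_lincomb_self[OF m \<phi> \<psi>, of 1 1] form_translate_self[OF m smooth_periodic_lincomb[OF \<phi> \<psi>, of 1 1], of t]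
    form_lincomb_self[OF m smooth_periodic_translate[OF \<phi>, of t] smooth_periodic_translate[OF \<psi>, of t], of 1 1]
    form_translate_self[OF m \<phi>, of t] form_translate_self[OF m \<psi>, of t]
  by simp

section \<open>Coefficients of derivatives\<close>

lemma periodic_bounded:
  fixes g :: "real ^ 3 \<Rightarrow> 'b::real_normed_vector"
  assumes "continuous_on UNIV g" "\<And>x n. g (x + lattice n) = g x"
  shows "\<exists>B. \<forall>x. norm (g x) \<le> B"
proof -
  let ?C = "cbox (vec (- pi)) (vec pi :: real ^ 3)"
  have "compact (g ` ?C)" using assms(1) by (intro compact_continuous_image) (auto intro: continuous_on_subset)
  then obtain B where B: "\<And>x. x \<in> ?C \<Longrightarrow> norm (g x) \<le> B"
    using compact_imp_bounded by (fastforce simp: bounded_iff)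
  have "norm (g x) \<le> B" for x
  proof -
    have "wrap x \<in> ?C" using wrap_cell[of x] by (auto simp: cell_def mem_box_cart less_imp_le)
    then have "norm (g (wrap x)) \<le> B" by (rule B)
    then show ?thesis by (simp add: wrap_def assms(2))
  qed
  then show ?thesis by blast
qed

lemma continuous_L2_torus:
  fixes g :: "real ^ 3 \<Rightarrow> 'b::euclidean_space"
  assumes "continuous_on UNIV g"
  shows "g \<in> L2 torus"
proof -
  let ?C = "cbox (vec (- pi)) (vec pi :: real ^ 3)"
  have "compact (g ` ?C)" using assms(1) by (intro compact_continuous_image) (auto intro: continuous_on_subset)
  then obtain B where B: "\<And>x. x \<in> ?C \<Longrightarrow> norm (g x) \<le> B"
    using compact_imp_bounded by (fastforce simp: bounded_iff)
  have "cube \<subseteq> ?C" unfolding cube_def by (rule box_subset_cbox)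
  then show ?thesis using B by (intro bounded_L2_torus[where B = B] continuous_torus assms) auto
qed

text \<open>
  Differentiation in the \<open>i\<close>-th variable multiplies coefficients by \<open>\<i> k\<^sub>i\<close>: the difference quotients with
  increment \<open>h\<close> have the coefficients of \<open>g\<close> times \<open>(cis (k\<^sub>i h) - 1) / h\<close>, and they converge boundedly.
\<close>

lemma coeff_derivative:
  fixes g g' :: "real ^ 3 \<Rightarrow> real"
  assumes g: "continuous_on UNIV g" "\<And>x n. g (x + lattice n) = g x"
    and g': "continuous_on UNIV g'" "\<And>x n. g' (x + lattice n) = g' x"
    and d: "\<And>x h. ((\<lambda>h. g (x + h *\<^sub>R axis i 1)) has_real_derivative g' (x + h *\<^sub>R axis i 1)) (at h)"
  shows "mode_coeff (\<lambda>x. of_real (g' x)) k = \<i> * of_int (k $ i) * mode_coeff (\<lambda>x. of_real (g x)) k"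
proof -
  define h where "h n = inverse (real (Suc n))" for n
  have h: "0 < h n" for n by (simp add: h_def)
  have hne: "h n \<noteq> 0" for n using h[of n] by simp
  have h0: "h \<longlonglongrightarrow> 0" unfolding h_def by (rule LIMSEQ_inverse_real_of_nat)
  have hat: "filterlim h (at 0) sequentially"
    by (rule filterlim_atI[OF h0]) (simp add: hne)
  obtain B where B: "\<And>x. \<bar>g' x\<bar> \<le> B" using periodic_bounded[OF g'] by auto
  define q where "q n x = (g (x + h n *\<^sub>R axis i 1) - g x) / h n" for n x
  have qB: "\<bar>q n x\<bar> \<le> B" for n x
  proof -
    obtain z where "g (x + h n *\<^sub>R axis i 1) - g (x + 0 *\<^sub>R axis i 1) = (h n - 0) * g' (x + z *\<^sub>R axis i 1)"
      using MVT2[OF h[of n], of "\<lambda>h. g (x + h *\<^sub>R axis i 1)" "\<lambda>h. g' (x + h *\<^sub>R axis i 1)"] d by blast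
    then have "q n x = g' (x + z *\<^sub>R axis i 1)" using h[of n] by (simp add: q_def)
    then show ?thesis using B by simp
  qed
  have qlim: "(\<lambda>n. q n x) \<longlonglongrightarrow> g' x" for x
  proof -
    have "(\<lambda>h. (g (x + (0 + h) *\<^sub>R axis i 1) - g (x + 0 *\<^sub>R axis i 1)) / h) \<midarrow>0\<rightarrow> g' (x + 0 *\<^sub>R axis i 1)"
      using d[of x 0] unfolding DERIV_def .
    then have "(\<lambda>h. (g (x + h *\<^sub>R axis i 1) - g x) / h) \<midarrow>0\<rightarrow> g' x" by simp
    from filterlim_compose[OF this hat] show ?thesis by (simp add: q_def)
  qed
  have qc: "continuous_on UNIV (q n)" for n
    unfolding q_def using g(1) h[of n] by (auto intro!: continuous_intros continuous_on_compose2[OF g(1)])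
  have L: "(\<lambda>x. complex_of_real (g x)) \<in> L2 torus" "(\<lambda>x. complex_of_real (g (x + t))) \<in> L2 torus" for t
    using g(1) by (auto intro!: continuous_L2_torus continuous_intros continuous_on_compose2[OF g(1)])
  have cq: "mode_coeff (\<lambda>x. of_real (q n x)) k = (cis (of_int (k $ i) * h n) - 1) / of_real (h n) * mode_coeff (\<lambda>x. of_real (g x)) k" for n
  proof -
    have "mode_coeff (\<lambda>x. complex_of_real (g (x + h n *\<^sub>R axis i 1))) k = cis (kdot k (h n *\<^sub>R axis i 1)) * mode_coeff (\<lambda>x. of_real (g x)) k"
      by (rule coeff_translate) (use g in \<open>auto intro!: borel_measurable_continuous_onI continuous_intros\<close>)
    also have "kdot k (h n *\<^sub>R axis i 1) = of_int (k $ i) * h n"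
      using kdot_axis[of k i "h n"] by (simp add: axis_def vec_eq_iff scaleR_vec_def if_distrib cong: if_cong)
    finally have e: "mode_coeff (\<lambda>x. complex_of_real (g (x + h n *\<^sub>R axis i 1))) k = cis (of_int (k $ i) * h n) * mode_coeff (\<lambda>x. of_real (g x)) k" .
    have "mode_coeff (\<lambda>x. of_real (q n x)) k = (LINT x|torus. inverse (of_real (h n)) *
        ((of_real (g (x + h n *\<^sub>R axis i 1)) - of_real (g x)) * cnj (mode k x)))"
      unfolding mode_coeff_def by (intro Bochner_Integration.integral_cong refl) (simp add: q_def divide_inverse mult_ac)
    also have "\<dots> = inverse (of_real (h n)) * mode_coeff (\<lambda>x. of_real (g (x + h n *\<^sub>R axis i 1)) - of_real (g x)) k"
      unfolding mode_coeff_def by (rule integral_mult_right_zero)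
    also have "\<dots> = inverse (of_real (h n)) * (mode_coeff (\<lambda>x. of_real (g (x + h n *\<^sub>R axis i 1))) k - mode_coeff (\<lambda>x. of_real (g x)) k)"
      by (simp only: coeff_diff[OF L(2) L(1)])
    finally show ?thesis unfolding e by (simp add: divide_inverse algebra_simps)
  qed
  have "(\<lambda>n. mode_coeff (\<lambda>x. of_real (q n x)) k) \<longlonglongrightarrow> mode_coeff (\<lambda>x. of_real (g' x)) k"
    unfolding mode_coeff_def
  proof (rule integral_dominated_convergence)
    show "(\<lambda>x. complex_of_real (g' x) * cnj (mode k x)) \<in> borel_measurable torus"
      "(\<lambda>x. complex_of_real (q n x) * cnj (mode k x)) \<in> borel_measurable torus" for n
      using g' qc by (auto intro!: continuous_torus continuous_intros)
    show "integrable torus (\<lambda>x. B * (2 * pi) powr (- 3 / 2))" by simp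
    show "AE x in torus. (\<lambda>n. complex_of_real (q n x) * cnj (mode k x)) \<longlonglongrightarrow> complex_of_real (g' x) * cnj (mode k x)"
      using qlim by (intro AE_I2 tendsto_intros) auto
    show "AE x in torus. cmod (complex_of_real (q n x) * cnj (mode k x)) \<le> B * (2 * pi) powr (- 3 / 2)" for n
      using qB by (intro AE_I2) (simp add: norm_mult norm_mode mult_right_mono)
  qed
  moreover have "(\<lambda>n. mode_coeff (\<lambda>x. of_real (q n x)) k) \<longlonglongrightarrow> \<i> * of_int (k $ i) * mode_coeff (\<lambda>x. of_real (g x)) k"
    unfolding cq
  proof (intro tendsto_mult tendsto_const)
    let ?c = "of_int (k $ i) :: real"
    have "((\<lambda>z. exp (\<i> * of_real ?c * z)) has_field_derivative \<i> * of_real ?c) (at 0)"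
      by (auto intro!: derivative_eq_intros)
    then have "(\<lambda>z. (exp (\<i> * of_real ?c * (0 + z)) - exp (\<i> * of_real ?c * 0)) / z) \<midarrow>0\<rightarrow> \<i> * of_real ?c"
      unfolding DERIV_def .
    then have l: "(\<lambda>z. (exp (\<i> * of_real ?c * z) - 1) / z) \<midarrow>0\<rightarrow> \<i> * of_real ?c" by simp
    have "filterlim (\<lambda>n. complex_of_real (h n)) (at 0) sequentially"
      by (rule filterlim_atI) (use tendsto_of_real[OF h0, where 'a = complex] hne in simp_all)
    from filterlim_compose[OF l this]
    show "(\<lambda>n. (cis (?c * h n) - 1) / of_real (h n)) \<longlonglongrightarrow> \<i> * of_int (k $ i)"
      by (simp add: cis_conv_exp mult.assoc)
  qed
  ultimately show ?thesis by (rule LIMSEQ_unique)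
qed

section \<open>Slices of smooth functions\<close>

lemma slice_continuous:
  fixes f :: "(real ^ 3) \<times> real \<Rightarrow> real"
  assumes f: "continuous_on closed_half f" and y: "0 \<le> y"
  shows "continuous_on UNIV (\<lambda>x. f (x, y))"
  by (rule continuous_on_compose2[OF f]) (use y in \<open>auto intro!: continuous_intros\<close>)

definition slice_coeff :: "((real ^ 3) \<times> real \<Rightarrow> real) \<Rightarrow> int ^ 3 \<Rightarrow> real \<Rightarrow> complex" where
  "slice_coeff f k y = mode_coeff (\<lambda>x. of_real (f (x, y))) k"

lemma slice_Bessel:
  fixes f :: "(real ^ 3) \<times> real \<Rightarrow> real"
  assumes f: "continuous_on closed_half f" and y: "0 \<le> y" and F: "finite F"
  shows "(\<Sum>k\<in>F. (cmod (slice_coeff f k y))\<^sup>2) \<le> (LINT x|torus. (f (x, y))\<^sup>2)"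
proof -
  have "(\<lambda>x. complex_of_real (f (x, y))) \<in> L2 torus"
    by (intro continuous_L2_torus continuous_intros slice_continuous f y)
  from Bessel[OF this F] show ?thesis by (simp add: slice_coeff_def l2_inner_self)
qed

text \<open>The contribution of the \<open>k\<close>-th mode to the energy density at height \<open>y\<close>.\<close>

definition slice_energy :: "real \<Rightarrow> ((real ^ 3) \<times> real \<Rightarrow> real) \<Rightarrow> int ^ 3 \<Rightarrow> real \<Rightarrow> real" where
  "slice_energy m \<phi> k y = (cmod (slice_coeff (pd \<phi> (0, 1)) k y))\<^sup>2 + symbol m k * (cmod (slice_coeff \<phi> k y))\<^sup>2"

text \<open>
  Bessel's inequality for each component of the field \<open>(m \<phi>, grad \<phi>)\<close>. The derivative in \<open>x\<^sub>i\<close> contributes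
  the term \<open>k\<^sub>i\<^sup>2\<close> of the symbol.
\<close>

lemma slice_energy_sum:
  assumes \<phi>: "\<phi> \<in> smooth_periodic s" and y: "0 < y" and F: "finite F"
  shows "ennreal (\<Sum>k\<in>F. slice_energy m \<phi> k y) \<le> (\<integral>\<^sup>+x. ennreal ((norm (smooth_field m \<phi> (x, y)))\<^sup>2) \<partial>torus)"
proof -
  note c = smooth_periodicD(1)[OF \<phi>] and cf = smooth_periodicD(2)[OF \<phi>]
  note cp = C1_continuous_pd[OF c]
  have y0: "0 \<le> y" using y by simp
  have co: "slice_coeff (pd \<phi> (axis i 1, 0)) k y = \<i> * of_int (k $ i) * slice_coeff \<phi> k y" for i k
    unfolding slice_coeff_def
  proof (rule coeff_derivative)
    show "continuous_on UNIV (\<lambda>x. \<phi> (x, y))" "continuous_on UNIV (\<lambda>x. pd \<phi> (axis i 1, 0) (x, y))"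
      by (intro slice_continuous cf cp y0)+
    show "\<phi> (x + lattice n, y) = \<phi> (x, y)" for x n
      using smooth_periodicD(5)[OF \<phi>, of "(x, y)" n] y by simp
    show "pd \<phi> (axis i 1, 0) (x + lattice n, y) = pd \<phi> (axis i 1, 0) (x, y)" for x n
      using C1_periodic[OF c smooth_periodicD(5)[OF \<phi>], of "(x, y)" "(axis i 1, 0)" n] y by simp
    fix x :: "real ^ 3" and h :: real
    have "(\<phi> has_derivative (\<lambda>v. pd \<phi> v (x + h *\<^sub>R axis i 1, y))) (at (x + h *\<^sub>R axis i 1, y))"
      using y by (intro C1_derivative_interior c) auto
    then have D: "(\<phi> has_derivative (\<lambda>v. pd \<phi> v (x + h *\<^sub>R axis i 1, y))) (at ((\<lambda>h. (x + h *\<^sub>R axis i 1, y)) h))" .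
    have "((\<lambda>h. (x + h *\<^sub>R axis i 1, y)) has_derivative (\<lambda>t. (t *\<^sub>R axis i 1, 0))) (at h)"
      by (auto intro!: derivative_eq_intros)
    from diff_chain_at[OF this D]
    have "((\<lambda>h. \<phi> (x + h *\<^sub>R axis i 1, y)) has_derivative (\<lambda>t. pd \<phi> (t *\<^sub>R axis i 1, 0) (x + h *\<^sub>R axis i 1, y))) (at h)"
      by (simp add: o_def)
    moreover have "pd \<phi> (t *\<^sub>R axis i 1, 0) (x + h *\<^sub>R axis i 1, y) = pd \<phi> (axis i 1, 0) (x + h *\<^sub>R axis i 1, y) * t" for t
      using linear_scale[OF has_derivative_linear[OF D], of t "(axis i 1, 0)"] by simp
    ultimately show "((\<lambda>h. \<phi> (x + h *\<^sub>R axis i 1, y)) has_real_derivative pd \<phi> (axis i 1, 0) (x + h *\<^sub>R axis i 1, y)) (at h)"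
      by (simp add: has_field_derivative_def)
  qed
  have se: "slice_energy m \<phi> k y = (cmod (slice_coeff (pd \<phi> (0, 1)) k y))\<^sup>2
      + (\<Sum>i\<in>UNIV. (cmod (slice_coeff (pd \<phi> (axis i 1, 0)) k y))\<^sup>2) + m\<^sup>2 * (cmod (slice_coeff \<phi> k y))\<^sup>2" for k
    by (simp add: slice_energy_def co symbol_def norm_mult power_mult_distrib sum_distrib_right distrib_right)
  have i: "integrable torus (\<lambda>x. (f (x, y))\<^sup>2)" if "continuous_on closed_half f" for f :: "(real ^ 3) \<times> real \<Rightarrow> real"
    using L2_integrable_norm_sq[OF continuous_L2_torus[OF slice_continuous[OF that y0]]] by simp
  have "(\<Sum>k\<in>F. slice_energy m \<phi> k y) = (\<Sum>k\<in>F. (cmod (slice_coeff (pd \<phi> (0, 1)) k y))\<^sup>2)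
      + (\<Sum>i\<in>UNIV. \<Sum>k\<in>F. (cmod (slice_coeff (pd \<phi> (axis i 1, 0)) k y))\<^sup>2) + m\<^sup>2 * (\<Sum>k\<in>F. (cmod (slice_coeff \<phi> k y))\<^sup>2)"
    unfolding se sum.distrib sum_distrib_left by (subst sum.swap) simp
  also have "\<dots> \<le> (LINT x|torus. (pd \<phi> (0, 1) (x, y))\<^sup>2) + (\<Sum>i\<in>UNIV. (LINT x|torus. (pd \<phi> (axis i 1, 0) (x, y))\<^sup>2))
      + m\<^sup>2 * (LINT x|torus. (\<phi> (x, y))\<^sup>2)"
    by (intro add_mono sum_mono mult_left_mono slice_Bessel cp cf y0 F) auto
  also have "\<dots> = (LINT x|torus. (pd \<phi> (0, 1) (x, y))\<^sup>2 + (\<Sum>i\<in>UNIV. (pd \<phi> (axis i 1, 0) (x, y))\<^sup>2) + m\<^sup>2 * (\<phi> (x, y))\<^sup>2)"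
    using i[OF cp] i[OF cf] by (simp add: Bochner_Integration.integral_sum)
  also have "\<dots> = (LINT x|torus. (norm (smooth_field m \<phi> (x, y)))\<^sup>2)"
    using y by (intro Bochner_Integration.integral_cong refl) (simp add: norm_smooth_field norm_grad[OF c])
  finally have le: "(\<Sum>k\<in>F. slice_energy m \<phi> k y) \<le> (LINT x|torus. (norm (smooth_field m \<phi> (x, y)))\<^sup>2)" .
  have "continuous_on UNIV (\<lambda>x. smooth_field m \<phi> (x, y))"
    by (rule continuous_on_compose2[OF continuous_smooth_field[OF c]]) (use y in \<open>auto intro!: continuous_intros\<close>)
  then have "integrable torus (\<lambda>x. (norm (smooth_field m \<phi> (x, y)))\<^sup>2)"
    by (intro L2_integrable_norm_sq continuous_L2_torus)
  then show ?thesis using le by (subst nn_integral_eq_integral) (auto intro: ennreal_leI)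
qed

section \<open>The trace inequality\<close>

lemma slice_coeff_measurable:
  fixes f :: "(real ^ 3) \<times> real \<Rightarrow> real"
  assumes f: "continuous_on closed_half f"
  shows "(\<lambda>y. indicator {0..} y *\<^sub>R slice_coeff f k y) \<in> borel_measurable borel"
proof -
  have "(\<lambda>p. indicator closed_half p *\<^sub>R f p) \<in> borel_measurable borel"
    using f by (intro borel_measurable_continuous_on_indicator) (auto intro!: borel_closed closed_Times)
  then have m: "(\<lambda>p. indicator closed_half p *\<^sub>R f p) \<in> borel_measurable (borel \<Otimes>\<^sub>M borel)" by (simp add: borel_prod)
  have [measurable]: "(\<lambda>q. (snd q, fst q)) \<in> borel \<Otimes>\<^sub>M torus \<rightarrow>\<^sub>M borel \<Otimes>\<^sub>M borel"
  proof (rule measurable_Pair)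
    show "snd \<in> borel \<Otimes>\<^sub>M torus \<rightarrow>\<^sub>M borel"
      by (rule measurable_compose[OF measurable_snd]) (rule borel_torus, simp)
  qed measurable
  have "(\<lambda>q. complex_of_real (indicator closed_half (snd q, fst q) *\<^sub>R f (snd q, fst q)) * cnj (mode k (snd q))) \<in> borel_measurable (borel \<Otimes>\<^sub>M torus)"
  proof (intro borel_measurable_times)
    show "(\<lambda>q. complex_of_real (indicator closed_half (snd q, fst q) *\<^sub>R f (snd q, fst q))) \<in> borel_measurable (borel \<Otimes>\<^sub>M torus)"
    proof -
      have [measurable]: "(\<lambda>q. indicator closed_half (snd q, fst q) *\<^sub>R f (snd q, fst q)) \<in> borel_measurable (borel \<Otimes>\<^sub>M torus)"
        by (rule measurable_compose[OF _ m]) measurable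
      show ?thesis by measurable
    qed
    have "(\<lambda>x. cnj (mode k x)) \<in> borel_measurable torus" by (rule borel_torus) measurable
    then show "(\<lambda>q. cnj (mode k (snd q))) \<in> borel_measurable (borel \<Otimes>\<^sub>M torus)" by measurable
  qed
  then have "(\<lambda>y. LINT x|torus. complex_of_real (indicator closed_half (x, y) *\<^sub>R f (x, y)) * cnj (mode k x)) \<in> borel_measurable borel"
    by (intro torus.borel_measurable_lebesgue_integral) (simp add: split_beta')
  also have "(\<lambda>y. LINT x|torus. complex_of_real (indicator closed_half (x, y) *\<^sub>R f (x, y)) * cnj (mode k x))
      = (\<lambda>y. indicator {0..} y *\<^sub>R slice_coeff f k y)"
    by (auto simp: fun_eq_iff slice_coeff_def mode_coeff_def split: split_indicator)
  finally show ?thesis .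
qed

text \<open>
  The identity \<open>u(0) = - \<integral>\<^sub>0\<^sup>L ((1 - y/L) u)' dy\<close> expresses the boundary coefficient by the
  coefficients of the function and of its normal derivative on \<open>[0, L]\<close>.
\<close>

lemma boundary_coeff_bound:
  assumes \<phi>: "\<phi> \<in> smooth_periodic s" and L: "0 < L"
  shows "ennreal (cmod (slice_coeff \<phi> k 0))
    \<le> (\<integral>\<^sup>+y. indicator {0..L} y * ennreal (cmod (slice_coeff (pd \<phi> (0, 1)) k y) + cmod (slice_coeff \<phi> k y) / L) \<partial>lborel)"
proof -
  note c = smooth_periodicD(1)[OF \<phi>] and cf = smooth_periodicD(2)[OF \<phi>]
  note cp = C1_continuous_pd[OF c, of "(0, 1)"]
  define h where "h p = (1 - snd p / L) * pd \<phi> (0, 1) p - \<phi> p / L" for p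
  have ch: "continuous_on closed_half h"
    unfolding h_def using L by (intro continuous_intros cf cp) auto
  define N where "N = restrict_space lborel {0..L}"
  have spN: "space N = {0..L}" by (simp add: N_def space_restrict_space)
  interpret N: finite_measure N
    unfolding N_def by standard (simp add: emeasure_restrict_space space_restrict_space emeasure_lborel_Icc_eq)
  interpret P: pair_sigma_finite torus N ..
  interpret P: finite_measure "torus \<Otimes>\<^sub>M N"
    by (rule finite_measure_pair_measure) (rule torus.finite_measure_axioms N.finite_measure_axioms)+
  have ftc: "(LINT y|N. h (x, y)) = - \<phi> (x, 0)" for x
  proof -
    have "(LINT y|N. h (x, y)) = (LINT y|lborel. indicator {0..L} y *\<^sub>R h (x, y))"
      unfolding N_def by (subst integral_restrict_space) auto
    also have "\<dots> = (1 - L / L) * \<phi> (x, L) - (1 - 0 / L) * \<phi> (x, 0)"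
    proof (rule integral_FTC_Icc)
      show "continuous_on {0..L} (\<lambda>y. h (x, y))"
        by (rule continuous_on_compose2[OF ch]) (auto intro!: continuous_intros)
      fix y assume y: "0 \<le> y" "y \<le> L"
      have D: "(\<phi> has_derivative (\<lambda>v. pd \<phi> v (x, y))) (at (x, y) within closed_half)"
        unfolding pd_def using y by (intro half_derivative C1_differentiable c) auto
      then have D': "(\<phi> has_derivative (\<lambda>v. pd \<phi> v (x, y))) (at (x, y) within (\<lambda>y. (x, y)) ` {0..L})"
        by (rule has_derivative_subset) auto
      have "((\<lambda>y. (x, y)) has_derivative (\<lambda>t. (0, t))) (at y within {0..L})"
        by (auto intro!: derivative_eq_intros)
      from diff_chain_within[OF this D']
      have "((\<lambda>y. \<phi> (x, y)) has_derivative (\<lambda>t. pd \<phi> (0, t) (x, y))) (at y within {0..L})"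
        by (simp add: o_def)
      moreover have "pd \<phi> (0, t) (x, y) = t *\<^sub>R pd \<phi> (0, 1) (x, y)" for t
        using linear_scale[OF has_derivative_linear[OF D], of t "(0, 1)"] by simp
      then have "(\<lambda>t. pd \<phi> (0, t) (x, y)) = (\<lambda>t. t *\<^sub>R pd \<phi> (0, 1) (x, y))" by (rule ext)
      ultimately have "((\<lambda>y. \<phi> (x, y)) has_vector_derivative pd \<phi> (0, 1) (x, y)) (at y within {0..L})"
        unfolding has_vector_derivative_def by (simp only:)
      then have "((\<lambda>y. \<phi> (x, y)) has_real_derivative pd \<phi> (0, 1) (x, y)) (at y within {0..L})"
        by (simp add: has_real_derivative_iff_has_vector_derivative)
      then have "((\<lambda>y. (1 - y / L) * \<phi> (x, y)) has_real_derivative h (x, y)) (at y within {0..L})"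
        using L by (auto intro!: derivative_eq_intros simp: h_def)
      then show "((\<lambda>y. (1 - y / L) * \<phi> (x, y)) has_vector_derivative h (x, y)) (at y within {0..L})"
        by (simp add: has_real_derivative_iff_has_vector_derivative)
    qed (use L in simp)
    finally show ?thesis using L by simp
  qed
  define H where "H x y = complex_of_real (indicator closed_half (x, y) *\<^sub>R h (x, y)) * cnj (mode k x)" for x y
  have Hy: "H x y = of_real (h (x, y)) * cnj (mode k x)" if "0 \<le> y" for x y
    using that by (simp add: H_def)
  have "(\<lambda>p. indicator closed_half p *\<^sub>R h p) \<in> borel_measurable borel"
    using ch by (intro borel_measurable_continuous_on_indicator) (auto intro!: borel_closed closed_Times)
  then have hm: "(\<lambda>p. indicator closed_half p *\<^sub>R h p) \<in> borel_measurable (borel \<Otimes>\<^sub>M borel)" by (simp add: borel_prod)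
  have idm: "(\<lambda>q. (fst q, snd q)) \<in> torus \<Otimes>\<^sub>M N \<rightarrow>\<^sub>M borel \<Otimes>\<^sub>M borel"
  proof (rule measurable_Pair)
    show "fst \<in> torus \<Otimes>\<^sub>M N \<rightarrow>\<^sub>M borel"
      by (rule measurable_compose[OF measurable_fst]) (rule borel_torus, simp)
    have "(\<lambda>x. x) \<in> N \<rightarrow>\<^sub>M borel" unfolding N_def by (simp add: measurable_restrict_space1)
    then show "snd \<in> torus \<Otimes>\<^sub>M N \<rightarrow>\<^sub>M borel" by (rule measurable_compose[OF measurable_snd])
  qed
  have HM: "case_prod H \<in> borel_measurable (torus \<Otimes>\<^sub>M N)"
    unfolding H_def split_beta'
  proof (intro borel_measurable_times)
    have [measurable]: "(\<lambda>q. indicator closed_half (fst q, snd q) *\<^sub>R h (fst q, snd q)) \<in> borel_measurable (torus \<Otimes>\<^sub>M N)"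
      by (rule measurable_compose[OF idm hm])
    show "(\<lambda>q. complex_of_real (indicator closed_half (fst q, snd q) *\<^sub>R h (fst q, snd q))) \<in> borel_measurable (torus \<Otimes>\<^sub>M N)"
      by measurable
    have "(\<lambda>x. cnj (mode k x)) \<in> borel_measurable torus" by (rule borel_torus) measurable
    then show "(\<lambda>q. cnj (mode k (fst q))) \<in> borel_measurable (torus \<Otimes>\<^sub>M N)" by measurable
  qed
  have "compact (h ` (cbox (vec (- pi)) (vec pi) \<times> {0..L}))"
    by (intro compact_continuous_image compact_Times continuous_on_subset[OF ch]) auto
  then obtain B where B: "\<And>p. p \<in> cbox (vec (- pi)) (vec pi) \<times> {0..L} \<Longrightarrow> \<bar>h p\<bar> \<le> B"
    using compact_imp_bounded by (fastforce simp: bounded_iff)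
  have "cube \<subseteq> cbox (vec (- pi)) (vec pi)" unfolding cube_def by (rule box_subset_cbox)
  then have HB: "cmod (H x y) \<le> B * (2 * pi) powr (- 3 / 2)" if "x \<in> cube" "y \<in> {0..L}" for x y
    using B[of "(x, y)"] that Hy[of y x] by (auto simp: norm_mult norm_mode mult_right_mono)
  have HI: "integrable (torus \<Otimes>\<^sub>M N) (case_prod H)"
  proof (rule P.integrable_const_bound[OF _ HM])
    show "AE q in torus \<Otimes>\<^sub>M N. cmod (case_prod H q) \<le> B * (2 * pi) powr (- 3 / 2)"
      using HB by (intro AE_I2) (auto simp: space_pair_measure spN)
  qed
  have inner: "(LINT x|torus. H x y) = (1 - y / L) * slice_coeff (pd \<phi> (0, 1)) k y - slice_coeff \<phi> k y / L"
    if y: "0 \<le> y" for y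
  proof -
    have i: "integrable torus (\<lambda>x. complex_of_real (f (x, y)) * cnj (mode k x))" if "continuous_on closed_half f" for f
      by (intro integrable_mult_mode L2_integrable_torus continuous_L2_torus continuous_intros slice_continuous that y)
    have "(LINT x|torus. H x y) = (LINT x|torus. (1 - y / L) * (of_real (pd \<phi> (0, 1) (x, y)) * cnj (mode k x))
        - (of_real (\<phi> (x, y)) * cnj (mode k x)) / L)"
      using y by (intro Bochner_Integration.integral_cong refl) (simp add: Hy h_def algebra_simps)
    also have "\<dots> = (1 - y / L) * slice_coeff (pd \<phi> (0, 1)) k y - slice_coeff \<phi> k y / L"
      unfolding slice_coeff_def mode_coeff_def using i[OF cp] i[OF cf] by simp
    finally show ?thesis .
  qed
  have "(LINT y|N. (LINT x|torus. H x y)) = (LINT x|torus. (LINT y|N. H x y))"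
    by (rule P.Fubini_integral[OF HI])
  also have "\<dots> = (LINT x|torus. - (of_real (\<phi> (x, 0)) * cnj (mode k x)))"
  proof (intro Bochner_Integration.integral_cong refl)
    fix x
    have "(LINT y|N. H x y) = (LINT y|N. of_real (h (x, y)) * cnj (mode k x))"
      by (intro Bochner_Integration.integral_cong) (auto simp: spN Hy)
    also have "\<dots> = of_real (LINT y|N. h (x, y)) * cnj (mode k x)" by simp
    finally show "(LINT y|N. H x y) = - (of_real (\<phi> (x, 0)) * cnj (mode k x))" by (simp add: ftc)
  qed
  also have "\<dots> = - slice_coeff \<phi> k 0" by (simp add: slice_coeff_def mode_coeff_def)
  finally have eq: "slice_coeff \<phi> k 0 = - (LINT y|N. (LINT x|torus. H x y))" by simp
  have "ennreal (cmod (slice_coeff \<phi> k 0)) \<le> (\<integral>\<^sup>+y. ennreal (cmod (LINT x|torus. H x y)) \<partial>N)"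
    unfolding eq norm_minus_cancel by (rule integral_norm_bound_ennreal) (rule P.integrable_snd[OF HI])
  also have "\<dots> \<le> (\<integral>\<^sup>+y. ennreal (cmod (slice_coeff (pd \<phi> (0, 1)) k y) + cmod (slice_coeff \<phi> k y) / L) \<partial>N)"
  proof (intro nn_integral_mono ennreal_leI)
    fix y assume "y \<in> space N"
    then have y: "0 \<le> y" "y \<le> L" by (auto simp: spN)
    have "cmod (LINT x|torus. H x y) \<le> cmod ((1 - y / L) * slice_coeff (pd \<phi> (0, 1)) k y) + cmod (slice_coeff \<phi> k y / L)"
      unfolding inner[OF y(1)] by (rule norm_triangle_ineq4)
    also have "\<dots> \<le> cmod (slice_coeff (pd \<phi> (0, 1)) k y) + cmod (slice_coeff \<phi> k y) / L"
    proof -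
      have "\<bar>1 - y / L\<bar> \<le> 1" using y L by simp
      then have "cmod (complex_of_real (1 - y / L)) \<le> 1" unfolding norm_of_real .
      then show ?thesis using L by (simp add: norm_mult norm_divide mult_left_le_one_le del: of_real_diff of_real_divide)
    qed
    finally show "cmod (LINT x|torus. H x y) \<le> cmod (slice_coeff (pd \<phi> (0, 1)) k y) + cmod (slice_coeff \<phi> k y) / L" .
  qed
  also have "\<dots> = (\<integral>\<^sup>+y. indicator {0..L} y * ennreal (cmod (slice_coeff (pd \<phi> (0, 1)) k y) + cmod (slice_coeff \<phi> k y) / L) \<partial>lborel)"
    unfolding N_def by (simp add: nn_integral_restrict_space mult.commute)
  finally show ?thesis .
qed

text \<open>
  The length \<open>L = (|k|\<^sup>2 + m\<^sup>2)\<^sup>-\<^sup>1\<^sup>/\<^sup>2\<close> makes both terms of the preceding bound scale alike. The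
  Cauchy--Schwarz inequality distributes the weight: \<open>y\<^sup>2\<^sup>s\<^sup>-\<^sup>1\<close> is integrable on \<open>[0, L]\<close>, and the other
  factor carries \<open>y\<^sup>1\<^sup>-\<^sup>2\<^sup>s\<close>, the weight of the energy.
\<close>

lemma mode_trace:
  assumes \<phi>: "\<phi> \<in> smooth_periodic s" and m: "0 < m" and s: "0 < s"
  shows "ennreal (symbol m k powr s * (cmod (slice_coeff \<phi> k 0))\<^sup>2)
    \<le> ennreal (1 / s) * (\<integral>\<^sup>+y. indicator {0<..} y * ennreal (y powr (1 - 2 * s)) * ennreal (slice_energy m \<phi> k y) \<partial>lborel)"
proof -
  note c = smooth_periodicD(1)[OF \<phi>] and cf = smooth_periodicD(2)[OF \<phi>]
  note cp = C1_continuous_pd[OF c, of "(0, 1)"]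
  define \<mu> where "\<mu> = symbol m k"
  have \<mu>: "0 < \<mu>" using symbol_pos[OF m] by (simp add: \<mu>_def)
  define L where "L = \<mu> powr (- 1 / 2)"
  have L: "0 < L" using \<mu> by (simp add: L_def)
  have L2: "1 / L\<^sup>2 = \<mu>"
  proof -
    have "L\<^sup>2 = \<mu> powr (- 1 / 2) * \<mu> powr (- 1 / 2)" by (simp add: L_def power2_eq_square)
    also have "\<dots> = \<mu> powr (- 1)" unfolding powr_add[symmetric] by simp
    finally show ?thesis using \<mu> by (simp add: powr_minus divide_inverse)
  qed
  define d c0 where "d y = cmod (indicator {0..} y *\<^sub>R slice_coeff (pd \<phi> (0, 1)) k y)"
    and "c0 y = cmod (indicator {0..} y *\<^sub>R slice_coeff \<phi> k y)" for y :: real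
  have [measurable]: "d \<in> borel_measurable borel" "c0 \<in> borel_measurable borel"
    unfolding d_def[abs_def] c0_def[abs_def] using slice_coeff_measurable[OF cp, of k] slice_coeff_measurable[OF cf, of k]
    by measurable
  define a where "a y = indicator {0..L} y * y powr ((2 * s - 1) / 2)" for y :: real
  define b where "b y = indicator {0<..L} y * y powr ((1 - 2 * s) / 2) * (d y + c0 y / L)" for y :: real
  have [measurable]: "a \<in> borel_measurable borel" "b \<in> borel_measurable borel"
    unfolding a_def[abs_def] b_def[abs_def] by measurable
  have ab0: "0 \<le> a y" "0 \<le> b y" for y using L by (auto simp: a_def b_def d_def c0_def split: split_indicator)
  let ?c = "ennreal (cmod (slice_coeff \<phi> k 0))"
  have "?c \<le> (\<integral>\<^sup>+y. indicator {0..L} y * ennreal (cmod (slice_coeff (pd \<phi> (0, 1)) k y) + cmod (slice_coeff \<phi> k y) / L) \<partial>lborel)"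
    by (rule boundary_coeff_bound[OF \<phi> L])
  also have "\<dots> = (\<integral>\<^sup>+y. ennreal (a y) * ennreal (b y) \<partial>lborel)"
  proof (rule nn_integral_cong_AE, use AE_lborel_singleton[of "0::real"] in eventually_elim)
    fix y :: real assume y: "y \<noteq> 0"
    have "y powr ((2 * s - 1) / 2) * y powr ((1 - 2 * s) / 2) = 1" if "0 < y"
      unfolding powr_add[symmetric] using that by (simp add: field_simps)
    then show "indicator {0..L} y * ennreal (cmod (slice_coeff (pd \<phi> (0, 1)) k y) + cmod (slice_coeff \<phi> k y) / L)
        = ennreal (a y) * ennreal (b y)"
      using y ab0 by (auto simp: a_def b_def d_def c0_def ennreal_mult[symmetric] mult.assoc[symmetric] split: split_indicator)
  qed
  finally have "?c\<^sup>2 \<le> (\<integral>\<^sup>+y. ennreal (a y) * ennreal (b y) \<partial>lborel)\<^sup>2" by (rule power_mono) simp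
  also have "\<dots> \<le> (\<integral>\<^sup>+y. (ennreal (a y))\<^sup>2 \<partial>lborel) * (\<integral>\<^sup>+y. (ennreal (b y))\<^sup>2 \<partial>lborel)"
    by (rule Cauchy_Schwarz_nn_integral) measurable
  also have "(\<integral>\<^sup>+y. (ennreal (a y))\<^sup>2 \<partial>lborel) = ennreal (\<mu> powr (- s) / (2 * s))"
  proof -
    have "(\<integral>\<^sup>+y. (ennreal (a y))\<^sup>2 \<partial>lborel) = (\<integral>\<^sup>+y. ennreal (y powr (2 * s - 1)) * indicator {0..L} y \<partial>lborel)"
    proof (intro nn_integral_cong)
      fix y :: real
      have "y powr ((2 * s - 1) / 2) * y powr ((2 * s - 1) / 2) = y powr (2 * s - 1)"
        unfolding powr_add[symmetric] by simp
      then show "(ennreal (a y))\<^sup>2 = ennreal (y powr (2 * s - 1)) * indicator {0..L} y"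
        by (auto simp: a_def power2_eq_square ennreal_mult[symmetric] split: split_indicator)
    qed
    also have "\<dots> = ennreal (L powr (2 * s - 1 + 1) / (2 * s - 1 + 1))"
      using s L by (intro nn_integral_has_integral_lebesgue' has_integral_powr_from_0) auto
    also have "L powr (2 * s - 1 + 1) = \<mu> powr (- s)" using \<mu> by (simp add: L_def powr_powr)
    finally show ?thesis by simp
  qed
  also have "(\<integral>\<^sup>+y. (ennreal (b y))\<^sup>2 \<partial>lborel)
      \<le> (\<integral>\<^sup>+y. ennreal 2 * (indicator {0<..} y * ennreal (y powr (1 - 2 * s)) * ennreal (slice_energy m \<phi> k y)) \<partial>lborel)"
  proof (intro nn_integral_mono)
    fix y :: real
    show "(ennreal (b y))\<^sup>2 \<le> ennreal 2 * (indicator {0<..} y * ennreal (y powr (1 - 2 * s)) * ennreal (slice_energy m \<phi> k y))"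
    proof (cases "y \<in> {0<..L}")
      case True
      have "(d y + c0 y / L)\<^sup>2 \<le> 2 * ((d y)\<^sup>2 + (c0 y / L)\<^sup>2)"
        using sum_squares_bound[of "d y" "c0 y / L"] by (simp add: power2_sum)
      also have "\<dots> = 2 * slice_energy m \<phi> k y"
        using True by (simp add: slice_energy_def d_def c0_def \<mu>_def[symmetric] L2[symmetric] power_divide)
      finally have e: "(d y + c0 y / L)\<^sup>2 \<le> 2 * slice_energy m \<phi> k y" .
      have "y powr ((1 - 2 * s) / 2) * y powr ((1 - 2 * s) / 2) = y powr (1 - 2 * s)"
        unfolding powr_add[symmetric] by simp
      then have "(b y)\<^sup>2 = y powr (1 - 2 * s) * (d y + c0 y / L)\<^sup>2"
        using True by (simp add: b_def power_mult_distrib power2_eq_square)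
      also have "\<dots> \<le> y powr (1 - 2 * s) * (2 * slice_energy m \<phi> k y)" by (rule mult_left_mono[OF e]) simp
      finally have "ennreal ((b y)\<^sup>2) \<le> ennreal (2 * (y powr (1 - 2 * s) * slice_energy m \<phi> k y))"
        by (intro ennreal_leI) simp
      moreover have "0 \<le> slice_energy m \<phi> k y" using \<mu> by (simp add: slice_energy_def \<mu>_def)
      ultimately show ?thesis using True ab0(2)[of y] by (simp add: ennreal_power ennreal_mult)
    next
      case False
      then have "b y = 0" by (simp add: b_def)
      then show ?thesis by simp
    qed
  qed
  also have "\<dots> = ennreal 2 * (\<integral>\<^sup>+y. indicator {0<..} y * ennreal (y powr (1 - 2 * s)) * ennreal (slice_energy m \<phi> k y) \<partial>lborel)"
  proof -
    have [measurable]: "(\<lambda>y. indicator {0<..} y * ((d y)\<^sup>2 + \<mu> * (c0 y)\<^sup>2)) \<in> borel_measurable borel" by measurable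
    have "(\<lambda>y. indicator {0<..} y * ennreal (y powr (1 - 2 * s)) * ennreal (slice_energy m \<phi> k y))
      = (\<lambda>y. ennreal (y powr (1 - 2 * s)) * ennreal (indicator {0<..} y * ((d y)\<^sup>2 + \<mu> * (c0 y)\<^sup>2)))"
      by (auto simp: fun_eq_iff slice_energy_def d_def c0_def \<mu>_def split: split_indicator)
    also have "\<dots> \<in> borel_measurable borel" by measurable
    finally show ?thesis by (intro nn_integral_cmult) simp
  qed
  finally have le: "?c\<^sup>2 \<le> ennreal (\<mu> powr (- s) / (2 * s)) * (ennreal 2 *
      (\<integral>\<^sup>+y. indicator {0<..} y * ennreal (y powr (1 - 2 * s)) * ennreal (slice_energy m \<phi> k y) \<partial>lborel))"
    by (simp add: mult_left_mono)
  have assoc: "ennreal a * (ennreal b * (ennreal c * I)) = ennreal (a * b * c) * I"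
    if "0 \<le> a" "0 \<le> b" "0 \<le> c" for a b c I
    using that by (simp add: ennreal_mult mult.assoc)
  have "ennreal (\<mu> powr s * (cmod (slice_coeff \<phi> k 0))\<^sup>2) = ennreal (\<mu> powr s) * ?c\<^sup>2"
    by (simp add: ennreal_mult ennreal_power)
  also have "\<dots> \<le> ennreal (\<mu> powr s) * (ennreal (\<mu> powr (- s) / (2 * s)) * (ennreal 2 *
      (\<integral>\<^sup>+y. indicator {0<..} y * ennreal (y powr (1 - 2 * s)) * ennreal (slice_energy m \<phi> k y) \<partial>lborel)))"
    by (rule mult_left_mono[OF le]) simp
  also have "\<dots> = ennreal (\<mu> powr s * (\<mu> powr (- s) / (2 * s)) * 2) *
      (\<integral>\<^sup>+y. indicator {0<..} y * ennreal (y powr (1 - 2 * s)) * ennreal (slice_energy m \<phi> k y) \<partial>lborel)"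
    using s by (intro assoc) auto
  also have "\<mu> powr s * (\<mu> powr (- s) / (2 * s)) * 2 = 1 / s"
    using \<mu> s by (simp add: powr_minus field_simps)
  finally show ?thesis by (simp add: \<mu>_def)
qed

text \<open>Summation over the modes, with Bessel's inequality on every slice, bounds the trace operator.\<close>

lemma trace_bound:
  assumes \<phi>: "\<phi> \<in> smooth_periodic s" and m: "0 < m" and s: "0 < s" "s < 1"
  shows "(\<lambda>x. complex_of_real (\<phi> (x, 0))) \<in> sobolev_class s m"
    and "sobolev_sum s m (\<lambda>x. complex_of_real (\<phi> (x, 0))) \<le> kappa s / s * form s m \<phi> \<phi>"
proof -
  note c = smooth_periodicD(1)[OF \<phi>] and cf = smooth_periodicD(2)[OF \<phi>]
  define u where "u x = complex_of_real (\<phi> (x, 0))" for x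
  define R where "R = kappa s / s * form s m \<phi> \<phi>"
  have k0: "0 < kappa s" by (rule kappa_pos[OF s])
  have R0: "0 \<le> R" using form_nonneg[OF s] k0 s by (simp add: R_def)
  have cu: "continuous_on UNIV u" unfolding u_def by (intro continuous_intros slice_continuous cf) simp
  have fin: "(\<Sum>k\<in>F. symbol m k powr s * (cmod (mode_coeff u k))\<^sup>2) \<le> R" if F: "finite F" for F
  proof -
    let ?w = "\<lambda>y. indicator {0<..} y * ennreal (y powr (1 - 2 * s))"
    have "ennreal (\<Sum>k\<in>F. symbol m k powr s * (cmod (mode_coeff u k))\<^sup>2)
        = (\<Sum>k\<in>F. ennreal (symbol m k powr s * (cmod (slice_coeff \<phi> k 0))\<^sup>2))"
      by (simp add: sum_ennreal slice_coeff_def u_def[abs_def])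
    also have "\<dots> \<le> (\<Sum>k\<in>F. ennreal (1 / s) * (\<integral>\<^sup>+y. ?w y * ennreal (slice_energy m \<phi> k y) \<partial>lborel))"
      by (intro sum_mono mode_trace[OF \<phi> m s(1)])
    also have "\<dots> = ennreal (1 / s) * (\<integral>\<^sup>+y. (\<Sum>k\<in>F. ?w y * ennreal (slice_energy m \<phi> k y)) \<partial>lborel)"
    proof -
      have "(\<lambda>y. ?w y * ennreal (slice_energy m \<phi> k y)) \<in> borel_measurable lborel" for k
      proof -
        have a: "(\<lambda>y. indicator {0..} y *\<^sub>R slice_coeff (pd \<phi> (0, 1)) k y) \<in> borel_measurable borel"
          "(\<lambda>y. indicator {0..} y *\<^sub>R slice_coeff \<phi> k y) \<in> borel_measurable borel"
          by (intro slice_coeff_measurable C1_continuous_pd c cf)+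
        note [measurable] = a
        have "(\<lambda>y. ?w y * ennreal ((cmod (indicator {0..} y *\<^sub>R slice_coeff (pd \<phi> (0, 1)) k y))\<^sup>2
            + symbol m k * (cmod (indicator {0..} y *\<^sub>R slice_coeff \<phi> k y))\<^sup>2)) \<in> borel_measurable lborel"
          by measurable
        also have "(\<lambda>y. ?w y * ennreal ((cmod (indicator {0..} y *\<^sub>R slice_coeff (pd \<phi> (0, 1)) k y))\<^sup>2
            + symbol m k * (cmod (indicator {0..} y *\<^sub>R slice_coeff \<phi> k y))\<^sup>2))
          = (\<lambda>y. ?w y * ennreal (slice_energy m \<phi> k y))"
          by (auto simp: fun_eq_iff slice_energy_def split: split_indicator)
        finally show ?thesis .
      qed
      then show ?thesis by (simp add: nn_integral_sum sum_distrib_left)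
    qed
    also have "\<dots> \<le> ennreal (1 / s) * (\<integral>\<^sup>+y. ?w y * (\<integral>\<^sup>+x. ennreal ((norm (smooth_field m \<phi> (x, y)))\<^sup>2) \<partial>torus) \<partial>lborel)"
    proof (intro mult_left_mono nn_integral_mono)
      fix y
      have se: "0 \<le> slice_energy m \<phi> k y" for k
        using symbol_pos[OF m, of k] by (simp add: slice_energy_def)
      show "(\<Sum>k\<in>F. ?w y * ennreal (slice_energy m \<phi> k y)) \<le> ?w y * (\<integral>\<^sup>+x. ennreal ((norm (smooth_field m \<phi> (x, y)))\<^sup>2) \<partial>torus)"
        unfolding sum_distrib_left[symmetric]
        using slice_energy_sum[OF \<phi> _ F, of y m] se
        by (cases "0 < y") (auto simp: sum_ennreal intro: mult_left_mono)
    qed simp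
    also have "\<dots> = ennreal (1 / s) * (\<integral>\<^sup>+p. ennreal ((norm (smooth_field m \<phi> p))\<^sup>2) \<partial>cyl_measure s)"
      unfolding nn_energy_slices[OF c] ..
    also have "(\<integral>\<^sup>+p. ennreal ((norm (smooth_field m \<phi> p))\<^sup>2) \<partial>cyl_measure s)
        = ennreal (l2_inner (cyl_measure s) (smooth_field m \<phi>) (smooth_field m \<phi>))"
      unfolding l2_inner_self using L2_integrable_norm_sq[OF smooth_periodicD(3)[OF \<phi> m]] by (intro nn_integral_eq_integral) auto
    also have "ennreal (1 / s) * \<dots> = ennreal (1 / s * l2_inner (cyl_measure s) (smooth_field m \<phi>) (smooth_field m \<phi>))"
      using s by (intro ennreal_mult[symmetric]) (auto simp: l2_inner_self_nonneg)
    also have "1 / s * l2_inner (cyl_measure s) (smooth_field m \<phi>) (smooth_field m \<phi>) = R"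
      using k0 by (simp add: R_def form_l2)
    finally show ?thesis using R0 by simp
  qed
  have summ: "(\<lambda>k. symbol m k powr s * (cmod (mode_coeff u k))\<^sup>2) summable_on UNIV"
    using fin by (intro nonneg_bdd_above_summable_on bdd_aboveI2[where M = R]) auto
  have "u \<in> sobolev_class s m"
    using summ continuous_L2_torus[OF cu] borel_measurable_continuous_onI[OF cu] by (simp add: sobolev_class_def)
  then show "(\<lambda>x. complex_of_real (\<phi> (x, 0))) \<in> sobolev_class s m" by (simp add: u_def[abs_def])
  have "sobolev_sum s m u \<le> R"
    unfolding sobolev_sum_def by (rule infsum_le_finite_sums[OF summ]) (use fin in auto)
  then show "sobolev_sum s m (\<lambda>x. complex_of_real (\<phi> (x, 0))) \<le> kappa s / s * form s m \<phi> \<phi>"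
    by (simp add: u_def[abs_def] R_def)
qed

section \<open>Limits of smooth functions\<close>

abbreviation cplx :: "(real ^ 3 \<Rightarrow> real) \<Rightarrow> real ^ 3 \<Rightarrow> complex" where
  "cplx u \<equiv> (\<lambda>x. complex_of_real (u x))"

lemma cplx_measurable_iff:
  fixes u :: "real ^ 3 \<Rightarrow> real"
  shows "cplx u \<in> borel_measurable M \<longleftrightarrow> u \<in> borel_measurable M"
proof
  assume "cplx u \<in> borel_measurable M"
  then have "(\<lambda>x. Re (cplx u x)) \<in> borel_measurable M" by measurable
  then show "u \<in> borel_measurable M" by simp
qed measurable

lemma cplx_L2_iff: "cplx u \<in> L2 torus \<longleftrightarrow> u \<in> L2 torus"
  unfolding L2_def by (simp add: cplx_measurable_iff)

lemma l2_norm_cplx_diff: "l2_norm torus (\<lambda>x. cplx u x - cplx v x) = l2_norm torus (\<lambda>x. u x - v x)"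
  unfolding l2_norm_def l2_inner_self by (simp flip: of_real_diff)

lemma Hs_coeff_eq: "Hs_coeff s m u k = symbol m k powr s * (cmod (mode_coeff (cplx u) k))\<^sup>2"
  by (simp add: Hs_coeff_def symbol_def fourier_coeff_eq)

lemma Hs_norm_eq: "Hs_norm s m u = sqrt (sobolev_sum s m (cplx u))"
  by (simp add: Hs_norm_def sobolev_sum_def Hs_coeff_eq)

lemma Hs_iff: "u \<in> Hs s m \<longleftrightarrow> periodic u \<and> cplx u \<in> sobolev_class s m"
proof -
  have "u \<in> L2 torus \<longleftrightarrow> integrable torus (\<lambda>x. (u x)\<^sup>2)" if "u \<in> borel_measurable borel"
    using borel_torus[OF that] by (simp add: L2_def)
  moreover have "Hs_coeff s m u = (\<lambda>k. symbol m k powr s * (cmod (mode_coeff (cplx u) k))\<^sup>2)"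
    by (rule ext) (rule Hs_coeff_eq)
  ultimately show ?thesis
    by (auto simp: Hs_def sobolev_class_def cplx_L2_iff cplx_measurable_iff set_integrable_cube)
qed

lemma sobolev_sum_nonneg: "0 \<le> sobolev_sum s m f"
  unfolding sobolev_sum_def by (rule infsum_nonneg) simp

lemma sobolev_class_diff:
  assumes f: "f \<in> sobolev_class s m" and g: "g \<in> sobolev_class s m"
  shows "(\<lambda>x. f x - g x) \<in> sobolev_class s m"
proof -
  have L: "f \<in> L2 torus" "g \<in> L2 torus" using f g by (auto simp: sobolev_class_def)
  have "(\<lambda>k. symbol m k powr s * (cmod (mode_coeff (\<lambda>x. f x - g x) k))\<^sup>2) summable_on UNIV"
  proof (rule summable_on_comparison_test)
    show "(\<lambda>k. 2 * (symbol m k powr s * (cmod (mode_coeff f k))\<^sup>2) + 2 * (symbol m k powr s * (cmod (mode_coeff g k))\<^sup>2)) summable_on UNIV"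
      using f g by (intro summable_on_add summable_on_cmult_right) (auto simp: sobolev_class_def)
    fix k
    have "(cmod (mode_coeff (\<lambda>x. f x - g x) k))\<^sup>2 \<le> (cmod (mode_coeff f k) + cmod (mode_coeff g k))\<^sup>2"
      unfolding coeff_diff[OF L] by (intro power_mono norm_triangle_ineq4) simp
    also have "\<dots> \<le> 2 * (cmod (mode_coeff f k))\<^sup>2 + 2 * (cmod (mode_coeff g k))\<^sup>2"
      using sum_squares_bound[of "cmod (mode_coeff f k)" "cmod (mode_coeff g k)"] by (simp add: power2_sum)
    finally have "symbol m k powr s * (cmod (mode_coeff (\<lambda>x. f x - g x) k))\<^sup>2 \<le> symbol m k powr s * (2 * (cmod (mode_coeff f k))\<^sup>2 + 2 * (cmod (mode_coeff g k))\<^sup>2)"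
      by (rule mult_left_mono) simp
    then show "symbol m k powr s * (cmod (mode_coeff (\<lambda>x. f x - g x) k))\<^sup>2 \<le> 2 * (symbol m k powr s * (cmod (mode_coeff f k))\<^sup>2) + 2 * (symbol m k powr s * (cmod (mode_coeff g k))\<^sup>2)"
      by (simp add: algebra_simps)
  qed simp
  then show ?thesis using f g L2_diff[OF L] by (auto simp: sobolev_class_def)
qed

lemma l2_le_sobolev_sum:
  assumes m: "0 < m" and s: "0 < s" and f: "f \<in> sobolev_class s m"
  shows "(l2_norm torus f)\<^sup>2 \<le> (m\<^sup>2) powr (- s) * sobolev_sum s m f"
proof -
  have L: "f \<in> L2 torus" "f \<in> borel_measurable borel" and
    summ: "(\<lambda>k. symbol m k powr s * (cmod (mode_coeff f k))\<^sup>2) summable_on UNIV"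
    using f by (auto simp: sobolev_class_def)
  have "(\<lambda>n. l2_norm torus (trig (mode_cube n) (mode_coeff f))) \<longlonglongrightarrow> l2_norm torus f"
    by (rule l2_norm_tendsto[OF trig_L2 L(1) trig_partial_sums_tendsto[OF L]])
  then have "(\<lambda>n. (l2_norm torus (trig (mode_cube n) (mode_coeff f)))\<^sup>2) \<longlonglongrightarrow> (l2_norm torus f)\<^sup>2"
    by (intro tendsto_intros)
  moreover have "(l2_norm torus (trig (mode_cube n) (mode_coeff f)))\<^sup>2 \<le> (m\<^sup>2) powr (- s) * sobolev_sum s m f" for n
  proof -
    have "(l2_norm torus (trig (mode_cube n) (mode_coeff f)))\<^sup>2 = (\<Sum>k\<in>mode_cube n. (cmod (mode_coeff f k))\<^sup>2)"
      by (simp add: l2_norm_sq l2_inner_trig_trig)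
    also have "\<dots> \<le> (\<Sum>k\<in>mode_cube n. (m\<^sup>2) powr (- s) * (symbol m k powr s * (cmod (mode_coeff f k))\<^sup>2))"
    proof (rule sum_mono)
      fix k
      have "1 = (m\<^sup>2) powr (- s) * (m\<^sup>2) powr s" using m by (simp flip: powr_add)
      also have "\<dots> \<le> (m\<^sup>2) powr (- s) * symbol m k powr s"
        using s by (intro mult_left_mono powr_mono2) (auto simp: symbol_ge)
      finally have "1 * (cmod (mode_coeff f k))\<^sup>2 \<le> (m\<^sup>2) powr (- s) * symbol m k powr s * (cmod (mode_coeff f k))\<^sup>2"
        by (rule mult_right_mono) simp
      then show "(cmod (mode_coeff f k))\<^sup>2 \<le> (m\<^sup>2) powr (- s) * (symbol m k powr s * (cmod (mode_coeff f k))\<^sup>2)"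
        by (simp add: mult.assoc)
    qed
    also have "\<dots> \<le> (m\<^sup>2) powr (- s) * sobolev_sum s m f"
      unfolding sum_distrib_left[symmetric] sobolev_sum_def
      by (intro mult_left_mono finite_sum_le_infsum[OF summ]) auto
    finally show ?thesis .
  qed
  ultimately show ?thesis using LIMSEQ_le_const2 by blast
qed

text \<open>
  Elements of \<open>\<bbbH>\<^sup>s\<close> are periodic everywhere, whereas a limit in \<open>L\<^sup>2\<close> is given only on the open cube. It is
  extended by zero and composed with \<open>wrap\<close>.
\<close>

lemma periodic_representative:
  fixes u :: "real ^ 3 \<Rightarrow> real"
  assumes "u \<in> borel_measurable torus"
  obtains v where "periodic v" "v \<in> borel_measurable borel" "\<And>x. x \<in> cube \<Longrightarrow> v x = u x"
proof
  define w where "w x = indicator cube x *\<^sub>R u x" for x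
  have [measurable]: "w \<in> borel_measurable borel"
    unfolding w_def[abs_def] using assms by (subst (asm) borel_measurable_restrict_space_iff) auto
  show "(\<lambda>x. w (wrap x)) \<in> borel_measurable borel" by measurable
  have "lattice (axis i 1) = (2 * pi) *\<^sub>R axis i 1" for i
    by (simp add: lattice_def vec_eq_iff axis_def)
  then show "periodic (\<lambda>x. w (wrap x))"
    unfolding periodic_def by (metis wrap_lattice)
  fix x assume x: "x \<in> cube"
  have "lattice 0 = 0" by (simp add: lattice_def vec_eq_iff)
  moreover have "x \<in> cell" using x by (auto simp: cell_def mem_cube less_imp_le)
  ultimately have "wrap_index x = 0" using cell_unique[of x 0] by simp
  then have "wrap x = x" using \<open>lattice 0 = 0\<close> by (simp add: wrap_def)
  then show "w (wrap x) = u x" using x by (simp add: w_def)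
qed

lemma smooth_trace_Hs:
  assumes "\<phi> \<in> smooth_periodic s" "0 < m" "0 < s" "s < 1"
  shows "(\<lambda>x. \<phi> (x, 0)) \<in> Hs s m"
  using trace_bound(1)[OF assms] smooth_periodicD(4)[OF assms(1), of 0] by (simp add: Hs_iff)

lemma X_norm_l2:
  "X_norm s m ((\<lambda>p. fst W p - \<phi> p), (\<lambda>p. snd W p - grad \<phi> p))
    = sqrt (1 / kappa s) * l2_norm (cyl_measure s) (\<lambda>p. jet_field m W p - smooth_field m \<phi> p)"
  using jet_field_diff[of m W "(\<phi>, grad \<phi>)"]
  by (simp add: X_norm_def X_inner_l2 l2_norm_def smooth_field_def real_sqrt_mult[symmetric])

lemma X_approx_iff:
  assumes s: "0 < s" "s < 1"
  shows "X_approx s m W \<phi> \<longleftrightarrow> (\<forall>n. \<phi> n \<in> smooth_periodic s)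
    \<and> (\<lambda>n. l2_norm (cyl_measure s) (\<lambda>p. smooth_field m (\<phi> n) p - jet_field m W p)) \<longlonglongrightarrow> 0"
proof -
  have k: "sqrt (1 / kappa s) \<noteq> 0" using kappa_pos[OF s] by simp
  have "(\<lambda>n. sqrt (1 / kappa s) * l2_norm (cyl_measure s) (\<lambda>p. jet_field m W p - smooth_field m (\<phi> n) p)) \<longlonglongrightarrow> 0
      \<longleftrightarrow> (\<lambda>n. l2_norm (cyl_measure s) (\<lambda>p. jet_field m W p - smooth_field m (\<phi> n) p)) \<longlonglongrightarrow> 0"
    using tendsto_mult_left_iff[OF k, of _ 0] by simp
  then show ?thesis unfolding X_approx_def X_norm_l2 by (simp add: l2_norm_minus_commute)
qed

lemma X_inner_tendsto:
  assumes s: "0 < s" "s < 1" and m: "0 < m" and W: "W \<in> weighted_L2 s" "X_approx s m W \<phi>"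
    and Z: "Z \<in> weighted_L2 s" "X_approx s m Z \<psi>"
  shows "(\<lambda>n. form s m (\<phi> n) (\<psi> n)) \<longlonglongrightarrow> X_inner s m W Z"
proof -
  have "\<phi> n \<in> smooth_periodic s" "\<psi> n \<in> smooth_periodic s" for n
    using W Z by (auto simp: X_approx_def)
  then show ?thesis
    unfolding form_l2 X_inner_l2 using W Z
    by (intro tendsto_mult tendsto_const l2_inner_tendsto smooth_periodicD(3)[OF _ m])
      (auto simp: weighted_L2_iff[OF m] X_approx_iff[OF s])
qed

text \<open>
  The limits on the cylinder and on its boundary exist by the completeness of \<open>L\<^sup>2\<close> and the trace
  inequality. The coefficients of the boundary values converge, and the norm of \<open>\<bbbH>\<^sup>s\<close> is lower
  semicontinuous under this, so that the boundary values converge in \<open>\<bbbH>\<^sup>s\<close> as well.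
\<close>

lemma Cauchy_has_trace:
  assumes m: "0 < m" and s: "0 < s" "s < 1" and \<phi>: "\<And>n. \<phi> n \<in> smooth_periodic s"
    and cau: "\<And>e. 0 < e \<Longrightarrow> \<exists>N. \<forall>i\<ge>N. \<forall>j\<ge>N. form s m (\<lambda>p. \<phi> i p - \<phi> j p) (\<lambda>p. \<phi> i p - \<phi> j p) < e"
  obtains W u where "W \<in> Xs s m" "X_approx s m W \<phi>" "u \<in> Hs s m" "has_trace s m W u"
    "(\<lambda>n. Hs_norm s m (\<lambda>x. u x - \<phi> n (x, 0))) \<longlonglongrightarrow> 0"
proof -
  let ?M = "cyl_measure s"
  have k: "0 < kappa s" by (rule kappa_pos[OF s])
  have L: "smooth_field m (\<phi> n) \<in> L2 ?M" for n by (rule smooth_periodicD(3)[OF \<phi> m])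
  have fd: "form s m (\<lambda>p. \<phi> i p - \<phi> j p) (\<lambda>p. \<phi> i p - \<phi> j p)
      = 1 / kappa s * (l2_norm ?M (\<lambda>p. smooth_field m (\<phi> i) p - smooth_field m (\<phi> j) p))\<^sup>2" for i j
    by (simp add: form_diff_self[OF \<phi> \<phi>] l2_norm_sq)
  have "\<exists>g\<in>L2 ?M. (\<lambda>n. l2_norm ?M (\<lambda>p. smooth_field m (\<phi> n) p - g p)) \<longlonglongrightarrow> 0"
  proof (rule l2_complete[OF L])
    fix e :: real assume e: "0 < e"
    then have "0 < e\<^sup>2 / kappa s" using k by simp
    from cau[OF this] obtain N where N: "\<And>i j. i \<ge> N \<Longrightarrow> j \<ge> N \<Longrightarrow>
        (l2_norm ?M (\<lambda>p. smooth_field m (\<phi> i) p - smooth_field m (\<phi> j) p))\<^sup>2 < e\<^sup>2"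
      unfolding fd using k by (auto simp: field_simps)
    then show "\<exists>N. \<forall>i\<ge>N. \<forall>j\<ge>N. l2_norm ?M (\<lambda>p. smooth_field m (\<phi> i) p - smooth_field m (\<phi> j) p) < e"
      using power2_less_imp_less[OF N] e by (meson less_imp_le)
  qed
  then obtain g where g: "g \<in> L2 ?M" and gl: "(\<lambda>n. l2_norm ?M (\<lambda>p. smooth_field m (\<phi> n) p - g p)) \<longlonglongrightarrow> 0"
    by blast
  define W where "W = ((\<lambda>p. fst (g p) / m), (\<lambda>p. snd (g p)))"
  have Wg: "jet_field m W = g" using m by (simp add: W_def jet_field_def fun_eq_iff)
  have W: "W \<in> weighted_L2 s" using g by (simp add: weighted_L2_iff[OF m] Wg)
  have WA: "X_approx s m W \<phi>" using \<phi> gl by (simp add: X_approx_iff[OF s] Wg)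
  have WX: "W \<in> Xs s m" using W WA by (auto simp: Xs_def)
  define v where "v n x = \<phi> n (x, 0)" for n x
  have vc: "cplx (v n) \<in> sobolev_class s m" for n
    using trace_bound(1)[OF \<phi> m s] by (simp add: v_def[abs_def])
  have vL: "v n \<in> L2 torus" "cplx (v n) \<in> L2 torus" for n
    using vc[of n] cplx_L2_iff by (auto simp: sobolev_class_def)
  have vd: "sobolev_sum s m (\<lambda>x. cplx (v i) x - cplx (v j) x)
      \<le> kappa s / s * form s m (\<lambda>p. \<phi> i p - \<phi> j p) (\<lambda>p. \<phi> i p - \<phi> j p)" for i j
    using trace_bound(2)[OF smooth_periodic_lincomb[OF \<phi>[of i] \<phi>[of j], of 1 "-1"] m s]
    by (simp add: v_def)
  have vcau: "\<exists>N. \<forall>i\<ge>N. \<forall>j\<ge>N. sobolev_sum s m (\<lambda>x. cplx (v i) x - cplx (v j) x) < e" if e: "0 < e" for e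
  proof -
    have "0 < e * s / kappa s" using e s k by simp
    from cau[OF this] obtain N where N: "\<And>i j. i \<ge> N \<Longrightarrow> j \<ge> N \<Longrightarrow> form s m (\<lambda>p. \<phi> i p - \<phi> j p) (\<lambda>p. \<phi> i p - \<phi> j p) < e * s / kappa s"
      by blast
    have "sobolev_sum s m (\<lambda>x. cplx (v i) x - cplx (v j) x) < e" if "i \<ge> N" "j \<ge> N" for i j
    proof -
      have "kappa s / s * form s m (\<lambda>p. \<phi> i p - \<phi> j p) (\<lambda>p. \<phi> i p - \<phi> j p) < kappa s / s * (e * s / kappa s)"
        using N[OF that] k s by (intro mult_strict_left_mono) auto
      also have "\<dots> = e" using k s by simp
      finally show ?thesis using vd[of i j] by simp
    qed
    then show ?thesis by blast
  qed
  have "\<exists>u\<in>L2 torus. (\<lambda>n. l2_norm torus (\<lambda>x. v n x - u x)) \<longlonglongrightarrow> 0"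
  proof (rule l2_complete[OF vL(1)])
    fix e :: real assume e: "0 < e"
    define c where "c = (m\<^sup>2) powr (- s)"
    have c: "0 < c" using m by (simp add: c_def)
    have "0 < e\<^sup>2 / c" using e c by simp
    from vcau[OF this] obtain N where N: "\<And>i j. i \<ge> N \<Longrightarrow> j \<ge> N \<Longrightarrow> sobolev_sum s m (\<lambda>x. cplx (v i) x - cplx (v j) x) < e\<^sup>2 / c" by blast
    have "l2_norm torus (\<lambda>x. v i x - v j x) < e" if "i \<ge> N" "j \<ge> N" for i j
    proof (rule power2_less_imp_less)
      have "(l2_norm torus (\<lambda>x. cplx (v i) x - cplx (v j) x))\<^sup>2 \<le> c * sobolev_sum s m (\<lambda>x. cplx (v i) x - cplx (v j) x)"
        unfolding c_def by (rule l2_le_sobolev_sum[OF m s(1) sobolev_class_diff[OF vc vc]])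
      also have "\<dots> < c * (e\<^sup>2 / c)" using N[OF that] c by (rule mult_strict_left_mono)
      finally show "(l2_norm torus (\<lambda>x. v i x - v j x))\<^sup>2 < e\<^sup>2" using c by (simp add: l2_norm_cplx_diff)
    qed (use e in simp)
    then show "\<exists>N. \<forall>i\<ge>N. \<forall>j\<ge>N. l2_norm torus (\<lambda>x. v i x - v j x) < e" by blast
  qed
  then obtain u0 where u0: "u0 \<in> L2 torus" and u0l: "(\<lambda>n. l2_norm torus (\<lambda>x. v n x - u0 x)) \<longlonglongrightarrow> 0" by blast
  obtain u where u: "periodic u" "u \<in> borel_measurable borel" "\<And>x. x \<in> cube \<Longrightarrow> u x = u0 x"
    using periodic_representative[OF L2_measurable[OF u0]] by blast
  have uL: "u \<in> L2 torus" using u0 u(3) L2_cong[of torus u u0] by simp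
  have ul: "(\<lambda>n. l2_norm torus (\<lambda>x. v n x - u x)) \<longlonglongrightarrow> 0"
  proof -
    have "l2_norm torus (\<lambda>x. v n x - u x) = l2_norm torus (\<lambda>x. v n x - u0 x)" for n
      unfolding l2_norm_def using u(3) by (intro arg_cong[where f = sqrt] l2_inner_cong) auto
    then show ?thesis using u0l by simp
  qed
  have cuL: "cplx u \<in> L2 torus" using uL by (simp add: cplx_L2_iff)
  have ck: "(\<lambda>n. mode_coeff (cplx (v n)) k) \<longlonglongrightarrow> mode_coeff (cplx u) k" for k
    by (rule coeff_tendsto[OF vL(2) cuL]) (simp add: l2_norm_cplx_diff ul)
  have small: "(\<lambda>x. cplx u x - cplx (v n) x) \<in> sobolev_class s m \<and> sobolev_sum s m (\<lambda>x. cplx u x - cplx (v n) x) \<le> e"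
    if N: "\<And>i j. i \<ge> N \<Longrightarrow> j \<ge> N \<Longrightarrow> sobolev_sum s m (\<lambda>x. cplx (v i) x - cplx (v j) x) < e" and n: "n \<ge> N" for e N n
  proof -
    let ?f = "\<lambda>x. cplx u x - cplx (v n) x"
    have cd: "mode_coeff ?f k = mode_coeff (cplx u) k - mode_coeff (cplx (v n)) k" for k
      by (rule coeff_diff[OF cuL vL(2)])
    have fin: "(\<Sum>k\<in>F. symbol m k powr s * (cmod (mode_coeff ?f k))\<^sup>2) \<le> e" if F: "finite F" for F
    proof (rule LIMSEQ_le_const2)
      show "(\<lambda>j. \<Sum>k\<in>F. symbol m k powr s * (cmod (mode_coeff (cplx (v j)) k - mode_coeff (cplx (v n)) k))\<^sup>2)
          \<longlonglongrightarrow> (\<Sum>k\<in>F. symbol m k powr s * (cmod (mode_coeff ?f k))\<^sup>2)"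
        unfolding cd by (intro tendsto_intros ck)
      have "(\<Sum>k\<in>F. symbol m k powr s * (cmod (mode_coeff (cplx (v j)) k - mode_coeff (cplx (v n)) k))\<^sup>2) \<le> e" if j: "j \<ge> N" for j
      proof -
        have "(\<Sum>k\<in>F. symbol m k powr s * (cmod (mode_coeff (\<lambda>x. cplx (v j) x - cplx (v n) x) k))\<^sup>2)
            \<le> sobolev_sum s m (\<lambda>x. cplx (v j) x - cplx (v n) x)"
          unfolding sobolev_sum_def using sobolev_class_diff[OF vc[of j] vc[of n]] F
          by (intro finite_sum_le_infsum) (auto simp: sobolev_class_def)
        then show ?thesis using N[OF j n] by (simp add: coeff_diff[OF vL(2) vL(2)])
      qed
      then show "\<exists>M. \<forall>j\<ge>M. (\<Sum>k\<in>F. symbol m k powr s * (cmod (mode_coeff (cplx (v j)) k - mode_coeff (cplx (v n)) k))\<^sup>2) \<le> e" by blast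
    qed
    have summ: "(\<lambda>k. symbol m k powr s * (cmod (mode_coeff ?f k))\<^sup>2) summable_on UNIV"
      using fin by (intro nonneg_bdd_above_summable_on bdd_aboveI2[where M = e]) auto
    have "?f \<in> sobolev_class s m"
      using summ L2_diff[OF cuL vL(2)] u(2) vc[of n] by (auto simp: sobolev_class_def cplx_measurable_iff)
    moreover have "sobolev_sum s m ?f \<le> e"
      unfolding sobolev_sum_def by (rule infsum_le_finite_sums[OF summ]) (use fin in auto)
    ultimately show ?thesis by simp
  qed
  have uH: "u \<in> Hs s m"
  proof -
    obtain N where "\<And>i j. i \<ge> N \<Longrightarrow> j \<ge> N \<Longrightarrow> sobolev_sum s m (\<lambda>x. cplx (v i) x - cplx (v j) x) < 1"
      using vcau[of 1] by auto
    from small[OF this order_refl] have d: "(\<lambda>x. cplx u x - cplx (v N) x) \<in> sobolev_class s m" by simp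
    have "(\<lambda>x. 0 - cplx (v N) x) \<in> sobolev_class s m"
    proof (rule sobolev_class_diff[OF _ vc])
      show "(\<lambda>x. 0) \<in> sobolev_class s m" by (simp add: sobolev_class_def L2_def mode_coeff_def)
    qed
    from sobolev_class_diff[OF d this] have "cplx u \<in> sobolev_class s m" by simp
    then show ?thesis using u(1) by (simp add: Hs_iff)
  qed
  have lim: "(\<lambda>n. Hs_norm s m (\<lambda>x. u x - \<phi> n (x, 0))) \<longlonglongrightarrow> 0"
  proof (rule LIMSEQ_I)
    fix e :: real assume e: "0 < e"
    then have "0 < (e / 2)\<^sup>2" by simp
    from vcau[OF this] obtain N where N: "\<And>i j. i \<ge> N \<Longrightarrow> j \<ge> N \<Longrightarrow> sobolev_sum s m (\<lambda>x. cplx (v i) x - cplx (v j) x) < (e / 2)\<^sup>2" by blast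
    have "norm (Hs_norm s m (\<lambda>x. u x - \<phi> n (x, 0)) - 0) < e" if "n \<ge> N" for n
    proof -
      have "sobolev_sum s m (\<lambda>x. cplx u x - cplx (v n) x) \<le> (e / 2)\<^sup>2" using small[OF N that] by simp
      then have "sqrt (sobolev_sum s m (\<lambda>x. cplx u x - cplx (v n) x)) \<le> e / 2"
        using e by (intro real_le_lsqrt) auto
      then show ?thesis using e sobolev_sum_nonneg[of s m] by (simp add: Hs_norm_eq v_def)
    qed
    then show "\<exists>N. \<forall>n\<ge>N. norm (Hs_norm s m (\<lambda>x. u x - \<phi> n (x, 0)) - 0) < e" by blast
  qed
  have "has_trace s m W u" unfolding has_trace_def using WX uH WA lim by blast
  then show ?thesis using that WX WA uH lim by blast
qed

section \<open>The nonlinear terms\<close>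

definition reaction :: "real \<Rightarrow> real \<Rightarrow> real \<Rightarrow> real \<Rightarrow> real" where
  "reaction lam q p t = lam * (\<bar>t\<bar> powr (q - 2) * t) + \<bar>t\<bar> powr (p - 2) * t"

definition potential :: "real \<Rightarrow> real \<Rightarrow> real \<Rightarrow> real \<Rightarrow> real" where
  "potential lam q p t = lam / q * \<bar>t\<bar> powr q + 1 / p * \<bar>t\<bar> powr p"

lemma abs_power_derivative: "\<bar>\<bar>t\<bar> powr (r - 2) * t\<bar> = \<bar>t :: real\<bar> powr (r - 1)"
proof (cases "t = 0")
  case False
  then have "\<bar>t\<bar> powr (r - 2) * \<bar>t\<bar> powr 1 = \<bar>t\<bar> powr (r - 1)"
    unfolding powr_add[symmetric] by simp
  then show ?thesis by (simp add: abs_mult)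
qed simp

text \<open>Young's inequality is the tangent inequality for the convex function \<open>|t|\<^sup>r / r\<close>.\<close>

lemma abs_power_tangent:
  fixes t h :: real
  assumes r: "1 < r"
  shows "1 / r * \<bar>t\<bar> powr r + \<bar>t\<bar> powr (r - 2) * t * h \<le> 1 / r * \<bar>t + h\<bar> powr r"
proof -
  let ?d = "\<bar>t\<bar> powr (r - 2) * t"
  define r' where "r' = r / (r - 1)"
  have r': "1 < r'" "1 / r + 1 / r' = 1" using r by (auto simp: r'_def field_simps)
  have "?d * (t + h) \<le> \<bar>?d\<bar> * \<bar>t + h\<bar>" by (metis abs_ge_self abs_mult)
  also have "\<dots> = \<bar>t + h\<bar> * \<bar>t\<bar> powr (r - 1)" unfolding abs_power_derivative by (rule mult.commute)
  also have "\<dots> \<le> \<bar>t + h\<bar> powr r / r + (\<bar>t\<bar> powr (r - 1)) powr r' / r'"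
    using r r' by (intro Youngs_inequality) auto
  also have "(\<bar>t\<bar> powr (r - 1)) powr r' = \<bar>t\<bar> powr r" using r by (simp add: powr_powr r'_def)
  finally have "?d * t + ?d * h \<le> \<bar>t + h\<bar> powr r / r + \<bar>t\<bar> powr r / r'" by (simp add: distrib_left)
  moreover have "?d * t = \<bar>t\<bar> powr r"
  proof (cases "t = 0")
    case False
    then have "\<bar>t\<bar> powr (r - 2) * \<bar>t\<bar> powr 2 = \<bar>t\<bar> powr r" unfolding powr_add[symmetric] by simp
    then show ?thesis by (simp add: power2_eq_square mult.assoc)
  qed simp
  moreover have "\<bar>t\<bar> powr r / r' = \<bar>t\<bar> powr r - 1 / r * \<bar>t\<bar> powr r"
    using r r' by (simp add: r'_def field_simps)
  ultimately show ?thesis by simp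
qed

lemma powr_le_one_plus:
  fixes x :: real
  assumes "0 \<le> x" "0 \<le> \<alpha>" "\<alpha> \<le> \<beta>"
  shows "x powr \<alpha> \<le> 1 + x powr \<beta>"
proof (cases "x \<le> 1")
  case True
  then have "x powr \<alpha> \<le> 1" using assms by (simp add: powr_le1)
  then show ?thesis by (simp add: add_increasing2)
next
  case False
  then have "x powr \<alpha> \<le> x powr \<beta>" using assms by (intro powr_mono) auto
  then show ?thesis by simp
qed

text \<open>
  A form of Young's inequality with a small constant at one of the terms, obtained by distinguishing
  whether \<open>B \<le> \<delta> A\<close>.
\<close>

lemma weighted_product_bound:
  fixes A B :: real
  assumes "0 \<le> A" "0 \<le> B" "0 < \<delta>" "1 < p"
  shows "A powr (p - 1) * B \<le> \<delta> * A powr p + \<delta> powr (- (p - 1)) * B powr p"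
proof (cases "B \<le> \<delta> * A")
  case True
  have "A powr (p - 1) * B \<le> A powr (p - 1) * (\<delta> * A)" by (rule mult_left_mono[OF True]) simp
  also have "\<dots> = \<delta> * A powr p"
  proof (cases "A = 0")
    case False
    then have "A powr (p - 1) * A powr 1 = A powr p" unfolding powr_add[symmetric] by simp
    then show ?thesis using assms by simp
  qed (use assms in simp)
  also have "\<dots> \<le> \<delta> * A powr p + \<delta> powr (- (p - 1)) * B powr p" by simp
  finally show ?thesis .
next
  case False
  then have B: "A \<le> B / \<delta>" "0 < B" using assms by (auto simp: field_simps) (smt (verit) mult_nonneg_nonneg)
  have "A powr (p - 1) * B \<le> (B / \<delta>) powr (p - 1) * B"
    using assms B by (intro mult_right_mono powr_mono2) auto
  also have "\<dots> = \<delta> powr (- (p - 1)) * (B powr (p - 1) * B powr 1)"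
  proof -
    have "(B / \<delta>) powr (p - 1) = B powr (p - 1) / \<delta> powr (p - 1)"
      by (rule powr_divide)
    then show ?thesis using assms B powr_minus[of \<delta> "p - 1"] by (simp only: divide_inverse powr_one mult_ac)
  qed
  also have "B powr (p - 1) * B powr 1 = B powr p" unfolding powr_add[symmetric] by simp
  also have "\<delta> powr (- (p - 1)) * B powr p \<le> \<delta> * A powr p + \<delta> powr (- (p - 1)) * B powr p"
    using assms by simp
  finally show ?thesis .
qed

definition Lp :: "real \<Rightarrow> (real ^ 3 \<Rightarrow> real) set" where
  "Lp p = {u \<in> borel_measurable torus. integrable torus (\<lambda>x. \<bar>u x\<bar> powr p)}"

definition moment :: "real \<Rightarrow> (real ^ 3 \<Rightarrow> real) \<Rightarrow> real" where
  "moment p u = (LINT x|torus. \<bar>u x\<bar> powr p)"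

lemma moment_nonneg: "0 \<le> moment p u"
  by (simp add: moment_def)

lemma abs_add_powr:
  fixes x y :: real
  assumes "0 < p"
  shows "\<bar>x + y\<bar> powr p \<le> 2 powr p * (\<bar>x\<bar> powr p + \<bar>y\<bar> powr p)"
proof -
  have "\<bar>x + y\<bar> powr p \<le> (2 * max \<bar>x\<bar> \<bar>y\<bar>) powr p" using assms by (intro powr_mono2) auto
  also have "\<dots> = 2 powr p * (max \<bar>x\<bar> \<bar>y\<bar>) powr p" by (rule powr_mult)
  also have "\<dots> \<le> 2 powr p * (\<bar>x\<bar> powr p + \<bar>y\<bar> powr p)" by (intro mult_left_mono) (auto simp: max_def)
  finally show ?thesis .
qed

lemma Lp_lincomb:
  assumes u: "u \<in> Lp p" and v: "v \<in> Lp p" and p: "0 < p"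
  shows "(\<lambda>x. \<alpha> * u x + \<beta> * v x) \<in> Lp p"
proof -
  have [measurable]: "u \<in> borel_measurable torus" "v \<in> borel_measurable torus" using u v by (auto simp: Lp_def)
  have "integrable torus (\<lambda>x. \<bar>\<alpha> * u x + \<beta> * v x\<bar> powr p)"
  proof (rule Bochner_Integration.integrable_bound)
    show "integrable torus (\<lambda>x. 2 powr p * (\<bar>\<alpha>\<bar> powr p * \<bar>u x\<bar> powr p + \<bar>\<beta>\<bar> powr p * \<bar>v x\<bar> powr p))"
      using u v by (simp add: Lp_def)
    have "\<bar>\<alpha> * u x + \<beta> * v x\<bar> powr p \<le> 2 powr p * (\<bar>\<alpha>\<bar> powr p * \<bar>u x\<bar> powr p + \<bar>\<beta>\<bar> powr p * \<bar>v x\<bar> powr p)" for x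
      using abs_add_powr[OF p, of "\<alpha> * u x" "\<beta> * v x"] by (simp add: abs_mult powr_mult)
    then show "AE x in torus. norm (\<bar>\<alpha> * u x + \<beta> * v x\<bar> powr p)
        \<le> norm (2 powr p * (\<bar>\<alpha>\<bar> powr p * \<bar>u x\<bar> powr p + \<bar>\<beta>\<bar> powr p * \<bar>v x\<bar> powr p))"
      by (intro AE_I2) (metis abs_ge_self abs_of_nonneg order_trans powr_ge_zero real_norm_def)
  qed measurable
  then show ?thesis by (simp add: Lp_def)
qed

lemma continuous_Lp:
  fixes u :: "real ^ 3 \<Rightarrow> real"
  assumes "continuous_on UNIV u" "0 < p"
  shows "u \<in> Lp p"
proof -
  have "(\<lambda>x. \<bar>u x\<bar> powr p) \<in> L2 torus"
    using assms by (intro continuous_L2_torus continuous_on_powr' continuous_intros) auto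
  then show ?thesis using continuous_torus[OF assms(1)] by (simp add: Lp_def L2_integrable_torus)
qed

locale concave_convex =
  fixes q p lam :: real
  assumes q: "1 < q" "q < 2" and p: "4 < p" and lam: "0 < lam"
begin

abbreviation g :: "real \<Rightarrow> real" where "g \<equiv> reaction lam q p"
abbreviation G :: "real \<Rightarrow> real" where "G \<equiv> potential lam q p"

lemma reaction_growth: "\<bar>g t\<bar> \<le> (lam + 1) * (1 + \<bar>t\<bar> powr (p - 1))"
proof -
  have "\<bar>g t\<bar> \<le> \<bar>lam * (\<bar>t\<bar> powr (q - 2) * t)\<bar> + \<bar>\<bar>t\<bar> powr (p - 2) * t\<bar>"
    unfolding reaction_def by (rule abs_triangle_ineq)
  also have "\<dots> = lam * \<bar>t\<bar> powr (q - 1) + \<bar>t\<bar> powr (p - 1)"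
    unfolding abs_mult[of lam] abs_power_derivative using lam by simp
  also have "\<dots> \<le> lam * (1 + \<bar>t\<bar> powr (p - 1)) + (1 + \<bar>t\<bar> powr (p - 1))"
    using lam q p by (intro add_mono mult_left_mono powr_le_one_plus) auto
  finally show ?thesis by (simp add: algebra_simps)
qed

text \<open>
  The potential is convex with derivative \<open>g\<close>. In this form the differentiation of integrals is avoided.
\<close>

lemma potential_tangent: "G t + g t * h \<le> G (t + h)"
proof -
  have "lam * (1 / q * \<bar>t\<bar> powr q + \<bar>t\<bar> powr (q - 2) * t * h) \<le> lam * (1 / q * \<bar>t + h\<bar> powr q)"
    using lam q by (intro mult_left_mono abs_power_tangent) auto
  moreover have "1 / p * \<bar>t\<bar> powr p + \<bar>t\<bar> powr (p - 2) * t * h \<le> 1 / p * \<bar>t + h\<bar> powr p"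
    using p by (intro abs_power_tangent) auto
  ultimately show ?thesis by (simp add: potential_def reaction_def algebra_simps)
qed

lemma potential_lipschitz: "\<bar>G x - G y\<bar> \<le> (\<bar>g x\<bar> + \<bar>g y\<bar>) * \<bar>x - y\<bar>"
proof -
  have "G y + g y * (x - y) \<le> G x" "G x + g x * (y - x) \<le> G y"
    using potential_tangent[of y "x - y"] potential_tangent[of x "y - x"] by simp_all
  moreover have "\<bar>g y * (x - y)\<bar> \<le> (\<bar>g x\<bar> + \<bar>g y\<bar>) * \<bar>x - y\<bar>" "\<bar>g x * (y - x)\<bar> \<le> (\<bar>g x\<bar> + \<bar>g y\<bar>) * \<bar>x - y\<bar>"
    by (auto simp: abs_mult abs_minus_commute intro!: mult_right_mono)
  ultimately show ?thesis by linarith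
qed

lemma potential_bounds: "0 \<le> G t" "G t \<le> lam + (lam + 1) * \<bar>t\<bar> powr p"
proof -
  show "0 \<le> G t" using lam q p by (simp add: potential_def)
  have "lam / q * \<bar>t\<bar> powr q \<le> lam * \<bar>t\<bar> powr q"
    using lam q by (intro mult_right_mono) (auto simp: field_simps)
  also have "\<dots> \<le> lam * (1 + \<bar>t\<bar> powr p)"
    using lam q p by (intro mult_left_mono powr_le_one_plus) auto
  finally have "lam / q * \<bar>t\<bar> powr q \<le> lam + lam * \<bar>t\<bar> powr p" by (simp add: algebra_simps)
  moreover have "1 / p * \<bar>t\<bar> powr p \<le> 1 * \<bar>t\<bar> powr p" using p by (intro mult_right_mono) auto
  ultimately show "G t \<le> lam + (lam + 1) * \<bar>t\<bar> powr p" by (simp add: potential_def algebra_simps)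
qed

lemma reaction_measurable [measurable]: "g \<in> borel_measurable borel"
  unfolding reaction_def[abs_def] by measurable

lemma potential_measurable [measurable]: "G \<in> borel_measurable borel"
  unfolding potential_def[abs_def] by measurable

lemma reaction_product_bound: "\<bar>g x * w\<bar> \<le> (lam + 1) * (1 + \<bar>x\<bar> powr p + 2 * \<bar>w\<bar> powr p)"
proof -
  have "\<bar>x\<bar> powr (p - 1) * \<bar>w\<bar> \<le> \<bar>x\<bar> powr p + \<bar>w\<bar> powr p"
    using weighted_product_bound[of "\<bar>x\<bar>" "\<bar>w\<bar>" 1 p] p by simp
  moreover have "\<bar>w\<bar> powr 1 \<le> 1 + \<bar>w\<bar> powr p" using p by (intro powr_le_one_plus) auto
  ultimately have "(1 + \<bar>x\<bar> powr (p - 1)) * \<bar>w\<bar> \<le> 1 + \<bar>x\<bar> powr p + 2 * \<bar>w\<bar> powr p"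
    by (simp add: algebra_simps)
  then have "(lam + 1) * ((1 + \<bar>x\<bar> powr (p - 1)) * \<bar>w\<bar>) \<le> (lam + 1) * (1 + \<bar>x\<bar> powr p + 2 * \<bar>w\<bar> powr p)"
    using lam by (intro mult_left_mono) auto
  moreover have "\<bar>g x * w\<bar> \<le> (lam + 1) * (1 + \<bar>x\<bar> powr (p - 1)) * \<bar>w\<bar>"
    unfolding abs_mult by (intro mult_right_mono reaction_growth) simp
  ultimately show ?thesis by (simp add: mult.assoc)
qed

lemma reaction_integrable:
  assumes u: "u \<in> Lp p" and w: "w \<in> Lp p"
  shows "integrable torus (\<lambda>x. g (u x) * w x)"
proof (rule Bochner_Integration.integrable_bound)
  have [measurable]: "u \<in> borel_measurable torus" "w \<in> borel_measurable torus" using u w by (auto simp: Lp_def)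
  show "integrable torus (\<lambda>x. (lam + 1) * (1 + \<bar>u x\<bar> powr p + 2 * \<bar>w x\<bar> powr p))"
    using u w by (simp add: Lp_def)
  show "(\<lambda>x. g (u x) * w x) \<in> borel_measurable torus" by measurable
  show "AE x in torus. norm (g (u x) * w x) \<le> norm ((lam + 1) * (1 + \<bar>u x\<bar> powr p + 2 * \<bar>w x\<bar> powr p))"
    using reaction_product_bound by (intro AE_I2) (simp only: real_norm_def, smt (verit))
qed

lemma potential_integrable:
  assumes u: "u \<in> Lp p"
  shows "integrable torus (\<lambda>x. G (u x))"
proof (rule Bochner_Integration.integrable_bound)
  have [measurable]: "u \<in> borel_measurable torus" using u by (auto simp: Lp_def)
  show "integrable torus (\<lambda>x. lam + (lam + 1) * \<bar>u x\<bar> powr p)" using u by (simp add: Lp_def)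
  show "(\<lambda>x. G (u x)) \<in> borel_measurable torus" by measurable
  show "AE x in torus. norm (G (u x)) \<le> norm (lam + (lam + 1) * \<bar>u x\<bar> powr p)"
    using potential_bounds by (intro AE_I2) (simp only: real_norm_def, smt (verit))
qed

definition pot :: "(real ^ 3 \<Rightarrow> real) \<Rightarrow> real" where
  "pot u = (LINT x|torus. G (u x))"

lemma pot_le:
  assumes u: "u \<in> Lp p"
  shows "pot u \<le> lam * (2 * pi) ^ 3 + (lam + 1) * moment p u"
proof -
  have "pot u \<le> (LINT x|torus. lam + (lam + 1) * \<bar>u x\<bar> powr p)"
    unfolding pot_def using potential_integrable[OF u] u potential_bounds(2)
    by (intro integral_mono) (auto simp: Lp_def)
  also have "\<dots> = lam * (2 * pi) ^ 3 + (lam + 1) * moment p u"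
    using u by (simp add: Lp_def moment_def measure_torus mult.commute)
  finally show ?thesis .
qed

lemma pot_tangent:
  assumes u: "u \<in> Lp p" and w: "w \<in> Lp p"
  shows "pot u + t * (LINT x|torus. g (u x) * w x) \<le> pot (\<lambda>x. u x + t * w x)"
proof -
  have L: "(\<lambda>x. u x + t * w x) \<in> Lp p" using Lp_lincomb[OF u w, of 1 t] p by simp
  have "pot u + t * (LINT x|torus. g (u x) * w x) = (LINT x|torus. G (u x) + t * (g (u x) * w x))"
    using potential_integrable[OF u] reaction_integrable[OF u w] by (simp add: pot_def)
  also have "\<dots> \<le> pot (\<lambda>x. u x + t * w x)"
    unfolding pot_def
  proof (rule integral_mono)
    show "integrable torus (\<lambda>x. G (u x) + t * (g (u x) * w x))"
      using potential_integrable[OF u] reaction_integrable[OF u w] by simp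
    show "integrable torus (\<lambda>x. G (u x + t * w x))" by (rule potential_integrable[OF L])
    show "G (u x) + t * (g (u x) * w x) \<le> G (u x + t * w x)" for x
      using potential_tangent[of "u x" "t * w x"] by (simp add: mult.left_commute)
  qed
  finally show ?thesis .
qed

lemma potential_difference_bound:
  assumes \<delta>: "0 < \<delta>"
  shows "\<bar>G x - G y\<bar> \<le> 2 * (lam + 1) * (\<delta> * (1 + \<bar>x\<bar> powr p + \<bar>y\<bar> powr p) + 3 * \<delta> powr (- (p - 1)) * \<bar>x - y\<bar> powr p)"
proof -
  have wp: "A powr (p - 1) * \<bar>x - y\<bar> \<le> \<delta> * A powr p + \<delta> powr (- (p - 1)) * \<bar>x - y\<bar> powr p" if "0 \<le> A" for A
    using that \<delta> p by (intro weighted_product_bound) auto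
  have "\<bar>g x\<bar> + \<bar>g y\<bar> \<le> 2 * (lam + 1) * (1 + \<bar>x\<bar> powr (p - 1) + \<bar>y\<bar> powr (p - 1))"
  proof -
    have "0 \<le> (lam + 1) * (\<bar>x\<bar> powr (p - 1) + \<bar>y\<bar> powr (p - 1))" using lam by simp
    then show ?thesis using reaction_growth[of x] reaction_growth[of y] by (simp add: algebra_simps)
  qed
  then have "\<bar>G x - G y\<bar> \<le> 2 * (lam + 1) * (1 + \<bar>x\<bar> powr (p - 1) + \<bar>y\<bar> powr (p - 1)) * \<bar>x - y\<bar>"
    by (intro order_trans[OF potential_lipschitz] mult_right_mono) auto
  also have "\<dots> = 2 * (lam + 1) * (1 powr (p - 1) * \<bar>x - y\<bar> + \<bar>x\<bar> powr (p - 1) * \<bar>x - y\<bar> + \<bar>y\<bar> powr (p - 1) * \<bar>x - y\<bar>)"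
    by (simp add: algebra_simps)
  also have "\<dots> \<le> 2 * (lam + 1) * (\<delta> * (1 + \<bar>x\<bar> powr p + \<bar>y\<bar> powr p) + 3 * \<delta> powr (- (p - 1)) * \<bar>x - y\<bar> powr p)"
    using wp[of 1] wp[of "\<bar>x\<bar>"] wp[of "\<bar>y\<bar>"] lam by (intro mult_left_mono) (auto simp: algebra_simps)
  finally show ?thesis .
qed

text \<open>
  The increments of the potential grow like \<open>|x|\<^sup>p\<^sup>-\<^sup>1 |x - y|\<close>; the weighted product bound puts a small
  constant in front of \<open>|x|\<^sup>p\<close>, whose integral is bounded, and the large constant in front of
  \<open>|x - y|\<^sup>p\<close>, whose integral is small.
\<close>

lemma pot_uniformly_continuous:
  assumes e: "0 < e" and B: "0 \<le> B"
  shows "\<exists>\<eta>>0. \<forall>u\<in>Lp p. \<forall>v\<in>Lp p. moment p u \<le> B \<longrightarrow> moment p v \<le> B \<longrightarrow>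
    moment p (\<lambda>x. u x - v x) \<le> \<eta> \<longrightarrow> \<bar>pot u - pot v\<bar> \<le> e"
proof -
  define V where "V = (2 * pi) ^ 3 + 2 * B"
  have V: "0 < V" using B by (simp add: V_def add_pos_nonneg)
  define \<delta> where "\<delta> = e / (4 * (lam + 1) * V)"
  have \<delta>: "0 < \<delta>" using e lam V by (simp add: \<delta>_def)
  define D where "D = 3 * \<delta> powr (- (p - 1))"
  have D: "0 < D" using \<delta> by (simp add: D_def)
  define \<eta> where "\<eta> = e / (4 * (lam + 1) * D)"
  have \<eta>: "0 < \<eta>" using e lam D by (simp add: \<eta>_def)
  have "\<bar>pot u - pot v\<bar> \<le> e" if u: "u \<in> Lp p" and v: "v \<in> Lp p" and mu: "moment p u \<le> B" and mv: "moment p v \<le> B"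
    and d: "moment p (\<lambda>x. u x - v x) \<le> \<eta>" for u v
  proof -
    have w: "(\<lambda>x. u x - v x) \<in> Lp p" using Lp_lincomb[OF u v, of 1 "-1"] p by simp
    have i: "integrable torus (\<lambda>x. 2 * (lam + 1) * (\<delta> * (1 + \<bar>u x\<bar> powr p + \<bar>v x\<bar> powr p) + D * \<bar>u x - v x\<bar> powr p))"
      using u v w by (simp add: Lp_def)
    have "\<bar>pot u - pot v\<bar> = \<bar>LINT x|torus. G (u x) - G (v x)\<bar>"
      using potential_integrable[OF u] potential_integrable[OF v] by (simp add: pot_def)
    also have "\<dots> \<le> (LINT x|torus. \<bar>G (u x) - G (v x)\<bar>)" by (rule integral_abs_bound)
    also have "\<dots> \<le> (LINT x|torus. 2 * (lam + 1) * (\<delta> * (1 + \<bar>u x\<bar> powr p + \<bar>v x\<bar> powr p) + D * \<bar>u x - v x\<bar> powr p))"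
      using potential_integrable[OF u] potential_integrable[OF v] i potential_difference_bound[OF \<delta>]
      by (intro integral_mono) (auto simp: D_def)
    also have "\<dots> = 2 * (lam + 1) * (\<delta> * ((2 * pi) ^ 3 + moment p u + moment p v) + D * moment p (\<lambda>x. u x - v x))"
      using u v w by (simp add: Lp_def moment_def measure_torus)
    also have "\<dots> \<le> 2 * (lam + 1) * (\<delta> * V + D * \<eta>)"
      using mu mv d lam \<delta> D by (intro mult_left_mono add_mono) (auto simp: V_def)
    also have "\<dots> = e"
    proof -
      have cancel: "L * (e / (4 * L * X) * X) = e / 4" if "0 < L" "0 < X" for L X :: real
        using that by (simp add: field_simps)
      have "(lam + 1) * (\<delta> * V) = e / 4" "(lam + 1) * (\<eta> * D) = e / 4"
        unfolding \<delta>_def \<eta>_def using lam V D by (intro cancel; simp)+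
      then show ?thesis by (simp add: algebra_simps)
    qed
    finally show ?thesis .
  qed
  then show ?thesis using \<eta> by blast
qed

text \<open>
  Passage to the limit in the nonlinear term. Up to an error that vanishes in the mean, the
  integrands are bounded by the fixed integrable function \<open>h\<close>; after clipping them to \<open>[-h, h]\<close> dominated
  convergence applies.
\<close>

lemma reaction_tendsto:
  assumes u: "\<And>n. u n \<in> Lp p" "u' \<in> Lp p" and w: "\<And>n. w n \<in> Lp p" "w' \<in> Lp p"
    and lu: "(\<lambda>n. moment p (\<lambda>x. u n x - u' x)) \<longlonglongrightarrow> 0" and lw: "(\<lambda>n. moment p (\<lambda>x. w n x - w' x)) \<longlonglongrightarrow> 0"
    and au: "AE x in torus. (\<lambda>n. u n x) \<longlonglongrightarrow> u' x" and aw: "AE x in torus. (\<lambda>n. w n x) \<longlonglongrightarrow> w' x"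
  shows "(\<lambda>n. LINT x|torus. g (u n x) * w n x) \<longlonglongrightarrow> (LINT x|torus. g (u' x) * w' x)"
proof -
  have [measurable]: "u n \<in> borel_measurable torus" "u' \<in> borel_measurable torus"
    "w n \<in> borel_measurable torus" "w' \<in> borel_measurable torus" for n
    using u w by (auto simp: Lp_def)
  define C where "C = (lam + 1) * (2 * 2 powr p)"
  have C: "0 \<le> C" using lam by (simp add: C_def)
  define h where "h x = (lam + 1) + C * (\<bar>u' x\<bar> powr p + \<bar>w' x\<bar> powr p)" for x
  define r where "r n x = C * (\<bar>u n x - u' x\<bar> powr p + \<bar>w n x - w' x\<bar> powr p)" for n x
  have dL: "(\<lambda>x. u n x - u' x) \<in> Lp p" "(\<lambda>x. w n x - w' x) \<in> Lp p" for n
    using Lp_lincomb[OF u(1) u(2), where \<alpha> = 1 and \<beta> = "-1"] Lp_lincomb[OF w(1) w(2), where \<alpha> = 1 and \<beta> = "-1"] p by simp_all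
  have h: "integrable torus h" unfolding h_def using u(2) w(2) by (simp add: Lp_def)
  have h0: "0 \<le> h x" for x using C lam by (simp add: h_def)
  have r: "integrable torus (r n)" for n unfolding r_def using dL by (simp add: Lp_def)
  have rl: "(\<lambda>n. LINT x|torus. r n x) \<longlonglongrightarrow> 0"
  proof -
    have "(LINT x|torus. r n x) = C * (moment p (\<lambda>x. u n x - u' x) + moment p (\<lambda>x. w n x - w' x))" for n
      using dL by (simp add: r_def moment_def Lp_def)
    then show ?thesis using lu lw by (auto intro!: tendsto_eq_intros)
  qed
  define f where "f n x = g (u n x) * w n x" for n x
  define f' where "f' x = g (u' x) * w' x" for x
  have fi: "integrable torus (f n)" "integrable torus f'" for n
    unfolding f_def f'_def using u w by (auto intro: reaction_integrable)
  have [measurable]: "f n \<in> borel_measurable torus" "f' \<in> borel_measurable torus" "h \<in> borel_measurable torus" for n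
    using fi h by auto
  have fb: "\<bar>f n x\<bar> \<le> h x + r n x" for n x
  proof -
    let ?P = "2 powr p"
    have a: "\<bar>u n x\<bar> powr p \<le> ?P * (\<bar>u' x\<bar> powr p + \<bar>u n x - u' x\<bar> powr p)"
      using abs_add_powr[of p "u' x" "u n x - u' x"] p by simp
    have b: "\<bar>w n x\<bar> powr p \<le> ?P * (\<bar>w' x\<bar> powr p + \<bar>w n x - w' x\<bar> powr p)"
      using abs_add_powr[of p "w' x" "w n x - w' x"] p by simp
    have "0 \<le> ?P * (\<bar>u' x\<bar> powr p + \<bar>u n x - u' x\<bar> powr p)" by simp
    then have "1 + \<bar>u n x\<bar> powr p + 2 * \<bar>w n x\<bar> powr p
        \<le> 1 + 2 * (?P * (\<bar>u' x\<bar> powr p + \<bar>u n x - u' x\<bar> powr p)) + 2 * (?P * (\<bar>w' x\<bar> powr p + \<bar>w n x - w' x\<bar> powr p))"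
      using a b by linarith
    then have "(lam + 1) * (1 + \<bar>u n x\<bar> powr p + 2 * \<bar>w n x\<bar> powr p)
        \<le> (lam + 1) * (1 + 2 * (?P * (\<bar>u' x\<bar> powr p + \<bar>u n x - u' x\<bar> powr p)) + 2 * (?P * (\<bar>w' x\<bar> powr p + \<bar>w n x - w' x\<bar> powr p)))"
      using lam by (intro mult_left_mono) auto
    also have "\<dots> = h x + r n x" by (simp add: h_def r_def C_def algebra_simps)
    finally show ?thesis using reaction_product_bound[of "u n x" "w n x"] by (simp add: f_def)
  qed
  have f'b: "\<bar>f' x\<bar> \<le> h x" for x
  proof -
    have "1 \<le> 2 powr p" using p by (simp add: ge_one_powr_ge_zero)
    then have "\<bar>u' x\<bar> powr p * 1 \<le> \<bar>u' x\<bar> powr p * (2 powr p * 2)" "2 * \<bar>w' x\<bar> powr p * 1 \<le> 2 * \<bar>w' x\<bar> powr p * 2 powr p"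
      by (intro mult_left_mono; simp)+
    then have "1 + \<bar>u' x\<bar> powr p + 2 * \<bar>w' x\<bar> powr p \<le> 1 + 2 * 2 powr p * (\<bar>u' x\<bar> powr p + \<bar>w' x\<bar> powr p)"
      by (simp add: algebra_simps)
    then have "(lam + 1) * (1 + \<bar>u' x\<bar> powr p + 2 * \<bar>w' x\<bar> powr p) \<le> (lam + 1) * (1 + 2 * 2 powr p * (\<bar>u' x\<bar> powr p + \<bar>w' x\<bar> powr p))"
      using lam by (intro mult_left_mono) auto
    also have "\<dots> = h x" by (simp add: h_def C_def algebra_simps)
    finally show ?thesis using reaction_product_bound[of "u' x" "w' x"] by (simp add: f'_def)
  qed
  define c where "c n x = max (- h x) (min (h x) (f n x))" for n x
  have [measurable]: "c n \<in> borel_measurable torus" for n unfolding c_def by measurable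
  have ci: "integrable torus (c n)" for n
    by (rule Bochner_Integration.integrable_bound[OF h]) (auto simp: c_def intro!: AE_I2 dest!: h0[THEN order_trans])
  have r0: "0 \<le> r n x" for n x using C by (simp add: r_def)
  have cr: "\<bar>f n x - c n x\<bar> \<le> r n x" for n x
    using fb[of n x] h0[of x] r0[of n x] by (auto simp: c_def max_def min_def)
  have "(\<lambda>n. LINT x|torus. c n x) \<longlonglongrightarrow> (LINT x|torus. f' x)"
  proof (rule integral_dominated_convergence[OF _ _ h])
    show "AE x in torus. (\<lambda>n. c n x) \<longlonglongrightarrow> f' x"
      using au aw
    proof eventually_elim
      case (elim x)
      have gc: "isCont g t" for t
      proof -
        have nz: "isCont (\<lambda>t. \<bar>t\<bar> powr (r - 2) * t) t" if r: "1 < r" for r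
        proof (cases "t = 0")
          case False
          then show ?thesis by (intro continuous_intros) auto
        next
          case True
          have "((\<lambda>t. \<bar>t\<bar> powr (r - 1)) \<longlongrightarrow> \<bar>0 :: real\<bar> powr (r - 1)) (at 0)"
            using r by (intro tendsto_powr2 tendsto_intros) auto
          then have "((\<lambda>t. \<bar>t\<bar> powr (r - 2) * t) \<longlongrightarrow> 0) (at (0 :: real))"
            by (intro tendsto_rabs_zero_cancel[of "\<lambda>t. \<bar>t\<bar> powr (r - 2) * t"]) (simp add: abs_power_derivative)
          then show ?thesis using True by (simp add: isCont_def)
        qed
        have "isCont (\<lambda>t. \<bar>t\<bar> powr (p - 2) * t) t" using nz p by simp
        from continuous_add[OF continuous_mult[OF continuous_const nz[OF q(1)]] this]
        show ?thesis unfolding reaction_def[abs_def] .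
      qed
      have "(\<lambda>n. f n x) \<longlonglongrightarrow> f' x"
        unfolding f_def f'_def by (intro tendsto_mult elim(2) isCont_tendsto_compose[OF gc elim(1)])
      then have "(\<lambda>n. c n x) \<longlonglongrightarrow> max (- h x) (min (h x) (f' x))"
        unfolding c_def by (intro tendsto_intros)
      also have "max (- h x) (min (h x) (f' x)) = f' x" using f'b[of x] by (auto simp: max_def min_def)
      finally show ?case .
    qed
    show "AE x in torus. norm (c n x) \<le> h x" for n using h0 by (intro AE_I2) (auto simp: c_def max_def min_def)
  qed auto
  moreover have "(\<lambda>n. (LINT x|torus. f n x) - (LINT x|torus. c n x)) \<longlonglongrightarrow> 0"
  proof (rule Lim_null_comparison[OF _ rl])
    have "\<bar>(LINT x|torus. f n x) - (LINT x|torus. c n x)\<bar> \<le> (LINT x|torus. r n x)" for n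
    proof -
      have "\<bar>(LINT x|torus. f n x) - (LINT x|torus. c n x)\<bar> = \<bar>LINT x|torus. f n x - c n x\<bar>"
        using fi ci by simp
      also have "\<dots> \<le> (LINT x|torus. \<bar>f n x - c n x\<bar>)" by (rule integral_abs_bound)
      also have "\<dots> \<le> (LINT x|torus. r n x)" using fi ci r cr by (intro integral_mono) auto
      finally show ?thesis .
    qed
    then show "\<forall>\<^sub>F n in sequentially. norm ((LINT x|torus. f n x) - (LINT x|torus. c n x)) \<le> (LINT x|torus. r n x)"
      by simp
  qed
  ultimately have "(\<lambda>n. ((LINT x|torus. f n x) - (LINT x|torus. c n x)) + (LINT x|torus. c n x)) \<longlonglongrightarrow> 0 + (LINT x|torus. f' x)"
    by (intro tendsto_add)
  then show ?thesis by (simp add: f_def f'_def)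
qed

end

section \<open>Critical sequences and weak solutions\<close>

lemma Hs_sobolev_class: "u \<in> Hs s m \<Longrightarrow> cplx u \<in> sobolev_class s m"
  by (simp add: Hs_iff)

lemma moment_minus_commute: "moment p (\<lambda>x. u x - v x) = moment p (\<lambda>x. v x - u x)"
  by (simp add: moment_def abs_minus_commute)

lemma X_norm_sq:
  assumes "0 < s" "s < 1"
  shows "(X_norm s m W)\<^sup>2 = X_inner s m W W"
proof -
  have "0 \<le> X_inner s m W W"
    using kappa_pos[OF assms] by (simp add: X_inner_l2 l2_inner_self_nonneg)
  then show ?thesis by (simp add: X_norm_def)
qed

locale fractional =
  fixes s m p :: real
  assumes s: "3 / 4 < s" "s < 1" and m: "0 < m" and p4: "4 < p" and p_subcritical: "p < 6 / (3 - 2 * s)"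
begin

lemma s0: "0 < s" using s by simp

lemma exponent_gap: "2 < p" "p * (3 / 2 - s) < 3"
  using p4 p_subcritical s by (auto simp: field_simps)

text \<open>
  Below the critical exponent \<open>6 / (3 - 2 s)\<close> the condition \<open>p (3/2 - s) < 3\<close> of the Sobolev inequality holds.
\<close>

lemma Lp_embedding:
  "\<exists>C>0. \<forall>u. cplx u \<in> sobolev_class s m \<longrightarrow> u \<in> Lp p \<and> moment p u \<le> C * sobolev_sum s m (cplx u) powr (p / 2)"
proof -
  obtain C where C: "0 < C" and CS: "\<And>f. f \<in> sobolev_class s m \<Longrightarrow> integrable torus (\<lambda>x. cmod (f x) powr p) \<and>
    (LINT x|torus. cmod (f x) powr p) \<le> C * sobolev_sum s m f powr (p / 2)"
    using Sobolev[OF m s0 exponent_gap] by blast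
  have "u \<in> Lp p \<and> moment p u \<le> C * sobolev_sum s m (cplx u) powr (p / 2)" if u: "cplx u \<in> sobolev_class s m" for u
  proof -
    have "u \<in> borel_measurable torus"
      using u cplx_L2_iff L2_measurable by (auto simp: sobolev_class_def)
    then show ?thesis using CS[OF u] by (simp add: Lp_def moment_def)
  qed
  then show ?thesis using C by blast
qed

lemma Hs_convergence:
  assumes u: "u \<in> Hs s m" and w: "\<And>n. w n \<in> Hs s m" and l: "(\<lambda>n. Hs_norm s m (\<lambda>x. u x - w n x)) \<longlonglongrightarrow> 0"
  shows "u \<in> Lp p" "w n \<in> Lp p" "(\<lambda>n. moment p (\<lambda>x. w n x - u x)) \<longlonglongrightarrow> 0"
    "\<exists>r. strict_mono r \<and> (AE x in torus. (\<lambda>n. w (r n) x) \<longlonglongrightarrow> u x)"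
    "(\<lambda>n. mode_coeff (cplx (w n)) k) \<longlonglongrightarrow> mode_coeff (cplx u) k"
proof -
  obtain C where C: "0 < C" and CE: "\<And>u. cplx u \<in> sobolev_class s m \<Longrightarrow> u \<in> Lp p"
    and CM: "\<And>u. cplx u \<in> sobolev_class s m \<Longrightarrow> moment p u \<le> C * sobolev_sum s m (cplx u) powr (p / 2)"
    using Lp_embedding by blast
  note cu = Hs_sobolev_class[OF u] and cw = Hs_sobolev_class[OF w]
  show "u \<in> Lp p" "w n \<in> Lp p" by (intro CE cu cw)+
  have d: "cplx (\<lambda>x. u x - w n x) \<in> sobolev_class s m" for n using sobolev_class_diff[OF cu cw] by simp
  have sq: "sobolev_sum s m (cplx (\<lambda>x. u x - w n x)) = (Hs_norm s m (\<lambda>x. u x - w n x))\<^sup>2" for n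
    by (simp add: Hs_norm_eq sobolev_sum_nonneg)
  have ss: "(\<lambda>n. sobolev_sum s m (cplx (\<lambda>x. u x - w n x))) \<longlonglongrightarrow> 0"
    unfolding sq using l by (auto intro!: tendsto_eq_intros)
  show "(\<lambda>n. moment p (\<lambda>x. w n x - u x)) \<longlonglongrightarrow> 0"
  proof (rule Lim_null_comparison)
    have "norm (moment p (\<lambda>x. w n x - u x)) \<le> C * sobolev_sum s m (cplx (\<lambda>x. u x - w n x)) powr (p / 2)" for n
      using CM[OF d[of n]] moment_nonneg[of p] by (simp add: moment_minus_commute[of p "w n" u])
    then show "\<forall>\<^sub>F n in sequentially. norm (moment p (\<lambda>x. w n x - u x)) \<le> C * sobolev_sum s m (cplx (\<lambda>x. u x - w n x)) powr (p / 2)"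
      by simp
    have "(\<lambda>n. C * sobolev_sum s m (cplx (\<lambda>x. u x - w n x)) powr (p / 2)) \<longlonglongrightarrow> C * 0 powr (p / 2)"
      using p4 by (intro tendsto_mult tendsto_const tendsto_powr2 ss) (auto simp: sobolev_sum_nonneg)
    then show "(\<lambda>n. C * sobolev_sum s m (cplx (\<lambda>x. u x - w n x)) powr (p / 2)) \<longlonglongrightarrow> 0" by simp
  qed
  have Lu: "u \<in> L2 torus" "cplx u \<in> L2 torus" using cu by (auto simp: sobolev_class_def cplx_L2_iff)
  have Lw: "w n \<in> L2 torus" "cplx (w n) \<in> L2 torus" for n using cw by (auto simp: sobolev_class_def cplx_L2_iff)
  have l2: "(\<lambda>n. l2_norm torus (\<lambda>x. w n x - u x)) \<longlonglongrightarrow> 0"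
  proof -
    have "(\<lambda>n. (l2_norm torus (\<lambda>x. w n x - u x))\<^sup>2) \<longlonglongrightarrow> 0"
    proof (rule Lim_null_comparison)
      have "(l2_norm torus (\<lambda>x. w n x - u x))\<^sup>2 \<le> (m\<^sup>2) powr (- s) * sobolev_sum s m (cplx (\<lambda>x. u x - w n x))" for n
        using l2_le_sobolev_sum[OF m s0 d[of n]] l2_norm_cplx_diff[of u "w n"] l2_norm_minus_commute[of torus u "w n"] by simp
      then show "\<forall>\<^sub>F n in sequentially. norm ((l2_norm torus (\<lambda>x. w n x - u x))\<^sup>2) \<le> (m\<^sup>2) powr (- s) * sobolev_sum s m (cplx (\<lambda>x. u x - w n x))"
        by simp
      show "(\<lambda>n. (m\<^sup>2) powr (- s) * sobolev_sum s m (cplx (\<lambda>x. u x - w n x))) \<longlonglongrightarrow> 0"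
        using tendsto_mult_right_zero[OF ss] by simp
    qed
    from tendsto_real_sqrt[OF this] show ?thesis by (simp add: l2_norm_nonneg)
  qed
  show "\<exists>r. strict_mono r \<and> (AE x in torus. (\<lambda>n. w (r n) x) \<longlonglongrightarrow> u x)"
    by (rule l2_AE_subseq[OF Lw(1) Lu(1) l2])
  show "(\<lambda>n. mode_coeff (cplx (w n)) k) \<longlonglongrightarrow> mode_coeff (cplx u) k"
    by (rule coeff_tendsto[OF Lw(2) Lu(2)]) (simp add: l2_norm_cplx_diff l2)
qed

end

locale kirchhoff = fractional s m p + concave_convex q p lam for s m p q lam :: real +
  fixes a b :: real
  assumes a: "0 < a" and b: "0 < b"
begin

abbreviation react :: "(real ^ 3 \<Rightarrow> real) \<Rightarrow> (real ^ 3 \<Rightarrow> real) \<Rightarrow> real" where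
  "react u w \<equiv> (LINT x|torus. g (u x) * w x)"

text \<open>
  The form is continuous in \<open>\<bbbX>\<^sup>s\<close>, and the boundary values converge in \<open>L\<^sup>p\<close> and, along a subsequence, almost
  everywhere. Hence each term of the equation has a limit, first for a fixed smooth test function and
  then, by density, along smooth functions that approximate an arbitrary one.
\<close>

lemma critical_sequence_solution:
  assumes \<phi>: "\<And>n. \<phi> n \<in> smooth_periodic s"
    and cau: "\<And>e. 0 < e \<Longrightarrow> \<exists>N. \<forall>i\<ge>N. \<forall>j\<ge>N. form s m (\<lambda>p. \<phi> i p - \<phi> j p) (\<lambda>p. \<phi> i p - \<phi> j p) < e"
    and res: "\<And>\<psi>. \<psi> \<in> smooth_periodic s \<Longrightarrow>
      (\<lambda>n. (a + b * form s m (\<phi> n) (\<phi> n)) * form s m (\<phi> n) \<psi> - react (\<lambda>x. \<phi> n (x, 0)) (\<lambda>x. \<psi> (x, 0))) \<longlonglongrightarrow> 0"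
  obtains u where "weak_solution s a b m q p lam u" "\<And>k. (\<lambda>n. mode_coeff (cplx (\<lambda>x. \<phi> n (x, 0))) k) \<longlonglongrightarrow> mode_coeff (cplx u) k"
proof -
  obtain W u where W: "W \<in> Xs s m" "X_approx s m W \<phi>" and u: "u \<in> Hs s m" "has_trace s m W u"
    and ul: "(\<lambda>n. Hs_norm s m (\<lambda>x. u x - \<phi> n (x, 0))) \<longlonglongrightarrow> 0"
    by (rule Cauchy_has_trace[OF m s0 s(2) \<phi> cau])
  have WL: "W \<in> weighted_L2 s" using W by (simp add: Xs_def)
  have tr: "(\<lambda>x. \<psi> (x, 0)) \<in> Hs s m" if "\<psi> \<in> smooth_periodic s" for \<psi>
    by (rule smooth_trace_Hs[OF that m s0 s(2)])
  note con = Hs_convergence[OF u(1) tr[OF \<phi>] ul]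
  obtain r where r: "strict_mono r" "AE x in torus. (\<lambda>n. \<phi> (r n) (x, 0)) \<longlonglongrightarrow> u x"
    using con(4) by blast
  let ?A = "a + b * (X_norm s m W)\<^sup>2"
  have smooth: "?A * X_inner s m W (\<psi>, grad \<psi>) = react u (\<lambda>x. \<psi> (x, 0))" if \<psi>: "\<psi> \<in> smooth_periodic s" for \<psi>
  proof -
    have "(\<psi>, grad \<psi>) \<in> weighted_L2 s" using \<psi> by (simp add: smooth_periodic_def)
    moreover have "X_approx s m (\<psi>, grad \<psi>) (\<lambda>_. \<psi>)"
      using \<psi> by (simp add: X_approx_iff[OF s0 s(2)] smooth_field_def l2_norm_def l2_inner_def)
    ultimately have "(\<lambda>n. form s m (\<phi> n) \<psi>) \<longlonglongrightarrow> X_inner s m W (\<psi>, grad \<psi>)"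
      using X_inner_tendsto[OF s0 s(2) m WL W(2)] by blast
    moreover have "(\<lambda>n. form s m (\<phi> n) (\<phi> n)) \<longlonglongrightarrow> (X_norm s m W)\<^sup>2"
      unfolding X_norm_sq[OF s0 s(2)] by (rule X_inner_tendsto[OF s0 s(2) m WL W(2) WL W(2)])
    ultimately have 1: "(\<lambda>n. (a + b * form s m (\<phi> n) (\<phi> n)) * form s m (\<phi> n) \<psi>) \<longlonglongrightarrow> ?A * X_inner s m W (\<psi>, grad \<psi>)"
      by (intro tendsto_intros)
    have \<psi>L: "(\<lambda>x. \<psi> (x, 0)) \<in> Lp p"
      using slice_continuous[OF smooth_periodicD(2)[OF \<psi>], of 0] p4 by (intro continuous_Lp) auto
    have "(\<lambda>n. react (\<lambda>x. \<phi> (r n) (x, 0)) (\<lambda>x. \<psi> (x, 0))) \<longlonglongrightarrow> react u (\<lambda>x. \<psi> (x, 0))"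
    proof (rule reaction_tendsto[OF con(2) con(1) \<psi>L \<psi>L])
      show "(\<lambda>n. moment p (\<lambda>x. \<phi> (r n) (x, 0) - u x)) \<longlonglongrightarrow> 0"
        using LIMSEQ_subseq_LIMSEQ[OF con(3) r(1)] by (simp add: o_def)
    qed (use r(2) p4 in \<open>auto simp: moment_def\<close>)
    from tendsto_diff[OF LIMSEQ_subseq_LIMSEQ[OF 1 r(1)] this] LIMSEQ_subseq_LIMSEQ[OF res[OF \<psi>] r(1)]
    have "?A * X_inner s m W (\<psi>, grad \<psi>) - react u (\<lambda>x. \<psi> (x, 0)) = 0"
      unfolding o_def by (rule LIMSEQ_unique)
    then show ?thesis by simp
  qed
  have "?A * X_inner s m W V = react u v" if tV: "has_trace s m V v" for V v
  proof -
    obtain \<psi> where V: "V \<in> Xs s m" "v \<in> Hs s m" "X_approx s m V \<psi>"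
      and vl: "(\<lambda>n. Hs_norm s m (\<lambda>x. v x - \<psi> n (x, 0))) \<longlonglongrightarrow> 0"
      using tV unfolding has_trace_def by blast
    have \<psi>: "\<psi> n \<in> smooth_periodic s" for n using V(3) by (simp add: X_approx_def)
    note cov = Hs_convergence[OF V(2) tr[OF \<psi>] vl]
    obtain r' where r': "strict_mono r'" "AE x in torus. (\<lambda>n. \<psi> (r' n) (x, 0)) \<longlonglongrightarrow> v x"
      using cov(4) by blast
    have "(\<lambda>n. X_inner s m W (\<psi> n, grad (\<psi> n))) \<longlonglongrightarrow> X_inner s m W V"
      unfolding X_inner_l2 smooth_field_def[symmetric]
    proof (intro tendsto_mult tendsto_const l2_inner_tendsto)
      show "jet_field m W \<in> L2 (cyl_measure s)" "jet_field m V \<in> L2 (cyl_measure s)"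
        using WL V(1) by (auto simp: weighted_L2_iff[OF m, symmetric] Xs_def)
      show "smooth_field m (\<psi> n) \<in> L2 (cyl_measure s)" for n by (rule smooth_periodicD(3)[OF \<psi> m])
      show "(\<lambda>n. l2_norm (cyl_measure s) (\<lambda>x. smooth_field m (\<psi> n) x - jet_field m V x)) \<longlonglongrightarrow> 0"
        using V(3) by (simp add: X_approx_iff[OF s0 s(2)])
      show "jet_field m W \<in> L2 (cyl_measure s)" for n :: nat using WL by (simp add: weighted_L2_iff[OF m])
    qed (simp add: l2_norm_def l2_inner_def)
    then have 1: "(\<lambda>n. ?A * X_inner s m W (\<psi> n, grad (\<psi> n))) \<longlonglongrightarrow> ?A * X_inner s m W V"
      by (intro tendsto_intros)
    have "(\<lambda>n. react u (\<lambda>x. \<psi> (r' n) (x, 0))) \<longlonglongrightarrow> react u v"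
    proof (rule reaction_tendsto[OF con(1) con(1) cov(2) cov(1)])
      show "(\<lambda>n. moment p (\<lambda>x. \<psi> (r' n) (x, 0) - v x)) \<longlonglongrightarrow> 0"
        using LIMSEQ_subseq_LIMSEQ[OF cov(3) r'(1)] by (simp add: o_def)
    qed (use r'(2) p4 in \<open>auto simp: moment_def\<close>)
    moreover have "(\<lambda>n. react u (\<lambda>x. \<psi> (r' n) (x, 0))) \<longlonglongrightarrow> ?A * X_inner s m W V"
      using LIMSEQ_subseq_LIMSEQ[OF 1 r'(1)] by (simp add: o_def smooth[OF \<psi>])
    ultimately show ?thesis using LIMSEQ_unique by blast
  qed
  then have "weak_solution s a b m q p lam u"
    unfolding weak_solution_def LINT_cube reaction_def[symmetric] using u W(1) by blast
  then show ?thesis using that con(5) by blast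
qed

end

section \<open>Translations and symmetry\<close>

definition bd :: "((real ^ 3) \<times> real \<Rightarrow> real) \<Rightarrow> real ^ 3 \<Rightarrow> real" where
  "bd \<phi> = (\<lambda>x. \<phi> (x, 0))"

definition shift :: "real ^ 3 \<Rightarrow> ((real ^ 3) \<times> real \<Rightarrow> real) \<Rightarrow> (real ^ 3) \<times> real \<Rightarrow> real" where
  "shift t \<phi> = (\<lambda>p. \<phi> (p + (t, 0)))"

lemma shift_smooth: "\<phi> \<in> smooth_periodic s \<Longrightarrow> shift t \<phi> \<in> smooth_periodic s"
  unfolding shift_def by (rule smooth_periodic_translate)

lemma shift_shift: "shift t (shift t' \<phi>) = shift (t + t') \<phi>"
  by (simp add: shift_def add.assoc)

lemma shift_0: "shift 0 \<phi> = \<phi>"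
  by (simp add: shift_def flip: zero_prod_def)

lemma form_shift_right:
  assumes "0 < m" "\<phi> \<in> smooth_periodic s" "\<psi> \<in> smooth_periodic s"
  shows "form s m \<phi> (shift t \<psi>) = form s m (shift (- t) \<phi>) \<psi>"
proof -
  have "form s m (shift (- t) \<phi>) (shift (- t) (shift t \<psi>)) = form s m \<phi> (shift t \<psi>)"
    unfolding shift_def[of "- t"] by (rule form_translate[OF assms(1,2) shift_smooth[OF assms(3)]])
  then show ?thesis by (simp add: shift_shift shift_0)
qed

lemma form_cong:
  assumes \<phi>: "C1 \<phi>" and e: "\<And>p. p \<in> closed_half \<Longrightarrow> \<phi> p = \<phi>' p" and \<phi>': "C1 \<phi>'"
  shows "form s m \<phi> \<psi> = form s m \<phi>' \<psi>"
proof -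
  have "smooth_field m \<phi> p = smooth_field m \<phi>' p" if p: "p \<in> open_half" for p
  proof -
    have ph: "p \<in> closed_half" using p by auto
    have "pd \<phi>' v p = pd \<phi> v p" for v by (rule pd_cong[OF e C1_differentiable[OF \<phi>] ph])
    then show ?thesis using e[OF ph] p by (simp add: smooth_field_def jet_field_def grad_pd[OF \<phi>] grad_pd[OF \<phi>'])
  qed
  then show ?thesis unfolding form_l2 by (intro arg_cong[where f = "(*) _"] l2_inner_cong) auto
qed

lemma bd_continuous: "\<phi> \<in> smooth_periodic s \<Longrightarrow> continuous_on UNIV (bd \<phi>)"
  unfolding bd_def by (rule slice_continuous[OF smooth_periodicD(2)]) simp_all

lemma bd_lattice: "\<phi> \<in> smooth_periodic s \<Longrightarrow> bd \<phi> (x + lattice n) = bd \<phi> x"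
  using smooth_periodicD(5)[of \<phi> s "(x, 0)" n] by (simp add: bd_def)

lemma bd_shift: "bd (shift t \<phi>) = (\<lambda>x. bd \<phi> (x + t))"
  by (simp add: bd_def shift_def)

lemma coeff_bd_shift:
  assumes "\<phi> \<in> smooth_periodic s"
  shows "mode_coeff (cplx (bd (shift t \<phi>))) k = cis (kdot k t) * mode_coeff (cplx (bd \<phi>)) k"
  unfolding bd_shift using bd_lattice[OF assms] bd_continuous[OF assms]
  by (intro coeff_translate) (auto simp: cplx_measurable_iff intro!: borel_measurable_continuous_onI)

section \<open>A decaying wave\<close>

text \<open>An explicit antiperiodic function of finite energy. Its small multiples will have negative energy.\<close>

definition wave :: "(real ^ 3) \<times> real \<Rightarrow> real" where
  "wave p = exp (- snd p) * cos (fst p $ 1)"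

lemma wave_smooth_on: "smooth_on closed_half wave"
  unfolding smooth_on_def using Ck_on_wave[of _ 1 0] by (simp add: wave_def[abs_def])

lemma pd_wave:
  assumes "p \<in> closed_half"
  shows "pd wave v p = - exp (- snd p) * (snd v * cos (fst p $ 1) + fst v $ 1 * sin (fst p $ 1))"
proof -
  have d: "(wave has_derivative (\<lambda>v. - exp (- snd p) * (snd v * cos (fst p $ 1) + fst v $ 1 * sin (fst p $ 1)))) (at p within closed_half)"
    unfolding wave_def[abs_def]
    by (rule derivative_eq_intros bounded_linear.has_derivative[OF bounded_linear_vec_nth] refl)+
      (auto simp: fun_eq_iff algebra_simps)
  show ?thesis unfolding pd_def half_derivative_unique[OF assms d] ..
qed

lemma norm_wave_field:
  assumes "p \<in> open_half"
  shows "(norm (smooth_field 1 wave p))\<^sup>2 \<le> 2 * exp (- snd p)"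
proof -
  have ph: "p \<in> closed_half" using assms by auto
  have y: "0 < snd p" using assms by auto
  let ?e = "exp (- snd p)" and ?c = "cos (fst p $ 1)" and ?s = "sin (fst p $ 1)"
  have "(norm (smooth_field 1 wave p))\<^sup>2 = (?e * ?c)\<^sup>2 + ((\<Sum>i\<in>UNIV. (?e * ((axis i 1 :: real ^ 3) $ 1 * ?s))\<^sup>2) + (?e * ?c)\<^sup>2)"
    by (simp add: norm_smooth_field norm_grad[OF smooth_on_C1[OF wave_smooth_on] assms] pd_wave[OF ph] wave_def)
  also have "(\<Sum>i\<in>UNIV. (?e * ((axis i 1 :: real ^ 3) $ 1 * ?s))\<^sup>2) = (?e * ?s)\<^sup>2"
    by (simp add: sum_3 axis_def)
  also have "(?e * ?c)\<^sup>2 + ((?e * ?s)\<^sup>2 + (?e * ?c)\<^sup>2) = ?e\<^sup>2 * ((?s\<^sup>2 + ?c\<^sup>2) + ?c\<^sup>2)"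
    by (simp only: power_mult_distrib distrib_left add_ac)
  also have "\<dots> \<le> ?e\<^sup>2 * 2" by (intro mult_left_mono) (simp_all add: abs_square_le_1)
  also have "?e\<^sup>2 \<le> ?e * 1" unfolding power2_eq_square using y by (intro mult_left_mono) auto
  finally show ?thesis by simp
qed

text \<open>
  The energy is dominated by a multiple of \<open>\<integral> y\<^sup>1\<^sup>-\<^sup>2\<^sup>s e\<^sup>-\<^sup>y dy = \<Gamma>(2 - 2 s)\<close>.
\<close>

lemma wave_smooth_periodic:
  assumes s: "0 < s" "s < 1"
  shows "wave \<in> smooth_periodic s"
proof -
  note c = smooth_on_C1[OF wave_smooth_on]
  have "smooth_field 1 wave \<in> L2 (cyl_measure s)"
    unfolding L2_def
  proof (intro CollectI conjI integrableI_bounded)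
    show "smooth_field 1 wave \<in> borel_measurable (cyl_measure s)"
      by (rule continuous_cyl[OF continuous_smooth_field[OF c]])
    then show "(\<lambda>p. (norm (smooth_field 1 wave p))\<^sup>2) \<in> borel_measurable (cyl_measure s)" by measurable
    have "(\<integral>\<^sup>+p. ennreal (norm ((norm (smooth_field 1 wave p))\<^sup>2)) \<partial>cyl_measure s)
        = (\<integral>\<^sup>+y. indicator {0<..} y * ennreal (y powr (1 - 2 * s))
            * (\<integral>\<^sup>+x. ennreal ((norm (smooth_field 1 wave (x, y)))\<^sup>2) \<partial>torus) \<partial>lborel)"
      unfolding nn_energy_slices[OF c, symmetric] by (intro nn_integral_cong) simp
    also have "\<dots> \<le> (\<integral>\<^sup>+y. ennreal (2 * (2 * pi) ^ 3) * (ennreal (y powr ((2 - 2 * s) - 1) / exp y) * indicator {0..} y) \<partial>lborel)"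
    proof (rule nn_integral_mono)
      fix y :: real
      show "indicator {0<..} y * ennreal (y powr (1 - 2 * s)) * (\<integral>\<^sup>+x. ennreal ((norm (smooth_field 1 wave (x, y)))\<^sup>2) \<partial>torus)
        \<le> ennreal (2 * (2 * pi) ^ 3) * (ennreal (y powr ((2 - 2 * s) - 1) / exp y) * indicator {0..} y)"
      proof (cases "0 < y")
        case True
        have "(\<integral>\<^sup>+x. ennreal ((norm (smooth_field 1 wave (x, y)))\<^sup>2) \<partial>torus) \<le> (\<integral>\<^sup>+x. ennreal (2 * exp (- y)) \<partial>torus)"
        proof (intro nn_integral_mono ennreal_leI)
          fix x :: "real ^ 3"
          show "(norm (smooth_field 1 wave (x, y)))\<^sup>2 \<le> 2 * exp (- y)"
            using norm_wave_field[of "(x, y)"] True by simp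
        qed
        also have "\<dots> = ennreal (2 * exp (- y)) * ennreal ((2 * pi) ^ 3)"
          by (simp add: torus.emeasure_eq_measure measure_torus)
        also have "\<dots> = ennreal (2 * (2 * pi) ^ 3 * exp (- y))" by (simp add: ennreal_mult[symmetric] mult_ac)
        finally have "ennreal (y powr (1 - 2 * s)) * (\<integral>\<^sup>+x. ennreal ((norm (smooth_field 1 wave (x, y)))\<^sup>2) \<partial>torus)
            \<le> ennreal (y powr (1 - 2 * s)) * ennreal (2 * (2 * pi) ^ 3 * exp (- y))" by (rule mult_left_mono) simp
        also have "\<dots> = ennreal (2 * (2 * pi) ^ 3) * ennreal (y powr ((2 - 2 * s) - 1) / exp y)"
          by (simp add: ennreal_mult[symmetric] exp_minus divide_inverse mult_ac)
        finally show ?thesis using True by simp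
      qed simp
    qed
    also have "\<dots> = ennreal (2 * (2 * pi) ^ 3) * (\<integral>\<^sup>+y. ennreal (y powr ((2 - 2 * s) - 1) / exp y) * indicator {0..} y \<partial>lborel)"
      by (rule nn_integral_cmult) measurable
    also have "(\<integral>\<^sup>+y. ennreal (y powr ((2 - 2 * s) - 1) / exp y) * indicator {0..} y \<partial>lborel) = ennreal (Gamma (2 - 2 * s))"
      using s by (intro nn_integral_has_integral_lebesgue' Gamma_integral_real) auto
    also have "ennreal (2 * (2 * pi) ^ 3) * ennreal (Gamma (2 - 2 * s)) < \<infinity>" by (simp add: ennreal_mult_less_top)
    finally show "(\<integral>\<^sup>+p. ennreal (norm ((norm (smooth_field 1 wave p))\<^sup>2)) \<partial>cyl_measure s) < \<infinity>" .
  qed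
  moreover have "periodic (\<lambda>x. wave (x, y))" for y
    unfolding periodic_def
  proof (intro allI)
    fix x :: "real ^ 3" and i :: 3
    show "wave (x + (2 * pi) *\<^sub>R axis i 1, y) = wave (x, y)"
      by (cases "i = 1") (auto simp: wave_def axis_def)
  qed
  ultimately show ?thesis
    using wave_smooth_on by (simp add: smooth_periodic_def smooth_field_def weighted_L2_iff[of 1])
qed

section \<open>Functions that change sign under half a period\<close>

abbreviation half_period :: "real ^ 3" where "half_period \<equiv> axis 1 pi"

text \<open>
  The sign change excludes the modes with \<open>k\<^sub>1 = 0\<close>, hence all nonzero limits that do not vary in \<open>x\<^sub>1\<close>. The
  condition is imposed only where smooth functions are determined, on the closed half space.
\<close>

definition antiperiodic :: "real \<Rightarrow> ((real ^ 3) \<times> real \<Rightarrow> real) set" where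
  "antiperiodic s = {\<phi> \<in> smooth_periodic s. \<forall>p\<in>closed_half. shift half_period \<phi> p = - \<phi> p}"

lemma antiperiodic_smooth: "\<phi> \<in> antiperiodic s \<Longrightarrow> \<phi> \<in> smooth_periodic s"
  by (simp add: antiperiodic_def)

lemma antiperiodic_lincomb:
  assumes "\<phi> \<in> antiperiodic s" "\<psi> \<in> antiperiodic s"
  shows "(\<lambda>p. \<alpha> * \<phi> p + \<beta> * \<psi> p) \<in> antiperiodic s"
  unfolding antiperiodic_def
proof (intro CollectI conjI ballI)
  show "(\<lambda>p. \<alpha> * \<phi> p + \<beta> * \<psi> p) \<in> smooth_periodic s"
    using assms by (intro smooth_periodic_lincomb antiperiodic_smooth)
  fix p assume "p \<in> closed_half"
  then have "shift half_period \<phi> p = - \<phi> p" "shift half_period \<psi> p = - \<psi> p"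
    using assms unfolding antiperiodic_def by blast+
  then show "shift half_period (\<lambda>p. \<alpha> * \<phi> p + \<beta> * \<psi> p) p = - (\<alpha> * \<phi> p + \<beta> * \<psi> p)"
    by (simp add: shift_def)
qed

lemma wave_antiperiodic: "0 < s \<Longrightarrow> s < 1 \<Longrightarrow> wave \<in> antiperiodic s"
  unfolding antiperiodic_def using wave_smooth_periodic by (auto simp: shift_def wave_def axis_def)

lemma shift_period:
  assumes "\<psi> \<in> smooth_periodic s" "p \<in> closed_half"
  shows "shift (half_period + half_period) \<psi> p = \<psi> p"
proof -
  have "half_period + half_period = lattice (axis 1 1)"
    by (simp add: vec_eq_iff lattice_def axis_def)
  then show ?thesis using smooth_periodicD(5)[OF assms] by (simp add: shift_def)
qed

lemma antisymmetrise:
  assumes \<psi>: "\<psi> \<in> smooth_periodic s"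
  shows "(\<lambda>p. (1 / 2) * \<psi> p + (- 1 / 2) * shift half_period \<psi> p) \<in> antiperiodic s"
  unfolding antiperiodic_def
proof (intro CollectI conjI ballI)
  show "(\<lambda>p. (1 / 2) * \<psi> p + (- 1 / 2) * shift half_period \<psi> p) \<in> smooth_periodic s"
    by (rule smooth_periodic_lincomb[OF \<psi> shift_smooth[OF \<psi>]])
  fix p assume "p \<in> closed_half"
  from shift_period[OF \<psi> this]
  have "\<psi> (p + (half_period, 0) + (half_period, 0)) = \<psi> p" by (simp add: shift_def add.assoc)
  then show "shift half_period (\<lambda>p. (1 / 2) * \<psi> p + (- 1 / 2) * shift half_period \<psi> p) p
      = - ((1 / 2) * \<psi> p + (- 1 / 2) * shift half_period \<psi> p)"
    by (simp add: shift_def)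
qed

text \<open>
  Symmetric criticality. An antiperiodic function is orthogonal to the part of a test function that
  is invariant under the translation by half a period, so that only the antiperiodic part counts. This
  holds for the form, which is invariant under translations, and for the reaction, which is moreover odd.
\<close>

lemma form_antiperiodic:
  assumes m: "0 < m" and \<phi>: "\<phi> \<in> antiperiodic s" and \<psi>: "\<psi> \<in> smooth_periodic s"
  shows "form s m \<phi> (\<lambda>p. (1 / 2) * \<psi> p + (- 1 / 2) * shift half_period \<psi> p) = form s m \<phi> \<psi>"
proof -
  note \<phi>' = antiperiodic_smooth[OF \<phi>]
  have neg: "(\<lambda>p. (- 1) * \<phi> p + 0 * \<phi> p) \<in> smooth_periodic s" by (rule smooth_periodic_lincomb[OF \<phi>' \<phi>'])
  have "form s m \<phi> (shift half_period \<psi>) = form s m (shift half_period \<phi>) (shift half_period (shift half_period \<psi>))"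
    using form_translate[OF m \<phi>' shift_smooth[OF \<psi>], of half_period half_period] by (simp add: shift_def)
  also have "\<dots> = form s m (\<lambda>p. (- 1) * \<phi> p + 0 * \<phi> p) (shift half_period (shift half_period \<psi>))"
    by (rule form_cong[OF smooth_periodicD(1)[OF shift_smooth[OF \<phi>']] _ smooth_periodicD(1)[OF neg]])
      (use \<phi> in \<open>auto simp: antiperiodic_def\<close>)
  also have "\<dots> = form s m (shift half_period (shift half_period \<psi>)) (\<lambda>p. (- 1) * \<phi> p + 0 * \<phi> p)"
    by (rule form_commute)
  also have "\<dots> = form s m \<psi> (\<lambda>p. (- 1) * \<phi> p + 0 * \<phi> p)"
    by (rule form_cong[OF smooth_periodicD(1)[OF shift_smooth[OF shift_smooth[OF \<psi>]]] _ smooth_periodicD(1)[OF \<psi>]])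
      (simp only: shift_shift shift_period[OF \<psi>])
  also have "\<dots> = - form s m \<phi> \<psi>"
    unfolding form_commute[of s m \<psi>] form_lincomb_left[OF m \<phi>' \<phi>' \<psi>] by simp
  finally have "form s m \<phi> (shift half_period \<psi>) = - form s m \<phi> \<psi>" .
  then show ?thesis
    using form_lincomb_left[OF m \<psi> shift_smooth[OF \<psi>] \<phi>', of "1 / 2" "- 1 / 2" half_period]
    by (simp add: form_commute[of s m _ \<phi>])
qed

context kirchhoff
begin

lemma bd_Lp: "\<phi> \<in> smooth_periodic s \<Longrightarrow> bd \<phi> \<in> Lp p"
  using bd_continuous p4 by (intro continuous_Lp) auto

lemma react_antiperiodic:
  assumes \<phi>: "\<phi> \<in> antiperiodic s" and \<psi>: "\<psi> \<in> smooth_periodic s"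
  shows "react (bd \<phi>) (bd (\<lambda>p. (1 / 2) * \<psi> p + (- 1 / 2) * shift half_period \<psi> p)) = react (bd \<phi>) (bd \<psi>)"
proof -
  note \<phi>' = antiperiodic_smooth[OF \<phi>]
  have odd: "g (- t) = - g t" for t by (simp add: reaction_def)
  have \<phi>x: "bd \<phi> (x + half_period) = - bd \<phi> x" for x
    using \<phi> by (auto simp: antiperiodic_def bd_def shift_def)
  have \<psi>x: "bd \<psi> (x + half_period + half_period) = bd \<psi> x" for x
    using shift_period[OF \<psi>, of "(x, 0)"] by (simp add: bd_def shift_def add.assoc)
  have [measurable]: "bd \<phi> \<in> borel_measurable borel" "bd \<psi> \<in> borel_measurable borel"
    using bd_continuous \<phi>' \<psi> by (auto intro!: borel_measurable_continuous_onI)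
  have "react (bd \<phi>) (bd (shift half_period \<psi>)) = (LINT x|torus. g (bd \<phi> x) * bd \<psi> (x + half_period))"
    by (simp add: bd_shift)
  also have "\<dots> = (LINT x|torus. g (bd \<phi> (x + half_period)) * bd \<psi> (x + half_period + half_period))"
  proof (rule integral_torus_translate[symmetric])
    show "(\<lambda>x. g (bd \<phi> x) * bd \<psi> (x + half_period)) \<in> borel_measurable borel" by measurable
    show "g (bd \<phi> (x + lattice n)) * bd \<psi> (x + lattice n + half_period) = g (bd \<phi> x) * bd \<psi> (x + half_period)" for x n
      using bd_lattice[OF \<phi>', of x n] bd_lattice[OF \<psi>, of "x + half_period" n] by (simp add: add_ac)
  qed
  also have "\<dots> = - react (bd \<phi>) (bd \<psi>)" unfolding \<phi>x \<psi>x odd by simp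
  finally have e: "react (bd \<phi>) (bd (shift half_period \<psi>)) = - react (bd \<phi>) (bd \<psi>)" .
  have "react (bd \<phi>) (bd (\<lambda>p. (1 / 2) * \<psi> p + (- 1 / 2) * shift half_period \<psi> p))
      = (LINT x|torus. (1 / 2) * (g (bd \<phi> x) * bd \<psi> x) + (- 1 / 2) * (g (bd \<phi> x) * bd (shift half_period \<psi>) x))"
    by (intro Bochner_Integration.integral_cong refl) (simp add: bd_def algebra_simps)
  also have "\<dots> = (1 / 2) * react (bd \<phi>) (bd \<psi>) + (- 1 / 2) * react (bd \<phi>) (bd (shift half_period \<psi>))"
    using reaction_integrable[OF bd_Lp[OF \<phi>'] bd_Lp[OF \<psi>]] reaction_integrable[OF bd_Lp[OF \<phi>'] bd_Lp[OF shift_smooth[OF \<psi>]]]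
    by simp
  finally show ?thesis using e by simp
qed

lemma react_shift:
  assumes \<phi>: "\<phi> \<in> smooth_periodic s" and \<psi>: "\<psi> \<in> smooth_periodic s"
  shows "react (bd (shift t \<phi>)) (bd \<psi>) = react (bd \<phi>) (bd (shift (- t) \<psi>))"
proof -
  have [measurable]: "bd \<phi> \<in> borel_measurable borel" "bd \<psi> \<in> borel_measurable borel"
    using bd_continuous \<phi> \<psi> by (auto intro!: borel_measurable_continuous_onI)
  have "(LINT x|torus. g (bd \<phi> (x + t)) * bd \<psi> (x + t - t)) = (LINT x|torus. g (bd \<phi> x) * bd \<psi> (x - t))"
  proof (rule integral_torus_translate)
    show "(\<lambda>x. g (bd \<phi> x) * bd \<psi> (x - t)) \<in> borel_measurable borel" by measurable
    show "g (bd \<phi> (x + lattice n)) * bd \<psi> (x + lattice n - t) = g (bd \<phi> x) * bd \<psi> (x - t)" for x n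
      using bd_lattice[OF \<phi>, of x n] bd_lattice[OF \<psi>, of "x - t" n] by (simp add: algebra_simps)
  qed
  then show ?thesis by (simp add: bd_shift)
qed

end

section \<open>Energy on small balls\<close>

context fractional
begin

lemma bd_class: "\<phi> \<in> smooth_periodic s \<Longrightarrow> cplx (bd \<phi>) \<in> sobolev_class s m"
  unfolding bd_def by (rule trace_bound(1)[OF _ m s0 s(2)])

lemma bd_sobolev_sum: "\<phi> \<in> smooth_periodic s \<Longrightarrow> sobolev_sum s m (cplx (bd \<phi>)) \<le> kappa s / s * form s m \<phi> \<phi>"
  unfolding bd_def by (rule trace_bound(2)[OF _ m s0 s(2)])

lemma form_ge_0: "0 \<le> form s m \<phi> \<phi>"
  by (rule form_nonneg[OF s0 s(2)])

lemma form_diff: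
  assumes "\<phi> \<in> smooth_periodic s" "\<psi> \<in> smooth_periodic s"
  shows "form s m (\<lambda>p. \<phi> p - \<psi> p) (\<lambda>p. \<phi> p - \<psi> p) = form s m \<phi> \<phi> - 2 * form s m \<phi> \<psi> + form s m \<psi> \<psi>"
  using form_lincomb_self[OF m assms, of 1 "-1"] by simp

lemma form_polar_bound:
  assumes "\<phi> \<in> smooth_periodic s" "\<psi> \<in> smooth_periodic s"
  shows "2 * \<bar>form s m \<phi> \<psi>\<bar> \<le> form s m \<phi> \<phi> + form s m \<psi> \<psi>"
  using form_lincomb_self[OF m assms, of 1 1] form_lincomb_self[OF m assms, of 1 "-1"]
    form_ge_0[of "\<lambda>p. 1 * \<phi> p + 1 * \<psi> p"] form_ge_0[of "\<lambda>p. 1 * \<phi> p + (-1) * \<psi> p"]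
  by simp

lemma bd_moment_bound:
  "\<exists>C>0. \<forall>\<phi>\<in>smooth_periodic s. moment p (bd \<phi>) \<le> C * form s m \<phi> \<phi> powr (p / 2)"
proof -
  obtain C where C: "0 < C" and CM: "\<And>u. cplx u \<in> sobolev_class s m \<Longrightarrow> moment p u \<le> C * sobolev_sum s m (cplx u) powr (p / 2)"
    using Lp_embedding by blast
  have k: "0 < kappa s / s" using kappa_pos[OF s0 s(2)] s0 by simp
  have "moment p (bd \<phi>) \<le> C * (kappa s / s) powr (p / 2) * form s m \<phi> \<phi> powr (p / 2)" if \<phi>: "\<phi> \<in> smooth_periodic s" for \<phi>
  proof -
    have "moment p (bd \<phi>) \<le> C * sobolev_sum s m (cplx (bd \<phi>)) powr (p / 2)" by (rule CM[OF bd_class[OF \<phi>]])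
    also have "\<dots> \<le> C * (kappa s / s * form s m \<phi> \<phi>) powr (p / 2)"
      using C p4 bd_sobolev_sum[OF \<phi>] by (intro mult_left_mono powr_mono2) (auto simp: sobolev_sum_nonneg)
    finally show ?thesis unfolding powr_mult by (simp only: mult.assoc)
  qed
  moreover have "0 < C * (kappa s / s) powr (p / 2)" using C k by (simp only: zero_less_mult_iff powr_gt_zero) auto
  ultimately show ?thesis by blast
qed

text \<open>
  The difference of two functions with \<open>form \<le> R\<close> satisfies \<open>form \<le> 4 R\<close>, so that the compactness of the
  embedding applies to its boundary values.
\<close>

lemma bd_moment_small:
  assumes "0 \<le> R" "0 < e"
  shows "\<exists>F \<delta>. finite F \<and> 0 < \<delta> \<and> (\<forall>\<phi>\<in>smooth_periodic s. \<forall>\<psi>\<in>smooth_periodic s. form s m \<phi> \<phi> \<le> R \<longrightarrow> form s m \<psi> \<psi> \<le> R \<longrightarrow>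
    (\<forall>k\<in>F. cmod (mode_coeff (cplx (bd \<phi>)) k - mode_coeff (cplx (bd \<psi>)) k) \<le> \<delta>) \<longrightarrow> moment p (\<lambda>x. bd \<phi> x - bd \<psi> x) \<le> e)"
proof -
  have k: "0 < kappa s / s" using kappa_pos[OF s0 s(2)] s0 by simp
  define R' where "R' = kappa s / s * (4 * R)"
  have R': "0 \<le> R'" unfolding R'_def using k assms by (intro mult_nonneg_nonneg) auto
  obtain F \<delta> where F: "finite F" "0 < \<delta>" and FR: "\<And>f. f \<in> sobolev_class s m \<Longrightarrow> sobolev_sum s m f \<le> R' \<Longrightarrow>
      \<forall>k\<in>F. cmod (mode_coeff f k) \<le> \<delta> \<Longrightarrow> (LINT x|torus. cmod (f x) powr p) \<le> e"
    using Rellich[OF m s0 exponent_gap assms(2) R'] by blast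
  have "moment p (\<lambda>x. bd \<phi> x - bd \<psi> x) \<le> e" if \<phi>: "\<phi> \<in> smooth_periodic s" and \<psi>: "\<psi> \<in> smooth_periodic s"
    and N: "form s m \<phi> \<phi> \<le> R" "form s m \<psi> \<psi> \<le> R" and c: "\<forall>k\<in>F. cmod (mode_coeff (cplx (bd \<phi>)) k - mode_coeff (cplx (bd \<psi>)) k) \<le> \<delta>" for \<phi> \<psi>
  proof -
    let ?\<omega> = "\<lambda>p. 1 * \<phi> p + (-1) * \<psi> p"
    have \<omega>: "?\<omega> \<in> smooth_periodic s" by (rule smooth_periodic_lincomb[OF \<phi> \<psi>])
    have b: "bd ?\<omega> = (\<lambda>x. bd \<phi> x - bd \<psi> x)" by (simp add: bd_def)
    have "form s m ?\<omega> ?\<omega> \<le> 4 * R"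
      using form_diff[OF \<phi> \<psi>] form_polar_bound[OF \<phi> \<psi>] N by simp
    then have "kappa s / s * form s m ?\<omega> ?\<omega> \<le> R'" unfolding R'_def using k by (intro mult_left_mono) auto
    then have "sobolev_sum s m (cplx (bd ?\<omega>)) \<le> R'" using bd_sobolev_sum[OF \<omega>] by linarith
    moreover have "cmod (mode_coeff (cplx (bd ?\<omega>)) k) \<le> \<delta>" if "k \<in> F" for k
    proof -
      have "mode_coeff (cplx (bd ?\<omega>)) k = mode_coeff (cplx (bd \<phi>)) k - mode_coeff (cplx (bd \<psi>)) k"
        unfolding b of_real_diff using bd_class[OF \<phi>] bd_class[OF \<psi>] by (intro coeff_diff) (auto simp: sobolev_class_def)
      then show ?thesis using c that by simp
    qed
    ultimately have "(LINT x|torus. cmod (cplx (bd ?\<omega>) x) powr p) \<le> e" by (intro FR bd_class[OF \<omega>]) auto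
    then show ?thesis by (simp add: moment_def bd_def flip: of_real_diff)
  qed
  then show ?thesis using F by blast
qed

text \<open>
  Each coefficient is bounded along the sequence and there are countably many of them, so that a
  diagonal subsequence works for all.
\<close>

lemma coeff_convergent_subseq:
  assumes \<phi>: "\<And>n. \<phi> n \<in> smooth_periodic s" and R: "\<And>n. form s m (\<phi> n) (\<phi> n) \<le> R"
  shows "\<exists>r. strict_mono (r :: nat \<Rightarrow> nat) \<and> (\<forall>k. convergent (\<lambda>n. mode_coeff (cplx (bd (\<phi> (r n)))) k))"
proof -
  define c where "c j n = mode_coeff (cplx (bd (\<phi> n))) (from_nat j :: int ^ 3)" for j n
  define B where "B = sqrt ((m\<^sup>2) powr (- s) * (kappa s / s * R))"
  have k: "0 < kappa s / s" using kappa_pos[OF s0 s(2)] s0 by simp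
  have cB: "cmod (c j n) \<le> B" for j n
  proof -
    have L: "cplx (bd (\<phi> n)) \<in> L2 torus" using bd_class[OF \<phi>] by (simp add: sobolev_class_def)
    have "(l2_norm torus (cplx (bd (\<phi> n))))\<^sup>2 \<le> (m\<^sup>2) powr (- s) * sobolev_sum s m (cplx (bd (\<phi> n)))"
      by (rule l2_le_sobolev_sum[OF m s0 bd_class[OF \<phi>]])
    also have "\<dots> \<le> (m\<^sup>2) powr (- s) * (kappa s / s * R)"
      using bd_sobolev_sum[OF \<phi>, of n] mult_left_mono[OF R[of n], of "kappa s / s"] k by (intro mult_left_mono) auto
    finally have "l2_norm torus (cplx (bd (\<phi> n))) \<le> B" unfolding B_def by (rule real_le_rsqrt)
    then show ?thesis using coeff_bound[OF L] unfolding c_def by (rule order_trans[rotated])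
  qed
  interpret ds: subseqs "\<lambda>j r. convergent (\<lambda>n. c j (r n))"
  proof
    fix j :: nat and r :: "nat \<Rightarrow> nat"
    have "bounded (range (\<lambda>n. c j (r n)))" using cB by (auto simp: bounded_iff)
    then obtain l r' where "strict_mono r'" "((\<lambda>n. c j (r n)) \<circ> r') \<longlonglongrightarrow> l"
      using bounded_imp_convergent_subsequence by blast
    then show "\<exists>r'. strict_mono r' \<and> convergent (\<lambda>n. c j ((r \<circ> r') n))"
      by (auto simp: o_def convergent_def)
  qed
  have "convergent (\<lambda>n. c j (ds.diagseq n))" for j
  proof -
    have "convergent (\<lambda>n. c j ((ds.diagseq \<circ> (+) (Suc j)) n))"
    proof (rule ds.diagseq_holds)
      fix n r r' assume "strict_mono (r' :: nat \<Rightarrow> nat)" "convergent (\<lambda>i. c n (r i))"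
      then show "convergent (\<lambda>i. c n ((r \<circ> r') i))"
        using convergent_subseq_convergent[of "\<lambda>i. c n (r i)" r'] by (simp add: o_def)
    qed
    then show ?thesis
      using convergent_ignore_initial_segment[of "\<lambda>n. c j (ds.diagseq n)" "Suc j"] by (simp add: o_def add.commute)
  qed
  moreover have "mode_coeff (cplx (bd (\<phi> n))) k = c (to_nat k) n" for k n by (simp add: c_def)
  ultimately show ?thesis using ds.subseq_diagseq by auto
qed

end

context kirchhoff
begin

definition energy :: "((real ^ 3) \<times> real \<Rightarrow> real) \<Rightarrow> real" where
  "energy \<phi> = a / 2 * form s m \<phi> \<phi> + b / 4 * (form s m \<phi> \<phi>)\<^sup>2 - pot (bd \<phi>)"

lemma integral_cos_sq: "(LINT x|torus. (cos (x $ 1))\<^sup>2) = (2 * pi) ^ 3 / 2"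
proof -
  have e: "(cos (x $ 1))\<^sup>2 = 1 / 2 + Re (cis (kdot (axis 1 2) x)) / 2" for x :: "real ^ 3"
    using cos_double_cos[of "x $ 1"] by (simp add: kdot_axis_left diff_divide_distrib)
  have i: "integrable torus (\<lambda>x. cis (kdot (axis 1 2) x))"
    by (rule torus.integrable_const_bound[where B = 1]) (auto intro!: borel_torus)
  have "axis 1 2 \<noteq> (0 :: int ^ 3)" by (simp add: axis_eq_0_iff)
  then have "(LINT x|torus. Re (cis (kdot (axis 1 2) x))) = 0"
    using integral_Re[OF i] by (simp add: integral_character)
  moreover have "integrable torus (\<lambda>x. Re (cis (kdot (axis 1 2) x)) / 2)" using i by (intro integrable_divide_zero integrable_Re) auto
  ultimately show ?thesis unfolding e using i by (simp add: measure_torus)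
qed

text \<open>
  Along the multiples \<open>t \<cdot> wave\<close> with \<open>t \<le> 1\<close> the energy is at most \<open>t\<^sup>2 K - t\<^sup>q M\<close> with \<open>M > 0\<close>, because
  \<open>|cos|\<^sup>q \<ge> cos\<^sup>2\<close>. This is negative for small \<open>t\<close> because \<open>q < 2\<close>.
\<close>

lemma energy_negative:
  assumes R: "0 < R"
  shows "\<exists>\<phi>\<in>antiperiodic s. form s m \<phi> \<phi> \<le> R \<and> energy \<phi> < 0"
proof -
  have w: "wave \<in> smooth_periodic s" by (rule wave_smooth_periodic[OF s0 s(2)])
  define N0 where "N0 = form s m wave wave"
  have N0: "0 \<le> N0" unfolding N0_def by (rule form_ge_0)
  define K where "K = a / 2 * N0 + b / 4 * N0\<^sup>2"
  have K: "0 \<le> K" using N0 a b by (simp add: K_def)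
  define M where "M = lam / q * ((2 * pi) ^ 3 / 2)"
  have M: "0 < M" using lam q by (simp add: M_def)
  define c where "c = M / (2 * (K + 1))"
  have c: "0 < c" "c * K < M"
  proof -
    show "0 < c" using M K by (simp add: c_def)
    have "c * K \<le> c * (K + 1)" using \<open>0 < c\<close> by (intro mult_left_mono) auto
    also have "\<dots> = M / 2"
    proof -
      have "M / (2 * X) * X = M / 2" if "X \<noteq> 0" for X using that by simp
      from this[of "K + 1"] show ?thesis using K by (simp only: c_def)
    qed
    finally show "c * K < M" using M by simp
  qed
  define t where "t = min 1 (min (sqrt (R / (N0 + 1))) (c powr (1 / (2 - q))))"
  have t: "0 < t" "t \<le> 1" using R N0 c by (auto simp: t_def)
  have t1: "t\<^sup>2 * N0 \<le> R"
  proof -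
    have "t \<le> sqrt (R / (N0 + 1))" by (simp add: t_def)
    then have "t\<^sup>2 \<le> (sqrt (R / (N0 + 1)))\<^sup>2" using t by (intro power_mono) auto
    then have "t\<^sup>2 \<le> R / (N0 + 1)" using R N0 by simp
    then have "t\<^sup>2 * (N0 + 1) \<le> R" using N0 by (simp add: field_simps)
    moreover have "t\<^sup>2 * N0 \<le> t\<^sup>2 * (N0 + 1)" by (intro mult_left_mono) auto
    ultimately show ?thesis by linarith
  qed
  have t2: "t powr (2 - q) \<le> c"
  proof -
    have "t powr (2 - q) \<le> (c powr (1 / (2 - q))) powr (2 - q)"
      using t q by (intro powr_mono2) (auto simp: t_def)
    also have "\<dots> = c" using q c by (simp add: powr_powr)
    finally show ?thesis .
  qed
  define \<phi> where "\<phi> p = t * wave p + 0 * wave p" for p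
  have \<phi>A: "\<phi> \<in> antiperiodic s"
    unfolding \<phi>_def[abs_def] by (intro antiperiodic_lincomb wave_antiperiodic s0 s)
  have N: "form s m \<phi> \<phi> = t\<^sup>2 * N0"
    unfolding \<phi>_def[abs_def] N0_def form_lincomb_self[OF m w w] by simp
  have "t powr q * M \<le> pot (bd \<phi>)"
  proof -
    have "t powr q * M = (LINT x|torus. lam / q * t powr q * (cos (x $ 1))\<^sup>2)"
      by (simp add: integral_cos_sq M_def)
    also have "\<dots> \<le> pot (bd \<phi>)"
      unfolding pot_def
    proof (rule integral_mono)
      have "integrable torus (\<lambda>x. (cos (x $ 1))\<^sup>2)"
        by (rule torus.integrable_const_bound[where B = 1]) (auto intro!: borel_torus simp: abs_square_le_1)
      then show "integrable torus (\<lambda>x. lam / q * t powr q * (cos (x $ 1))\<^sup>2)" by simp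
      show "integrable torus (\<lambda>x. G (bd \<phi> x))"
        by (rule potential_integrable[OF bd_Lp[OF antiperiodic_smooth[OF \<phi>A]]])
      fix x :: "real ^ 3"
      let ?C = "\<bar>cos (x $ 1)\<bar>"
      have "?C powr 2 \<le> ?C powr q"
      proof (cases "?C = 0")
        case False
        then show ?thesis using q abs_cos_le_one[of "x $ 1"] by (intro powr_mono') auto
      qed simp
      then have "(cos (x $ 1))\<^sup>2 \<le> ?C powr q" by simp
      then have "lam / q * t powr q * (cos (x $ 1))\<^sup>2 \<le> lam / q * t powr q * ?C powr q"
        using lam q by (intro mult_left_mono) auto
      also have "\<dots> = lam / q * \<bar>t * cos (x $ 1)\<bar> powr q" using t by (simp add: abs_mult powr_mult)
      also have "\<dots> \<le> G (t * cos (x $ 1))" using p by (simp add: potential_def)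
      also have "t * cos (x $ 1) = bd \<phi> x" by (simp add: bd_def \<phi>_def wave_def)
      finally show "lam / q * t powr q * (cos (x $ 1))\<^sup>2 \<le> G (bd \<phi> x)" .
    qed
    finally show ?thesis .
  qed
  then have "energy \<phi> \<le> a / 2 * (t\<^sup>2 * N0) + b / 4 * (t\<^sup>2 * N0)\<^sup>2 - t powr q * M"
    unfolding energy_def N by simp
  also have "\<dots> \<le> t\<^sup>2 * K - t powr q * M"
  proof -
    have "t\<^sup>2 * t\<^sup>2 \<le> t\<^sup>2 * 1" using t by (intro mult_left_mono) (auto simp: power_le_one)
    then have "(t\<^sup>2 * t\<^sup>2) * N0\<^sup>2 \<le> t\<^sup>2 * N0\<^sup>2" by (intro mult_right_mono) auto
    then have "(t\<^sup>2 * N0)\<^sup>2 \<le> t\<^sup>2 * N0\<^sup>2" by (simp only: power_mult_distrib power2_eq_square[of "t\<^sup>2"])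
    then have "b / 4 * (t\<^sup>2 * N0)\<^sup>2 \<le> b / 4 * (t\<^sup>2 * N0\<^sup>2)" using b by (intro mult_left_mono) auto
    then show ?thesis by (simp add: K_def algebra_simps)
  qed
  also have "\<dots> = t powr q * (t powr (2 - q) * K - M)"
  proof -
    have "t powr q * t powr (2 - q) = t powr 2" unfolding powr_add[symmetric] by simp
    also have "\<dots> = t\<^sup>2" using t by simp
    finally show ?thesis by (simp add: algebra_simps)
  qed
  also have "\<dots> < 0"
  proof -
    have "t powr (2 - q) * K \<le> c * K" using t2 K by (rule mult_right_mono)
    then show ?thesis using c t by (intro mult_pos_neg) auto
  qed
  finally have "energy \<phi> < 0" .
  moreover have "form s m \<phi> \<phi> \<le> R" unfolding N by (rule t1)
  ultimately show ?thesis using \<phi>A by blast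
qed

text \<open>
  On a ball with this property the energy is at least \<open>a/4 \<cdot> form \<phi> \<phi> - a R / 8\<close>, which is nonnegative
  for \<open>form \<phi> \<phi> \<ge> R / 2\<close>. Functions of negative energy therefore stay away from the boundary of the
  ball, and the constraint is not felt.
\<close>

definition coercive :: "real \<Rightarrow> bool" where
  "coercive R \<longleftrightarrow> 0 < R \<and> lam * (2 * pi) ^ 3 < a * R / 8 \<and>
    (\<forall>\<phi>\<in>smooth_periodic s. form s m \<phi> \<phi> \<le> R \<longrightarrow> pot (bd \<phi>) \<le> lam * (2 * pi) ^ 3 + a / 4 * form s m \<phi> \<phi>)"

lemma energy_lower:
  assumes "coercive R" "\<phi> \<in> smooth_periodic s" "form s m \<phi> \<phi> \<le> R"
  shows "a / 4 * form s m \<phi> \<phi> - lam * (2 * pi) ^ 3 \<le> energy \<phi>"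
proof -
  have "pot (bd \<phi>) \<le> lam * (2 * pi) ^ 3 + a / 4 * form s m \<phi> \<phi>" using assms by (auto simp: coercive_def)
  moreover have "0 \<le> b / 4 * (form s m \<phi> \<phi>)\<^sup>2" using b by simp
  ultimately show ?thesis by (simp add: energy_def)
qed

lemma negative_energy_inside:
  assumes "coercive R" "\<phi> \<in> smooth_periodic s" "form s m \<phi> \<phi> \<le> R" "energy \<phi> < 0"
  shows "form s m \<phi> \<phi> < R / 2"
proof -
  have "a / 4 * form s m \<phi> \<phi> < a * R / 8"
    using energy_lower[OF assms(1-3)] assms(1,4) by (auto simp: coercive_def)
  then have "a * form s m \<phi> \<phi> < a * (R / 2)" by simp
  then show ?thesis using a by simp
qed

text \<open>
  The quadratic part of the energy is strongly convex. Comparing two functions of almost minimal energy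
  with their midpoint shows that they are close, once their boundary values are.
\<close>

lemma midpoint_energy:
  assumes \<phi>: "\<phi> \<in> antiperiodic s" and \<psi>: "\<psi> \<in> antiperiodic s" and R: "form s m \<phi> \<phi> \<le> R" "form s m \<psi> \<psi> \<le> R"
    and e: "\<And>\<omega>. \<omega> \<in> antiperiodic s \<Longrightarrow> form s m \<omega> \<omega> \<le> R \<Longrightarrow> e \<le> energy \<omega>"
  shows "a / 8 * form s m (\<lambda>p. \<phi> p - \<psi> p) (\<lambda>p. \<phi> p - \<psi> p)
    \<le> (energy \<phi> - e) / 2 + (energy \<psi> - e) / 2
      + (pot (bd \<phi>) - pot (bd (\<lambda>p. 1 / 2 * \<phi> p + 1 / 2 * \<psi> p))) / 2
      + (pot (bd \<psi>) - pot (bd (\<lambda>p. 1 / 2 * \<phi> p + 1 / 2 * \<psi> p))) / 2"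
proof -
  note \<phi>' = antiperiodic_smooth[OF \<phi>] and \<psi>' = antiperiodic_smooth[OF \<psi>]
  define \<omega> where "\<omega> p = 1 / 2 * \<phi> p + 1 / 2 * \<psi> p" for p
  define D where "D = form s m (\<lambda>p. \<phi> p - \<psi> p) (\<lambda>p. \<phi> p - \<psi> p)"
  define A where "A = (form s m \<phi> \<phi> + form s m \<psi> \<psi>) / 2"
  have D0: "0 \<le> D" unfolding D_def by (rule form_ge_0)
  have \<omega>: "\<omega> \<in> antiperiodic s" unfolding \<omega>_def[abs_def] by (rule antiperiodic_lincomb[OF \<phi> \<psi>])
  have N: "form s m \<omega> \<omega> = A - D / 4"
    unfolding \<omega>_def[abs_def] form_lincomb_self[OF m \<phi>' \<psi>'] D_def A_def form_diff[OF \<phi>' \<psi>']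
    by (simp add: power2_eq_square field_simps)
  have "A \<le> R" using R by (simp add: A_def)
  then have "e \<le> energy \<omega>" using N D0 by (intro e[OF \<omega>]) linarith
  also have "\<dots> \<le> a / 2 * (A - D / 4) + b / 4 * (((form s m \<phi> \<phi>)\<^sup>2 + (form s m \<psi> \<psi>)\<^sup>2) / 2) - pot (bd \<omega>)"
  proof -
    have "(A - D / 4)\<^sup>2 \<le> A\<^sup>2" using N form_ge_0[of \<omega>] D0 by (intro power_mono) auto
    also have "\<dots> \<le> ((form s m \<phi> \<phi>)\<^sup>2 + (form s m \<psi> \<psi>)\<^sup>2) / 2"
      using sum_squares_bound[of "form s m \<phi> \<phi>" "form s m \<psi> \<psi>"] by (simp add: A_def power_divide power2_sum)
    finally have "b / 4 * (A - D / 4)\<^sup>2 \<le> b / 4 * (((form s m \<phi> \<phi>)\<^sup>2 + (form s m \<psi> \<psi>)\<^sup>2) / 2)"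
      using b by (intro mult_left_mono) auto
    then show ?thesis by (simp add: energy_def N)
  qed
  also have "\<dots> = (energy \<phi> + pot (bd \<phi>)) / 2 + (energy \<psi> + pot (bd \<psi>)) / 2 - a / 8 * D - pot (bd \<omega>)"
    by (simp add: energy_def A_def field_simps)
  finally have "a / 8 * D \<le> (energy \<phi> - e) / 2 + (energy \<psi> - e) / 2 + (pot (bd \<phi>) - pot (bd \<omega>)) / 2 + (pot (bd \<psi>) - pot (bd \<omega>)) / 2"
    by (simp add: field_simps)
  then show ?thesis unfolding D_def \<omega>_def[abs_def] .
qed

text \<open>
  Since \<open>- pot\<close> is concave, it lies below its tangent, and testing almost minimality in both
  directions \<open>\<plusminus> t \<psi>\<close> bounds the residual of the weak equation by \<open>(energy \<phi> - e) / t + O(t)\<close>.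
\<close>

lemma residual_bound:
  assumes \<phi>: "\<phi> \<in> antiperiodic s" and \<psi>: "\<psi> \<in> antiperiodic s" and R: "0 < R" "form s m \<phi> \<phi> \<le> R / 2"
    and e: "\<And>\<omega>. \<omega> \<in> antiperiodic s \<Longrightarrow> form s m \<omega> \<omega> \<le> R \<Longrightarrow> e \<le> energy \<omega>"
    and L: "L = R + 2 * form s m \<psi> \<psi>" and t: "0 < t" "t \<le> 1" "t * L \<le> R / 2"
  shows "\<bar>(a + b * form s m \<phi> \<phi>) * form s m \<phi> \<psi> - react (bd \<phi>) (bd \<psi>)\<bar>
    \<le> (energy \<phi> - e) / t + t * ((a + b * R) * L + b * L\<^sup>2)"
proof -
  note \<phi>' = antiperiodic_smooth[OF \<phi>] and \<psi>' = antiperiodic_smooth[OF \<psi>]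
  let ?N = "form s m \<phi> \<phi>" and ?B = "form s m \<phi> \<psi>" and ?P = "form s m \<psi> \<psi>"
  define r where "r = (a + b * ?N) * ?B - react (bd \<phi>) (bd \<psi>)"
  define C where "C = (a + b * R) * L + b * L\<^sup>2"
  have P0: "0 \<le> ?P" and N0: "0 \<le> ?N" by (rule form_ge_0)+
  have B: "2 * \<bar>?B\<bar> \<le> R + ?P" using form_polar_bound[OF \<phi>' \<psi>'] R by simp
  have L0: "0 \<le> L" using L R P0 by simp
  have step: "- (\<tau> * r) \<le> energy \<phi> - e + t\<^sup>2 * C" if \<tau>: "\<bar>\<tau>\<bar> = t" for \<tau>
  proof -
    define \<delta> where "\<delta> = 2 * \<tau> * ?B + \<tau>\<^sup>2 * ?P"
    have \<tau>2: "\<tau>\<^sup>2 = t\<^sup>2" using \<tau> by (metis power2_abs)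
    have tt: "t\<^sup>2 \<le> t" using t by (simp add: power2_eq_square mult_left_le)
    have \<delta>: "\<bar>\<delta>\<bar> \<le> t * L"
    proof -
      have "\<bar>\<delta>\<bar> \<le> t * (2 * \<bar>?B\<bar>) + t\<^sup>2 * ?P"
        unfolding \<delta>_def \<tau>2 using \<tau> P0 by (intro order_trans[OF abs_triangle_ineq]) (simp add: abs_mult)
      also have "\<dots> \<le> t * (R + ?P) + t * ?P" using B tt t P0 by (intro add_mono mult_left_mono mult_right_mono) auto
      finally show ?thesis by (simp add: L algebra_simps)
    qed
    define \<omega> where "\<omega> p = 1 * \<phi> p + \<tau> * \<psi> p" for p
    have \<omega>: "\<omega> \<in> antiperiodic s" unfolding \<omega>_def[abs_def] by (rule antiperiodic_lincomb[OF \<phi> \<psi>])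
    have N: "form s m \<omega> \<omega> = ?N + \<delta>"
      unfolding \<omega>_def[abs_def] form_lincomb_self[OF m \<phi>' \<psi>'] \<delta>_def by simp
    have "?N + \<delta> \<le> R" using \<delta> t R by linarith
    then have "e \<le> energy \<omega>" using N by (intro e[OF \<omega>]) simp
    also have "\<dots> = a / 2 * (?N + \<delta>) + b / 4 * (?N + \<delta>)\<^sup>2 - pot (\<lambda>x. bd \<phi> x + \<tau> * bd \<psi> x)"
      unfolding energy_def N by (simp add: \<omega>_def bd_def)
    also have "\<dots> \<le> a / 2 * (?N + \<delta>) + b / 4 * (?N + \<delta>)\<^sup>2 - (pot (bd \<phi>) + \<tau> * react (bd \<phi>) (bd \<psi>))"
      using pot_tangent[OF bd_Lp[OF \<phi>'] bd_Lp[OF \<psi>'], of \<tau>] by simp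
    also have "\<dots> = energy \<phi> + \<tau> * r + (a + b * ?N) / 2 * (\<tau>\<^sup>2 * ?P) + b / 4 * \<delta>\<^sup>2"
      by (simp add: energy_def r_def \<delta>_def power2_sum algebra_simps)
    also have "\<dots> \<le> energy \<phi> + \<tau> * r + t\<^sup>2 * C"
    proof -
      have "(a + b * ?N) / 2 * (\<tau>\<^sup>2 * ?P) \<le> (a + b * R) * (t\<^sup>2 * L)"
      proof (rule mult_mono)
        have "b * ?N \<le> b * R" using b R N0 by (intro mult_left_mono) auto
        moreover have "0 \<le> b * ?N" using b N0 by simp
        ultimately show "(a + b * ?N) / 2 \<le> a + b * R" using a by simp
        show "\<tau>\<^sup>2 * ?P \<le> t\<^sup>2 * L" unfolding \<tau>2 using L R P0 by (intro mult_left_mono) auto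
      qed (use a b R P0 in auto)
      moreover have "b / 4 * \<delta>\<^sup>2 \<le> b * (t * L)\<^sup>2"
      proof (rule mult_mono)
        have "\<bar>\<delta>\<bar>\<^sup>2 \<le> (t * L)\<^sup>2" using \<delta> by (intro power_mono) auto
        then show "\<delta>\<^sup>2 \<le> (t * L)\<^sup>2" by simp
      qed (use b in auto)
      moreover have "t\<^sup>2 * C = (a + b * R) * (t\<^sup>2 * L) + b * (t * L)\<^sup>2"
        by (simp add: C_def power_mult_distrib algebra_simps)
      ultimately show ?thesis by linarith
    qed
    finally show ?thesis by simp
  qed
  have "t * \<bar>r\<bar> \<le> energy \<phi> - e + t\<^sup>2 * C"
    using step[of t] step[of "- t"] t by (simp add: abs_real_def split: if_splits)
  then have "t * \<bar>r\<bar> / t \<le> (energy \<phi> - e + t\<^sup>2 * C) / t" using t by (intro divide_right_mono) auto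
  then have "\<bar>r\<bar> \<le> (energy \<phi> - e) / t + t * C" using t by (simp add: add_divide_distrib power2_eq_square)
  then show ?thesis unfolding r_def C_def .
qed

end

section \<open>Minimisation and multiplicity\<close>

context kirchhoff
begin

text \<open>
  The infimum is negative, so that almost minimal functions have negative energy and lie in the half
  ball. Passing to a subsequence makes their boundary coefficients converge.
\<close>

lemma minimizing_sequence:
  assumes R: "coercive R"
  obtains \<phi> e where "\<And>n. \<phi> n \<in> antiperiodic s" "\<And>n. form s m (\<phi> n) (\<phi> n) \<le> R / 2" "e < 0"
    "\<And>\<omega>. \<omega> \<in> antiperiodic s \<Longrightarrow> form s m \<omega> \<omega> \<le> R \<Longrightarrow> e \<le> energy \<omega>"
    "\<And>n. energy (\<phi> n) \<le> e + 1 / real (Suc n)"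
    "\<And>k. convergent (\<lambda>n. mode_coeff (cplx (bd (\<phi> n))) k)"
proof -
  have R0: "0 < R" using R by (simp add: coercive_def)
  define K where "K = {\<phi> \<in> antiperiodic s. form s m \<phi> \<phi> \<le> R}"
  define e where "e = Inf (energy ` K)"
  have bdd: "bdd_below (energy ` K)"
  proof (rule bdd_belowI2)
    fix \<phi> assume "\<phi> \<in> K"
    then have "a / 4 * form s m \<phi> \<phi> - lam * (2 * pi) ^ 3 \<le> energy \<phi>"
      using energy_lower[OF R] antiperiodic_smooth by (auto simp: K_def)
    moreover have "0 \<le> a / 4 * form s m \<phi> \<phi>" using a form_ge_0 by simp
    ultimately show "- (lam * (2 * pi) ^ 3) \<le> energy \<phi>" by linarith
  qed
  have elow: "e \<le> energy \<omega>" if "\<omega> \<in> antiperiodic s" "form s m \<omega> \<omega> \<le> R" for \<omega>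
    unfolding e_def using bdd that by (intro cInf_lower) (auto simp: K_def)
  obtain \<phi>0 where \<phi>0: "\<phi>0 \<in> K" "energy \<phi>0 < 0"
    using energy_negative[OF R0] by (auto simp: K_def)
  have e0: "e < 0" using elow[of \<phi>0] \<phi>0 by (auto simp: K_def)
  have "\<exists>\<phi>\<in>K. energy \<phi> < min (e + 1 / real (Suc n)) 0" for n
  proof -
    have "e < min (e + 1 / real (Suc n)) 0" using e0 by simp
    then show ?thesis
      using cInf_lessD[of "energy ` K" "min (e + 1 / real (Suc n)) 0"] \<phi>0 unfolding e_def by blast
  qed
  then obtain \<phi> where \<phi>: "\<And>n. \<phi> n \<in> K" "\<And>n. energy (\<phi> n) < min (e + 1 / real (Suc n)) 0" by metis
  have A: "\<phi> n \<in> antiperiodic s" "form s m (\<phi> n) (\<phi> n) \<le> R" for n using \<phi>(1)[of n] by (auto simp: K_def)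
  obtain r where r: "strict_mono (r :: nat \<Rightarrow> nat)" "\<And>k. convergent (\<lambda>n. mode_coeff (cplx (bd (\<phi> (r n)))) k)"
    using coeff_convergent_subseq[of \<phi> R, OF antiperiodic_smooth[OF A(1)] A(2)] by blast
  show ?thesis
  proof (rule that[of "\<lambda>n. \<phi> (r n)" e])
    show "\<phi> (r n) \<in> antiperiodic s" for n by (rule A(1))
    show "form s m (\<phi> (r n)) (\<phi> (r n)) \<le> R / 2" for n
      using negative_energy_inside[OF R antiperiodic_smooth[OF A(1)] A(2), of "r n"] \<phi>(2)[of "r n"] by simp
    show "e < 0" by (rule e0)
    show "energy (\<phi> (r n)) \<le> e + 1 / real (Suc n)" for n
    proof -
      have "1 / real (Suc (r n)) \<le> 1 / real (Suc n)" using seq_suble[OF r(1), of n] by (simp add: frac_le)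
      then show ?thesis using \<phi>(2)[of "r n"] by simp
    qed
    show "convergent (\<lambda>n. mode_coeff (cplx (bd (\<phi> (r n)))) k)" for k by (rule r(2))
  qed (use elow in auto)
qed

text \<open>
  A minimising sequence of antiperiodic functions has all that is asked of a critical sequence: it is
  Cauchy because the potentials of the functions and of their midpoints are close; it satisfies the
  weak equation asymptotically; and some boundary coefficient does not tend to \<open>0\<close>, since otherwise
  the potential would tend to \<open>0\<close> and the limit of the energies would not be negative.
\<close>

lemma critical_sequence:
  assumes R: "coercive R"
  obtains \<phi> k where "\<And>n. \<phi> n \<in> smooth_periodic s"
    "\<And>e. 0 < e \<Longrightarrow> \<exists>N. \<forall>i\<ge>N. \<forall>j\<ge>N. form s m (\<lambda>p. \<phi> i p - \<phi> j p) (\<lambda>p. \<phi> i p - \<phi> j p) < e"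
    "\<And>\<psi>. \<psi> \<in> smooth_periodic s \<Longrightarrow>
      (\<lambda>n. (a + b * form s m (\<phi> n) (\<phi> n)) * form s m (\<phi> n) \<psi> - react (bd (\<phi> n)) (bd \<psi>)) \<longlonglongrightarrow> 0"
    "k $ 1 \<noteq> 0" "\<not> (\<lambda>n. mode_coeff (cplx (bd (\<phi> n))) k) \<longlonglongrightarrow> 0"
proof -
  have R0: "0 < R" using R by (simp add: coercive_def)
  obtain \<phi> e where \<phi>: "\<And>n. \<phi> n \<in> antiperiodic s" and N: "\<And>n. form s m (\<phi> n) (\<phi> n) \<le> R / 2" and e0: "e < 0"
    and e: "\<And>\<omega>. \<omega> \<in> antiperiodic s \<Longrightarrow> form s m \<omega> \<omega> \<le> R \<Longrightarrow> e \<le> energy \<omega>"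
    and E: "\<And>n. energy (\<phi> n) \<le> e + 1 / real (Suc n)"
    and c: "\<And>k. convergent (\<lambda>n. mode_coeff (cplx (bd (\<phi> n))) k)"
    using minimizing_sequence[OF R] by blast
  note \<phi>' = antiperiodic_smooth[OF \<phi>]
  have NR: "form s m (\<phi> n) (\<phi> n) \<le> R" for n using N[of n] R0 by simp
  obtain C where C: "0 < C" and CM: "\<And>\<phi>. \<phi> \<in> smooth_periodic s \<Longrightarrow> moment p (bd \<phi>) \<le> C * form s m \<phi> \<phi> powr (p / 2)"
    using bd_moment_bound by blast
  define B where "B = C * R powr (p / 2)"
  have B0: "0 \<le> B" using C by (simp add: B_def)
  have MB: "moment p (bd \<omega>) \<le> B" if "\<omega> \<in> smooth_periodic s" "form s m \<omega> \<omega> \<le> R" for \<omega>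
  proof -
    have "C * form s m \<omega> \<omega> powr (p / 2) \<le> B"
      unfolding B_def using C p4 that form_ge_0 by (intro mult_left_mono powr_mono2) auto
    then show ?thesis using CM[OF that(1)] by linarith
  qed
  have cau: "\<exists>M. \<forall>i\<ge>M. \<forall>j\<ge>M. form s m (\<lambda>p. \<phi> i p - \<phi> j p) (\<lambda>p. \<phi> i p - \<phi> j p) < \<epsilon>" if \<epsilon>: "0 < \<epsilon>" for \<epsilon>
  proof -
    \<comment> \<open>Excess energies and differences of potentials below \<open>h\<close> give a distance of at most \<open>8/a \<cdot> 2 h = \<epsilon> / 2\<close>.\<close>
    define h where "h = a * \<epsilon> / 32"
    have h: "0 < h" using a \<epsilon> by (simp add: h_def)
    obtain \<eta> where \<eta>: "0 < \<eta>" and unif: "\<And>u v. u \<in> Lp p \<Longrightarrow> v \<in> Lp p \<Longrightarrow> moment p u \<le> B \<Longrightarrow> moment p v \<le> B \<Longrightarrow>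
        moment p (\<lambda>x. u x - v x) \<le> \<eta> \<Longrightarrow> \<bar>pot u - pot v\<bar> \<le> h"
      using pot_uniformly_continuous[OF h B0] by blast
    obtain F \<delta> where F: "finite F" "0 < \<delta>" and small: "\<And>\<phi> \<psi>. \<phi> \<in> smooth_periodic s \<Longrightarrow> \<psi> \<in> smooth_periodic s \<Longrightarrow>
        form s m \<phi> \<phi> \<le> R \<Longrightarrow> form s m \<psi> \<psi> \<le> R \<Longrightarrow> \<forall>k\<in>F. cmod (mode_coeff (cplx (bd \<phi>)) k - mode_coeff (cplx (bd \<psi>)) k) \<le> \<delta> \<Longrightarrow>
        moment p (\<lambda>x. bd \<phi> x - bd \<psi> x) \<le> \<eta>"
      using bd_moment_small[OF less_imp_le[OF R0] \<eta>] by blast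
    have "\<forall>k\<in>F. \<exists>M. \<forall>i\<ge>M. \<forall>j\<ge>M. cmod (mode_coeff (cplx (bd (\<phi> i))) k - mode_coeff (cplx (bd (\<phi> j))) k) \<le> \<delta>"
    proof
      fix k
      obtain M where "\<forall>i\<ge>M. \<forall>j\<ge>M. cmod (mode_coeff (cplx (bd (\<phi> i))) k - mode_coeff (cplx (bd (\<phi> j))) k) < \<delta>"
        using CauchyD[OF convergent_Cauchy[OF c[of k]] F(2)] by blast
      then show "\<exists>M. \<forall>i\<ge>M. \<forall>j\<ge>M. cmod (mode_coeff (cplx (bd (\<phi> i))) k - mode_coeff (cplx (bd (\<phi> j))) k) \<le> \<delta>"
        by (meson less_imp_le)
    qed
    then obtain Mk where Mk: "\<And>k i j. k \<in> F \<Longrightarrow> i \<ge> Mk k \<Longrightarrow> j \<ge> Mk k \<Longrightarrow> cmod (mode_coeff (cplx (bd (\<phi> i))) k - mode_coeff (cplx (bd (\<phi> j))) k) \<le> \<delta>"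
      by metis
    obtain M1 :: nat where M1: "1 / h \<le> real M1" using real_arch_simple by blast
    define M where "M = max M1 (\<Sum>k\<in>F. Mk k)"
    have "form s m (\<lambda>p. \<phi> i p - \<phi> j p) (\<lambda>p. \<phi> i p - \<phi> j p) < \<epsilon>" if ij: "i \<ge> M" "j \<ge> M" for i j
    proof -
      define \<omega> where "\<omega> p = 1 / 2 * \<phi> i p + 1 / 2 * \<phi> j p" for p
      have \<omega>: "\<omega> \<in> smooth_periodic s" unfolding \<omega>_def[abs_def] by (rule smooth_periodic_lincomb[OF \<phi>' \<phi>'])
      have \<omega>R: "form s m \<omega> \<omega> \<le> R"
        unfolding \<omega>_def[abs_def] form_lincomb_self[OF m \<phi>'[of i] \<phi>'[of j]]
        using form_polar_bound[OF \<phi>'[of i] \<phi>'[of j]] NR[of i] NR[of j] by (simp add: power2_eq_square)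
      have "Mk k \<le> M" if "k \<in> F" for k
        using member_le_sum[of k F Mk] F(1) that by (simp add: M_def)
      then have cc: "\<forall>k\<in>F. cmod (mode_coeff (cplx (bd (\<phi> i))) k - mode_coeff (cplx (bd (\<phi> j))) k) \<le> \<delta>"
        using Mk ij by (meson order_trans)
      have mom: "moment p (\<lambda>x. bd (\<phi> i) x - bd (\<phi> j) x) \<le> \<eta>"
        by (rule small[OF \<phi>' \<phi>' NR NR cc])
      have half: "moment p (\<lambda>x. bd (\<phi> l) x - bd \<omega> x) \<le> \<eta>" if l: "l = i \<or> l = j" for l
      proof -
        have "\<bar>bd (\<phi> l) x - bd \<omega> x\<bar> powr p = \<bar>1 / 2 * (bd (\<phi> i) x - bd (\<phi> j) x)\<bar> powr p" for x
          using l by (intro arg_cong[where f = "\<lambda>t. t powr p"]) (auto simp: bd_def \<omega>_def abs_real_def field_simps)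
        also have "\<dots> x = (1 / 2) powr p * \<bar>bd (\<phi> i) x - bd (\<phi> j) x\<bar> powr p" for x
          unfolding abs_mult powr_mult by simp
        finally have "moment p (\<lambda>x. bd (\<phi> l) x - bd \<omega> x) = (1 / 2) powr p * moment p (\<lambda>x. bd (\<phi> i) x - bd (\<phi> j) x)"
          by (simp add: moment_def)
        also have "\<dots> \<le> 1 * moment p (\<lambda>x. bd (\<phi> i) x - bd (\<phi> j) x)"
          using p4 by (intro mult_right_mono moment_nonneg) (simp add: powr_le1)
        finally show ?thesis using mom by simp
      qed
      have pd: "\<bar>pot (bd (\<phi> l)) - pot (bd \<omega>)\<bar> \<le> h" if l: "l = i \<or> l = j" for l
        by (rule unif[OF bd_Lp[OF \<phi>'] bd_Lp[OF \<omega>] MB[OF \<phi>' NR] MB[OF \<omega> \<omega>R] half[OF l]])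
      have en: "energy (\<phi> l) - e \<le> h" if "l \<ge> M" for l
      proof -
        have "1 / h \<le> real (Suc l)" using M1 that by (simp add: M_def)
        then have "1 / real (Suc l) \<le> h" using h by (simp add: field_simps)
        then show ?thesis using E[of l] by linarith
      qed
      have "a / 8 * form s m (\<lambda>p. \<phi> i p - \<phi> j p) (\<lambda>p. \<phi> i p - \<phi> j p)
          \<le> (energy (\<phi> i) - e) / 2 + (energy (\<phi> j) - e) / 2
            + (pot (bd (\<phi> i)) - pot (bd \<omega>)) / 2 + (pot (bd (\<phi> j)) - pot (bd \<omega>)) / 2"
        unfolding \<omega>_def[abs_def] by (rule midpoint_energy[OF \<phi> \<phi> NR NR]) (rule e)
      moreover have "pot (bd (\<phi> i)) - pot (bd \<omega>) \<le> h" "pot (bd (\<phi> j)) - pot (bd \<omega>) \<le> h"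
        by (rule abs_le_D1[OF pd]; simp)+
      moreover have "D \<le> 2 * h"
        if "D \<le> x / 2 + y / 2 + v / 2 + w / 2" "v \<le> h" "w \<le> h" "x \<le> h" "y \<le> h" for D x y v w :: real
        using that by linarith
      ultimately have "a / 8 * form s m (\<lambda>p. \<phi> i p - \<phi> j p) (\<lambda>p. \<phi> i p - \<phi> j p) \<le> 2 * h"
        using en[OF ij(1)] en[OF ij(2)] by blast
      then have "a * form s m (\<lambda>p. \<phi> i p - \<phi> j p) (\<lambda>p. \<phi> i p - \<phi> j p) \<le> a * (\<epsilon> / 2)" by (simp add: h_def mult_ac)
      then show ?thesis using a \<epsilon> by simp
    qed
    then show ?thesis by blast
  qed
  have res: "(\<lambda>n. (a + b * form s m (\<phi> n) (\<phi> n)) * form s m (\<phi> n) \<psi> - react (bd (\<phi> n)) (bd \<psi>)) \<longlonglongrightarrow> 0"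
    if \<psi>: "\<psi> \<in> antiperiodic s" for \<psi>
  proof (rule LIMSEQ_I)
    fix \<epsilon> :: real assume \<epsilon>: "0 < \<epsilon>"
    define L where "L = R + 2 * form s m \<psi> \<psi>"
    have L: "0 < L" using R0 form_ge_0[of \<psi>] by (simp add: L_def)
    define C' where "C' = (a + b * R) * L + b * L\<^sup>2"
    have C': "0 \<le> C'" using a b R0 L by (simp add: C'_def)
    \<comment> \<open>The step \<open>t\<close> keeps the varied function in the ball and makes the error of second order small.\<close>
    define t where "t = min 1 (min (R / (2 * L)) (\<epsilon> / (4 * (C' + 1))))"
    have t: "0 < t" "t \<le> 1" using R0 L \<epsilon> C' by (auto simp: t_def)
    have tL: "t * L \<le> R / 2"
    proof -
      have "t * L \<le> R / (2 * L) * L" using L by (intro mult_right_mono) (auto simp: t_def)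
      then show ?thesis using L by simp
    qed
    have tC: "t * C' \<le> \<epsilon> / 4"
    proof -
      have "t * (C' + 1) \<le> \<epsilon> / (4 * (C' + 1)) * (C' + 1)" using C' by (intro mult_right_mono) (auto simp: t_def)
      also have "\<dots> = \<epsilon> / 4"
      proof -
        have "\<epsilon> / (4 * X) * X = \<epsilon> / 4" if "X \<noteq> 0" for X using that by simp
        from this[of "C' + 1"] show ?thesis using C' by simp
      qed
      finally show ?thesis using t by (simp add: distrib_left)
    qed
    obtain M :: nat where M: "4 / (t * \<epsilon>) \<le> real M" using real_arch_simple by blast
    have "norm ((a + b * form s m (\<phi> n) (\<phi> n)) * form s m (\<phi> n) \<psi> - react (bd (\<phi> n)) (bd \<psi>) - 0) < \<epsilon>" if n: "n \<ge> M" for n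
    proof -
      have "4 / (t * \<epsilon>) \<le> real (Suc n)" using M n by simp
      then have "1 / real (Suc n) \<le> t * \<epsilon> / 4" using t \<epsilon> by (simp add: field_simps)
      then have "energy (\<phi> n) - e \<le> t * \<epsilon> / 4" using E[of n] by linarith
      then have "(energy (\<phi> n) - e) / t \<le> \<epsilon> / 4" using t by (simp add: field_simps)
      moreover have "\<bar>(a + b * form s m (\<phi> n) (\<phi> n)) * form s m (\<phi> n) \<psi> - react (bd (\<phi> n)) (bd \<psi>)\<bar>
          \<le> (energy (\<phi> n) - e) / t + t * C'"
        unfolding C'_def by (rule residual_bound[OF \<phi> \<psi> R0 N e L_def t tL])
      moreover have "norm (z - 0) < \<epsilon>" if "\<bar>z\<bar> \<le> x + y" "x \<le> \<epsilon> / 4" "y \<le> \<epsilon> / 4" for x y z :: real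
        using that \<epsilon> by simp
      ultimately show ?thesis using tC by blast
    qed
    then show "\<exists>M. \<forall>n\<ge>M. norm ((a + b * form s m (\<phi> n) (\<phi> n)) * form s m (\<phi> n) \<psi> - react (bd (\<phi> n)) (bd \<psi>) - 0) < \<epsilon>" by blast
  qed
  have res': "(\<lambda>n. (a + b * form s m (\<phi> n) (\<phi> n)) * form s m (\<phi> n) \<psi> - react (bd (\<phi> n)) (bd \<psi>)) \<longlonglongrightarrow> 0"
    if \<psi>: "\<psi> \<in> smooth_periodic s" for \<psi>
    using res[OF antisymmetrise[OF \<psi>]]
    by (simp only: form_antiperiodic[OF m \<phi> \<psi>] react_antiperiodic[OF \<phi> \<psi>])
  have "\<exists>k. \<not> (\<lambda>n. mode_coeff (cplx (bd (\<phi> n))) k) \<longlonglongrightarrow> 0"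
  proof (rule ccontr)
    assume "\<nexists>k. \<not> (\<lambda>n. mode_coeff (cplx (bd (\<phi> n))) k) \<longlonglongrightarrow> 0"
    then have z: "(\<lambda>n. mode_coeff (cplx (bd (\<phi> n))) k) \<longlonglongrightarrow> 0" for k by blast
    \<comment> \<open>All boundary coefficients tend to those of the zero function \<open>o0\<close>, hence the potentials tend to \<open>0\<close>.\<close>
    define h where "h = - e / 4"
    have h: "0 < h" using e0 by (simp add: h_def)
    define o0 where "o0 p = 0 * wave p + 0 * wave p" for p
    have o0: "o0 \<in> smooth_periodic s" unfolding o0_def[abs_def]
      by (intro smooth_periodic_lincomb wave_smooth_periodic s0 s)
    have oN: "form s m o0 o0 \<le> R"
      unfolding o0_def[abs_def] form_lincomb_self[OF m wave_smooth_periodic[OF s0 s(2)] wave_smooth_periodic[OF s0 s(2)]]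
      using R0 by simp
    have bo: "bd o0 = (\<lambda>x. 0)" by (simp add: bd_def o0_def)
    have po: "pot (bd o0) = 0" by (simp add: bo pot_def potential_def)
    have co: "mode_coeff (cplx (bd o0)) k = 0" for k by (simp add: bo mode_coeff_def)
    obtain \<eta> where \<eta>: "0 < \<eta>" and unif: "\<And>u v. u \<in> Lp p \<Longrightarrow> v \<in> Lp p \<Longrightarrow> moment p u \<le> B \<Longrightarrow> moment p v \<le> B \<Longrightarrow>
        moment p (\<lambda>x. u x - v x) \<le> \<eta> \<Longrightarrow> \<bar>pot u - pot v\<bar> \<le> h"
      using pot_uniformly_continuous[OF h B0] by blast
    obtain F \<delta> where F: "finite F" "0 < \<delta>" and small: "\<And>\<phi> \<psi>. \<phi> \<in> smooth_periodic s \<Longrightarrow> \<psi> \<in> smooth_periodic s \<Longrightarrow>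
        form s m \<phi> \<phi> \<le> R \<Longrightarrow> form s m \<psi> \<psi> \<le> R \<Longrightarrow> \<forall>k\<in>F. cmod (mode_coeff (cplx (bd \<phi>)) k - mode_coeff (cplx (bd \<psi>)) k) \<le> \<delta> \<Longrightarrow>
        moment p (\<lambda>x. bd \<phi> x - bd \<psi> x) \<le> \<eta>"
      using bd_moment_small[OF less_imp_le[OF R0] \<eta>] by blast
    have "\<forall>\<^sub>F n in sequentially. \<forall>k\<in>F. cmod (mode_coeff (cplx (bd (\<phi> n))) k) \<le> \<delta>"
    proof (subst eventually_ball_finite_distrib[OF F(1)], intro ballI)
      fix k
      have "\<forall>\<^sub>F n in sequentially. dist (mode_coeff (cplx (bd (\<phi> n))) k) 0 < \<delta>" using z F(2) by (rule tendstoD)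
      then show "\<forall>\<^sub>F n in sequentially. cmod (mode_coeff (cplx (bd (\<phi> n))) k) \<le> \<delta>"
        by (rule eventually_mono) simp
    qed
    moreover obtain M :: nat where M: "1 / h \<le> real M" using real_arch_simple by blast
    moreover note eventually_ge_at_top[of M]
    ultimately have "\<forall>\<^sub>F n in sequentially. (\<forall>k\<in>F. cmod (mode_coeff (cplx (bd (\<phi> n))) k) \<le> \<delta>) \<and> n \<ge> M"
      by (intro eventually_conj)
    then obtain n where n: "\<forall>k\<in>F. cmod (mode_coeff (cplx (bd (\<phi> n))) k) \<le> \<delta>" "n \<ge> M"
      using eventually_happens by fastforce
    have "moment p (\<lambda>x. bd (\<phi> n) x - bd o0 x) \<le> \<eta>"
      by (rule small[OF \<phi>' o0 NR oN]) (use n(1) co in simp)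
    from unif[OF bd_Lp[OF \<phi>'] bd_Lp[OF o0] MB[OF \<phi>' NR] MB[OF o0 oN] this]
    have "pot (bd (\<phi> n)) \<le> h" using po by simp
    moreover have "- pot (bd (\<phi> n)) \<le> energy (\<phi> n)"
      using a b form_ge_0[of "\<phi> n"] by (simp add: energy_def)
    moreover have "1 / real (Suc n) \<le> h"
    proof -
      have "1 / h \<le> real (Suc n)" using M n(2) by simp
      then show ?thesis using h by (simp add: field_simps)
    qed
    ultimately show False using E[of n] e0 by (simp add: h_def)
  qed
  then obtain k where k: "\<not> (\<lambda>n. mode_coeff (cplx (bd (\<phi> n))) k) \<longlonglongrightarrow> 0" by blast
  \<comment> \<open>The coefficients with \<open>k\<^sub>1 = 0\<close> do not change under the half period, which yet changes their sign.\<close>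
  have "k $ 1 \<noteq> 0"
  proof
    assume k1: "k $ 1 = 0"
    have "mode_coeff (cplx (bd (\<phi> n))) k = 0" for n
    proof -
      have "\<forall>p\<in>closed_half. shift half_period (\<phi> n) p = - \<phi> n p"
        using \<phi>[of n] unfolding antiperiodic_def by blast
      then have "bd (shift half_period (\<phi> n)) = (\<lambda>x. - bd (\<phi> n) x)" by (simp add: bd_def)
      then have "mode_coeff (cplx (\<lambda>x. - bd (\<phi> n) x)) k = cis (kdot k half_period) * mode_coeff (cplx (bd (\<phi> n))) k"
        using coeff_bd_shift[OF \<phi>'[of n], of half_period k] by simp
      moreover have "mode_coeff (cplx (\<lambda>x. - bd (\<phi> n) x)) k = - mode_coeff (cplx (bd (\<phi> n))) k"
        by (simp add: mode_coeff_def)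
      moreover have "kdot k half_period = 0" by (simp add: kdot_axis k1)
      ultimately show ?thesis by (simp add: neg_equal_iff_equal)
    qed
    then show False using k by simp
  qed
  then show ?thesis using that[OF \<phi>' cau res'] k by blast
qed

text \<open>
  Translates of a critical sequence are critical. Their coefficients differ by the phase
  \<open>e\<^sup>i\<^sup>k\<^sup>t\<close>, so that a single nonvanishing mode tells infinitely many of the limits apart.
\<close>

lemma infinitely_many_solutions:
  assumes R: "coercive R"
  shows "infinite ({u. weak_solution s a b m q p lam u} // ae_eq)"
proof
  assume fin: "finite ({u. weak_solution s a b m q p lam u} // ae_eq)"
  obtain \<phi> k where \<phi>: "\<And>n. \<phi> n \<in> smooth_periodic s"
    and cau: "\<And>e. 0 < e \<Longrightarrow> \<exists>N. \<forall>i\<ge>N. \<forall>j\<ge>N. form s m (\<lambda>p. \<phi> i p - \<phi> j p) (\<lambda>p. \<phi> i p - \<phi> j p) < e"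
    and res: "\<And>\<psi>. \<psi> \<in> smooth_periodic s \<Longrightarrow>
      (\<lambda>n. (a + b * form s m (\<phi> n) (\<phi> n)) * form s m (\<phi> n) \<psi> - react (bd (\<phi> n)) (bd \<psi>)) \<longlonglongrightarrow> 0"
    and k: "k $ 1 \<noteq> 0" and nz: "\<not> (\<lambda>n. mode_coeff (cplx (bd (\<phi> n))) k) \<longlonglongrightarrow> 0"
    using critical_sequence[OF R] by blast
  have tr: "\<exists>u. weak_solution s a b m q p lam u \<and> (\<lambda>n. cis (kdot k t) * mode_coeff (cplx (bd (\<phi> n))) k) \<longlonglongrightarrow> mode_coeff (cplx u) k" for t
  proof -
    let ?\<phi> = "\<lambda>n. shift t (\<phi> n)"
    obtain u where u: "weak_solution s a b m q p lam u"
      "\<And>k. (\<lambda>n. mode_coeff (cplx (\<lambda>x. ?\<phi> n (x, 0))) k) \<longlonglongrightarrow> mode_coeff (cplx u) k"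
    proof (rule critical_sequence_solution[of ?\<phi>])
      show "?\<phi> n \<in> smooth_periodic s" for n by (rule shift_smooth[OF \<phi>])
      show "\<exists>N. \<forall>i\<ge>N. \<forall>j\<ge>N. form s m (\<lambda>p. ?\<phi> i p - ?\<phi> j p) (\<lambda>p. ?\<phi> i p - ?\<phi> j p) < e" if "0 < e" for e
      proof -
        have "form s m (\<lambda>p. ?\<phi> i p - ?\<phi> j p) (\<lambda>p. ?\<phi> i p - ?\<phi> j p) = form s m (\<lambda>p. \<phi> i p - \<phi> j p) (\<lambda>p. \<phi> i p - \<phi> j p)" for i j
          using form_translate_self[OF m smooth_periodic_lincomb[OF \<phi>[of i] \<phi>[of j], of 1 "-1"], of t] by (simp add: shift_def)
        then show ?thesis using cau[OF that] by simp
      qed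
      fix \<psi> assume \<psi>: "\<psi> \<in> smooth_periodic s"
      have "form s m (?\<phi> n) (?\<phi> n) = form s m (\<phi> n) (\<phi> n)" for n
        using form_translate_self[OF m \<phi>[of n], of t] by (simp add: shift_def)
      moreover have "form s m (?\<phi> n) \<psi> = form s m (\<phi> n) (shift (- t) \<psi>)" for n
        using form_shift_right[OF m \<phi>[of n] \<psi>, of "- t"] by simp
      moreover have "react (\<lambda>x. ?\<phi> n (x, 0)) (\<lambda>x. \<psi> (x, 0)) = react (bd (\<phi> n)) (bd (shift (- t) \<psi>))" for n
        using react_shift[OF \<phi>[of n] \<psi>, of t] by (simp add: bd_def)
      ultimately show "(\<lambda>n. (a + b * form s m (?\<phi> n) (?\<phi> n)) * form s m (?\<phi> n) \<psi> - react (\<lambda>x. ?\<phi> n (x, 0)) (\<lambda>x. \<psi> (x, 0))) \<longlonglongrightarrow> 0"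
        using res[OF shift_smooth[OF \<psi>, of "- t"]] by simp
    qed blast
    have "mode_coeff (cplx (\<lambda>x. ?\<phi> n (x, 0))) k = cis (kdot k t) * mode_coeff (cplx (bd (\<phi> n))) k" for n
      using coeff_bd_shift[OF \<phi>[of n], of t k] by (simp add: bd_def)
    then have "(\<lambda>n. cis (kdot k t) * mode_coeff (cplx (bd (\<phi> n))) k) \<longlonglongrightarrow> mode_coeff (cplx u) k"
      using u(2)[of k] by (simp only:)
    with u(1) show ?thesis by blast
  qed
  obtain u0 where u0: "(\<lambda>n. mode_coeff (cplx (bd (\<phi> n))) k) \<longlonglongrightarrow> mode_coeff (cplx u0) k"
    using tr[of 0] by (auto simp: kdot_def)
  define c where "c = mode_coeff (cplx u0) k"
  have c0: "c \<noteq> 0" using u0 nz by (auto simp: c_def)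
  define S where "S = {u. weak_solution s a b m q p lam u}"
  \<comment> \<open>For translations \<open>t e\<^sub>1\<close> with \<open>0 < t < 1 / |k\<^sub>1|\<close> the phases \<open>k\<^sub>1 t\<close> are distinct and stay in \<open>(-\<pi>, \<pi>]\<close>.\<close>
  define \<kappa> where "\<kappa> = \<bar>real_of_int (k $ 1)\<bar>"
  have \<kappa>: "0 < \<kappa>" using k by (simp add: \<kappa>_def)
  have sub: "(\<lambda>t. cis (kdot k (axis 1 t)) * c) ` {0<..<1 / \<kappa>} \<subseteq> (\<lambda>u. mode_coeff (cplx u) k) ` S"
  proof
    fix z assume "z \<in> (\<lambda>t. cis (kdot k (axis 1 t)) * c) ` {0<..<1 / \<kappa>}"
    then obtain t where z: "z = cis (kdot k (axis 1 t)) * c" by blast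
    obtain u where u: "u \<in> S" "(\<lambda>n. cis (kdot k (axis 1 t)) * mode_coeff (cplx (bd (\<phi> n))) k) \<longlonglongrightarrow> mode_coeff (cplx u) k"
      using tr by (auto simp: S_def)
    have "(\<lambda>n. cis (kdot k (axis 1 t)) * mode_coeff (cplx (bd (\<phi> n))) k) \<longlonglongrightarrow> z"
      unfolding z c_def by (intro tendsto_mult tendsto_const u0)
    then have "mode_coeff (cplx u) k = z" using u(2) LIMSEQ_unique by blast
    then show "z \<in> (\<lambda>u. mode_coeff (cplx u) k) ` S" using u(1) by blast
  qed
  have "inj_on (\<lambda>t. cis (kdot k (axis 1 t)) * c) {0<..<1 / \<kappa>}"
  proof (rule inj_onI)
    fix t t' assume t: "t \<in> {0<..<1 / \<kappa>}" "t' \<in> {0<..<1 / \<kappa>}"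
      and eq: "cis (kdot k (axis 1 t)) * c = cis (kdot k (axis 1 t')) * c"
    have small: "real_of_int (k $ 1) * x \<in> {- pi<..pi}" if x: "x \<in> {0<..<1 / \<kappa>}" for x
    proof -
      have "\<bar>real_of_int (k $ 1) * x\<bar> < 1" using x \<kappa> by (simp add: abs_mult \<kappa>_def[symmetric] field_simps)
      then show ?thesis using pi_gt3 by (simp add: abs_less_iff)
    qed
    have "cis (real_of_int (k $ 1) * t) = cis (real_of_int (k $ 1) * t')" using eq c0 by (simp add: kdot_axis)
    then have "real_of_int (k $ 1) * t = real_of_int (k $ 1) * t'"
      by (metis Arg_cis[OF small[OF t(1)]] Arg_cis[OF small[OF t(2)]])
    then show "t = t'" using k by simp
  qed
  moreover have "infinite {0<..<1 / \<kappa>}" using \<kappa> by (simp add: infinite_Ioo)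
  ultimately have "infinite ((\<lambda>u. mode_coeff (cplx u) k) ` S)"
    using sub finite_imageD finite_subset by blast
  \<comment> \<open>The coefficient depends only on the class modulo null sets.\<close>
  moreover have "finite ((\<lambda>u. mode_coeff (cplx u) k) ` S)"
  proof -
    define h where "h X = mode_coeff (cplx (SOME u. u \<in> X \<and> u \<in> S)) k" for X
    have "(\<lambda>u. mode_coeff (cplx u) k) ` S \<subseteq> h ` (S // ae_eq)"
    proof
      fix z assume "z \<in> (\<lambda>u. mode_coeff (cplx u) k) ` S"
      then obtain u where u: "u \<in> S" "z = mode_coeff (cplx u) k" by blast
      let ?X = "ae_eq `` {u}"
      define v where "v = (SOME v. v \<in> ?X \<and> v \<in> S)"
      have "u \<in> ?X \<and> u \<in> S" using u by (simp add: ae_eq_def)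
      then have v: "v \<in> ?X \<and> v \<in> S" unfolding v_def by (rule someI[where P = "\<lambda>v. v \<in> ?X \<and> v \<in> S"])
      have meas: "(\<lambda>x. cplx w x * cnj (mode k x)) \<in> borel_measurable torus" if "w \<in> S" for w
        using that by (intro borel_torus borel_measurable_times cnj_mode_measurable)
          (simp add: cplx_measurable_iff S_def weak_solution_def Hs_def)
      have "AE x in torus. u x = v x"
        using v by (subst AE_restrict_space_iff) (auto simp: ae_eq_def)
      then have "mode_coeff (cplx u) k = mode_coeff (cplx v) k"
        unfolding mode_coeff_def using meas[OF u(1)] meas v by (intro integral_cong_AE) auto
      then have "z = h ?X" using u(2) by (simp add: h_def v_def)
      moreover have "?X \<in> S // ae_eq" using u(1) by (rule quotientI)
      ultimately show "z \<in> h ` (S // ae_eq)" by blast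
    qed
    then show ?thesis using fin finite_subset finite_imageI unfolding S_def by meson
  qed
  ultimately show False by blast
qed

end

text \<open>
  The trace and Sobolev inequalities give \<open>\<integral> |u|\<^sup>p \<le> C (form \<phi> \<phi>)\<^sup>p\<^sup>/\<^sup>2\<close> with \<open>p > 2\<close>. On a small ball this is
  absorbed by half of the quadratic part of the energy, up to a constant that is small with \<open>\<lambda>\<close>.
\<close>

theorem theorem2:
  fixes s a b m q p :: real
  assumes "3 / 4 < s" and "s < 1"
    and "0 < a" and "0 < b" and "0 < m"
    and "1 < q" and "q < 2"
    and "4 < p" and "p < 6 / (3 - 2 * s)"
  shows "\<exists>lam0>0. \<forall>lam. 0 < lam \<and> lam < lam0 \<longrightarrow>
           infinite ({u. weak_solution s a b m q p lam u} // ae_eq)"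
proof -
  interpret fractional s m p by standard (use assms in auto)
  obtain C where C: "0 < C" and CM: "\<And>\<phi>. \<phi> \<in> smooth_periodic s \<Longrightarrow> moment p (bd \<phi>) \<le> C * form s m \<phi> \<phi> powr (p / 2)"
    using bd_moment_bound by blast
  \<comment> \<open>With \<open>\<lambda> + 1 \<le> 2\<close> the choice \<open>2 C R\<^sup>\<alpha> = a / 4\<close> bounds the superquadratic term by \<open>a / 4 \<cdot> form \<phi> \<phi>\<close>.\<close>
  define \<alpha> where "\<alpha> = p / 2 - 1"
  have \<alpha>: "0 < \<alpha>" using p4 by (simp add: \<alpha>_def)
  define R where "R = (a / (8 * C)) powr (1 / \<alpha>)"
  have R: "0 < R" using C assms by (simp add: R_def)
  have RC: "2 * C * R powr \<alpha> = a / 4" using C \<alpha> assms by (simp add: R_def powr_powr)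
  define lam0 where "lam0 = min 1 (a * R / (8 * (2 * pi) ^ 3))"
  have "0 < lam0" using R assms by (simp add: lam0_def)
  moreover have "infinite ({u. weak_solution s a b m q p lam u} // ae_eq)" if bound: "0 < lam" "lam < lam0" for lam
  proof -
    interpret kirchhoff s m p q lam a b by standard (use assms bound in auto)
    have "coercive R"
      unfolding coercive_def
    proof (intro conjI ballI impI)
      show "0 < R" by (rule R)
      have "lam < a * R / (8 * (2 * pi) ^ 3)" using bound unfolding lam0_def by (simp only: min_less_iff_conj)
      then have "lam * (2 * pi) ^ 3 < a * R / (8 * (2 * pi) ^ 3) * (2 * pi) ^ 3"
        by (rule mult_strict_right_mono) simp
      then show "lam * (2 * pi) ^ 3 < a * R / 8" by (simp add: mult.commute)
      fix \<phi> assume \<phi>: "\<phi> \<in> smooth_periodic s" "form s m \<phi> \<phi> \<le> R"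
      let ?N = "form s m \<phi> \<phi>"
      have "pot (bd \<phi>) \<le> lam * (2 * pi) ^ 3 + (lam + 1) * moment p (bd \<phi>)" by (rule pot_le[OF bd_Lp[OF \<phi>(1)]])
      also have "(lam + 1) * moment p (bd \<phi>) \<le> 2 * (C * ?N powr (p / 2))"
        using bound CM[OF \<phi>(1)] by (intro mult_mono moment_nonneg) (auto simp: lam0_def)
      also have "?N powr (p / 2) = ?N powr \<alpha> * ?N"
      proof (cases "?N = 0")
        case False
        then have "?N powr \<alpha> * ?N powr 1 = ?N powr (p / 2)" unfolding powr_add[symmetric] by (simp add: \<alpha>_def)
        then show ?thesis using form_ge_0[of \<phi>] by simp
      qed (use p4 in simp)
      also have "2 * (C * (?N powr \<alpha> * ?N)) \<le> 2 * (C * (R powr \<alpha> * ?N))"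
        using C \<alpha> \<phi>(2) form_ge_0[of \<phi>] by (intro mult_left_mono mult_right_mono powr_mono2) auto
      also have "\<dots> = (2 * C * R powr \<alpha>) * ?N" by (simp only: mult.assoc)
      also have "\<dots> = a / 4 * ?N" by (simp only: RC)
      finally show "pot (bd \<phi>) \<le> lam * (2 * pi) ^ 3 + a / 4 * ?N" by simp
    qed
    then show ?thesis by (rule infinitely_many_solutions)
  qed
  ultimately show ?thesis by blast
qed

end
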